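(* Let $\alpha\in(0,1)$, $J\ge J_0$ with $2^J\le n$, and consider the linear inverse problem with $f_0\in B^s_{\infty,\infty}$, a sieve prior $\Pi_\beta$ on $\mathbb R^{2^J}$, the weight sequence $w$, and the Castillo–Nickl band $\mathcal C_w(\hat f_\infty,\hat R_\alpha)$ described in the context. Put $X=\Sigma^{-1/2}\mathrm{diag}\{\kappa_{l,k}:(l,k)\in\mathcal I(J)\}$ and assume that for some $C_1>0$ $$\pi(\beta_0)\ge\sqrt{\det(X^\top X)}\,n^{-C_12^J}\quad\text{and}\quad\phi_{\Pi_\beta}(1/\sqrt n)\le1/2 .$$ Then there exist positive constants $c_1,c_2$ depending only on $C_1$, $K$ and $\{\psi_{l,k}:(l,k)\in\mathcal I_\infty\}$ such that the following hold. For $n\ge2$, $$|\mathbb P(f_0\in\mathcal C_w(\hat f_\infty,\hat R_\alpha))-(1-\alpha)|\le\phi_{\Pi_\beta}\big(c_1\sqrt{2^J\log n}\big)+c_1n^{-c_22^J}+\mathbb P(Y\notin\tilde H_3).$$ In addition, there exist positive constants $c_3,c_4$ depending only on $\alpha$, $K$ and $\{\psi_{l,k}:(l,k)\in\mathcal I_\infty\}$ such that the following hold. Assume that the right-hand side above except $\mathbb P(Y\notin\tilde H_3)$, that is $\phi_{\Pi_\beta}(c_1\sqrt{2^J\log n})+c_1n^{-c_22^J}$, is smaller than $\min\{\alpha/2,(1-\alpha)/2\}$. Then $$\mathbb P(Y\notin\tilde H_3)\le c_3\Big(e^{-c_4J\{J/(\overline\kappa_J\overline w_J)^2\}u_J^2}+n^{-c_22^J}\Big)$$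 for sufficiently large $J$ depending only on $\alpha$, $\{w_l\}$, $K$ and $\{\psi_{l,k}:(l,k)\in\mathcal I_\infty\}$; and, for any $B>0$, the $L^\infty$-diameter of $\mathcal C_w^B(\hat f_\infty,\hat R_\alpha):=\mathcal C_w(\hat f_\infty,\hat R_\alpha)\cap\{f:\|f\|_{B^s_{\infty,\infty}}\le B\}$ satisfies $$\sup_{f,g\in\mathcal C_w^B(\hat f_\infty,\hat R_\alpha)}\|f-g\|_\infty\le c_3\Big(v_J\sqrt{\frac{2^JJ}{\underline\kappa_J^2n}}+2^{-Js}B\Big)$$ with probability at least $1-c_1n^{-c_22^J}$.
   Context: Model: $dY(t)=K(f_0)(t)dt+n^{-1/2}dW(t)$, $t\in[0,1]$, with $K$ a known linear operator and $dW$ canonical white noise. $\mathbb P$ refers to this true distribution; $\|\cdot\|$ is the Euclidean norm and $\|\cdot\|_\infty$ the supremum norm. Wavelets and function space (fixed throughout): $s>0$, $S>s$ an integer, $J_0=J_0(S)$ sufficiently large, $\{\phi_{J_0,k}:0\le k\le2^{J_0}-1\}\cup\{\psi_{l,k}:l\ge J_0,0\le k\le2^l-1\}$ an $S$-regular wavelet basis of $L^2[0,1]$ (Cohen–Daubechies–Vial), with the convention $\psi_{J_0-1,k}:=\phi_{J_0,k}$ for $0\le k\le2^{J_0}-1$. $\langle\cdot,\cdot\rangle$ is the $L^2[0,1]$ inner product. $\|f\|_{B^s_{\infty,\infty}}=\max_{0\le k\le 2^{J_0}-1}|\langle\phi_{J_0,k},f\rangle|+\sup_{l\ge J_0,0\le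 k\le2^l-1}2^{l(s+1/2)}|\langle\psi_{l,k},f\rangle|$ and $B^s_{\infty,\infty}=\{f:\|f\|_{B^s_{\infty,\infty}}<\infty\}$. At level $l=J_0-1$ the index $k$ ranges over $0\le k\le2^{J_0}-1$. $\mathcal I(J)=\{(l,k):J_0\le l\le J-1,0\le k\le2^l-1\}\cup\{(J_0-1,k):0\le k\le2^{J_0}-1\}$ (so $|\mathcal I(J)|=2^J$) and $\mathcal I_\infty=\bigcup_J\mathcal I(J)$. Wavelet–vaguelette decomposition of $K$: $\{\psi_{l,k},v^{(1)}_{l,k},v^{(2)}_{l,k},\kappa_{l,k}:(l,k)\in\mathcal I_\infty\}$, with quasi-singular values $\kappa_{l,k}>0$, $K\psi_{l,k}=\kappa_{l,k}v^{(2)}_{l,k}$, $\langle v^{(1)}_{l,k},v^{(2)}_{l',k'}\rangle=1$ if $(l,k)=(l',k')$ and $0$ otherwise, and $\{v^{(1)}_{l,k}\}$, $\{v^{(2)}_{l,k}\}$ near-orthogonal (i.e. for $i=1,2$, $\|\sum a_{l,k}v^{(i)}_{l,k}\|_{L^2}^2$ is bounded above and below by positive constants times $\sum a_{l,k}^2$). Hence $\tilde Y_{l,k}:=\int v^{(1)}_{l,k}dY=\kappa_{l,k}\langle f_0,\psi_{l,k}\rangle+n^{-1/2}\int v^{(1)}_{l,k}dW$. The problem may be mildly ill-posed ($\kappa_{l,k}\sim2^{-rl}$ for some $r>0$) or severely ill-posed ($\kappa_{l,k}\sim e^{-r2^l}$ for some $r>0$). $\Sigma$ is the $2^J\times2^J$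 covariance matrix of $(\tilde Y_{l,k})_{(l,k)\in\mathcal I(J)}$. Sieve prior and quasi-posterior: $\Pi_\beta(d\beta)=\pi(\beta)d\beta$ on $\mathbb R^{2^J}$ induces a prior on $f$ via $\beta\mapsto\sum_{(l,k)\in\mathcal I(J)}\beta_{l,k}\psi_{l,k}$. $\Pi_\beta(\cdot\mid Y)$ is the quasi-posterior based on the truncated indirect Gaussian sequence model $\tilde Y_{l,k}=\kappa_{l,k}\beta_{l,k}+n^{-1/2}\int v^{(1)}_{l,k}dW$, $(l,k)\in\mathcal I(J)$; i.e. its density is proportional to $\pi(\beta)\exp\{-\tfrac12\|\Sigma^{-1/2}\tilde Y_{\mathcal I(J)}-X\beta\|^2\}$, where $\tilde Y_{\mathcal I(J)}=(\tilde Y_{l,k})_{(l,k)\in\mathcal I(J)}$ and $X=\Sigma^{-1/2}\mathrm{diag}\{\kappa_{l,k}:(l,k)\in\mathcal I(J)\}$. Let $\beta_0=(\langle f_0,\psi_{l,k}\rangle)_{(l,k)\in\mathcal I(J)}$, $B(R)=\{\beta:\|X(\beta-\beta_0)\|\le R\}$, $\phi_{\Pi_\beta}(R)=1-\inf_{\beta,\tilde\beta\in B(R)}\{\pi(\tilde\beta)/\pi(\beta)\}$. Weights: $w=(w_1,w_2,\dots)$ is positive with $\min_{0\le k\le2^l-1}\kappa_{l,k}w_l/\sqrt l\uparrow\infty$ as $l\to\infty$. $\overline w_J=\max_{J_0-1\le l\le J-1}w_l$, $u_J=\inf_{J\le l,0\le k\le2^l-1}\kappa_{l,k}w_l/\sqrt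 l$, $v_J=\sup_{J_0\le l\le J-1,0\le k\le2^l-1}\kappa_{l,k}w_l/\sqrt l$, $\overline\kappa_J=\max_{(l,k)\in\mathcal I(J)}\kappa_{l,k}$, $\underline\kappa_J=\min_{(l,k)\in\mathcal I(J)}\kappa_{l,k}$. It is assumed that $1\le\{J^{1/2}/(\overline\kappa_J\overline w_J)\}u_J\uparrow\infty$ as $J\to\infty$. Band: $\hat f_\infty=\sum_{(l,k)\in\mathcal I_\infty}\psi_{l,k}\kappa_{l,k}^{-1}\int v^{(1)}_{l,k}dY$, i.e. the (possibly generalized) function with $\langle\hat f_\infty,\psi_{l,k}\rangle=\kappa_{l,k}^{-1}\tilde Y_{l,k}$. For a centering $\hat f$ and $R>0$, $\mathcal C_w(\hat f,R)=\{f:\sup_{(l,k)\in\mathcal I_\infty}|\langle f-\hat f,\psi_{l,k}\rangle|/w_l\le R\}$. $\hat R_\alpha$ is such that $\Pi_\beta(\mathcal C_w(\sum_{(l,k)\in\mathcal I(J)}\langle\hat f_\infty,\psi_{l,k}\rangle\psi_{l,k},\hat R_\alpha)\mid Y)=1-\alpha$. Finally $\tilde H_3=\{Y:\sup_{J\le l,0\le k\le2^l-1}|\langle f_0-\hat f_\infty,\psi_{l,k}\rangle|/w_l\le\hat R_\alpha\}$.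
   Formalization: The condition "for sufficiently large J depending only on α, {w_l}, K and ψ" is applied to the diameter bound too; without it that bound fails, since rescaling w leaves the band unchanged but scales v_J, while c_3 may not depend on w (and v_J is a sup over no indices at J=J_0). *)

theory Defs
  imports
    "HOL-Probability.Probability"
    "HOL-Library.Discrete_Functions"
    "Jordan_Normal_Form.Determinant"
begin

section \<open>The space L2[0,1]\<close>

text \<open>Functions on [0,1] are total functions on the reals of which only the restriction to
  [0,1] matters; they are not quotiented by a.e. equality.\<close>

definition L2 :: "(real \<Rightarrow> real) set" where
  "L2 = {f \<in> borel_measurable (lebesgue_on {0..1}).
           integrable (lebesgue_on {0..1}) (\<lambda>x. (f x)\<^sup>2)}"

definition ip :: "(real \<Rightarrow> real) \<Rightarrow> (real \<Rightarrow> real) \<Rightarrow> real" where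
  "ip f g = (\<integral>x. f x * g x \<partial>lebesgue_on {0..1})"

definition L2norm :: "(real \<Rightarrow> real) \<Rightarrow> real" where
  "L2norm f = sqrt (ip f f)"

text \<open>An essential supremum, because changing a function on a null set does not change its
  wavelet coefficients.\<close>

definition Linf_norm :: "(real \<Rightarrow> real) \<Rightarrow> ereal" where
  "Linf_norm f = esssup (lebesgue_on {0..1}) (\<lambda>x. ereal \<bar>f x\<bar>)"

section \<open>Wavelet indices\<close>

definition idx :: "nat \<Rightarrow> nat \<Rightarrow> (nat \<times> nat) set" where
  "idx J0 J = {(l, k). J0 \<le> l \<and> l < J \<and> k < 2 ^ l} \<union> {(l, k). l = J0 - 1 \<and> k < 2 ^ J0}"

definition idx_inf :: "nat \<Rightarrow> (nat \<times> nat) set" where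
  "idx_inf J0 = (\<Union>J\<in>{J0..}. idx J0 J)"

text \<open>Enumeration of \<open>idx J0 J\<close> by \<open>{..<2 ^ J}\<close>, used only to write vectors and matrices
  indexed by \<open>idx J0 J\<close> as vectors and matrices of dimension \<open>2 ^ J\<close>.\<close>

definition enum_idx :: "nat \<Rightarrow> nat \<Rightarrow> nat \<times> nat" where
  "enum_idx J0 i =
     (if i < 2 ^ J0 then (J0 - 1, i) else (floor_log i, i - 2 ^ floor_log i))"

lemma bij_betw_enum_idx:
  assumes "1 \<le> J0" "J0 \<le> J"
  shows "bij_betw (enum_idx J0) {..<2 ^ J} (idx J0 J)"
proof (rule bij_betw_byWitness[where f' = "\<lambda>(l, k). if l = J0 - 1 then k else 2 ^ l + k"])
  have ge: "2 ^ floor_log i \<le> i" and gt: "i < 2 * 2 ^ floor_log i" if "2 ^ J0 \<le> i" for i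
    using floor_log_exp2_le[of i] floor_log_exp2_gt[of i] less_le_trans[OF _ that, of 0] by auto
  have lev: "J0 \<le> floor_log i" if "2 ^ J0 \<le> i" for i
    using floor_log_le_iff[OF that] by simp
  show "\<forall>a\<in>{..<2 ^ J}. (case enum_idx J0 a of (l, k) \<Rightarrow> if l = J0 - 1 then k else 2 ^ l + k) = a"
  proof
    fix a :: nat
    show "(case enum_idx J0 a of (l, k) \<Rightarrow> if l = J0 - 1 then k else 2 ^ l + k) = a"
      using assms(1) ge[of a] lev[of a] by (auto simp: enum_idx_def)
  qed
  have fl: "floor_log (2 ^ l + k) = l" if "k < 2 ^ l" for l k
    using that by (intro floor_log_eqI) auto
  have pw: "(2::nat) ^ J0 \<le> 2 ^ l + k" if "J0 \<le> l" for l k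
    using power_increasing[OF that, of "2::nat"] by (intro trans_le_add1) simp
  show "\<forall>a'\<in>idx J0 J. enum_idx J0 (case a' of (l, k) \<Rightarrow> if l = J0 - 1 then k else 2 ^ l + k) = a'"
    using assms(1) fl pw by (force simp: idx_def enum_idx_def not_less)
  show "enum_idx J0 ` {..<2 ^ J} \<subseteq> idx J0 J"
  proof safe
    fix i a b :: nat assume i: "i < 2 ^ J" and e: "(a, b) = enum_idx J0 i"
    show "(a, b) \<in> idx J0 J"
    proof (cases "i < 2 ^ J0")
      case True then show ?thesis using e by (simp add: enum_idx_def idx_def)
    next
      case False
      then have g: "2 ^ floor_log i \<le> i" "i < 2 * 2 ^ floor_log i" "J0 \<le> floor_log i"
        using ge lev gt by (auto simp: not_less)
      have "(2::nat) ^ floor_log i < 2 ^ J" using g(1) i by linarith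
      then have "floor_log i < J" by simp
      then show ?thesis using False e g by (auto simp: enum_idx_def idx_def)
    qed
  qed
  show "(\<lambda>(l, k). if l = J0 - 1 then k else 2 ^ l + k) ` idx J0 J \<subseteq> {..<2 ^ J}"
  proof safe
    fix l k assume lk: "(l, k) \<in> idx J0 J"
    show "(if l = J0 - 1 then k else 2 ^ l + k) < 2 ^ J"
    proof (cases "l = J0 - 1")
      case True
      then have "k < 2 ^ J0" using lk assms(1) by (auto simp: idx_def)
      also have "(2::nat) ^ J0 \<le> 2 ^ J" using assms(2) by simp
      finally show ?thesis using True by simp
    next
      case False
      then have "l < J" "k < 2 ^ l" using lk by (auto simp: idx_def)
      then have "2 ^ l + k < 2 ^ Suc l" by simp
      also have "(2::nat) ^ Suc l \<le> 2 ^ J"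
        using \<open>l < J\<close> by (intro power_increasing) auto
      finally show ?thesis using False by simp
    qed
  qed
qed

section \<open>Cohen--Daubechies--Vial wavelets\<close>

definition Ck_smooth :: "nat \<Rightarrow> (real \<Rightarrow> real) \<Rightarrow> bool" where
  "Ck_smooth m f \<longleftrightarrow> (\<forall>i<m. \<forall>x. (deriv ^^ i) f field_differentiable at x)
                  \<and> continuous_on UNIV ((deriv ^^ m) f)"

text \<open>Daubechies scaling function and wavelet on the real line with \<open>N\<close> vanishing moments;
  \<open>h\<close> is the low-pass filter, shifted so that both supports are \<open>[1 - N, N]\<close>.\<close>

definition daubechies_pair :: "nat \<Rightarrow> (real \<Rightarrow> real) \<Rightarrow> (real \<Rightarrow> real) \<Rightarrow> bool" where
  "daubechies_pair N p q \<longleftrightarrow>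
     (\<forall>x. x \<notin> {1 - real N .. real N} \<longrightarrow> p x = 0 \<and> q x = 0) \<and>
     (\<exists>h :: int \<Rightarrow> real. \<forall>x.
        p x = sqrt 2 * (\<Sum>m = 1 - int N .. int N. h m * p (2 * x - of_int m)) \<and>
        q x = sqrt 2 * (\<Sum>m = 1 - int N .. int N.
                          (if even m then 1 else -1) * h (1 - m) * p (2 * x - of_int m))) \<and>
     (\<integral>x. p x \<partial>lborel) = 1 \<and>
     (\<forall>m :: int. (\<integral>x. p x * p (x - of_int m) \<partial>lborel) = (if m = 0 then 1 else 0)) \<and>
     (\<forall>i<N. (\<integral>x. x ^ i * q x \<partial>lborel) = 0)"

text \<open>Level-\<open>j\<close> system on [0,1]: \<open>N\<close> left edge functions, interior dilates and translates,
  and \<open>N\<close> right edge functions (counted from the right end point, in the variable \<open>1 - x\<close>).\<close>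

definition interval_system ::
    "nat \<Rightarrow> (real \<Rightarrow> real) \<Rightarrow> (nat \<Rightarrow> real \<Rightarrow> real) \<Rightarrow> (nat \<Rightarrow> real \<Rightarrow> real)
       \<Rightarrow> nat \<Rightarrow> nat \<Rightarrow> real \<Rightarrow> real" where
  "interval_system N g gL gR j k x =
     2 powr (real j / 2) *
       (if k < N then gL k (2 ^ j * x)
        else if k < 2 ^ j - N then g (2 ^ j * x - real k)
        else gR (2 ^ j - 1 - k) (2 ^ j * (1 - x)))"

definition level_span :: "(nat \<Rightarrow> nat \<Rightarrow> real \<Rightarrow> real) \<Rightarrow> nat \<Rightarrow> (real \<Rightarrow> real) set" where
  "level_span \<Phi> j = {g. \<exists>a. \<forall>x\<in>{0..1}. g x = (\<Sum>k<2 ^ j. a k * \<Phi> j k x)}"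

definition orthonormal_basis_on :: "'i set \<Rightarrow> ('i \<Rightarrow> real \<Rightarrow> real) \<Rightarrow> bool" where
  "orthonormal_basis_on I \<psi> \<longleftrightarrow>
     (\<forall>i\<in>I. \<psi> i \<in> L2) \<and>
     (\<forall>i\<in>I. \<forall>j\<in>I. ip (\<psi> i) (\<psi> j) = (if i = j then 1 else 0)) \<and>
     (\<forall>f\<in>L2. (\<forall>i\<in>I. ip f (\<psi> i) = 0) \<longrightarrow> L2norm f = 0)"

text \<open>\<open>\<psi>\<close> is an \<open>S\<close>-regular boundary-corrected wavelet basis of L2[0,1] with coarsest level
  \<open>J0\<close>; \<open>\<psi> (J0 - 1, k)\<close> is the scaling function \<open>\<Phi> J0 k\<close>.  \<open>2 \<le> J0\<close> is part of "\<open>J0\<close>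
  sufficiently large": the weights \<open>w l\<close> are used at levels \<open>l \<ge> J0 - 1\<close> and are indexed by
  \<open>l \<ge> 1\<close>.\<close>

definition cdv_wavelet_basis :: "nat \<Rightarrow> nat \<Rightarrow> (nat \<times> nat \<Rightarrow> real \<Rightarrow> real) \<Rightarrow> bool" where
  "cdv_wavelet_basis S J0 \<psi> \<longleftrightarrow>
     (\<exists>N p q pL pR qL qR \<Phi> \<Psi>.
        \<Phi> = interval_system N p pL pR \<and> \<Psi> = interval_system N q qL qR \<and>
        2 \<le> J0 \<and> S \<le> N \<and> 2 * N \<le> 2 ^ J0 \<and>
        daubechies_pair N p q \<and> Ck_smooth S p \<and> Ck_smooth S q \<and>
        (\<forall>k<N. \<forall>g\<in>{pL k, pR k, qL k, qR k}. Ck_smooth S g \<and> (\<exists>A. \<forall>y>A. g y = 0)) \<and>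
        (\<forall>j\<ge>J0.
           (\<forall>k<2 ^ j. \<forall>m<2 ^ j. ip (\<Phi> j k) (\<Phi> j m) = (if k = m then 1 else 0)) \<and>
           (\<forall>k<2 ^ j. \<forall>m<2 ^ j. ip (\<Phi> j k) (\<Psi> j m) = 0) \<and>
           (\<forall>k<2 ^ j. \<Phi> j k \<in> level_span \<Phi> (Suc j) \<and> \<Psi> j k \<in> level_span \<Phi> (Suc j)) \<and>
           (\<forall>i<N. (\<lambda>x. x ^ i) \<in> level_span \<Phi> j)) \<and>
        (\<forall>k<2 ^ J0. \<psi> (J0 - 1, k) = \<Phi> J0 k) \<and>
        (\<forall>l\<ge>J0. \<forall>k<2 ^ l. \<psi> (l, k) = \<Psi> l k) \<and>
        orthonormal_basis_on (idx_inf J0) \<psi>)"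

definition besov_norm :: "real \<Rightarrow> nat \<Rightarrow> (nat \<times> nat \<Rightarrow> real \<Rightarrow> real) \<Rightarrow> (real \<Rightarrow> real) \<Rightarrow> ereal" where
  "besov_norm s J0 \<psi> f =
     ereal (Max ((\<lambda>k. \<bar>ip (\<psi> (J0 - 1, k)) f\<bar>) ` {..<2 ^ J0})) +
     (SUP (l, k)\<in>{(l, k). J0 \<le> l \<and> k < 2 ^ l}.
        ereal (2 powr (real l * (s + 1 / 2)) * \<bar>ip (\<psi> (l, k)) f\<bar>))"

text \<open>Restricting to \<open>L2\<close> loses nothing: a finite norm with \<open>s > 0\<close> makes the
  coefficients square summable.\<close>

definition besov :: "real \<Rightarrow> nat \<Rightarrow> (nat \<times> nat \<Rightarrow> real \<Rightarrow> real) \<Rightarrow> (real \<Rightarrow> real) set" where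
  "besov s J0 \<psi> = {f \<in> L2. besov_norm s J0 \<psi> f < \<infinity>}"

section \<open>Wavelet--vaguelette decomposition\<close>

definition linear_on_L2 :: "((real \<Rightarrow> real) \<Rightarrow> real \<Rightarrow> real) \<Rightarrow> bool" where
  "linear_on_L2 K \<longleftrightarrow>
     (\<forall>f\<in>L2. K f \<in> L2) \<and>
     (\<forall>f\<in>L2. \<forall>g\<in>L2. \<forall>a b.
        AE x in lebesgue_on {0..1}. K (\<lambda>x. a * f x + b * g x) x = a * K f x + b * K g x)"

definition near_orthogonal :: "'i set \<Rightarrow> ('i \<Rightarrow> real \<Rightarrow> real) \<Rightarrow> bool" where
  "near_orthogonal I v \<longleftrightarrow>
     (\<exists>c>0. \<exists>C>0. \<forall>F a. finite F \<and> F \<subseteq> I \<longrightarrow>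
        c * (\<Sum>i\<in>F. (a i)\<^sup>2) \<le> (L2norm (\<lambda>x. \<Sum>i\<in>F. a i * v i x))\<^sup>2 \<and>
        (L2norm (\<lambda>x. \<Sum>i\<in>F. a i * v i x))\<^sup>2 \<le> C * (\<Sum>i\<in>F. (a i)\<^sup>2))"

definition comparable_on :: "'i set \<Rightarrow> ('i \<Rightarrow> real) \<Rightarrow> ('i \<Rightarrow> real) \<Rightarrow> bool" where
  "comparable_on I f g \<longleftrightarrow> (\<exists>c>0. \<exists>C>0. \<forall>i\<in>I. c * g i \<le> f i \<and> f i \<le> C * g i)"

text \<open>The relation \<open>ip (v1 i) (K f) = \<kappa> i * ip f (\<psi> i)\<close> is what turns the observation
  \<open>\<integral> v1 i dY\<close> into \<open>\<kappa> i * ip f (\<psi> i)\<close> plus noise.  For a continuous \<open>K\<close> it follows from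
  \<open>K (\<psi> i) = \<kappa> i * v2 i\<close> and biorthogonality; continuity itself is not assumed.\<close>

definition wvd ::
    "nat \<Rightarrow> (nat \<times> nat \<Rightarrow> real \<Rightarrow> real) \<Rightarrow> ((real \<Rightarrow> real) \<Rightarrow> real \<Rightarrow> real)
       \<Rightarrow> (nat \<times> nat \<Rightarrow> real \<Rightarrow> real) \<Rightarrow> (nat \<times> nat \<Rightarrow> real \<Rightarrow> real) \<Rightarrow> (nat \<times> nat \<Rightarrow> real) \<Rightarrow> bool" where
  "wvd J0 \<psi> K v1 v2 \<kappa> \<longleftrightarrow>
     linear_on_L2 K \<and>
     (\<forall>i\<in>idx_inf J0. v1 i \<in> L2 \<and> v2 i \<in> L2 \<and> 0 < \<kappa> i) \<and>
     (\<forall>i\<in>idx_inf J0. AE x in lebesgue_on {0..1}. K (\<psi> i) x = \<kappa> i * v2 i x) \<and>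
     (\<forall>i\<in>idx_inf J0. \<forall>f\<in>L2. ip (v1 i) (K f) = \<kappa> i * ip f (\<psi> i)) \<and>
     (\<forall>i\<in>idx_inf J0. \<forall>j\<in>idx_inf J0. ip (v1 i) (v2 j) = (if i = j then 1 else 0)) \<and>
     near_orthogonal (idx_inf J0) v1 \<and> near_orthogonal (idx_inf J0) v2 \<and>
     (\<exists>r>0. comparable_on (idx_inf J0) \<kappa> (\<lambda>(l, k). 2 powr (- r * real l)) \<or>
            comparable_on (idx_inf J0) \<kappa> (\<lambda>(l, k). exp (- r * 2 ^ l)))"

section \<open>The white noise model\<close>

text \<open>The law of canonical white noise, as a measure on the product space of the values
  \<open>W g = \<integral> g dW\<close>: the \<open>W g\<close> are centred Gaussian with variance \<open>(L2norm g)\<^sup>2\<close>, and \<open>W\<close> is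
  almost surely linear, so that they are jointly Gaussian with covariance \<open>ip\<close>.\<close>

definition white_noise :: "((real \<Rightarrow> real) \<Rightarrow> real) measure \<Rightarrow> bool" where
  "white_noise Q \<longleftrightarrow>
     prob_space Q \<and> sets Q = sets (Pi\<^sub>M L2 (\<lambda>_. borel)) \<and>
     (\<forall>g\<in>L2. 0 < L2norm g \<longrightarrow>
        distributed Q lborel (\<lambda>W. W g) (normal_density 0 (L2norm g))) \<and>
     (\<forall>g\<in>L2. L2norm g = 0 \<longrightarrow> (AE W in Q. W g = 0)) \<and>
     (\<forall>g\<in>L2. \<forall>h\<in>L2. \<forall>a b. AE W in Q. W (\<lambda>x. a * g x + b * h x) = a * W g + b * W h)"

text \<open>The law of \<open>Y\<close>, \<open>dY = \<mu> dt + n powr (-1/2) dW\<close>; a sample point \<open>Y\<close> gives the values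
  \<open>Y g = \<integral> g dY\<close>.\<close>

definition obs_law ::
    "nat \<Rightarrow> (real \<Rightarrow> real) \<Rightarrow> ((real \<Rightarrow> real) \<Rightarrow> real) measure \<Rightarrow> ((real \<Rightarrow> real) \<Rightarrow> real) measure" where
  "obs_law n \<mu> Q = distr Q (Pi\<^sub>M L2 (\<lambda>_. borel)) (\<lambda>W. \<lambda>g\<in>L2. ip g \<mu> + W g / sqrt (real n))"

definition covariance :: "'a measure \<Rightarrow> ('a \<Rightarrow> real) \<Rightarrow> ('a \<Rightarrow> real) \<Rightarrow> real" where
  "covariance M X Z = (\<integral>\<omega>. (X \<omega> - (\<integral>\<omega>'. X \<omega>' \<partial>M)) * (Z \<omega> - (\<integral>\<omega>'. Z \<omega>' \<partial>M)) \<partial>M)"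

definition obs_cov ::
    "nat \<Rightarrow> nat \<Rightarrow> (nat \<times> nat \<Rightarrow> real \<Rightarrow> real) \<Rightarrow> ((real \<Rightarrow> real) \<Rightarrow> real) measure \<Rightarrow> real mat" where
  "obs_cov J0 J v1 P =
     mat (2 ^ J) (2 ^ J) (\<lambda>(i, j).
       covariance P (\<lambda>Y. Y (v1 (enum_idx J0 i))) (\<lambda>Y. Y (v1 (enum_idx J0 j))))"

definition inv_sqrt_mat :: "real mat \<Rightarrow> real mat" where
  "inv_sqrt_mat M =
     (THE A. A \<in> carrier_mat (dim_row M) (dim_row M) \<and> transpose_mat A = A \<and>
        (\<forall>v\<in>carrier_vec (dim_row M). v \<noteq> 0\<^sub>v (dim_row M) \<longrightarrow> 0 < scalar_prod v (A *\<^sub>v v)) \<and>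
        A * A * M = 1\<^sub>m (dim_row M))"

definition design ::
    "nat \<Rightarrow> nat \<Rightarrow> (nat \<times> nat \<Rightarrow> real) \<Rightarrow> (nat \<times> nat \<Rightarrow> real \<Rightarrow> real)
       \<Rightarrow> ((real \<Rightarrow> real) \<Rightarrow> real) measure \<Rightarrow> real mat" where
  "design J0 J \<kappa> v1 P =
     inv_sqrt_mat (obs_cov J0 J v1 P) * mat_diag (2 ^ J) (\<lambda>i. \<kappa> (enum_idx J0 i))"

definition to_vec :: "nat \<Rightarrow> nat \<Rightarrow> (nat \<times> nat \<Rightarrow> real) \<Rightarrow> real Matrix.vec" where
  "to_vec J0 J b = Matrix.vec (2 ^ J) (\<lambda>i. b (enum_idx J0 i))"

definition vec_norm2 :: "real Matrix.vec \<Rightarrow> real" where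
  "vec_norm2 v = sqrt (scalar_prod v v)"

section \<open>Sieve prior and quasi-posterior\<close>

text \<open>Coefficient vectors indexed by \<open>idx J0 J\<close> are extensional functions, with Lebesgue
  measure.\<close>

definition coef_lebesgue :: "nat \<Rightarrow> nat \<Rightarrow> (nat \<times> nat \<Rightarrow> real) measure" where
  "coef_lebesgue J0 J = Pi\<^sub>M (idx J0 J) (\<lambda>_. lborel)"

definition prior_density :: "nat \<Rightarrow> nat \<Rightarrow> ((nat \<times> nat \<Rightarrow> real) \<Rightarrow> real) \<Rightarrow> bool" where
  "prior_density J0 J \<pi> \<longleftrightarrow>
     \<pi> \<in> borel_measurable (coef_lebesgue J0 J) \<and>
     (\<forall>b\<in>space (coef_lebesgue J0 J). 0 \<le> \<pi> b) \<and>
     (\<integral>\<^sup>+b. ennreal (\<pi> b) \<partial>coef_lebesgue J0 J) = 1"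

definition true_coefs ::
    "nat \<Rightarrow> nat \<Rightarrow> (nat \<times> nat \<Rightarrow> real \<Rightarrow> real) \<Rightarrow> (real \<Rightarrow> real) \<Rightarrow> nat \<times> nat \<Rightarrow> real" where
  "true_coefs J0 J \<psi> f0 = (\<lambda>i\<in>idx J0 J. ip f0 (\<psi> i))"

definition series :: "nat \<Rightarrow> nat \<Rightarrow> (nat \<times> nat \<Rightarrow> real \<Rightarrow> real) \<Rightarrow> (nat \<times> nat \<Rightarrow> real) \<Rightarrow> real \<Rightarrow> real" where
  "series J0 J \<psi> b x = (\<Sum>i\<in>idx J0 J. b i * \<psi> i x)"

definition local_ball ::
    "nat \<Rightarrow> nat \<Rightarrow> real mat \<Rightarrow> (nat \<times> nat \<Rightarrow> real) \<Rightarrow> real \<Rightarrow> (nat \<times> nat \<Rightarrow> real) set" where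
  "local_ball J0 J X b0 R =
     {b \<in> space (coef_lebesgue J0 J). vec_norm2 (X *\<^sub>v to_vec J0 J (\<lambda>i. b i - b0 i)) \<le> R}"

text \<open>The convention \<open>x / 0 = 0\<close> is harmless when \<open>\<pi> b0 > 0\<close>: if \<open>\<pi>\<close> vanishes somewhere on
  the ball, the infimum is 0 in any case.\<close>

definition prior_flatness ::
    "nat \<Rightarrow> nat \<Rightarrow> real mat \<Rightarrow> (nat \<times> nat \<Rightarrow> real) \<Rightarrow> ((nat \<times> nat \<Rightarrow> real) \<Rightarrow> real) \<Rightarrow> real \<Rightarrow> real" where
  "prior_flatness J0 J X b0 \<pi> R =
     1 - (INF (b, b')\<in>local_ball J0 J X b0 R \<times> local_ball J0 J X b0 R. \<pi> b' / \<pi> b)"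

definition quasi_posterior ::
    "nat \<Rightarrow> nat \<Rightarrow> (nat \<times> nat \<Rightarrow> real) \<Rightarrow> (nat \<times> nat \<Rightarrow> real \<Rightarrow> real) \<Rightarrow> ((real \<Rightarrow> real) \<Rightarrow> real) measure
       \<Rightarrow> ((nat \<times> nat \<Rightarrow> real) \<Rightarrow> real) \<Rightarrow> ((real \<Rightarrow> real) \<Rightarrow> real) \<Rightarrow> (nat \<times> nat \<Rightarrow> real) measure" where
  "quasi_posterior J0 J \<kappa> v1 P \<pi> Y =
     (let lik = (\<lambda>b. exp (- (1 / 2) *
                 (vec_norm2 (inv_sqrt_mat (obs_cov J0 J v1 P) *\<^sub>v to_vec J0 J (\<lambda>i. Y (v1 i))
                             - design J0 J \<kappa> v1 P *\<^sub>v to_vec J0 J b))\<^sup>2))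
      in density (coef_lebesgue J0 J)
           (\<lambda>b. ennreal (\<pi> b * lik b / (\<integral>b'. \<pi> b' * lik b' \<partial>coef_lebesgue J0 J))))"

section \<open>Weights and bands\<close>

definition weight_max :: "nat \<Rightarrow> (nat \<Rightarrow> real) \<Rightarrow> nat \<Rightarrow> real" where
  "weight_max J0 w J = Max (w ` {J0 - 1..J - 1})"

definition weight_u :: "(nat \<times> nat \<Rightarrow> real) \<Rightarrow> (nat \<Rightarrow> real) \<Rightarrow> nat \<Rightarrow> real" where
  "weight_u \<kappa> w J = (INF (l, k)\<in>{(l, k). J \<le> l \<and> k < 2 ^ l}. \<kappa> (l, k) * w l / sqrt (real l))"

definition weight_v :: "nat \<Rightarrow> (nat \<times> nat \<Rightarrow> real) \<Rightarrow> (nat \<Rightarrow> real) \<Rightarrow> nat \<Rightarrow> real" where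
  "weight_v J0 \<kappa> w J =
     (SUP (l, k)\<in>{(l, k). J0 \<le> l \<and> l \<le> J - 1 \<and> k < 2 ^ l}. \<kappa> (l, k) * w l / sqrt (real l))"

definition kappa_max :: "nat \<Rightarrow> (nat \<times> nat \<Rightarrow> real) \<Rightarrow> nat \<Rightarrow> real" where
  "kappa_max J0 \<kappa> J = Max (\<kappa> ` idx J0 J)"

definition kappa_min :: "nat \<Rightarrow> (nat \<times> nat \<Rightarrow> real) \<Rightarrow> nat \<Rightarrow> real" where
  "kappa_min J0 \<kappa> J = Min (\<kappa> ` idx J0 J)"

definition weight_ratio :: "nat \<Rightarrow> (nat \<times> nat \<Rightarrow> real) \<Rightarrow> (nat \<Rightarrow> real) \<Rightarrow> nat \<Rightarrow> real" where
  "weight_ratio J0 \<kappa> w J =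
     sqrt (real J) / (kappa_max J0 \<kappa> J * weight_max J0 w J) * weight_u \<kappa> w J"

text \<open>Both divergences are monotone, on the levels \<open>\<ge> J0\<close> where the quantities are defined.\<close>

definition admissible_weights :: "nat \<Rightarrow> (nat \<times> nat \<Rightarrow> real) \<Rightarrow> (nat \<Rightarrow> real) \<Rightarrow> bool" where
  "admissible_weights J0 \<kappa> w \<longleftrightarrow>
     (\<forall>l\<ge>1. 0 < w l) \<and>
     (let m = (\<lambda>l. Min ((\<lambda>k. \<kappa> (l, k) * w l / sqrt (real l)) ` {..<2 ^ l}))
      in mono_on {J0..} m \<and> filterlim m at_top sequentially) \<and>
     (\<forall>J\<ge>J0. 1 \<le> weight_ratio J0 \<kappa> w J) \<and>
     mono_on {J0..} (weight_ratio J0 \<kappa> w) \<and>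
     filterlim (weight_ratio J0 \<kappa> w) at_top sequentially"

text \<open>Wavelet coefficients of the (possibly generalized) function with series
  \<open>\<Sum>i. \<psi> i * Y (v1 i) / \<kappa> i\<close>.\<close>

definition fhat_coef ::
    "(nat \<times> nat \<Rightarrow> real) \<Rightarrow> (nat \<times> nat \<Rightarrow> real \<Rightarrow> real) \<Rightarrow> ((real \<Rightarrow> real) \<Rightarrow> real) \<Rightarrow> nat \<times> nat \<Rightarrow> real" where
  "fhat_coef \<kappa> v1 Y i = Y (v1 i) / \<kappa> i"

text \<open>A band is given by the coefficients \<open>c\<close> of its centre, which may be a generalized
  function.  The supremum is extended-valued.  Only members of \<open>L2\<close> are relevant below: the
  true function, the finite series under the posterior, and functions in a Besov ball.\<close>

definition band ::
    "nat \<Rightarrow> (nat \<times> nat \<Rightarrow> real \<Rightarrow> real) \<Rightarrow> (nat \<Rightarrow> real) \<Rightarrow> (nat \<times> nat \<Rightarrow> real) \<Rightarrow> real \<Rightarrow> (real \<Rightarrow> real) set" where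
  "band J0 \<psi> w c R =
     {f \<in> L2. (SUP (l, k)\<in>idx_inf J0. ereal (\<bar>ip f (\<psi> (l, k)) - c (l, k)\<bar> / w l)) \<le> ereal R}"

definition credible_radius ::
    "nat \<Rightarrow> nat \<Rightarrow> (nat \<times> nat \<Rightarrow> real \<Rightarrow> real) \<Rightarrow> (nat \<times> nat \<Rightarrow> real) \<Rightarrow> (nat \<times> nat \<Rightarrow> real \<Rightarrow> real)
       \<Rightarrow> (nat \<Rightarrow> real) \<Rightarrow> ((real \<Rightarrow> real) \<Rightarrow> real) measure \<Rightarrow> ((nat \<times> nat \<Rightarrow> real) \<Rightarrow> real) \<Rightarrow> real
       \<Rightarrow> (((real \<Rightarrow> real) \<Rightarrow> real) \<Rightarrow> real) \<Rightarrow> bool" where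
  "credible_radius J0 J \<psi> \<kappa> v1 w P \<pi> \<alpha> Rhat \<longleftrightarrow>
     Rhat \<in> borel_measurable P \<and>
     (\<forall>Y\<in>space P. measure (quasi_posterior J0 J \<kappa> v1 P \<pi> Y)
        {b \<in> space (coef_lebesgue J0 J).
           series J0 J \<psi> b
             \<in> band J0 \<psi> w (\<lambda>i. ip (series J0 J \<psi> (fhat_coef \<kappa> v1 Y)) (\<psi> i)) (Rhat Y)} = 1 - \<alpha>)"

definition high_freq_event ::
    "nat \<Rightarrow> (nat \<times> nat \<Rightarrow> real \<Rightarrow> real) \<Rightarrow> (nat \<times> nat \<Rightarrow> real) \<Rightarrow> (nat \<times> nat \<Rightarrow> real \<Rightarrow> real)
       \<Rightarrow> (nat \<Rightarrow> real) \<Rightarrow> ((real \<Rightarrow> real) \<Rightarrow> real) measure \<Rightarrow> (real \<Rightarrow> real)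
       \<Rightarrow> (((real \<Rightarrow> real) \<Rightarrow> real) \<Rightarrow> real) \<Rightarrow> ((real \<Rightarrow> real) \<Rightarrow> real) set" where
  "high_freq_event J \<psi> \<kappa> v1 w P f0 Rhat =
     {Y \<in> space P. (SUP (l, k)\<in>{(l, k). J \<le> l \<and> k < 2 ^ l}.
        ereal (\<bar>ip f0 (\<psi> (l, k)) - fhat_coef \<kappa> v1 Y (l, k)\<bar> / w l)) \<le> ereal (Rhat Y)}"

end

theory Submission
  imports Defs
begin

text \<open>
  The coefficients of the band's centre are the true coefficients plus Gaussian errors, and
  everything is compared with the exact law of these errors.  Let \<open>M\<close> be a triangular matrix
  with positive diagonal for which the levels below \<open>J\<close> of the error, multiplied by \<open>M\<close>, become
  standard normal.  It is produced by orthonormalising the functions \<open>v1\<close> (\<open>gram_schmidt\<close>,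
  \<open>whitening_exists\<close>), which near-orthogonality permits, and which bounds the diagonal of \<open>M\<close>
  by \<open>sqrt (n / c) * \<kappa>\<close>.  The design matrix \<open>X\<close> contains the symmetric root of the inverse
  covariance instead; both have the same Gram matrix, so norms \<open>\<parallel>X b\<parallel>\<close> and the determinant of
  \<open>X\<^sup>T X\<close> are those of \<open>M\<close> (\<open>whitened_design\<close>).  Triangular matrices are convenient because
  densities, volumes and conditional laws reduce to one coordinate at a time.

  Call \<open>Y\<close> good if the whitened error is at most \<open>R / 4\<close>, where \<open>R\<close> is a multiple of
  \<open>sqrt (2^J * ln n)\<close>; this fails with probability at most \<open>n powr (- 2^J)\<close>.  For a good \<open>Y\<close> the
  quasi-posterior is close in total variation to the normal law around the centre with precision
  \<open>X\<^sup>T X\<close>: on the ball of radius \<open>R\<close> the prior density is constant up to the flatness of the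
  prior, and outside it the likelihood is negligible against the evidence, which the ball of
  radius \<open>1 / sqrt n\<close> bounds from below (\<open>posterior_normal_approximation\<close>, \<open>posterior_close\<close>).

  The credible radius is therefore an approximate \<open>(1 - \<alpha>)\<close>-quantile of the maximal weighted
  error below level \<open>J\<close>.  It depends on the same data as that maximum, but it lies between two
  deterministic quantiles, and this suffices for the coverage of the low levels
  (\<open>random_quantile_coverage\<close>, \<open>coverage\<close>).  The high levels enter through the event \<open>H3\<close>.

  To bound the probability of its complement, the credible radius has to be bounded from below.
  Given the preceding ones, each of the \<open>2^J\<close> errors is normal with standard deviation at least
  \<open>sqrt (c / n) / \<kappa>\<close>, so that the maximum is rarely smaller than a multiple of
  \<open>sqrt (J / n) / (kappa_max * weight_max)\<close> (\<open>gauss_cube_bound\<close>, \<open>radius_lower_bound\<close>); a union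
  bound over the levels from \<open>J\<close> on finishes the argument (\<open>high_frequency_tail\<close>).

  For the diameter, the credible radius is at most \<open>\<tau> / sqrt n\<close> with \<open>\<tau>\<close> independent of \<open>n\<close> and
  \<open>J\<close>, by the same kind of union bound (\<open>radius_upper_bound\<close>).  The levels from \<open>J - 1\<close> on are
  controlled by the Besov ball.  Below them the weights are small in comparison with
  \<open>weight_v * sqrt J / kappa_min\<close> once the ratio of the admissibility condition at \<open>J - 1\<close>
  exceeds \<open>\<tau>\<close> (\<open>coarse_weights_bound\<close>), and the band gives the bound (\<open>band_diameter\<close>).
\<close>

section \<open>Triangular changes of variables\<close>

interpretation lborel_prod: product_sigma_finite "\<lambda>_. lborel :: real measure"
  by standard

text \<open>Lower triangular with positive diagonal, without an order on the index set: the indices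
  are added one at a time, and a new index does not occur in the rows of the earlier ones.
  Induction on the predicate then integrates out, or solves for, the new coordinate.\<close>
inductive triangular :: "('i \<Rightarrow> 'i \<Rightarrow> real) \<Rightarrow> 'i set \<Rightarrow> bool" for M where
  empty: "triangular M {}"
| insert: "triangular M I \<Longrightarrow> i \<notin> I \<Longrightarrow> (\<And>j. j \<in> I \<Longrightarrow> M j i = 0) \<Longrightarrow> 0 < M i i
    \<Longrightarrow> triangular M (insert i I)"

definition lin :: "('i \<Rightarrow> 'i \<Rightarrow> real) \<Rightarrow> 'i set \<Rightarrow> ('i \<Rightarrow> real) \<Rightarrow> 'i \<Rightarrow> real" where
  "lin M I b = (\<lambda>i\<in>I. \<Sum>j\<in>I. M i j * b j)"

lemma triangular_finite: "triangular M I \<Longrightarrow> finite I"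
  by (induction rule: triangular.induct) auto

lemma triangular_diag_pos: "triangular M I \<Longrightarrow> i \<in> I \<Longrightarrow> 0 < M i i"
  by (induction rule: triangular.induct) auto

lemma lin_measurable [measurable]:
  assumes "i \<in> I"
  shows "(\<lambda>b. lin M I b i) \<in> borel_measurable (Pi\<^sub>M I (\<lambda>_. lborel))"
  using assms unfolding lin_def by simp

lemma affine_measurable [measurable]:
  "(\<lambda>b. \<lambda>i\<in>I. lin M I b i + a i) \<in> measurable (Pi\<^sub>M I (\<lambda>_. lborel)) (Pi\<^sub>M I (\<lambda>_. lborel))"
  by (rule measurable_restrict) simp

lemma lin_insert:
  assumes "finite I" "i \<notin> I" "\<And>j. j \<in> I \<Longrightarrow> M j i = 0"
  shows "k \<in> I \<Longrightarrow> lin M (insert i I) (x(i := y)) k = lin M I x k"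
    and "lin M (insert i I) (x(i := y)) i = M i i * y + (\<Sum>j\<in>I. M i j * x j)"
proof -
  have e: "(\<Sum>j\<in>I. M k j * (if j = i then y else x j)) = (\<Sum>j\<in>I. M k j * x j)" for k
    using assms(2) by (intro sum.cong) auto
  show "k \<in> I \<Longrightarrow> lin M (insert i I) (x(i := y)) k = lin M I x k"
    using assms e[of k] by (simp add: lin_def)
  show "lin M (insert i I) (x(i := y)) i = M i i * y + (\<Sum>j\<in>I. M i j * x j)"
    using assms e[of i] by (simp add: lin_def)
qed

text \<open>The substitution is an iterated one-dimensional affine substitution, so that Fubini's
  theorem suffices and the Jacobian determinant is the product of the diagonal.\<close>
lemma nn_integral_triangular:
  assumes "triangular M I" "F \<in> borel_measurable (Pi\<^sub>M I (\<lambda>_. lborel))"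
  shows "(\<integral>\<^sup>+b. F b \<partial>Pi\<^sub>M I (\<lambda>_. lborel))
    = ennreal (\<Prod>i\<in>I. M i i) * (\<integral>\<^sup>+b. F (\<lambda>i\<in>I. lin M I b i + a i) \<partial>Pi\<^sub>M I (\<lambda>_. lborel))"
  using assms
proof (induction arbitrary: F rule: triangular.induct)
  case empty
  then show ?case by (simp add: PiM_empty nn_integral_count_space_finite)
next
  case (insert I i)
  note [measurable] = insert.prems
  have fin[simp]: "finite I" using insert.hyps triangular_finite by auto
  define t where "t x = (\<Sum>j\<in>I. M i j * x j) + a i" for x
  have upd: "(\<lambda>k\<in>insert i I. lin M (insert i I) (x(i := y)) k + a k)
      = (\<lambda>k\<in>I. lin M I x k + a k)(i := t x + M i i * y)" for x y
    using lin_insert[of I i M] insert.hyps by (auto simp: fun_eq_iff t_def restrict_def)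
  have ne: "M i i \<noteq> 0" using insert.hyps by simp
  have F'[measurable]: "(\<lambda>x. \<integral>\<^sup>+y. F (x(i := y)) \<partial>lborel) \<in> borel_measurable (Pi\<^sub>M I (\<lambda>_. lborel))"
    by measurable
  have aff: "(\<integral>\<^sup>+y. F (z(i := y)) \<partial>lborel)
      = ennreal (M i i) * (\<integral>\<^sup>+y. F (z(i := c + M i i * y)) \<partial>lborel)"
    if "z \<in> space (Pi\<^sub>M I (\<lambda>_. lborel))" for z c
  proof -
    have "(\<lambda>y. F (z(i := y))) \<in> borel_measurable borel"
      using measurable_compose[OF measurable_component_update[OF that insert.hyps(2)] insert.prems]
      by (simp add: fun_upd_def)
    from nn_integral_real_affine[OF this ne, of c] show ?thesis using insert.hyps by simp
  qed
  have "(\<integral>\<^sup>+b. F b \<partial>Pi\<^sub>M (insert i I) (\<lambda>_. lborel))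
      = (\<integral>\<^sup>+x. \<integral>\<^sup>+y. F (x(i := y)) \<partial>lborel \<partial>Pi\<^sub>M I (\<lambda>_. lborel))"
    by (rule lborel_prod.product_nn_integral_insert) (use insert in auto)
  also have "\<dots> = ennreal (\<Prod>k\<in>I. M k k) *
      (\<integral>\<^sup>+x. \<integral>\<^sup>+y. F ((\<lambda>k\<in>I. lin M I x k + a k)(i := y)) \<partial>lborel \<partial>Pi\<^sub>M I (\<lambda>_. lborel))"
    by (rule insert.IH[OF F'])
  also have "(\<integral>\<^sup>+x. \<integral>\<^sup>+y. F ((\<lambda>k\<in>I. lin M I x k + a k)(i := y)) \<partial>lborel \<partial>Pi\<^sub>M I (\<lambda>_. lborel))
      = (\<integral>\<^sup>+x. ennreal (M i i) * (\<integral>\<^sup>+y. F ((\<lambda>k\<in>I. lin M I x k + a k)(i := t x + M i i * y)) \<partial>lborel)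
          \<partial>Pi\<^sub>M I (\<lambda>_. lborel))"
    by (intro nn_integral_cong aff) (simp add: space_PiM)
  also have "\<dots> = (\<integral>\<^sup>+x. ennreal (M i i) *
        (\<integral>\<^sup>+y. F (\<lambda>k\<in>insert i I. lin M (insert i I) (x(i := y)) k + a k) \<partial>lborel) \<partial>Pi\<^sub>M I (\<lambda>_. lborel))"
    by (simp only: upd)
  also have "\<dots> = ennreal (M i i) *
      (\<integral>\<^sup>+x. (\<integral>\<^sup>+y. F (\<lambda>k\<in>insert i I. lin M (insert i I) (x(i := y)) k + a k) \<partial>lborel) \<partial>Pi\<^sub>M I (\<lambda>_. lborel))"
    by (rule nn_integral_cmult) (use insert.hyps in measurable)
  also have "(\<integral>\<^sup>+x. (\<integral>\<^sup>+y. F (\<lambda>k\<in>insert i I. lin M (insert i I) (x(i := y)) k + a k) \<partial>lborel) \<partial>Pi\<^sub>M I (\<lambda>_. lborel))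
     = (\<integral>\<^sup>+b. F (\<lambda>k\<in>insert i I. lin M (insert i I) b k + a k) \<partial>Pi\<^sub>M (insert i I) (\<lambda>_. lborel))"
    by (rule lborel_prod.product_nn_integral_insert[symmetric]) (use insert in auto)
  finally have "(\<integral>\<^sup>+b. F b \<partial>Pi\<^sub>M (insert i I) (\<lambda>_. lborel)) = ennreal (\<Prod>k\<in>I. M k k) * (ennreal (M i i) *
      (\<integral>\<^sup>+b. F (\<lambda>k\<in>insert i I. lin M (insert i I) b k + a k) \<partial>Pi\<^sub>M (insert i I) (\<lambda>_. lborel)))" .
  moreover have "ennreal (\<Prod>k\<in>insert i I. M k k) = ennreal (\<Prod>k\<in>I. M k k) * ennreal (M i i)"
    using insert.hyps triangular_diag_pos[OF insert.hyps(1)]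
    by (simp add: ennreal_mult' less_imp_le mult.commute)
  ultimately show ?case by (simp only: mult.assoc)
qed

section \<open>One-dimensional Gaussian estimates\<close>

lemma nn_integral_std_normal: "(\<integral>\<^sup>+x. ennreal (std_normal_density x) \<partial>lborel) = 1"
  using prob_space.emeasure_space_1[OF prob_space_normal_density[of 1 0]]
  by (simp add: emeasure_density)

text \<open>The tilted density is \<open>sqrt 2\<close> times the density of variance \<open>2 * \<sigma>\<^sup>2\<close>.  The Chernoff
  bounds below all use the exponential of this square, which extends to Euclidean norms.\<close>
lemma nn_integral_exp_square_normal:
  assumes "0 < \<sigma>"
  shows "(\<integral>\<^sup>+x. ennreal (exp (x\<^sup>2 / (4 * \<sigma>\<^sup>2)) * normal_density 0 \<sigma> x) \<partial>lborel) = ennreal (sqrt 2)"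
proof -
  have e: "exp (x\<^sup>2 / (4 * \<sigma>\<^sup>2)) * normal_density 0 \<sigma> x = sqrt 2 * normal_density 0 (sqrt 2 * \<sigma>) x" for x
  proof -
    have "exp (x\<^sup>2 / (4 * \<sigma>\<^sup>2)) * exp (- (x\<^sup>2 / (2 * \<sigma>\<^sup>2))) = exp (- (x\<^sup>2 / (4 * \<sigma>\<^sup>2)))"
      using assms by (simp add: exp_add[symmetric] field_simps)
    moreover have "1 / sqrt (2 * pi * \<sigma>\<^sup>2) = sqrt 2 * (1 / sqrt (2 * pi * (sqrt 2 * \<sigma>)\<^sup>2))"
      using assms by (simp add: power_mult_distrib real_sqrt_mult divide_simps)
    ultimately show ?thesis using assms
      by (simp add: normal_density_def power_mult_distrib)
  qed
  have "(\<integral>\<^sup>+x. ennreal (exp (x\<^sup>2 / (4 * \<sigma>\<^sup>2)) * normal_density 0 \<sigma> x) \<partial>lborel)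
      = ennreal (sqrt 2) * (\<integral>\<^sup>+x. ennreal (normal_density 0 (sqrt 2 * \<sigma>) x) \<partial>lborel)"
    unfolding e by (simp add: ennreal_mult' nn_integral_cmult)
  also have "(\<integral>\<^sup>+x. ennreal (normal_density 0 (sqrt 2 * \<sigma>) x) \<partial>lborel) = 1"
    using prob_space.emeasure_space_1[OF prob_space_normal_density[of "sqrt 2 * \<sigma>" 0]] assms
    by (simp add: emeasure_density)
  finally show ?thesis by simp
qed

lemma normal_tail:
  assumes "prob_space Q" "0 < \<sigma>" "\<sigma>\<^sup>2 \<le> V" "0 \<le> t"
    and d: "distributed Q lborel X (normal_density 0 \<sigma>)"
  shows "measure Q {x \<in> space Q. t < \<bar>X x\<bar>} \<le> sqrt 2 * exp (- (t\<^sup>2 / (4 * V)))"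
proof -
  interpret prob_space Q by fact
  have m[measurable]: "X \<in> borel_measurable Q" using distributed_measurable[OF d] by simp
  have "emeasure Q {x \<in> space Q. t < \<bar>X x\<bar>}
      = (\<integral>\<^sup>+x. ennreal (normal_density 0 \<sigma> x) * indicator {x. t < \<bar>x\<bar>} x \<partial>lborel)"
    using distributed_emeasure[OF d, of "{x. t < \<bar>x\<bar>}"]
    by (simp add: vimage_def Int_def conj_commute)
  also have "\<dots> \<le> (\<integral>\<^sup>+x. ennreal (exp (- (t\<^sup>2 / (4 * \<sigma>\<^sup>2)))) *
      ennreal (exp (x\<^sup>2 / (4 * \<sigma>\<^sup>2)) * normal_density 0 \<sigma> x) \<partial>lborel)"
  proof (rule nn_integral_mono)
    fix x
    have "1 \<le> exp (x\<^sup>2 / (4 * \<sigma>\<^sup>2) - t\<^sup>2 / (4 * \<sigma>\<^sup>2))" if "t < \<bar>x\<bar>"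
    proof -
      have "t\<^sup>2 \<le> x\<^sup>2" using that assms(4) by (simp add: abs_le_square_iff[symmetric])
      then show ?thesis by (simp add: divide_right_mono)
    qed
    then have "normal_density 0 \<sigma> x * indicator {x. t < \<bar>x\<bar>} x
       \<le> exp (- (t\<^sup>2 / (4 * \<sigma>\<^sup>2))) * (exp (x\<^sup>2 / (4 * \<sigma>\<^sup>2)) * normal_density 0 \<sigma> x)"
      using mult_right_mono[of 1 "exp (x\<^sup>2 / (4 * \<sigma>\<^sup>2) - t\<^sup>2 / (4 * \<sigma>\<^sup>2))" "normal_density 0 \<sigma> x"]
      by (auto simp: indicator_def exp_diff exp_minus field_simps)
    then show "ennreal (normal_density 0 \<sigma> x) * indicator {x. t < \<bar>x\<bar>} x
       \<le> ennreal (exp (- (t\<^sup>2 / (4 * \<sigma>\<^sup>2)))) * ennreal (exp (x\<^sup>2 / (4 * \<sigma>\<^sup>2)) * normal_density 0 \<sigma> x)"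
      by (simp add: ennreal_mult'[symmetric] ennreal_indicator[symmetric] ennreal_leI del: ennreal_indicator)
  qed
  also have "\<dots> = ennreal (exp (- (t\<^sup>2 / (4 * \<sigma>\<^sup>2)))) * ennreal (sqrt 2)"
    using nn_integral_exp_square_normal[OF assms(2)] by (subst nn_integral_cmult) auto
  finally have "measure Q {x \<in> space Q. t < \<bar>X x\<bar>} \<le> exp (- (t\<^sup>2 / (4 * \<sigma>\<^sup>2))) * sqrt 2"
    by (simp add: emeasure_eq_measure ennreal_mult'[symmetric])
  also have "exp (- (t\<^sup>2 / (4 * \<sigma>\<^sup>2))) \<le> exp (- (t\<^sup>2 / (4 * V)))"
    using assms by (simp add: frac_le)
  finally show ?thesis by (simp add: mult_ac)
qed

text \<open>A lower bound for the probability that a standard normal variable exceeds \<open>t\<close>: on the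
  interval from \<open>t\<close> to \<open>t + 1\<close> the density is at least its value at the right end.  The default
  for negative \<open>t\<close> matches intervals of negative half-width, which are empty.\<close>
definition upper_tail :: "real \<Rightarrow> real" where
  "upper_tail t = (if 0 \<le> t then std_normal_density (t + 1) else 0)"

lemma upper_tail_bounds: "0 \<le> upper_tail t" "upper_tail t \<le> 1/2"
proof -
  have p: "2 \<le> sqrt (2 * pi)" by (rule real_le_rsqrt) (use pi_gt3 in auto)
  have "exp (- ((t+1)\<^sup>2 / 2)) \<le> 1" by simp
  then have "std_normal_density (t + 1) \<le> 1 / 2"
    using frac_le[of 1 "exp (- ((t+1)\<^sup>2 / 2))" 2 "sqrt (2 * pi)"] p by (simp add: normal_density_def)
  then show "0 \<le> upper_tail t" "upper_tail t \<le> 1/2" by (auto simp: upper_tail_def)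
qed

text \<open>Wherever the interval is centred, it misses an interval of length one just beyond
  distance \<open>t\<close> from the origin, on the side away from the centre.\<close>
lemma std_normal_interval_bound:
  "(\<integral>\<^sup>+x. ennreal (std_normal_density x) * indicator {x. \<bar>x - a\<bar> \<le> t} x \<partial>lborel)
     \<le> ennreal (1 - upper_tail t)"
proof (cases "0 \<le> t")
  case False
  then have "{x. \<bar>x - a\<bar> \<le> t} = {}" by auto
  then show ?thesis by simp
next
  case True
  define U where "U = (if 0 \<le> a then {-(t+1)..< -t} else {t<..t+1})"
  have dis: "{x. \<bar>x - a\<bar> \<le> t} \<inter> U = {}" unfolding U_def using True by auto
  have Um[measurable]: "U \<in> sets borel" by (simp add: U_def)
  have em: "emeasure lborel U = 1" unfolding U_def by auto
  have lb: "std_normal_density (t+1) \<le> std_normal_density x" if "x \<in> U" for x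
  proof -
    have "\<bar>x\<bar> \<le> t + 1" using that True by (auto simp: U_def split: if_splits)
    then have "x\<^sup>2 \<le> (t+1)\<^sup>2" using abs_le_square_iff[of x "t+1"] True by simp
    then show ?thesis by (simp add: normal_density_def divide_right_mono)
  qed
  have "(\<integral>\<^sup>+x. ennreal (std_normal_density x) * indicator {x. \<bar>x - a\<bar> \<le> t} x \<partial>lborel)
      + ennreal (upper_tail t)
    = (\<integral>\<^sup>+x. ennreal (std_normal_density x) * indicator {x. \<bar>x - a\<bar> \<le> t} x \<partial>lborel)
      + (\<integral>\<^sup>+x. ennreal (std_normal_density (t+1)) * indicator U x \<partial>lborel)"
    using True em by (simp add: upper_tail_def nn_integral_cmult)
  also have "\<dots> \<le> (\<integral>\<^sup>+x. ennreal (std_normal_density x) * indicator {x. \<bar>x - a\<bar> \<le> t} x \<partial>lborel)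
      + (\<integral>\<^sup>+x. ennreal (std_normal_density x) * indicator U x \<partial>lborel)"
    by (intro add_left_mono nn_integral_mono) (auto simp: indicator_def lb ennreal_leI)
  also have "\<dots> = (\<integral>\<^sup>+x. ennreal (std_normal_density x) * indicator ({x. \<bar>x - a\<bar> \<le> t} \<union> U) x \<partial>lborel)"
    using dis by (subst nn_integral_add[symmetric]) (auto intro!: nn_integral_cong simp: indicator_def)
  also have "\<dots> \<le> (\<integral>\<^sup>+x. ennreal (std_normal_density x) \<partial>lborel)"
    by (intro nn_integral_mono) (auto simp: indicator_def)
  finally have "(\<integral>\<^sup>+x. ennreal (std_normal_density x) * indicator {x. \<bar>x - a\<bar> \<le> t} x \<partial>lborel)
      + ennreal (upper_tail t) \<le> 1" by (simp only: nn_integral_std_normal)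
  then have "(\<integral>\<^sup>+x. ennreal (std_normal_density x) * indicator {x. \<bar>x - a\<bar> \<le> t} x \<partial>lborel)
      \<le> ennreal 1 - ennreal (upper_tail t)" by (simp add: ennreal_le_minus_iff)
  also have "ennreal 1 - ennreal (upper_tail t) = ennreal (1 - upper_tail t)"
    by (rule ennreal_minus) (rule upper_tail_bounds)
  finally show ?thesis .
qed

text \<open>The density of the centred normal law whose precision matrix is \<open>M\<^sup>T M\<close>, written in the
  whitened coordinates.\<close>
definition gauss :: "('i \<Rightarrow> 'i \<Rightarrow> real) \<Rightarrow> 'i set \<Rightarrow> ('i \<Rightarrow> real) \<Rightarrow> real" where
  "gauss M I b = (\<Prod>i\<in>I. M i i * std_normal_density (lin M I b i))"

lemma gauss_measurable [measurable]: "gauss M I \<in> borel_measurable (Pi\<^sub>M I (\<lambda>_. lborel))"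
  unfolding gauss_def by measurable

text \<open>Anti-concentration without independence.  Given the earlier coordinates, the last one is
  normal with standard deviation \<open>1 / M i i\<close>; whatever its conditional mean, the bound for
  intervals with an arbitrary centre applies.\<close>
lemma gauss_cube_bound:
  assumes "triangular M I"
  shows "(\<integral>\<^sup>+b. ennreal (gauss M I b) * indicator {b. \<forall>i\<in>I. \<bar>b i\<bar> \<le> r i} b \<partial>Pi\<^sub>M I (\<lambda>_. lborel))
    \<le> ennreal (\<Prod>i\<in>I. 1 - upper_tail (M i i * r i))"
  using assms
proof (induction rule: triangular.induct)
  case empty
  then show ?case by (simp add: PiM_empty nn_integral_count_space_finite gauss_def)
next
  case (insert I i)
  have fin[simp]: "finite I" using insert.hyps triangular_finite by auto
  have pos: "0 < M i i" using insert.hyps by simp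
  define t where "t x = (\<Sum>j\<in>I. M i j * x j)" for x
  have g: "gauss M (insert i I) (x(i := y)) = gauss M I x * (M i i * std_normal_density (t x + M i i * y))" for x y
    using lin_insert[of I i M] insert.hyps by (simp add: gauss_def t_def add.commute)
  have gnn: "0 \<le> gauss M I x" for x unfolding gauss_def
    using triangular_diag_pos[OF insert.hyps(1)] by (intro prod_nonneg) (auto simp: less_imp_le)
  have ind: "indicator {b. \<forall>k\<in>insert i I. \<bar>b k\<bar> \<le> r k} (x(i := y)) =
      (indicator {b. \<forall>k\<in>I. \<bar>b k\<bar> \<le> r k} x * indicator {y. \<bar>y\<bar> \<le> r i} y :: ennreal)" for x y
    using insert.hyps by (auto simp: indicator_def)
  have inner: "(\<integral>\<^sup>+y. ennreal (M i i * std_normal_density (c + M i i * y)) * indicator {y. \<bar>y\<bar> \<le> r i} y \<partial>lborel)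
      \<le> ennreal (1 - upper_tail (M i i * r i))" for c
  proof -
    have "(\<integral>\<^sup>+y. ennreal (M i i * std_normal_density (c + M i i * y)) * indicator {y. \<bar>y\<bar> \<le> r i} y \<partial>lborel)
      = ennreal \<bar>M i i\<bar> * (\<integral>\<^sup>+y. ennreal (std_normal_density (c + M i i * y)) *
          indicator {x. \<bar>x - c\<bar> \<le> M i i * r i} (c + M i i * y) \<partial>lborel)"
      using pos by (subst nn_integral_cmult[symmetric])
        (auto intro!: nn_integral_cong simp: indicator_def ennreal_mult' abs_mult mult_le_cancel_left)
    also have "\<dots> = (\<integral>\<^sup>+x. ennreal (std_normal_density x) * indicator {x. \<bar>x - c\<bar> \<le> M i i * r i} x \<partial>lborel)"
      using pos by (intro nn_integral_real_affine[symmetric]) auto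
    finally show ?thesis using std_normal_interval_bound by simp
  qed
  have "(\<integral>\<^sup>+b. ennreal (gauss M (insert i I) b) * indicator {b. \<forall>k\<in>insert i I. \<bar>b k\<bar> \<le> r k} b \<partial>Pi\<^sub>M (insert i I) (\<lambda>_. lborel))
      = (\<integral>\<^sup>+x. \<integral>\<^sup>+y. ennreal (gauss M (insert i I) (x(i := y))) *
          indicator {b. \<forall>k\<in>insert i I. \<bar>b k\<bar> \<le> r k} (x(i := y)) \<partial>lborel \<partial>Pi\<^sub>M I (\<lambda>_. lborel))"
    by (rule lborel_prod.product_nn_integral_insert) (use insert in auto)
  also have "\<dots> = (\<integral>\<^sup>+x. ennreal (gauss M I x) * indicator {b. \<forall>k\<in>I. \<bar>b k\<bar> \<le> r k} x *
     (\<integral>\<^sup>+y. ennreal (M i i * std_normal_density (t x + M i i * y)) * indicator {y. \<bar>y\<bar> \<le> r i} y \<partial>lborel) \<partial>Pi\<^sub>M I (\<lambda>_. lborel))"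
    unfolding g ind using gnn pos
    by (intro nn_integral_cong) (auto simp: nn_integral_cmult[symmetric] ennreal_mult' mult_ac)
  also have "\<dots> \<le> (\<integral>\<^sup>+x. ennreal (gauss M I x) * indicator {b. \<forall>k\<in>I. \<bar>b k\<bar> \<le> r k} x *
      ennreal (1 - upper_tail (M i i * r i)) \<partial>Pi\<^sub>M I (\<lambda>_. lborel))"
    by (intro nn_integral_mono mult_left_mono inner) auto
  also have "\<dots> = (\<integral>\<^sup>+x. ennreal (gauss M I x) * indicator {b. \<forall>k\<in>I. \<bar>b k\<bar> \<le> r k} x \<partial>Pi\<^sub>M I (\<lambda>_. lborel)) *
      ennreal (1 - upper_tail (M i i * r i))"
    by (rule nn_integral_multc) measurable
  also have "\<dots> \<le> ennreal (\<Prod>i\<in>I. 1 - upper_tail (M i i * r i)) * ennreal (1 - upper_tail (M i i * r i))"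
    by (intro mult_right_mono insert.IH) auto
  also have "\<dots> = ennreal (\<Prod>k\<in>insert i I. 1 - upper_tail (M k k * r k))"
    using insert.hyps upper_tail_bounds(2)[of "M i i * r i"] by (simp add: ennreal_mult'[symmetric] mult.commute)
  finally show ?case .
qed

section \<open>Joint normality from one-dimensional projections\<close>

text \<open>Uniqueness of characteristic functions, in terms of their real and imaginary parts.\<close>
lemma std_normal_by_cos_sin:
  assumes "real_distribution D"
    and c: "\<And>s. (\<integral>x. cos (s * x) \<partial>D) = exp (- s\<^sup>2 / 2)"
    and z: "\<And>s. (\<integral>x. sin (s * x) \<partial>D) = 0"
  shows "D = std_normal_distribution"
proof (rule Levy_uniqueness[OF assms(1) real_dist_normal_dist])
  interpret real_distribution D by fact
  show "char D = char std_normal_distribution"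
  proof
    fix s
    have e: "iexp (s * x) = cis (s * x)" for x by (simp add: cis_conv_exp)
    have i: "integrable D (\<lambda>x. iexp (s * x))" by (rule integrable_const_bound[of _ 1]) auto
    have "Re (char D s) = exp (- s\<^sup>2 / 2)"
      unfolding char_def using c[of s] by (subst integral_Re[OF i, symmetric]) (simp only: e cis.sel)
    moreover have "Im (char D s) = 0"
      unfolding char_def using z[of s] by (subst integral_Im[OF i, symmetric]) (simp only: e cis.sel)
    ultimately show "char D s = char std_normal_distribution s"
      by (simp add: char_std_normal_distribution complex_eq_iff)
  qed
qed

text \<open>The hypotheses say that \<open>X\<close> is standard normal and that the signed measure with density
  \<open>g\<close> has the characteristic function of a multiple of this law.  This allows an indicator of
  \<open>X\<close> to be split off from \<open>g\<close>, which is how the coordinates of a vector are separated one by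
  one below.\<close>
lemma weighted_std_normal:
  fixes X g :: "'a \<Rightarrow> real"
  assumes "prob_space M" and [measurable]: "X \<in> borel_measurable M" "g \<in> borel_measurable M"
    and g1: "\<And>\<omega>. \<bar>g \<omega>\<bar> \<le> 1"
    and cX: "\<And>s. (\<integral>\<omega>. cos (s * X \<omega>) \<partial>M) = exp (- s\<^sup>2 / 2)"
    and sX: "\<And>s. (\<integral>\<omega>. sin (s * X \<omega>) \<partial>M) = 0"
    and cg: "\<And>s. (\<integral>\<omega>. g \<omega> * cos (s * X \<omega>) \<partial>M) = (\<integral>\<omega>. g \<omega> \<partial>M) * exp (- s\<^sup>2 / 2)"
    and sg: "\<And>s. (\<integral>\<omega>. g \<omega> * sin (s * X \<omega>) \<partial>M) = 0"
    and A: "A \<in> sets borel"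
  shows "(\<integral>\<omega>. g \<omega> * indicator A (X \<omega>) \<partial>M)
    = (\<integral>\<omega>. g \<omega> \<partial>M) * measure std_normal_distribution A"
proof -
  interpret prob_space M by fact
  have int: "integrable M h" if "h \<in> borel_measurable M" "\<And>\<omega>. \<bar>h \<omega>\<bar> \<le> 1" for h :: "'a \<Rightarrow> real"
    using that by (intro integrable_const_bound[of _ 1]) auto
  have gi: "integrable M g" by (rule int) (use g1 in auto)
  have gb: "\<bar>g \<omega> * x\<bar> \<le> 1" if "\<bar>x\<bar> \<le> 1" for \<omega> x
    using g1[of \<omega>] that by (simp add: abs_mult mult_le_one)
  \<comment> \<open>Adding 2 turns the signed weight into a positive density, to which uniqueness of
      characteristic functions applies.\<close>
  define E where "E f = (\<integral>\<omega>. (2 + g \<omega>) * f (X \<omega>) \<partial>M)" for f :: "real \<Rightarrow> real"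
  have Eadd: "E f = 2 * (\<integral>\<omega>. f (X \<omega>) \<partial>M) + (\<integral>\<omega>. g \<omega> * f (X \<omega>) \<partial>M)"
    if [measurable]: "f \<in> borel_measurable borel" and b: "\<And>x. \<bar>f x\<bar> \<le> 1" for f
  proof -
    have "integrable M (\<lambda>\<omega>. f (X \<omega>))" by (rule int) (use b in auto)
    moreover have "integrable M (\<lambda>\<omega>. g \<omega> * f (X \<omega>))"
      by (rule int) (use b gb in auto)
    ultimately show ?thesis unfolding E_def by (simp add: distrib_right)
  qed
  define c where "c = 2 + (\<integral>\<omega>. g \<omega> \<partial>M)"
  have gl: "- 1 \<le> g \<omega>" "g \<omega> \<le> 1" for \<omega> using g1[of \<omega>] by auto
  have "- 1 \<le> (\<integral>\<omega>. g \<omega> \<partial>M)"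
    using integral_mono[of M "\<lambda>_. - 1" g] gi gl by (simp add: prob_space)
  then have c: "0 < c" by (simp add: c_def)
  define N where "N = density M (\<lambda>\<omega>. ennreal ((2 + g \<omega>) / c))"
  define D where "D = distr N borel X"
  have w0: "0 \<le> (2 + g \<omega>) / c" for \<omega> using c gl[of \<omega>] by (simp add: divide_nonneg_pos)
  have Nint: "(\<integral>x. f x \<partial>D) = E f / c" if [measurable]: "f \<in> borel_measurable borel" for f :: "real \<Rightarrow> real"
  proof -
    have "(\<integral>x. f x \<partial>D) = (\<integral>\<omega>. f (X \<omega>) \<partial>N)" unfolding D_def N_def by (rule integral_distr) measurable
    also have "\<dots> = (\<integral>\<omega>. ((2 + g \<omega>) / c) * f (X \<omega>) \<partial>M)"
      unfolding N_def by (subst integral_density) (use w0 in auto)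
    also have "\<dots> = E f / c" unfolding E_def
      by (subst integral_divide_zero[symmetric]) (simp add: field_simps)
    finally show ?thesis .
  qed
  have E1: "E (\<lambda>_. 1) = c" using Eadd[of "\<lambda>_. 1"] by (simp add: c_def prob_space)
  have "prob_space N"
  proof
    have "integrable M (\<lambda>\<omega>. (2 + g \<omega>) / c)" using gi by simp
    then have "emeasure N (space N) = ennreal (\<integral>\<omega>. (2 + g \<omega>) / c \<partial>M)"
      unfolding N_def using w0 by (simp add: emeasure_density nn_integral_eq_integral cong: nn_integral_cong_simp)
    also have "(\<integral>\<omega>. (2 + g \<omega>) / c \<partial>M) = 1" using E1 c by (simp add: E_def)
    finally show "emeasure N (space N) = 1" by simp
  qed
  then have psD: "prob_space D" unfolding D_def
    by (rule prob_space.prob_space_distr) (simp add: N_def)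
  interpret D: real_distribution D
    using psD by (auto simp: real_distribution_def real_distribution_axioms_def D_def)
  have "D = std_normal_distribution"
  proof (rule std_normal_by_cos_sin)
    show "real_distribution D" by (rule D.real_distribution_axioms)
    fix s
    have cs: "E (\<lambda>x. cos (s * x)) = c * exp (- s\<^sup>2 / 2)"
      by (subst Eadd) (auto simp: cX cg c_def algebra_simps)
    have ss: "E (\<lambda>x. sin (s * x)) = 0" by (subst Eadd) (auto simp: sX sg)
    show "(\<integral>x. cos (s * x) \<partial>D) = exp (- s\<^sup>2 / 2)" "(\<integral>x. sin (s * x) \<partial>D) = 0"
      using Nint[of "\<lambda>x. cos (s * x)"] Nint[of "\<lambda>x. sin (s * x)"] cs ss c by auto
  qed
  then have "measure std_normal_distribution A = (\<integral>x. indicator A x \<partial>D)" using A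
    by simp
  also have "\<dots> = E (indicator A) / c" using Nint[of "indicator A"] A by simp
  finally have e1: "E (indicator A) = c * measure std_normal_distribution A" using c by simp
  \<comment> \<open>The contribution of the added constant is known because \<open>X\<close> itself is standard normal.\<close>
  have "distr M borel X = std_normal_distribution"
  proof -
    interpret X: real_distribution "distr M borel X"
      by (simp add: real_distribution_def real_distribution_axioms_def prob_space_distr)
    show ?thesis using cX sX
      by (intro std_normal_by_cos_sin X.real_distribution_axioms) (simp_all add: integral_distr)
  qed
  moreover have "(\<integral>\<omega>. indicator A (X \<omega>) \<partial>M) = (\<integral>x. (indicator A x :: real) \<partial>distr M borel X)"
    using A by (subst integral_distr) auto
  ultimately have "measure std_normal_distribution A = (\<integral>\<omega>. indicator A (X \<omega>) \<partial>M)"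
    using A by simp
  moreover have "E (indicator A) = 2 * (\<integral>\<omega>. indicator A (X \<omega>) \<partial>M) + (\<integral>\<omega>. g \<omega> * indicator A (X \<omega>) \<partial>M)"
    using A by (intro Eadd) (auto simp: indicator_def)
  ultimately show ?thesis using e1 by (simp add: c_def algebra_simps)
qed

text \<open>Induction on the set \<open>F\<close> of coordinates that enter through an event instead of a
  trigonometric function.  In the step, the indicators of \<open>F\<close> times the cosine or sine of the
  remaining combination are the weight \<open>g\<close> of \<open>weighted_std_normal\<close>.\<close>
lemma joint_normal_factor:
  fixes Z :: "'i \<Rightarrow> 'a \<Rightarrow> real"
  assumes "prob_space M" "finite I" and Zm: "\<And>i. i \<in> I \<Longrightarrow> Z i \<in> borel_measurable M"
    and cZ: "\<And>t. (\<integral>\<omega>. cos (\<Sum>i\<in>I. t i * Z i \<omega>) \<partial>M) = exp (- (\<Sum>i\<in>I. (t i)\<^sup>2) / 2)"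
    and sZ: "\<And>t. (\<integral>\<omega>. sin (\<Sum>i\<in>I. t i * Z i \<omega>) \<partial>M) = 0"
    and A: "\<And>i. i \<in> I \<Longrightarrow> A i \<in> sets borel"
    and "F \<subseteq> I"
  shows "(\<forall>t. (\<integral>\<omega>. (\<Prod>i\<in>F. indicator (A i) (Z i \<omega>)) * cos (\<Sum>i\<in>I-F. t i * Z i \<omega>) \<partial>M)
          = (\<Prod>i\<in>F. measure std_normal_distribution (A i)) * exp (- (\<Sum>i\<in>I-F. (t i)\<^sup>2) / 2)) \<and>
    (\<forall>t. (\<integral>\<omega>. (\<Prod>i\<in>F. indicator (A i) (Z i \<omega>)) * sin (\<Sum>i\<in>I-F. t i * Z i \<omega>) \<partial>M) = 0)"
proof -
  interpret prob_space M by fact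
  have "finite F" using assms(2) \<open>F \<subseteq> I\<close> finite_subset by blast
  then show ?thesis using \<open>F \<subseteq> I\<close>
  proof (induction F)
    case empty
    then show ?case using cZ sZ by simp
  next
    case (insert a F)
    note [measurable] = Zm A
    have aI: "a \<in> I" "F \<subseteq> I" using insert.prems by auto
    have IH1: "\<And>t. (\<integral>\<omega>. (\<Prod>i\<in>F. indicator (A i) (Z i \<omega>)) * cos (\<Sum>i\<in>I-F. t i * Z i \<omega>) \<partial>M)
          = (\<Prod>i\<in>F. measure std_normal_distribution (A i)) * exp (- (\<Sum>i\<in>I-F. (t i)\<^sup>2) / 2)"
      and IH2: "\<And>t. (\<integral>\<omega>. (\<Prod>i\<in>F. indicator (A i) (Z i \<omega>)) * sin (\<Sum>i\<in>I-F. t i * Z i \<omega>) \<partial>M) = 0"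
      using insert.IH aI by auto
    define R where "R = I - insert a F"
    have R: "I - F = insert a R" "a \<notin> R" "finite R" using aI insert.hyps assms(2) by (auto simp: R_def)
    define e :: "'a \<Rightarrow> real" where "e \<omega> = (\<Prod>i\<in>F. indicator (A i) (Z i \<omega>))" for \<omega>
    define p where "p = (\<Prod>i\<in>F. measure std_normal_distribution (A i))"
    define \<theta> where "\<theta> t \<omega> = (\<Sum>i\<in>R. t i * Z i \<omega>)" for t \<omega>
    define q where "q t = (\<Sum>i\<in>R. (t i)\<^sup>2)" for t :: "'i \<Rightarrow> real"
    have em[measurable]: "e \<in> borel_measurable M" unfolding e_def
      by (intro borel_measurable_prod measurable_compose[OF Zm borel_measurable_indicator[OF A]])
        (use aI in auto)
    have tm[measurable]: "\<theta> t \<in> borel_measurable M" for t unfolding \<theta>_def by (measurable, auto simp: R_def)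
    have am[measurable]: "Z a \<in> borel_measurable M" using aI by measurable
    have e1: "\<bar>e \<omega>\<bar> \<le> 1" for \<omega> unfolding e_def
      by (auto simp: indicator_def abs_prod intro!: prod_le_1)
    have int: "integrable M h" if "h \<in> borel_measurable M" "\<And>\<omega>. \<bar>h \<omega>\<bar> \<le> 1" for h :: "'a \<Rightarrow> real"
      using that by (intro integrable_const_bound[of _ 1]) auto
    have b1: "\<bar>e \<omega> * x\<bar> \<le> 1" if "\<bar>x\<bar> \<le> 1" for \<omega> x
      using e1[of \<omega>] that by (simp add: abs_mult mult_le_one)
    have C: "(\<integral>\<omega>. e \<omega> * cos (s * Z a \<omega> + \<theta> t \<omega>) \<partial>M) = p * exp (- q t / 2) * exp (- s\<^sup>2 / 2)"
      and S: "(\<integral>\<omega>. e \<omega> * sin (s * Z a \<omega> + \<theta> t \<omega>) \<partial>M) = 0" for s t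
    proof -
      have u: "(\<Sum>i\<in>I-F. (t(a := s)) i * Z i \<omega>) = s * Z a \<omega> + \<theta> t \<omega>" for \<omega>
        using R by (auto simp: \<theta>_def intro!: sum.cong)
      have v: "(\<Sum>i\<in>I-F. ((t(a := s)) i)\<^sup>2) = s\<^sup>2 + q t"
        using R by (auto simp: q_def intro!: sum.cong)
      have "exp (- (s\<^sup>2 + q t) / 2) = exp (- q t / 2) * exp (- s\<^sup>2 / 2)"
        by (simp add: exp_add[symmetric] field_simps)
      then show "(\<integral>\<omega>. e \<omega> * cos (s * Z a \<omega> + \<theta> t \<omega>) \<partial>M) = p * exp (- q t / 2) * exp (- s\<^sup>2 / 2)"
        using IH1[of "t(a := s)"] unfolding u v
        by (simp add: e_def p_def mult.assoc)
      show "(\<integral>\<omega>. e \<omega> * sin (s * Z a \<omega> + \<theta> t \<omega>) \<partial>M) = 0"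
        using IH2[of "t(a := s)"] unfolding u by (simp add: e_def)
    qed
    have neg: "\<theta> (\<lambda>i. - t i) \<omega> = - \<theta> t \<omega>" "q (\<lambda>i. - t i) = q t" for t \<omega>
      by (simp_all add: \<theta>_def q_def sum_negf)
    have ints: "integrable M (\<lambda>\<omega>. e \<omega> * cos (s * Z a \<omega> + \<theta> t \<omega>))"
       "integrable M (\<lambda>\<omega>. e \<omega> * sin (s * Z a \<omega> + \<theta> t \<omega>))" for s t
      by (intro int b1; simp)+
    \<comment> \<open>Product-to-sum formulas, from the induction hypothesis for \<open>t\<close> and for \<open>- t\<close>.\<close>
    have CC: "(\<integral>\<omega>. e \<omega> * cos (\<theta> t \<omega>) * cos (s * Z a \<omega>) \<partial>M) = p * exp (- q t / 2) * exp (- s\<^sup>2 / 2)"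
      and CS: "(\<integral>\<omega>. e \<omega> * cos (\<theta> t \<omega>) * sin (s * Z a \<omega>) \<partial>M) = 0"
      and SC: "(\<integral>\<omega>. e \<omega> * sin (\<theta> t \<omega>) * cos (s * Z a \<omega>) \<partial>M) = 0"
      and SS: "(\<integral>\<omega>. e \<omega> * sin (\<theta> t \<omega>) * sin (s * Z a \<omega>) \<partial>M) = 0" for s t
    proof -
      let ?n = "\<lambda>i. - t i"
      have e: "(\<lambda>\<omega>. e \<omega> * cos (\<theta> t \<omega>) * cos (s * Z a \<omega>))
        = (\<lambda>\<omega>. (e \<omega> * cos (s * Z a \<omega> + \<theta> t \<omega>) + e \<omega> * cos (s * Z a \<omega> + \<theta> ?n \<omega>)) / 2)"
        by (rule ext) (simp add: neg cos_add cos_diff algebra_simps diff_divide_distrib add_divide_distrib)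
      show "(\<integral>\<omega>. e \<omega> * cos (\<theta> t \<omega>) * cos (s * Z a \<omega>) \<partial>M) = p * exp (- q t / 2) * exp (- s\<^sup>2 / 2)"
        unfolding e using ints[of s t] ints[of s ?n] C[of s t] C[of s ?n] by (simp add: neg)
      have e: "(\<lambda>\<omega>. e \<omega> * cos (\<theta> t \<omega>) * sin (s * Z a \<omega>))
        = (\<lambda>\<omega>. (e \<omega> * sin (s * Z a \<omega> + \<theta> t \<omega>) + e \<omega> * sin (s * Z a \<omega> + \<theta> ?n \<omega>)) / 2)"
        by (rule ext) (simp add: neg sin_add sin_diff algebra_simps diff_divide_distrib add_divide_distrib)
      show "(\<integral>\<omega>. e \<omega> * cos (\<theta> t \<omega>) * sin (s * Z a \<omega>) \<partial>M) = 0"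
        unfolding e using ints[of s t] ints[of s ?n] S[of s t] S[of s ?n] by (simp add: neg)
      have e: "(\<lambda>\<omega>. e \<omega> * sin (\<theta> t \<omega>) * cos (s * Z a \<omega>))
        = (\<lambda>\<omega>. (e \<omega> * sin (s * Z a \<omega> + \<theta> t \<omega>) - e \<omega> * sin (s * Z a \<omega> + \<theta> ?n \<omega>)) / 2)"
        by (rule ext) (simp add: neg sin_add sin_diff algebra_simps diff_divide_distrib add_divide_distrib)
      show "(\<integral>\<omega>. e \<omega> * sin (\<theta> t \<omega>) * cos (s * Z a \<omega>) \<partial>M) = 0"
        unfolding e using ints[of s t] ints[of s ?n] S[of s t] S[of s ?n] by (simp add: neg)
      have e: "(\<lambda>\<omega>. e \<omega> * sin (\<theta> t \<omega>) * sin (s * Z a \<omega>))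
        = (\<lambda>\<omega>. (e \<omega> * cos (s * Z a \<omega> + \<theta> ?n \<omega>) - e \<omega> * cos (s * Z a \<omega> + \<theta> t \<omega>)) / 2)"
        by (rule ext) (simp add: neg cos_add cos_diff algebra_simps diff_divide_distrib add_divide_distrib)
      show "(\<integral>\<omega>. e \<omega> * sin (\<theta> t \<omega>) * sin (s * Z a \<omega>) \<partial>M) = 0"
        unfolding e using ints[of s t] ints[of s ?n] C[of s t] C[of s ?n] by (simp add: neg)
    qed
    have cXa: "(\<integral>\<omega>. cos (s * Z a \<omega>) \<partial>M) = exp (- s\<^sup>2 / 2)"
      and sXa: "(\<integral>\<omega>. sin (s * Z a \<omega>) \<partial>M) = 0" for s
    proof -
      have *: "(\<Sum>i\<in>I. (if i = a then s else 0) * Z i \<omega>) = s * Z a \<omega>" for \<omega>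
        using aI assms(2) by (simp add: if_distrib[of "\<lambda>x. x * _"] cong: if_cong)
      have **: "(\<Sum>i\<in>I. (if i = a then s else 0)\<^sup>2) = s\<^sup>2"
        using aI assms(2) by (simp add: if_distrib[of "\<lambda>x. x\<^sup>2"] cong: if_cong)
      show "(\<integral>\<omega>. cos (s * Z a \<omega>) \<partial>M) = exp (- s\<^sup>2 / 2)" "(\<integral>\<omega>. sin (s * Z a \<omega>) \<partial>M) = 0"
        using cZ[of "\<lambda>i. if i = a then s else 0"] sZ[of "\<lambda>i. if i = a then s else 0"]
        unfolding * ** by auto
    qed
    have Aa: "A a \<in> sets borel" using A aI by auto
    have i1: "(\<integral>\<omega>. e \<omega> * cos (\<theta> t \<omega>) * indicator (A a) (Z a \<omega>) \<partial>M)
        = p * exp (- q t / 2) * measure std_normal_distribution (A a)" for t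
      using weighted_std_normal[where M=M and X = "Z a" and g = "\<lambda>\<omega>. e \<omega> * cos (\<theta> t \<omega>)" and A = "A a"]
        CC[of t] CC[of t 0] CS cXa sXa b1 Aa assms(1) by simp
    have i2: "(\<integral>\<omega>. e \<omega> * sin (\<theta> t \<omega>) * indicator (A a) (Z a \<omega>) \<partial>M) = 0" for t
      using weighted_std_normal[where M=M and X = "Z a" and g = "\<lambda>\<omega>. e \<omega> * sin (\<theta> t \<omega>)" and A = "A a"]
        SC[of t] SC[of t 0] SS cXa sXa b1 Aa assms(1) by simp
    show ?case using i1 i2 insert.hyps
      unfolding R_def[symmetric] by (simp add: e_def p_def q_def \<theta>_def mult_ac)
  qed
qed

text \<open>The Gaussian case of the Cramer--Wold device: the laws of all linear combinations
  determine the joint law.\<close>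
lemma distr_joint_std_normal:
  fixes Z :: "'i \<Rightarrow> 'a \<Rightarrow> real"
  assumes "prob_space M" "finite I" and Zm: "\<And>i. i \<in> I \<Longrightarrow> Z i \<in> borel_measurable M"
    and cZ: "\<And>t. (\<integral>\<omega>. cos (\<Sum>i\<in>I. t i * Z i \<omega>) \<partial>M) = exp (- (\<Sum>i\<in>I. (t i)\<^sup>2) / 2)"
    and sZ: "\<And>t. (\<integral>\<omega>. sin (\<Sum>i\<in>I. t i * Z i \<omega>) \<partial>M) = 0"
  shows "distr M (Pi\<^sub>M I (\<lambda>_. lborel)) (\<lambda>\<omega>. \<lambda>i\<in>I. Z i \<omega>)
    = density (Pi\<^sub>M I (\<lambda>_. lborel)) (\<lambda>z. ennreal (\<Prod>i\<in>I. std_normal_density (z i)))"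
proof -
  interpret prob_space M by fact
  interpret N: prob_space std_normal_distribution by (rule prob_space_normal_density) simp
  interpret G: product_sigma_finite "\<lambda>_. std_normal_distribution"
    by (simp add: product_sigma_finite_def N.sigma_finite_measure_axioms)
  note [measurable] = Zm
  have Zm'[measurable]: "(\<lambda>\<omega>. \<lambda>i\<in>I. Z i \<omega>) \<in> measurable M (Pi\<^sub>M I (\<lambda>_. lborel))"
    by (rule measurable_restrict) simp
  have sets: "sets (Pi\<^sub>M I (\<lambda>_. lborel)) = sets (Pi\<^sub>M I (\<lambda>_. std_normal_distribution))"
    by (rule sets_PiM_cong) auto
  let ?g = "\<lambda>i. std_normal_distribution"
  have "distr M (Pi\<^sub>M I (\<lambda>_. lborel)) (\<lambda>\<omega>. \<lambda>i\<in>I. Z i \<omega>) = Pi\<^sub>M I (\<lambda>_. std_normal_distribution)"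
  proof (rule G.PiM_eqI[OF assms(2)])
    show "sets (distr M (Pi\<^sub>M I (\<lambda>_. lborel)) (\<lambda>\<omega>. \<lambda>i\<in>I. Z i \<omega>)) = sets (Pi\<^sub>M I (\<lambda>_. std_normal_distribution))"
      using sets by simp
    fix A :: "'i \<Rightarrow> real set" assume A: "\<And>i. i \<in> I \<Longrightarrow> A i \<in> sets (?g i)"
    then have Ab: "\<And>i. i \<in> I \<Longrightarrow> A i \<in> sets borel" by auto
    have m: "Pi\<^sub>E I A \<in> sets (Pi\<^sub>M I (\<lambda>_. lborel))" using Ab assms(2) by (intro sets_PiM_I_finite) auto
    have "emeasure (distr M (Pi\<^sub>M I (\<lambda>_. lborel)) (\<lambda>\<omega>. \<lambda>i\<in>I. Z i \<omega>)) (Pi\<^sub>E I A)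
       = emeasure M ((\<lambda>\<omega>. \<lambda>i\<in>I. Z i \<omega>) -` Pi\<^sub>E I A \<inter> space M)" (is "_ = emeasure M ?E")
      using m by (intro emeasure_distr) auto
    also have "\<dots> = ennreal (\<integral>\<omega>. indicator ?E \<omega> \<partial>M)"
      using measurable_sets[OF Zm' m] by (simp add: emeasure_eq_measure)
    also have "(\<integral>\<omega>. (indicator ?E \<omega> :: real) \<partial>M) = (\<integral>\<omega>. (\<Prod>i\<in>I. indicator (A i) (Z i \<omega>)) \<partial>M)"
    proof (rule Bochner_Integration.integral_cong[OF refl])
      fix \<omega> assume w: "\<omega> \<in> space M"
      show "(indicator ?E \<omega> :: real) = (\<Prod>i\<in>I. indicator (A i) (Z i \<omega>))"
      proof (cases "\<forall>i\<in>I. Z i \<omega> \<in> A i")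
        case True then show ?thesis using w by (auto simp: indicator_def PiE_def Pi_def)
      next
        case False
        then obtain i where i: "i \<in> I" "Z i \<omega> \<notin> A i" by auto
        have "(\<Prod>i\<in>I. indicator (A i) (Z i \<omega>)) = (0::real)"
          using assms(2) i by (intro prod_zero bexI[of _ i]) auto
        moreover have "\<omega> \<notin> ?E"
        proof
          assume "\<omega> \<in> ?E"
          then have "(\<lambda>i\<in>I. Z i \<omega>) \<in> Pi\<^sub>E I A" by blast
          from PiE_mem[OF this i(1)] show False using i by simp
        qed
        then have "indicator ?E \<omega> = (0::real)" by (rule indicator_simps(2))
        ultimately show ?thesis by (simp only:)
      qed
    qed
    also have "\<dots> = (\<Prod>i\<in>I. measure std_normal_distribution (A i))"
      using joint_normal_factor[of M I Z A I] assms Ab by simp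
    also have "ennreal \<dots> = (\<Prod>i\<in>I. emeasure (?g i) (A i))"
      using N.emeasure_eq_measure
      by (simp add: prod_ennreal)
    finally show "emeasure (distr M (Pi\<^sub>M I (\<lambda>_. lborel)) (\<lambda>\<omega>. \<lambda>i\<in>I. Z i \<omega>)) (Pi\<^sub>E I A)
      = (\<Prod>i\<in>I. emeasure (?g i) (A i))" .
  qed
  moreover have "density (Pi\<^sub>M I (\<lambda>_. lborel)) (\<lambda>z. ennreal (\<Prod>i\<in>I. std_normal_density (z i)))
      = Pi\<^sub>M I (\<lambda>_. std_normal_distribution)"
  proof (rule G.PiM_eqI[OF assms(2)])
    show "sets (density (Pi\<^sub>M I (\<lambda>_. lborel)) (\<lambda>z. ennreal (\<Prod>i\<in>I. std_normal_density (z i))))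
      = sets (Pi\<^sub>M I (\<lambda>_. std_normal_distribution))" using sets by simp
    fix A :: "'i \<Rightarrow> real set" assume A: "\<And>i. i \<in> I \<Longrightarrow> A i \<in> sets (?g i)"
    then have Ab[measurable]: "\<And>i. i \<in> I \<Longrightarrow> A i \<in> sets borel" by auto
    have m: "Pi\<^sub>E I A \<in> sets (Pi\<^sub>M I (\<lambda>_. lborel))" using Ab assms(2) by (intro sets_PiM_I_finite) auto
    have "emeasure (density (Pi\<^sub>M I (\<lambda>_. lborel)) (\<lambda>z. ennreal (\<Prod>i\<in>I. std_normal_density (z i)))) (Pi\<^sub>E I A)
       = (\<integral>\<^sup>+z. ennreal (\<Prod>i\<in>I. std_normal_density (z i)) * indicator (Pi\<^sub>E I A) z \<partial>Pi\<^sub>M I (\<lambda>_. lborel))"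
      using m by (subst emeasure_density) auto
    also have "\<dots> = (\<integral>\<^sup>+z. (\<Prod>i\<in>I. ennreal (std_normal_density (z i)) * indicator (A i) (z i)) \<partial>Pi\<^sub>M I (\<lambda>_. lborel))"
    proof (rule nn_integral_cong)
      fix z :: "'i \<Rightarrow> real" assume z: "z \<in> space (Pi\<^sub>M I (\<lambda>_. lborel))"
      show "ennreal (\<Prod>i\<in>I. std_normal_density (z i)) * indicator (Pi\<^sub>E I A) z
        = (\<Prod>i\<in>I. ennreal (std_normal_density (z i)) * indicator (A i) (z i))"
      proof (cases "z \<in> Pi\<^sub>E I A")
        case True then show ?thesis by (auto simp: PiE_def Pi_def prod_ennreal intro!: prod.cong)
      next
        case False
        then obtain i where "i \<in> I" "z i \<notin> A i" using z by (auto simp: PiE_def Pi_def space_PiM)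
        then show ?thesis using False assms(2) by (auto simp: prod_zero_iff intro!: bexI[of _ i])
      qed
    qed
    also have "\<dots> = (\<Prod>i\<in>I. (\<integral>\<^sup>+z. ennreal (std_normal_density z) * indicator (A i) z \<partial>lborel))"
      by (rule lborel_prod.product_nn_integral_prod[OF assms(2)]) measurable
    also have "\<dots> = (\<Prod>i\<in>I. emeasure (?g i) (A i))"
      using Ab by (intro prod.cong) (auto simp: emeasure_density)
    finally show "emeasure (density (Pi\<^sub>M I (\<lambda>_. lborel)) (\<lambda>z. ennreal (\<Prod>i\<in>I. std_normal_density (z i)))) (Pi\<^sub>E I A)
      = (\<Prod>i\<in>I. emeasure (?g i) (A i))" .
  qed
  ultimately show ?thesis by simp
qed

section \<open>Gram--Schmidt for positive definite matrices\<close>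

text \<open>The rows of \<open>T\<close> orthonormalise the standard basis for the bilinear form \<open>G\<close>.  Row \<open>p\<close> is a
  combination of the first \<open>p + 1\<close> basis vectors, whence the triangular shape.\<close>
lemma gram_schmidt:
  fixes G :: "nat \<Rightarrow> nat \<Rightarrow> real"
  assumes sym: "\<And>a b. G a b = G b a"
    and pd: "\<And>x. (\<exists>a<p. x a \<noteq> 0) \<Longrightarrow> 0 < (\<Sum>a<p. \<Sum>b<p. x a * G a b * x b)"
  shows "\<exists>T. (\<forall>a<p. 0 < T a a) \<and> (\<forall>a b. a < b \<longrightarrow> T a b = 0) \<and>
    (\<forall>a<p. \<forall>b<p. (\<Sum>c<p. \<Sum>d<p. T a c * G c d * T b d) = (if a = b then 1 else 0))"
  using pd
proof (induction p)
  case 0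
  show ?case by (rule exI[of _ "\<lambda>_ _. 0"]) simp
next
  case (Suc p)
  have "0 < (\<Sum>a<p. \<Sum>b<p. x a * G a b * x b)" if nz: "\<exists>a<p. x a \<noteq> 0" for x
  proof -
    define y where "y a = (if a < p then x a else 0)" for a
    obtain a where "a < p" "x a \<noteq> 0" using nz by auto
    then have "0 < (\<Sum>a<Suc p. \<Sum>b<Suc p. y a * G a b * y b)"
      by (intro Suc.prems exI[of _ a]) (simp add: y_def)
    also have "\<dots> = (\<Sum>a<p. \<Sum>b<p. x a * G a b * x b)" by (simp add: y_def)
    finally show ?thesis .
  qed
  from Suc.IH[OF this] obtain T where T: "\<forall>a<p. 0 < T a a" "\<forall>a b. a < b \<longrightarrow> T a b = 0"
    "\<forall>a<p. \<forall>b<p. (\<Sum>c<p. \<Sum>d<p. T a c * G c d * T b d) = (if a = b then 1 else 0)" by blast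
  define B where "B x y = (\<Sum>c<Suc p. \<Sum>d<Suc p. x c * G c d * y d)" for x y :: "nat \<Rightarrow> real"
  have Bsym: "B x y = B y x" for x y
    unfolding B_def by (subst sum.swap) (simp add: sym mult_ac)
  have Badd: "B (\<lambda>c. x c - y c) z = B x z - B y z" for x y z
    by (simp add: B_def left_diff_distrib sum_subtractf)
  have Bscale: "B (\<lambda>c. k * x c) z = k * B x z" for k x z
    by (simp only: B_def sum_distrib_left mult.assoc)
  have Bsum: "B (\<lambda>c. \<Sum>m<q. k m * f m c) z = (\<Sum>m<q. k m * B (f m) z)" for q :: nat and k f z
  proof (induction q)
    case 0 show ?case by (simp add: B_def)
  next
    case (Suc q)
    have "B (\<lambda>c. (\<Sum>m<q. k m * f m c) + k q * f q c) z
        = B (\<lambda>c. \<Sum>m<q. k m * f m c) z + B (\<lambda>c. k q * f q c) z"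
      by (simp add: B_def distrib_right sum.distrib)
    then show ?case using Suc Bscale by simp
  qed
  have BT: "B (T a) (T b) = (if a = b then 1 else 0)" if "a < p" "b < p" for a b
    using T that by (simp add: B_def)
  define e :: "nat \<Rightarrow> real" where "e c = (if c = p then 1 else 0)" for c
  \<comment> \<open>The last basis vector minus its projection to the span of the earlier rows.\<close>
  define y where "y c = e c - (\<Sum>m<p. B e (T m) * T m c)" for c
  have yp: "y p = 1" using T(2) by (simp add: y_def e_def)
  have y0: "y c = 0" if "p < c" for c using that T(2) by (simp add: y_def e_def)
  have yT: "B y (T k) = 0" if "k < p" for k
  proof -
    have "B y (T k) = B e (T k) - (\<Sum>m<p. B e (T m) * B (T m) (T k))"
      unfolding y_def by (simp add: Badd Bsum)
    also have "(\<Sum>m<p. B e (T m) * B (T m) (T k)) = (\<Sum>m<p. if m = k then B e (T m) else 0)"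
      using that by (intro sum.cong) (auto simp: BT)
    also have "\<dots> = B e (T k)" using that by simp
    finally show ?thesis by simp
  qed
  have pos: "0 < B y y" unfolding B_def by (rule Suc.prems) (use yp in \<open>auto intro!: exI[of _ p]\<close>)
  define \<nu> where "\<nu> = sqrt (B y y)"
  have \<nu>: "0 < \<nu>" "\<nu>\<^sup>2 = B y y" using pos by (simp_all add: \<nu>_def)
  define U where "U a = (if a = p then (\<lambda>c. (1 / \<nu>) * y c) else T a)" for a
  have UB: "B (U a) (U b) = (if a = b then 1 else 0)" if "a < Suc p" "b < Suc p" for a b
  proof -
    have pp: "B (U p) (U p) = 1"
    proof -
      have Up: "U p = (\<lambda>c. (1 / \<nu>) * y c)" by (simp add: U_def)
      have "B (U p) (U p) = (1 / \<nu>) * B y (U p)" by (subst Up) (rule Bscale)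
      also have "B y (U p) = (1 / \<nu>) * B y y"
        by (subst Bsym, subst Up) (rule Bscale)
      finally have eq: "B (U p) (U p) = (1 / \<nu>) * ((1 / \<nu>) * B y y)" .
      show ?thesis using \<nu>(1) by (simp add: eq \<nu>(2)[symmetric] power2_eq_square)
    qed
    have pk: "B (U p) (U k) = 0" "B (U k) (U p) = 0" if "k < p" for k
    proof -
      have "B (U p) (T k) = (1 / \<nu>) * B y (T k)" by (simp only: U_def simp_thms if_True Bscale)
      then show "B (U p) (U k) = 0" using that yT by (simp add: U_def)
      then show "B (U k) (U p) = 0" using Bsym by simp
    qed
    show ?thesis
      using that pp pk BT by (cases "a = p"; cases "b = p") (auto simp: U_def less_Suc_eq)
  qed
  show ?case
  proof (intro exI[of _ U] conjI allI impI)
    fix a assume "a < Suc p" then show "0 < U a a"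
      using T(1) yp \<nu> by (auto simp: U_def less_Suc_eq)
  next
    fix a b :: nat assume "a < b" then show "U a b = 0"
      using T(2) y0 by (auto simp: U_def)
  next
    fix a b assume "a < Suc p" "b < Suc p"
    then show "(\<Sum>c<Suc p. \<Sum>d<Suc p. U a c * G c d * U b d) = (if a = b then 1 else 0)"
      using UB by (simp add: B_def)
  qed
qed

section \<open>The inverse square root of a positive definite matrix\<close>

text \<open>The coefficients of the power series of \<open>(1 - x) powr (- 1 / 2)\<close>.\<close>
definition inv_sqrt_coeff :: "nat \<Rightarrow> real" where
  "inv_sqrt_coeff k = (- 1) ^ k * ((- 1 / 2) gchoose k)"

lemma inv_sqrt_coeff_0 [simp]: "inv_sqrt_coeff 0 = 1"
  by (simp add: inv_sqrt_coeff_def)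

lemma inv_sqrt_coeff_nonneg: "0 \<le> inv_sqrt_coeff k"
  using pochhammer_nonneg[of "1/2 :: real" k]
  by (simp add: inv_sqrt_coeff_def gbinomial_pochhammer power_mult_distrib[symmetric] mult.assoc[symmetric])

text \<open>The square of the series is the geometric series, by Vandermonde's identity.\<close>
lemma inv_sqrt_coeff_conv: "(\<Sum>k\<le>n. inv_sqrt_coeff k * inv_sqrt_coeff (n - k)) = 1"
proof -
  have "(\<Sum>k\<le>n. inv_sqrt_coeff k * inv_sqrt_coeff (n - k))
      = (\<Sum>k\<le>n. (- 1) ^ n * (((- 1 / 2) gchoose k) * ((- 1 / 2) gchoose (n - k))))"
    by (intro sum.cong) (auto simp: inv_sqrt_coeff_def power_add[symmetric])
  also have "\<dots> = (- 1) ^ n * ((- 1 / 2 + - 1 / 2 :: real) gchoose n)"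
    by (simp only: sum_distrib_left[symmetric] gbinomial_Vandermonde atLeast0AtMost[symmetric])
  also have "\<dots> = 1"
    by (simp add: gbinomial_pochhammer pochhammer_fact[symmetric] mult.assoc[symmetric]
        power_mult_distrib[symmetric])
  finally show ?thesis .
qed

lemma inv_sqrt_coeff_le_1: "inv_sqrt_coeff k \<le> 1"
proof -
  have "inv_sqrt_coeff k * inv_sqrt_coeff (k - k) \<le> (\<Sum>i\<le>k. inv_sqrt_coeff i * inv_sqrt_coeff (k - i))"
    by (rule member_le_sum) (auto simp: inv_sqrt_coeff_nonneg)
  then show ?thesis by (simp add: inv_sqrt_coeff_conv)
qed

lemma scalar_prod_self_nonneg: "0 \<le> v \<bullet> (v :: real Matrix.vec)"
  by (simp add: scalar_prod_def sum_nonneg)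

lemma scalar_prod_self_pos:
  assumes "v \<in> carrier_vec p" "v \<noteq> 0\<^sub>v p" shows "0 < v \<bullet> (v :: real Matrix.vec)"
proof -
  obtain i where "i < p" "v $ i \<noteq> 0" using assms by (auto simp: vec_eq_iff)
  then show ?thesis using assms unfolding scalar_prod_def
    by (intro sum_pos2[of _ i]) (auto simp: zero_less_mult_iff)
qed

lemma symmetric_scalar_prod:
  fixes B :: "real mat"
  assumes "B \<in> carrier_mat p p" "transpose_mat B = B" "v \<in> carrier_vec p" "w \<in> carrier_vec p"
  shows "(B *\<^sub>v v) \<bullet> w = v \<bullet> (B *\<^sub>v w)"
  using transpose_vec_mult_scalar[of B p p w v] assms by simp

lemma pow_mat_Suc_left:
  assumes "(B :: real mat) \<in> carrier_mat p p"
  shows "B ^\<^sub>m Suc k = B * B ^\<^sub>m k"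
  using assms
proof (induction k)
  case (Suc k)
  then have "B ^\<^sub>m Suc (Suc k) = (B * B ^\<^sub>m k) * B" by simp
  also have "\<dots> = B * (B ^\<^sub>m k * B)" using Suc.prems by (intro assoc_mult_mat) auto
  finally show ?case by simp
qed simp

lemma pow_mat_symmetric:
  assumes "(B :: real mat) \<in> carrier_mat p p" "transpose_mat B = B"
  shows "transpose_mat (B ^\<^sub>m k) = B ^\<^sub>m k"
proof (induction k)
  case 0 then show ?case by (rule eq_matI) (use assms in auto)
next
  case (Suc k)
  have "transpose_mat (B ^\<^sub>m Suc k) = transpose_mat B * transpose_mat (B ^\<^sub>m k)"
    unfolding pow_mat.simps by (rule transpose_mult) (use assms in auto)
  then show ?case using Suc assms pow_mat_Suc_left[of B p k] by simp
qed

lemma pow_mat_add: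
  assumes "(B :: real mat) \<in> carrier_mat p p"
  shows "B ^\<^sub>m (k + l) = B ^\<^sub>m k * B ^\<^sub>m l"
proof (induction l)
  case 0 then show ?case using assms by simp
next
  case (Suc l)
  then show ?case using assms by (simp add: assoc_mult_mat[of _ p p _ p _ p])
qed

text \<open>A bound for the quadratic form becomes a bound for the operator.  The idea, which avoids
  the spectral theorem, is to evaluate the nonnegative form at \<open>w - \<rho> * v\<close> for \<open>w = B v\<close>.\<close>
lemma psd_norm_contraction:
  fixes B :: "real mat"
  assumes B: "B \<in> carrier_mat p p" "transpose_mat B = B"
    and q: "\<And>v. v \<in> carrier_vec p \<Longrightarrow> 0 \<le> v \<bullet> (B *\<^sub>v v) \<and> v \<bullet> (B *\<^sub>v v) \<le> \<rho> * (v \<bullet> v)"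
    and "0 < \<rho>" and v: "v \<in> carrier_vec p"
  shows "(B *\<^sub>v v) \<bullet> (B *\<^sub>v v) \<le> \<rho>\<^sup>2 * (v \<bullet> v)"
proof -
  define w where "w = B *\<^sub>v v"
  have w: "w \<in> carrier_vec p" and Bw: "B *\<^sub>v w \<in> carrier_vec p" using B v by (auto simp: w_def)
  have d: "w - \<rho> \<cdot>\<^sub>v v \<in> carrier_vec p" using v w by simp
  have vBw: "v \<bullet> (B *\<^sub>v w) = w \<bullet> w"
    using symmetric_scalar_prod[OF B v w] by (simp add: w_def)
  have ex: "(w - \<rho> \<cdot>\<^sub>v v) \<bullet> (z - \<rho> \<cdot>\<^sub>v w) = w \<bullet> z - \<rho> * (w \<bullet> w) - \<rho> * (v \<bullet> z) + \<rho>\<^sup>2 * (v \<bullet> w)"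
    if "z \<in> carrier_vec p" for z
    using v w that by (simp add: scalar_prod_def sum_subtractf sum_distrib_left algebra_simps power2_eq_square sum.distrib)
  have "(w - \<rho> \<cdot>\<^sub>v v) \<bullet> (B *\<^sub>v (w - \<rho> \<cdot>\<^sub>v v)) = (w - \<rho> \<cdot>\<^sub>v v) \<bullet> (B *\<^sub>v w - \<rho> \<cdot>\<^sub>v w)"
    using B v w by (subst mult_minus_distrib_mat_vec[of _ p p]) (auto simp: mult_mat_vec w_def)
  also have "\<dots> = w \<bullet> (B *\<^sub>v w) - \<rho> * (w \<bullet> w) - \<rho> * (v \<bullet> (B *\<^sub>v w)) + \<rho>\<^sup>2 * (v \<bullet> w)"
    by (rule ex[OF Bw])
  finally have "0 \<le> w \<bullet> (B *\<^sub>v w) - 2 * \<rho> * (w \<bullet> w) + \<rho>\<^sup>2 * (v \<bullet> w)"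
    using q[OF d] vBw by simp
  moreover have "w \<bullet> (B *\<^sub>v w) \<le> \<rho> * (w \<bullet> w)" using q[OF w] by simp
  moreover have "\<rho>\<^sup>2 * (v \<bullet> w) \<le> \<rho>\<^sup>2 * (\<rho> * (v \<bullet> v))"
    using q[OF v] by (intro mult_left_mono) (auto simp: w_def)
  ultimately have "\<rho> * (w \<bullet> w) \<le> \<rho> * (\<rho>\<^sup>2 * (v \<bullet> v))" by (simp add: algebra_simps)
  then show ?thesis using \<open>0 < \<rho>\<close> by (simp add: w_def)
qed

text \<open>The form of \<open>B ^ (2 * m)\<close> at \<open>v\<close> is the squared norm of \<open>B ^ m v\<close>, and that of
  \<open>B ^ (2 * m + 1)\<close> is the form of \<open>B\<close> at \<open>B ^ m v\<close>.\<close>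
lemma psd_pow_mat:
  fixes B :: "real mat"
  assumes B: "B \<in> carrier_mat p p" "transpose_mat B = B"
    and q: "\<And>v. v \<in> carrier_vec p \<Longrightarrow> 0 \<le> v \<bullet> (B *\<^sub>v v) \<and> v \<bullet> (B *\<^sub>v v) \<le> \<rho> * (v \<bullet> v)"
    and "0 < \<rho>" and v: "v \<in> carrier_vec p"
  shows "0 \<le> v \<bullet> (B ^\<^sub>m k *\<^sub>v v)" and "(B ^\<^sub>m k *\<^sub>v v) \<bullet> (B ^\<^sub>m k *\<^sub>v v) \<le> (\<rho> ^ k)\<^sup>2 * (v \<bullet> v)"
proof -
  have Bk: "B ^\<^sub>m m \<in> carrier_mat p p" for m using B by simp
  have c: "B ^\<^sub>m m *\<^sub>v v \<in> carrier_vec p" for m using Bk[of m] v by auto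
  have "v \<bullet> (B ^\<^sub>m (2 * m) *\<^sub>v v) = (B ^\<^sub>m m *\<^sub>v v) \<bullet> (B ^\<^sub>m m *\<^sub>v v)" for m
    unfolding mult_2 pow_mat_add[OF B(1)]
    using symmetric_scalar_prod[OF Bk[of m] pow_mat_symmetric[OF B], of v "B ^\<^sub>m m *\<^sub>v v"] c v Bk[of m] by simp
  moreover have "v \<bullet> (B ^\<^sub>m (m + (1 + m)) *\<^sub>v v) = (B ^\<^sub>m m *\<^sub>v v) \<bullet> (B *\<^sub>v (B ^\<^sub>m m *\<^sub>v v))" for m
  proof -
    have "B ^\<^sub>m (m + (1 + m)) *\<^sub>v v = B ^\<^sub>m m *\<^sub>v (B *\<^sub>v (B ^\<^sub>m m *\<^sub>v v))"
      unfolding pow_mat_add[OF B(1)] using Bk[of m] B v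
      by (simp add: assoc_mult_mat_vec[of _ p p _ p])
    then show ?thesis
      using symmetric_scalar_prod[OF Bk[of m] pow_mat_symmetric[OF B], of v "B *\<^sub>v (B ^\<^sub>m m *\<^sub>v v)"] c B v by simp
  qed
  ultimately have "0 \<le> v \<bullet> (B ^\<^sub>m (2 * m) *\<^sub>v v)" "0 \<le> v \<bullet> (B ^\<^sub>m (m + (1 + m)) *\<^sub>v v)" for m
    using q[OF c] scalar_prod_self_nonneg by simp_all
  moreover obtain m where "k = 2 * m \<or> k = m + (1 + m)"
    by (metis evenE oddE mult_2 add.assoc add.commute)
  ultimately show "0 \<le> v \<bullet> (B ^\<^sub>m k *\<^sub>v v)" by metis
  show "(B ^\<^sub>m k *\<^sub>v v) \<bullet> (B ^\<^sub>m k *\<^sub>v v) \<le> (\<rho> ^ k)\<^sup>2 * (v \<bullet> v)"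
  proof (induction k)
    case 0 then show ?case using v B by simp
  next
    case (Suc k)
    have "B ^\<^sub>m Suc k *\<^sub>v v = B *\<^sub>v (B ^\<^sub>m k *\<^sub>v v)"
      unfolding pow_mat_Suc_left[OF B(1)] by (rule assoc_mult_mat_vec[OF B(1) Bk v])
    then have "(B ^\<^sub>m Suc k *\<^sub>v v) \<bullet> (B ^\<^sub>m Suc k *\<^sub>v v)
        \<le> \<rho>\<^sup>2 * ((B ^\<^sub>m k *\<^sub>v v) \<bullet> (B ^\<^sub>m k *\<^sub>v v))"
      using psd_norm_contraction[OF B q \<open>0 < \<rho>\<close> c[of k]] by simp
    also have "\<dots> \<le> \<rho>\<^sup>2 * ((\<rho> ^ k)\<^sup>2 * (v \<bullet> v))" by (intro mult_left_mono Suc) auto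
    finally show ?case by (simp add: power_mult_distrib mult_ac)
  qed
qed

lemma smult_mat_mult_vec:
  assumes "(A :: real mat) \<in> carrier_mat p p" "v \<in> carrier_vec p"
  shows "(k \<cdot>\<^sub>m A) *\<^sub>v v = k \<cdot>\<^sub>v (A *\<^sub>v v)"
  using assms by (intro eq_vecI) auto

lemma quadratic_form_sum:
  assumes "(A :: real mat) \<in> carrier_mat p p" "v \<in> carrier_vec p"
  shows "v \<bullet> (A *\<^sub>v v) = (\<Sum>i<p. \<Sum>j<p. v $ i * A $$ (i, j) * v $ j)"
  using assms by (simp add: scalar_prod_def sum_distrib_left mult.assoc atLeast0LessThan)

text \<open>Write \<open>M = C (1 - B)\<close>.  The form of \<open>B\<close> lies between 0 and \<open>\<rho> < 1\<close>, so the entries of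
  \<open>B ^ k\<close> are at most \<open>\<rho> ^ k\<close> and the binomial series of \<open>(1 - B) powr (- 1 / 2)\<close> converges
  entrywise.  Its terms are positive semidefinite, and it squares to the inverse of \<open>1 - B\<close>.\<close>
lemma inverse_sqrt_mat_exists:
  fixes M :: "real mat"
  assumes M: "M \<in> carrier_mat p p" "transpose_mat M = M"
    and q: "\<And>v. v \<in> carrier_vec p \<Longrightarrow> c * (v \<bullet> v) \<le> v \<bullet> (M *\<^sub>v v) \<and> v \<bullet> (M *\<^sub>v v) \<le> C * (v \<bullet> v)"
    and c: "0 < c" "c \<le> C"
  shows "\<exists>A. A \<in> carrier_mat p p \<and> transpose_mat A = A \<and>
    (\<forall>v\<in>carrier_vec p. v \<noteq> 0\<^sub>v p \<longrightarrow> 0 < v \<bullet> (A *\<^sub>v v)) \<and> A * A * M = 1\<^sub>m p"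
proof -
  define B where "B = 1\<^sub>m p - (1 / C) \<cdot>\<^sub>m M"
  have C: "0 < C" using c by simp
  \<comment> \<open>\<open>1 - c / C\<close> would also bound the form, but it can be 0.\<close>
  define \<rho> where "\<rho> = 1 - c / (2 * C)"
  have \<rho>: "0 < \<rho>" "\<rho> < 1" using c C by (auto simp: \<rho>_def field_simps)
  have B: "B \<in> carrier_mat p p" using M unfolding B_def by (intro minus_carrier_mat) simp
  have Bsym: "transpose_mat B = B"
  proof (rule eq_matI)
    fix i j assume "i < dim_row B" "j < dim_col B"
    then have ij: "i < p" "j < p" using B by auto
    have "M $$ (j, i) = M $$ (i, j)" using M ij by (metis carrier_matD index_transpose_mat(1))
    then show "transpose_mat B $$ (i, j) = B $$ (i, j)" using M ij by (simp add: B_def)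
  qed (use B in auto)
  have Bv: "v \<bullet> (B *\<^sub>v v) = v \<bullet> v - (1 / C) * (v \<bullet> (M *\<^sub>v v))" if v: "v \<in> carrier_vec p" for v
  proof -
    have "B *\<^sub>v v = v - (1 / C) \<cdot>\<^sub>v (M *\<^sub>v v)"
      unfolding B_def using M v
      by (subst minus_mult_distrib_mat_vec[of _ p p]) (auto simp: smult_mat_mult_vec)
    then show ?thesis using v M by (simp add: scalar_prod_minus_distrib)
  qed
  have Bq: "0 \<le> v \<bullet> (B *\<^sub>v v) \<and> v \<bullet> (B *\<^sub>v v) \<le> \<rho> * (v \<bullet> v)" if v: "v \<in> carrier_vec p" for v
  proof -
    have "c * (v \<bullet> v) \<le> v \<bullet> (M *\<^sub>v v)" "v \<bullet> (M *\<^sub>v v) \<le> C * (v \<bullet> v)" using q[OF v] by auto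
    moreover have "c / 2 * (v \<bullet> v) \<le> c * (v \<bullet> v)" using c scalar_prod_self_nonneg[of v] by simp
    ultimately show ?thesis using C by (simp add: Bv[OF v] \<rho>_def field_simps)
  qed
  define b where "b k i j = (B ^\<^sub>m k) $$ (i, j)" for k i j
  have Bk: "B ^\<^sub>m k \<in> carrier_mat p p" for k using B by simp
  have bb: "\<bar>b k i j\<bar> \<le> \<rho> ^ k" if ij: "i < p" "j < p" for k i j
  proof -
    have u: "unit_vec p j \<in> carrier_vec p" "unit_vec p j \<bullet> (unit_vec p j :: real Matrix.vec) = 1"
      using ij by auto
    define x where "x = B ^\<^sub>m k *\<^sub>v unit_vec p j"
    have x: "x \<in> carrier_vec p" using Bk[of k] by (simp add: x_def)
    have xi: "x $ i = b k i j" using ij carrier_matD[OF Bk[of k]] scalar_prod_right_unit[of j p "Matrix.row (B ^\<^sub>m k) i"]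
      by (simp add: x_def b_def)
    have "(x $ i)\<^sup>2 \<le> x \<bullet> x" unfolding scalar_prod_def
      using x ij by (auto simp: power2_eq_square intro!: member_le_sum)
    also have "\<dots> \<le> (\<rho> ^ k)\<^sup>2 * 1"
      using psd_pow_mat(2)[OF B Bsym Bq \<rho>(1) u(1), of k] u(2) by (simp add: x_def)
    finally have "(b k i j)\<^sup>2 \<le> (\<rho> ^ k)\<^sup>2" by (simp add: xi)
    then show ?thesis using \<rho> by (simp add: abs_le_square_iff[symmetric])
  qed
  have b0: "b 0 i j = (if i = j then 1 else 0)" if "i < p" "j < p" for i j
    using that B by (simp add: b_def)
  have badd: "(\<Sum>m<p. b k i m * b l m j) = b (k + l) i j" if "i < p" "j < p" for k l i j
    using that carrier_matD[OF Bk[of k]] carrier_matD[OF Bk[of l]]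
    by (simp add: b_def pow_mat_add[OF B] scalar_prod_def atLeast0LessThan)
  have bsum: "summable (\<lambda>k. norm (inv_sqrt_coeff k * b k i j))" if ij: "i < p" "j < p" for i j
  proof (rule summable_comparison_test')
    show "summable (\<lambda>k. \<rho> ^ k)" using \<rho> by (intro summable_geometric) auto
    show "norm (norm (inv_sqrt_coeff k * b k i j)) \<le> \<rho> ^ k" if "0 \<le> k" for k
      using mult_mono[OF inv_sqrt_coeff_le_1[of k] bb[OF ij, of k]] inv_sqrt_coeff_nonneg[of k]
      by (simp add: abs_mult)
  qed
  define s where "s i j = (\<Sum>k. inv_sqrt_coeff k * b k i j)" for i j
  have s: "(\<lambda>k. inv_sqrt_coeff k * b k i j) sums s i j" if "i < p" "j < p" for i j
    unfolding s_def by (rule summable_sums[OF summable_norm_cancel[OF bsum[OF that]]])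
  define t where "t i j = (\<Sum>k. b k i j)" for i j
  have t: "(\<lambda>k. b k i j) sums t i j" if ij: "i < p" "j < p" for i j
    unfolding t_def
  proof (rule summable_sums, rule summable_comparison_test')
    show "summable (\<lambda>k. \<rho> ^ k)" using \<rho> by (intro summable_geometric) auto
    show "norm (b k i j) \<le> \<rho> ^ k" if "0 \<le> k" for k using bb[OF ij, of k] by simp
  qed
  \<comment> \<open>By the convolution identity, the square of the series is the Neumann series.\<close>
  have ss: "(\<Sum>m<p. s i m * s m j) = t i j" if ij: "i < p" "j < p" for i j
  proof -
    have "(\<lambda>n. \<Sum>k\<le>n. (inv_sqrt_coeff k * b k i m) * (inv_sqrt_coeff (n - k) * b (n - k) m j))
        sums (s i m * s m j)" if "m < p" for m
      using Cauchy_product_sums[OF bsum[OF ij(1) that] bsum[OF that ij(2)]] by (simp add: s_def)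
    then have "(\<lambda>n. \<Sum>m<p. \<Sum>k\<le>n. (inv_sqrt_coeff k * b k i m) * (inv_sqrt_coeff (n - k) * b (n - k) m j))
        sums (\<Sum>m<p. s i m * s m j)" by (intro sums_sum) auto
    moreover have "(\<Sum>m<p. \<Sum>k\<le>n. (inv_sqrt_coeff k * b k i m) * (inv_sqrt_coeff (n - k) * b (n - k) m j)) = b n i j" for n
    proof -
      have "(\<Sum>m<p. \<Sum>k\<le>n. (inv_sqrt_coeff k * b k i m) * (inv_sqrt_coeff (n - k) * b (n - k) m j))
        = (\<Sum>k\<le>n. inv_sqrt_coeff k * inv_sqrt_coeff (n - k) * (\<Sum>m<p. b k i m * b (n - k) m j))"
        by (subst sum.swap) (simp add: sum_distrib_left mult_ac)
      also have "\<dots> = (\<Sum>k\<le>n. inv_sqrt_coeff k * inv_sqrt_coeff (n - k)) * b n i j"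
        unfolding sum_distrib_right using ij by (intro sum.cong) (auto simp: badd)
      finally show ?thesis by (simp add: inv_sqrt_coeff_conv)
    qed
    ultimately show ?thesis using t[OF ij] sums_unique2 by simp
  qed
  \<comment> \<open>The Neumann series telescopes when multiplied by \<open>1 - B\<close>.\<close>
  have tB: "(\<Sum>m<p. t i m * M $$ (m, j)) = (if i = j then C else 0)" if ij: "i < p" "j < p" for i j
  proof -
    have "(\<lambda>k. \<Sum>m<p. b k i m * b 1 m j) sums (\<Sum>m<p. t i m * b 1 m j)"
      using t ij by (intro sums_sum sums_mult2) auto
    then have "(\<lambda>k. b (Suc k) i j) sums (\<Sum>m<p. t i m * b 1 m j)"
      using ij by (simp add: badd)
    moreover have "(\<lambda>k. b (Suc k) i j) sums (t i j - b 0 i j)"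
      using t[OF ij] by (subst sums_Suc_iff) simp
    ultimately have e: "(\<Sum>m<p. t i m * b 1 m j) = t i j - b 0 i j" using sums_unique2 by blast
    have Me: "M $$ (m, j) = C * ((if m = j then 1 else 0) - b 1 m j)" if "m < p" for m
      using that ij B M C by (simp add: b_def) (simp add: B_def)
    have "(\<Sum>m<p. t i m * M $$ (m, j)) = (\<Sum>m<p. C * ((if m = j then t i m else 0) - t i m * b 1 m j))"
      by (intro sum.cong) (auto simp: Me right_diff_distrib)
    also have "\<dots> = C * (t i j - (\<Sum>m<p. t i m * b 1 m j))"
      using ij by (simp only: sum_distrib_left[symmetric] sum_subtractf) simp
    finally show ?thesis using ij e b0[OF ij] by (simp del: One_nat_def)
  qed
  define A where "A = Matrix.mat p p (\<lambda>(i, j). sqrt (1 / C) * s i j)"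
  have A: "A \<in> carrier_mat p p" by (simp add: A_def)
  have "transpose_mat A = A"
  proof (rule eq_matI)
    fix i j assume "i < dim_row A" "j < dim_col A"
    then have ij: "i < p" "j < p" using A by auto
    have "b k j i = b k i j" for k
      using pow_mat_symmetric[OF B Bsym, of k] Bk[of k] ij unfolding b_def
      by (metis carrier_matD index_transpose_mat(1))
    then show "transpose_mat A $$ (i, j) = A $$ (i, j)" using ij by (simp add: A_def s_def)
  qed (use A in auto)
  moreover have "0 < v \<bullet> (A *\<^sub>v v)" if v: "v \<in> carrier_vec p" "v \<noteq> 0\<^sub>v p" for v
  proof -
    have "(\<lambda>k. \<Sum>i<p. \<Sum>j<p. v $ i * (inv_sqrt_coeff k * b k i j) * v $ j)
        sums (\<Sum>i<p. \<Sum>j<p. v $ i * s i j * v $ j)"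
      using s by (intro sums_sum sums_mult sums_mult2) auto
    moreover have "(\<Sum>i<p. \<Sum>j<p. v $ i * (inv_sqrt_coeff k * b k i j) * v $ j)
       = inv_sqrt_coeff k * (v \<bullet> (B ^\<^sub>m k *\<^sub>v v))" for k
      using quadratic_form_sum[OF Bk[of k] v(1)] by (simp add: sum_distrib_left b_def mult_ac)
    ultimately have *: "(\<lambda>k. inv_sqrt_coeff k * (v \<bullet> (B ^\<^sub>m k *\<^sub>v v))) sums (\<Sum>i<p. \<Sum>j<p. v $ i * s i j * v $ j)"
      by simp
    have nn: "0 \<le> inv_sqrt_coeff k * (v \<bullet> (B ^\<^sub>m k *\<^sub>v v))" for k
      using psd_pow_mat(1)[OF B Bsym Bq \<rho>(1) v(1)] inv_sqrt_coeff_nonneg by simp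
    \<comment> \<open>The term for \<open>k = 0\<close> is positive, and the others are nonnegative.\<close>
    have "v \<bullet> v = (\<Sum>k<1. inv_sqrt_coeff k * (v \<bullet> (B ^\<^sub>m k *\<^sub>v v)))" using v B by simp
    also have "\<dots> \<le> (\<Sum>i<p. \<Sum>j<p. v $ i * s i j * v $ j)"
      using sum_le_suminf[OF sums_summable[OF *], of "{..<1}"] nn sums_unique[OF *] by simp
    finally have "0 < (\<Sum>i<p. \<Sum>j<p. v $ i * s i j * v $ j)" using scalar_prod_self_pos[OF v] by simp
    moreover have "v \<bullet> (A *\<^sub>v v) = sqrt (1 / C) * (\<Sum>i<p. \<Sum>j<p. v $ i * s i j * v $ j)"
      unfolding quadratic_form_sum[OF A v(1)] by (simp add: A_def sum_distrib_left mult_ac)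
    ultimately show ?thesis using C by simp
  qed
  moreover have "A * A * M = 1\<^sub>m p"
  proof (rule eq_matI)
    fix i j assume "i < dim_row (1\<^sub>m p)" "j < dim_col (1\<^sub>m p)"
    then have ij: "i < p" "j < p" by auto
    have AA: "(A * A) $$ (i, m) = (1 / C) * t i m" if "m < p" for m
    proof -
      have "(A * A) $$ (i, m) = (\<Sum>k<p. (sqrt (1 / C) * sqrt (1 / C)) * (s i k * s k m))"
        using ij that by (simp add: A_def scalar_prod_def atLeast0LessThan mult_ac)
      also have "\<dots> = (1 / C) * (\<Sum>k<p. s i k * s k m)"
        unfolding sum_distrib_left using C by simp
      finally show ?thesis using ss[OF ij(1) that] by simp
    qed
    have "(P * M) $$ (i, j) = (\<Sum>m<p. P $$ (i, m) * M $$ (m, j))" if "P \<in> carrier_mat p p" for P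
      using ij that M by (simp add: scalar_prod_def atLeast0LessThan)
    from this[of "A * A"] have "(A * A * M) $$ (i, j) = (\<Sum>m<p. (A * A) $$ (i, m) * M $$ (m, j))"
      using A by simp
    also have "\<dots> = (1 / C) * (\<Sum>m<p. t i m * M $$ (m, j))"
      unfolding sum_distrib_left using AA by (intro sum.cong) auto
    finally show "(A * A * M) $$ (i, j) = (1\<^sub>m p) $$ (i, j)" using ij C by (simp add: tB)
  qed (use A M in auto)
  ultimately show ?thesis using A by blast
qed

text \<open>For \<open>D = A - A'\<close> one has \<open>A D + D A' = 0\<close>.  The scalar product of this identity with \<open>D\<close> is
  the sum of the values of the form of \<open>A\<close> at the columns of \<open>D\<close> and of that of \<open>A'\<close> at its
  rows, so all of them vanish.\<close>
lemma positive_sqrt_unique: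
  fixes A A' :: "real mat"
  assumes A: "A \<in> carrier_mat p p" "\<forall>v\<in>carrier_vec p. v \<noteq> 0\<^sub>v p \<longrightarrow> 0 < v \<bullet> (A *\<^sub>v v)"
    and A': "A' \<in> carrier_mat p p" "\<forall>v\<in>carrier_vec p. v \<noteq> 0\<^sub>v p \<longrightarrow> 0 < v \<bullet> (A' *\<^sub>v v)"
    and sq: "A * A = A' * A'"
  shows "A = A'"
proof -
  define D where "D = A - A'"
  have D: "D \<in> carrier_mat p p" unfolding D_def by (rule minus_carrier_mat) (rule A'(1))
  have e: "(\<Sum>k<p. A $$ (i, k) * D $$ (k, j)) + (\<Sum>k<p. D $$ (i, k) * A' $$ (k, j)) = 0"
    if ij: "i < p" "j < p" for i j
  proof -
    have "(\<Sum>k<p. A $$ (i, k) * A $$ (k, j)) = (\<Sum>k<p. A' $$ (i, k) * A' $$ (k, j))"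
      using arg_cong[OF sq, of "\<lambda>M. M $$ (i, j)"] ij A(1) A'(1)
      by (simp add: scalar_prod_def atLeast0LessThan)
    moreover have "A $$ (i, k) * D $$ (k, j) + D $$ (i, k) * A' $$ (k, j)
        = A $$ (i, k) * A $$ (k, j) - A' $$ (i, k) * A' $$ (k, j)" if "k < p" for k
      using that ij A(1) A'(1) by (simp add: D_def algebra_simps)
    ultimately show ?thesis by (simp add: sum.distrib[symmetric] sum_subtractf)
  qed
  define q where "q M v = v \<bullet> (M *\<^sub>v v)" for M :: "real mat" and v
  have nn: "0 \<le> q A v" "0 \<le> q A' v" if "v \<in> carrier_vec p" for v
    using A A' that by (cases "v = 0\<^sub>v p"; force simp: q_def less_imp_le)+
  have cq: "q A (col D j) = (\<Sum>i<p. \<Sum>k<p. D $$ (i, j) * A $$ (i, k) * D $$ (k, j))" if "j < p" for j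
    unfolding q_def using that D by (subst quadratic_form_sum[OF A(1)]) auto
  have rq: "q A' (row D i) = (\<Sum>k<p. \<Sum>j<p. D $$ (i, k) * A' $$ (k, j) * D $$ (i, j))" if "i < p" for i
    unfolding q_def using that D by (subst quadratic_form_sum[OF A'(1)]) auto
  have "(\<Sum>j<p. q A (col D j)) + (\<Sum>i<p. q A' (row D i))
      = (\<Sum>i<p. \<Sum>j<p. D $$ (i, j) * ((\<Sum>k<p. A $$ (i, k) * D $$ (k, j)) + (\<Sum>k<p. D $$ (i, k) * A' $$ (k, j))))"
  proof -
    have "(\<Sum>j<p. q A (col D j)) = (\<Sum>i<p. \<Sum>j<p. D $$ (i, j) * (\<Sum>k<p. A $$ (i, k) * D $$ (k, j)))"
    proof -
      have "(\<Sum>j<p. q A (col D j)) = (\<Sum>j<p. \<Sum>i<p. D $$ (i, j) * (\<Sum>k<p. A $$ (i, k) * D $$ (k, j)))"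
        by (simp add: cq sum_distrib_left mult.assoc)
      also have "\<dots> = (\<Sum>i<p. \<Sum>j<p. D $$ (i, j) * (\<Sum>k<p. A $$ (i, k) * D $$ (k, j)))"
        by (rule sum.swap)
      finally show ?thesis .
    qed
    moreover have "(\<Sum>i<p. q A' (row D i)) = (\<Sum>i<p. \<Sum>j<p. D $$ (i, j) * (\<Sum>k<p. D $$ (i, k) * A' $$ (k, j)))"
    proof (intro sum.cong refl)
      fix i assume "i \<in> {..<p}"
      then show "q A' (row D i) = (\<Sum>j<p. D $$ (i, j) * (\<Sum>k<p. D $$ (i, k) * A' $$ (k, j)))"
        by (subst rq, simp, subst sum.swap) (simp add: sum_distrib_left mult_ac)
    qed
    ultimately show ?thesis by (simp add: distrib_left sum.distrib)
  qed
  also have "\<dots> = 0" by (simp add: e)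
  finally have z: "(\<Sum>j<p. q A (col D j)) + (\<Sum>i<p. q A' (row D i)) = 0" .
  have "0 \<le> (\<Sum>j<p. q A (col D j))" "0 \<le> (\<Sum>i<p. q A' (row D i))"
    using D by (auto intro!: sum_nonneg nn)
  with z have "(\<Sum>j<p. q A (col D j)) = 0" by linarith
  then have zj: "q A (col D j) = 0" if "j < p" for j
    using that D by (subst (asm) sum_nonneg_eq_0_iff) (auto intro: nn)
  have cD: "col D j = 0\<^sub>v p" if "j < p" for j
  proof (rule ccontr)
    assume "col D j \<noteq> 0\<^sub>v p"
    moreover have "col D j \<in> carrier_vec p" using D by auto
    ultimately have "0 < q A (col D j)" using A(2) by (simp add: q_def)
    then show False using zj[OF that] by simp
  qed
  show ?thesis
  proof (rule eq_matI)
    fix i j assume "i < dim_row A'" "j < dim_col A'"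
    then have ij: "i < p" "j < p" using A' by auto
    have "col D j $ i = 0" using cD[OF ij(2)] ij by simp
    then show "A $$ (i, j) = A' $$ (i, j)" using ij D A A' by (simp add: D_def)
  qed (use A A' in auto)
qed

text \<open>The definite description is justified because two positive definite candidates have the
  same square, namely the inverse of \<open>M\<close>.\<close>
lemma inv_sqrt_mat:
  fixes M :: "real mat"
  assumes M: "M \<in> carrier_mat p p" "transpose_mat M = M"
    and q: "\<And>v. v \<in> carrier_vec p \<Longrightarrow> c * (v \<bullet> v) \<le> v \<bullet> (M *\<^sub>v v) \<and> v \<bullet> (M *\<^sub>v v) \<le> C * (v \<bullet> v)"
    and c: "0 < c" "c \<le> C"
  shows "inv_sqrt_mat M \<in> carrier_mat p p" "transpose_mat (inv_sqrt_mat M) = inv_sqrt_mat M"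
    "inv_sqrt_mat M * inv_sqrt_mat M * M = 1\<^sub>m p"
proof -
  define P where "P A \<longleftrightarrow> A \<in> carrier_mat p p \<and> transpose_mat A = A \<and>
    (\<forall>v\<in>carrier_vec p. v \<noteq> 0\<^sub>v p \<longrightarrow> 0 < v \<bullet> (A *\<^sub>v v)) \<and> A * A * M = 1\<^sub>m p" for A
  obtain A where A: "P A" using inverse_sqrt_mat_exists[OF M q c] unfolding P_def by blast
  have "A' = A" if A': "P A'" for A'
  proof -
    have AA: "A * A \<in> carrier_mat p p" "A' * A' \<in> carrier_mat p p" using A A' by (auto simp: P_def)
    have "M * (A * A) = 1\<^sub>m p"
      using mat_mult_left_right_inverse[OF AA(1) M(1)] A by (simp add: P_def)
    then have "A' * A' = (A' * A') * (M * (A * A))"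
      using right_mult_one_mat[OF AA(2)] by simp
    also have "\<dots> = (A' * A' * M) * (A * A)"
      using AA M by (intro assoc_mult_mat[symmetric]) auto
    also have "\<dots> = A * A" using A' left_mult_one_mat[OF AA(1)] by (simp add: P_def)
    finally show ?thesis using positive_sqrt_unique[of A' p A] A A' by (simp add: P_def)
  qed
  then have "P (THE A. P A)" using A by (intro theI'[of P]) auto
  moreover have "inv_sqrt_mat M = (THE A. P A)"
    using M by (simp add: inv_sqrt_mat_def P_def)
  ultimately show "inv_sqrt_mat M \<in> carrier_mat p p" "transpose_mat (inv_sqrt_mat M) = inv_sqrt_mat M"
    "inv_sqrt_mat M * inv_sqrt_mat M * M = 1\<^sub>m p" by (simp_all add: P_def)
qed

text \<open>The symmetric matrix \<open>A\<close> and the triangular matrix \<open>sqrt n T\<close> have the same Gram matrix, the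
  inverse of \<open>S\<close>.  They differ by an orthogonal factor, so \<open>A\<close> may be replaced by \<open>sqrt n T\<close> in
  norms and, up to sign, in determinants.\<close>
lemma whitened_design:
  fixes G :: "nat \<Rightarrow> nat \<Rightarrow> real"
  assumes sym: "\<And>a b. G a b = G b a"
    and lo: "\<And>x. c * (\<Sum>a<p. (x a)\<^sup>2) \<le> (\<Sum>a<p. \<Sum>b<p. x a * G a b * x b)"
    and hi: "\<And>x. (\<Sum>a<p. \<Sum>b<p. x a * G a b * x b) \<le> C * (\<Sum>a<p. (x a)\<^sup>2)"
    and c: "0 < c" and n: "0 < n" and k: "\<And>a. 0 < k a"
    and T: "\<forall>a<p. 0 < T a a" "\<forall>a b. a < b \<longrightarrow> T a b = 0"
      "\<forall>a<p. \<forall>b<p. (\<Sum>c<p. \<Sum>d<p. T a c * G c d * T b d) = (if a = b then 1 else 0)"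
  defines "S \<equiv> Matrix.mat p p (\<lambda>(a, b). G a b / n)"
  defines "A \<equiv> inv_sqrt_mat S"
  defines "X \<equiv> A * mat_diag p k"
  shows "(vec_norm2 (X *\<^sub>v Matrix.vec p u))\<^sup>2 = (\<Sum>a<p. (\<Sum>b<p. sqrt n * T a b * k b * u b)\<^sup>2)"
    and "(vec_norm2 (A *\<^sub>v Matrix.vec p y - X *\<^sub>v Matrix.vec p u))\<^sup>2
      = (\<Sum>a<p. (\<Sum>b<p. sqrt n * T a b * k b * (y b / k b - u b))\<^sup>2)"
    and "sqrt (Determinant.det (transpose_mat X * X)) = (\<Prod>a<p. sqrt n * T a a * k a)"
proof -
  have S: "S \<in> carrier_mat p p" by (simp add: S_def)
  have St: "transpose_mat S = S" by (rule eq_matI) (auto simp: S_def sym)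
  have qS: "v \<bullet> (S *\<^sub>v v) = (\<Sum>a<p. \<Sum>b<p. v $ a * G a b * v $ b) / n" if "v \<in> carrier_vec p" for v
    unfolding quadratic_form_sum[OF S that] by (simp add: S_def sum_divide_distrib)
  have vv: "v \<bullet> v = (\<Sum>a<p. (v $ a)\<^sup>2)" if "v \<in> carrier_vec p" for v :: "real Matrix.vec"
    using that by (simp add: scalar_prod_def power2_eq_square atLeast0LessThan)
  \<comment> \<open>For \<open>p = 0\<close> the hypotheses do not imply \<open>c \<le> C\<close>.\<close>
  define C' where "C' = max c C"
  have "C * (\<Sum>a<p. (x a)\<^sup>2) \<le> C' * (\<Sum>a<p. (x a)\<^sup>2)" for x :: "nat \<Rightarrow> real"
    by (intro mult_right_mono sum_nonneg) (auto simp: C'_def)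
  then have hi': "(\<Sum>a<p. \<Sum>b<p. x a * G a b * x b) \<le> C' * (\<Sum>a<p. (x a)\<^sup>2)" for x
    using hi[of x] order_trans by blast
  have q: "c / n * (v \<bullet> v) \<le> v \<bullet> (S *\<^sub>v v) \<and> v \<bullet> (S *\<^sub>v v) \<le> C' / n * (v \<bullet> v)"
    if "v \<in> carrier_vec p" for v
    using lo[of "\<lambda>a. v $ a"] hi'[of "\<lambda>a. v $ a"] n
    unfolding qS[OF that] vv[OF that] by (auto simp: divide_right_mono)
  have cc: "0 < c / n" "c / n \<le> C' / n" using c n by (auto simp: C'_def divide_right_mono)
  note A = inv_sqrt_mat[OF S St q cc, folded A_def]
  define Tm where "Tm = Matrix.mat p p (\<lambda>(a, b). T a b)"
  define Gm where "Gm = Matrix.mat p p (\<lambda>(a, b). G a b)"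
  have Tm: "Tm \<in> carrier_mat p p" and Gm: "Gm \<in> carrier_mat p p" by (auto simp: Tm_def Gm_def)
  note Tt = transpose_carrier_mat[THEN iffD2, OF Tm]
  have TGT: "Tm * (Gm * transpose_mat Tm) = 1\<^sub>m p"
  proof (rule eq_matI)
    fix i j assume "i < dim_row (1\<^sub>m p)" "j < dim_col (1\<^sub>m p)"
    then have ij: "i < p" "j < p" by auto
    have "(Tm * (Gm * transpose_mat Tm)) $$ (i, j) = (\<Sum>c<p. T i c * (\<Sum>d<p. G c d * T j d))"
      using ij by (simp add: Tm_def Gm_def scalar_prod_def atLeast0LessThan)
    also have "\<dots> = (\<Sum>c<p. \<Sum>d<p. T i c * G c d * T j d)"
      by (simp add: sum_distrib_left mult.assoc)
    finally show "(Tm * (Gm * transpose_mat Tm)) $$ (i, j) = (1\<^sub>m p) $$ (i, j)" using T(3) ij by simp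
  qed (auto simp: Tm_def Gm_def)
  define Q where "Q = transpose_mat Tm * Tm"
  have Q: "Q \<in> carrier_mat p p" using Tm Tt by (simp add: Q_def)
  have "Gm * transpose_mat Tm * Tm = 1\<^sub>m p"
    using mat_mult_left_right_inverse[OF Tm _ TGT] Gm Tt by simp
  then have GQ: "Gm * Q = 1\<^sub>m p"
    unfolding Q_def using assoc_mult_mat[OF Gm Tt Tm] by simp
  have SG: "S = (1 / n) \<cdot>\<^sub>m Gm" by (rule eq_matI) (auto simp: S_def Gm_def)
  have AA: "A * A \<in> carrier_mat p p" using A(1) by simp
  have SQ: "S * (n \<cdot>\<^sub>m Q) = 1\<^sub>m p"
  proof -
    have "S * (n \<cdot>\<^sub>m Q) = n \<cdot>\<^sub>m (S * Q)" by (rule mult_smult_distrib[OF S Q])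
    also have "S * Q = (1 / n) \<cdot>\<^sub>m (Gm * Q)" unfolding SG by (rule mult_smult_assoc_mat[OF Gm Q])
    finally show ?thesis using n GQ by (auto intro!: eq_matI)
  qed
  have AAQ: "A * A = n \<cdot>\<^sub>m Q"
  proof -
    have nQ: "n \<cdot>\<^sub>m Q \<in> carrier_mat p p" using Q by simp
    have "A * A = A * A * (S * (n \<cdot>\<^sub>m Q))" using SQ right_mult_one_mat[OF AA] by simp
    also have "\<dots> = A * A * S * (n \<cdot>\<^sub>m Q)" by (rule assoc_mult_mat[symmetric, OF AA S nQ])
    finally show ?thesis using A(3) left_mult_one_mat[OF nQ] by simp
  qed
  have D: "mat_diag p k \<in> carrier_mat p p" by simp
  have X: "X \<in> carrier_mat p p" using A(1) D by (simp add: X_def)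
  have Dv: "mat_diag p k *\<^sub>v Matrix.vec p u = Matrix.vec p (\<lambda>b. k b * u b)" for u
    by (rule eq_vecI) (auto simp: mat_diag_def scalar_prod_def if_distrib[of "\<lambda>x. x * _"] cong: if_cong)
  have Xv: "X *\<^sub>v Matrix.vec p u = A *\<^sub>v Matrix.vec p (\<lambda>b. k b * u b)" for u
    unfolding X_def using assoc_mult_mat_vec[OF A(1) D, of "Matrix.vec p u"] Dv by simp
  have nA: "(A *\<^sub>v Matrix.vec p z) \<bullet> (A *\<^sub>v Matrix.vec p z) = n * (\<Sum>a<p. (\<Sum>b<p. T a b * z b)\<^sup>2)" for z
  proof -
    define v where "v = Matrix.vec p z"
    have v: "v \<in> carrier_vec p" by (simp add: v_def)
    have Av: "A *\<^sub>v v \<in> carrier_vec p" using A(1) v by simp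
    have Tv: "Tm *\<^sub>v v \<in> carrier_vec p" using Tm v by simp
    have "(A *\<^sub>v v) \<bullet> (A *\<^sub>v v) = v \<bullet> (A *\<^sub>v (A *\<^sub>v v))"
      by (rule symmetric_scalar_prod[OF A(1,2) v Av])
    also have "A *\<^sub>v (A *\<^sub>v v) = (n \<cdot>\<^sub>m Q) *\<^sub>v v"
      using assoc_mult_mat_vec[OF A(1) A(1) v] AAQ by simp
    also have "\<dots> = n \<cdot>\<^sub>v (Q *\<^sub>v v)" by (rule smult_mat_mult_vec[OF Q v])
    also have "v \<bullet> (n \<cdot>\<^sub>v (Q *\<^sub>v v)) = n * (v \<bullet> (Q *\<^sub>v v))" using Q v by simp
    also have "Q *\<^sub>v v = transpose_mat Tm *\<^sub>v (Tm *\<^sub>v v)"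
      unfolding Q_def by (rule assoc_mult_mat_vec[OF Tt Tm v])
    also have "v \<bullet> (transpose_mat Tm *\<^sub>v (Tm *\<^sub>v v)) = (transpose_mat Tm *\<^sub>v (Tm *\<^sub>v v)) \<bullet> v"
      by (rule comm_scalar_prod[OF v]) (use Tt Tv in simp)
    also have "\<dots> = (Tm *\<^sub>v v) \<bullet> (Tm *\<^sub>v v)" by (rule transpose_vec_mult_scalar[OF Tm v Tv])
    also have "\<dots> = (\<Sum>a<p. ((Tm *\<^sub>v v) $ a)\<^sup>2)" by (rule vv[OF Tv])
    also have "\<dots> = (\<Sum>a<p. (\<Sum>b<p. T a b * z b)\<^sup>2)"
      by (intro sum.cong refl) (simp add: Tm_def v_def scalar_prod_def atLeast0LessThan)
    finally show ?thesis by (simp add: v_def)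
  qed
  have nX: "(vec_norm2 (X *\<^sub>v Matrix.vec p u))\<^sup>2 = (\<Sum>a<p. (\<Sum>b<p. sqrt n * T a b * k b * u b)\<^sup>2)" for u
  proof -
    have "(vec_norm2 (X *\<^sub>v Matrix.vec p u))\<^sup>2 = n * (\<Sum>a<p. (\<Sum>b<p. T a b * (k b * u b))\<^sup>2)"
      unfolding Xv vec_norm2_def nA[symmetric] using scalar_prod_self_nonneg by simp
    also have "\<dots> = (\<Sum>a<p. (sqrt n * (\<Sum>b<p. T a b * (k b * u b)))\<^sup>2)"
      using n by (simp add: sum_distrib_left[of n] power_mult_distrib)
    finally show ?thesis by (simp add: sum_distrib_left mult.assoc)
  qed
  show "(vec_norm2 (X *\<^sub>v Matrix.vec p u))\<^sup>2 = (\<Sum>a<p. (\<Sum>b<p. sqrt n * T a b * k b * u b)\<^sup>2)" by (rule nX)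
  have "A *\<^sub>v Matrix.vec p y = X *\<^sub>v Matrix.vec p (\<lambda>b. y b / k b)"
    using k unfolding Xv by (intro arg_cong[of _ _ "\<lambda>v. A *\<^sub>v v"]) (auto intro!: eq_vecI simp: less_imp_neq[symmetric])
  then have "A *\<^sub>v Matrix.vec p y - X *\<^sub>v Matrix.vec p u
      = X *\<^sub>v (Matrix.vec p (\<lambda>b. y b / k b) - Matrix.vec p u)"
    using mult_minus_distrib_mat_vec[OF X, of "Matrix.vec p (\<lambda>b. y b / k b)" "Matrix.vec p u"] by simp
  also have "Matrix.vec p (\<lambda>b. y b / k b) - Matrix.vec p u = Matrix.vec p (\<lambda>b. y b / k b - u b)"
    by (rule eq_vecI) auto
  finally show "(vec_norm2 (A *\<^sub>v Matrix.vec p y - X *\<^sub>v Matrix.vec p u))\<^sup>2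
      = (\<Sum>a<p. (\<Sum>b<p. sqrt n * T a b * k b * (y b / k b - u b))\<^sup>2)" by (simp only: nX)
  have dT: "Determinant.det Tm = (\<Prod>a<p. T a a)"
  proof -
    have "Determinant.det Tm = prod_list (diag_mat Tm)"
      by (rule det_lower_triangular[OF _ Tm]) (use T(2) in \<open>auto simp: Tm_def\<close>)
    also have "\<dots> = (\<Prod>a<p. Tm $$ (a, a))" using Tm by (simp add: prod_list_diag_prod atLeast0LessThan)
    finally show ?thesis by (simp add: Tm_def)
  qed
  have dD: "Determinant.det (mat_diag p k) = (\<Prod>a<p. k a)"
  proof -
    have "Determinant.det (mat_diag p k) = prod_list (diag_mat (mat_diag p k))"
      by (rule det_lower_triangular[OF _ D]) (auto simp: mat_diag_def)
    also have "\<dots> = (\<Prod>a<p. mat_diag p k $$ (a, a))"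
      by (simp add: prod_list_diag_prod atLeast0LessThan mat_diag_def)
    finally show ?thesis by (simp add: mat_diag_def)
  qed
  have "Determinant.det (transpose_mat X * X) = (Determinant.det X)\<^sup>2"
    using det_mult[OF transpose_carrier_mat[THEN iffD2, OF X] X] det_transpose[OF X]
    by (simp add: power2_eq_square)
  also have "Determinant.det X = Determinant.det A * (\<Prod>a<p. k a)"
    unfolding X_def using det_mult[OF A(1) D] dD by simp
  also have "(Determinant.det A * (\<Prod>a<p. k a))\<^sup>2 = Determinant.det (A * A) * (\<Prod>a<p. k a)\<^sup>2"
    using det_mult[OF A(1) A(1)] by (simp add: power2_eq_square mult_ac)
  also have "Determinant.det (A * A) = n ^ p * (\<Prod>a<p. T a a)\<^sup>2"
    unfolding AAQ using Q det_mult[OF Tt Tm] det_transpose[OF Tm] dT carrier_matD[OF Tm]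
    by (simp add: Q_def power2_eq_square)
  also have "n ^ p * (\<Prod>a<p. T a a)\<^sup>2 * (\<Prod>a<p. k a)\<^sup>2 = (\<Prod>a<p. sqrt n * T a a * k a)\<^sup>2"
  proof -
    have "n ^ p = (sqrt n ^ p)\<^sup>2" using n by (simp add: power_mult[symmetric] mult.commute[of p] power_mult)
    then show ?thesis by (simp add: prod.distrib power_mult_distrib)
  qed
  finally have "Determinant.det (transpose_mat X * X) = (\<Prod>a<p. sqrt n * T a a * k a)\<^sup>2" .
  moreover have "0 \<le> (\<Prod>a<p. sqrt n * T a a * k a)"
    using T(1) k n by (intro prod_nonneg) (auto simp: less_imp_le)
  ultimately show "sqrt (Determinant.det (transpose_mat X * X)) = (\<Prod>a<p. sqrt n * T a a * k a)" by simp
qed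

section \<open>Square integrable functions on the unit interval\<close>

abbreviation "unit_leb \<equiv> lebesgue_on {0..1::real}"

lemma L2_prod_integrable:
  assumes "f \<in> L2" "g \<in> L2" shows "integrable unit_leb (\<lambda>x. f x * g x)"
proof (rule Bochner_Integration.integrable_bound[where f = "\<lambda>x. (f x)\<^sup>2 + (g x)\<^sup>2"])
  show "integrable unit_leb (\<lambda>x. (f x)\<^sup>2 + (g x)\<^sup>2)" using assms by (auto simp: L2_def)
  show "(\<lambda>x. f x * g x) \<in> borel_measurable unit_leb" using assms by (auto simp: L2_def)
  have "\<bar>f x * g x\<bar> \<le> (f x)\<^sup>2 + (g x)\<^sup>2" for x
  proof -
    have "0 \<le> (\<bar>f x\<bar> - \<bar>g x\<bar>)\<^sup>2" by simp
    then have "2 * (\<bar>f x\<bar> * \<bar>g x\<bar>) \<le> (f x)\<^sup>2 + (g x)\<^sup>2" by (simp add: power2_diff)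
    moreover have "0 \<le> \<bar>f x\<bar> * \<bar>g x\<bar>" by simp
    ultimately show ?thesis unfolding abs_mult by linarith
  qed
  then show "AE x in unit_leb. norm (f x * g x) \<le> norm ((f x)\<^sup>2 + (g x)\<^sup>2)"
    by (intro AE_I2) simp
qed

lemma L2_lin:
  assumes "f \<in> L2" "g \<in> L2" shows "(\<lambda>x. a * f x + b * g x) \<in> L2"
proof -
  have "integrable unit_leb (\<lambda>x. a\<^sup>2 * (f x)\<^sup>2 + (2 * a * b) * (f x * g x) + b\<^sup>2 * (g x)\<^sup>2)"
    using assms L2_prod_integrable[OF assms] by (auto simp: L2_def)
  moreover have "a\<^sup>2 * (f x)\<^sup>2 + (2 * a * b) * (f x * g x) + b\<^sup>2 * (g x)\<^sup>2 = (a * f x + b * g x)\<^sup>2" for x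
    by (simp add: power2_sum power_mult_distrib)
  ultimately show ?thesis using assms by (auto simp: L2_def)
qed

lemma L2_zero: "(\<lambda>_. 0) \<in> L2" by (simp add: L2_def)

lemma L2_sum:
  assumes "finite F" "\<And>i. i \<in> F \<Longrightarrow> f i \<in> L2"
  shows "(\<lambda>x. \<Sum>i\<in>F. a i * f i x) \<in> L2"
  using assms
proof (induction F)
  case empty then show ?case by (simp add: L2_zero)
next
  case (insert i F)
  then show ?case using L2_lin[of "f i" "\<lambda>x. \<Sum>i\<in>F. a i * f i x" "a i" 1] by simp
qed

lemma L2_diff: "f \<in> L2 \<Longrightarrow> g \<in> L2 \<Longrightarrow> (\<lambda>x. f x - g x) \<in> L2"
  using L2_lin[of f g 1 "- 1"] by simp

lemma ip_commute: "ip f g = ip g f" by (simp add: ip_def mult.commute)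

lemma ip_lin:
  assumes "f \<in> L2" "g \<in> L2" "h \<in> L2"
  shows "ip (\<lambda>x. a * f x + b * g x) h = a * ip f h + b * ip g h"
proof -
  have "(\<lambda>x. (a * f x + b * g x) * h x) = (\<lambda>x. a * (f x * h x) + b * (g x * h x))"
    by (auto simp: algebra_simps)
  then show ?thesis unfolding ip_def
    using L2_prod_integrable[OF assms(1,3)] L2_prod_integrable[OF assms(2,3)] by simp
qed

lemma ip_diff:
  assumes "f \<in> L2" "g \<in> L2" "h \<in> L2" shows "ip (\<lambda>x. f x - g x) h = ip f h - ip g h"
  using ip_lin[OF assms, of 1 "- 1"] by simp

lemma ip_sum:
  assumes "finite F" "\<And>i. i \<in> F \<Longrightarrow> f i \<in> L2" "h \<in> L2"
  shows "ip (\<lambda>x. \<Sum>i\<in>F. a i * f i x) h = (\<Sum>i\<in>F. a i * ip (f i) h)"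
  using assms
proof (induction F)
  case empty then show ?case by (simp add: ip_def)
next
  case (insert i F)
  then show ?case
    using ip_lin[of "f i" "\<lambda>x. \<Sum>i\<in>F. a i * f i x" h "a i" 1] L2_sum[of F f a] by simp
qed

lemma ip_sum_sum:
  assumes "finite F" "\<And>i. i \<in> F \<Longrightarrow> f i \<in> L2"
  shows "ip (\<lambda>x. \<Sum>i\<in>F. a i * f i x) (\<lambda>x. \<Sum>i\<in>F. b i * f i x) = (\<Sum>i\<in>F. \<Sum>j\<in>F. a i * ip (f i) (f j) * b j)"
proof -
  have "ip (\<lambda>x. \<Sum>i\<in>F. a i * f i x) (\<lambda>x. \<Sum>i\<in>F. b i * f i x)
      = (\<Sum>i\<in>F. a i * ip (f i) (\<lambda>x. \<Sum>i\<in>F. b i * f i x))"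
    by (rule ip_sum) (use assms L2_sum in auto)
  also have "\<dots> = (\<Sum>i\<in>F. a i * (\<Sum>j\<in>F. b j * ip (f j) (f i)))"
    using assms by (intro sum.cong refl) (simp add: ip_commute[of "f _" "\<lambda>x. \<Sum>i\<in>F. b i * f i x"] ip_sum)
  also have "\<dots> = (\<Sum>i\<in>F. \<Sum>j\<in>F. a i * ip (f i) (f j) * b j)"
    by (simp add: sum_distrib_left ip_commute mult_ac)
  finally show ?thesis .
qed

lemma ip_self_nonneg: "0 \<le> ip f f"
  unfolding ip_def by (intro Bochner_Integration.integral_nonneg) simp

lemma L2norm_square: "(L2norm f)\<^sup>2 = ip f f"
  by (simp add: L2norm_def ip_self_nonneg)

section \<open>White noise\<close>

lemma std_normal_cos_sin:
  "(\<integral>x. cos (t * x) \<partial>std_normal_distribution) = exp (- t\<^sup>2 / 2)"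
  "(\<integral>x. sin (t * x) \<partial>std_normal_distribution) = 0"
proof -
  interpret real_distribution std_normal_distribution by (rule real_dist_normal_dist)
  have e: "iexp (t * x) = cis (t * x)" for x by (simp add: cis_conv_exp)
  have i: "integrable std_normal_distribution (\<lambda>x. iexp (t * x))"
    by (rule integrable_const_bound[of _ 1]) auto
  have "(\<integral>x. cos (t * x) \<partial>std_normal_distribution) = Re (char std_normal_distribution t)"
    unfolding char_def by (subst integral_Re[OF i, symmetric]) (simp only: e cis.sel)
  then show "(\<integral>x. cos (t * x) \<partial>std_normal_distribution) = exp (- t\<^sup>2 / 2)"
    by (simp add: char_std_normal_distribution)
  have "(\<integral>x. sin (t * x) \<partial>std_normal_distribution) = Im (char std_normal_distribution t)"
    unfolding char_def by (subst integral_Im[OF i, symmetric]) (simp only: e cis.sel)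
  then show "(\<integral>x. sin (t * x) \<partial>std_normal_distribution) = 0"
    by (simp add: char_std_normal_distribution)
qed

locale white_noise_law =
  fixes Q :: "((real \<Rightarrow> real) \<Rightarrow> real) measure"
  assumes wn: "white_noise Q"
begin

sublocale prob_space Q using wn by (simp add: white_noise_def)

lemma sets_Q [measurable_cong]: "sets Q = sets (Pi\<^sub>M L2 (\<lambda>_. borel))"
  using wn by (simp add: white_noise_def)

lemma noise_measurable [measurable (raw)]: "g \<in> L2 \<Longrightarrow> (\<lambda>W. W g) \<in> borel_measurable Q"
  by (subst measurable_cong_sets[OF sets_Q refl]) (rule measurable_component_singleton)

lemma noise_normal:
  "g \<in> L2 \<Longrightarrow> 0 < L2norm g \<Longrightarrow> distributed Q lborel (\<lambda>W. W g) (normal_density 0 (L2norm g))"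
  using wn by (simp add: white_noise_def)

lemma noise_zero: "g \<in> L2 \<Longrightarrow> L2norm g = 0 \<Longrightarrow> AE W in Q. W g = 0"
  using wn by (simp add: white_noise_def)

lemma noise_lin: "g \<in> L2 \<Longrightarrow> h \<in> L2 \<Longrightarrow> AE W in Q. W (\<lambda>x. a * g x + b * h x) = a * W g + b * W h"
  using wn by (simp add: white_noise_def)

lemma L2norm_cases: "L2norm g = 0 \<or> 0 < L2norm g"
  using ip_self_nonneg[of g] by (auto simp: L2norm_def less_eq_real_def)

lemma noise_sum:
  assumes "finite F" "\<And>i. i \<in> F \<Longrightarrow> f i \<in> L2"
  shows "AE W in Q. W (\<lambda>x. \<Sum>i\<in>F. a i * f i x) = (\<Sum>i\<in>F. a i * W (f i))"
  using assms
proof (induction F)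
  case empty
  then show ?case using noise_zero[OF L2_zero] by (simp add: L2norm_def ip_def)
next
  case (insert i F)
  have "AE W in Q. W (\<lambda>x. a i * f i x + 1 * (\<Sum>i\<in>F. a i * f i x))
      = a i * W (f i) + 1 * W (\<lambda>x. \<Sum>i\<in>F. a i * f i x)"
    using insert by (intro noise_lin L2_sum) auto
  moreover have "AE W in Q. W (\<lambda>x. \<Sum>i\<in>F. a i * f i x) = (\<Sum>i\<in>F. a i * W (f i))"
    using insert by auto
  ultimately show ?case using insert(1,2) by (auto elim: AE_mp)
qed

lemma noise_zero_integral:
  fixes f :: "real \<Rightarrow> real"
  assumes g: "g \<in> L2" "L2norm g = 0" and [measurable]: "f \<in> borel_measurable borel"
  shows "integrable Q (\<lambda>W. f (W g))" "(\<integral>W. f (W g) \<partial>Q) = f 0"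
proof -
  note [measurable] = noise_measurable[OF g(1)]
  have ae: "AE W in Q. f (W g) = f 0" using noise_zero[OF g] by eventually_elim simp
  have "integrable Q (\<lambda>W. f (W g)) \<longleftrightarrow> integrable Q (\<lambda>_. f 0)"
    using ae by (intro integrable_cong_AE) auto
  then show "integrable Q (\<lambda>W. f (W g))" by simp
  have "(\<integral>W. f (W g) \<partial>Q) = (\<integral>_. f 0 \<partial>Q)" using ae by (intro integral_cong_AE) auto
  then show "(\<integral>W. f (W g) \<partial>Q) = f 0" by (simp add: prob_space)
qed

lemma noise_cos_sin:
  assumes g: "g \<in> L2"
  shows "(\<integral>W. cos (W g) \<partial>Q) = exp (- ip g g / 2)" "(\<integral>W. sin (W g) \<partial>Q) = 0"
proof -
  note [measurable] = noise_measurable[OF g]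
  have "(\<integral>W. cos (W g) \<partial>Q) = exp (- ip g g / 2) \<and> (\<integral>W. sin (W g) \<partial>Q) = 0"
    using L2norm_cases[of g]
  proof
    assume z: "L2norm g = 0"
    then have "ip g g = 0" using L2norm_square[of g] by simp
    then show ?thesis
      using noise_zero_integral(2)[OF g z, of cos] noise_zero_integral(2)[OF g z, of sin] by simp
  next
    assume p: "0 < L2norm g"
    define \<sigma> where "\<sigma> = L2norm g"
    have "distributed Q lborel (\<lambda>W. (W g - 0) / \<sigma>) std_normal_density"
      using noise_normal[OF g p] normal_standard_normal_convert[OF p] unfolding \<sigma>_def by simp
    then have d: "distr Q lborel (\<lambda>W. W g / \<sigma>) = std_normal_distribution"
      using distributed_distr_eq_density by fastforce
    have "(\<integral>W. f (\<sigma> * (W g / \<sigma>)) \<partial>Q) = (\<integral>x. f (\<sigma> * x) \<partial>std_normal_distribution)"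
      if [measurable]: "f \<in> borel_measurable borel" for f :: "real \<Rightarrow> real"
      unfolding d[symmetric] using g by (intro integral_distr[symmetric]) auto
    moreover have "\<sigma> * (W g / \<sigma>) = W g" for W :: "(real \<Rightarrow> real) \<Rightarrow> real" using p by (simp add: \<sigma>_def)
    ultimately have "(\<integral>W. cos (W g) \<partial>Q) = exp (- \<sigma>\<^sup>2 / 2)" "(\<integral>W. sin (W g) \<partial>Q) = 0"
      using std_normal_cos_sin[of \<sigma>] by auto
    then show ?thesis by (simp add: \<sigma>_def L2norm_square)
  qed
  then show "(\<integral>W. cos (W g) \<partial>Q) = exp (- ip g g / 2)" "(\<integral>W. sin (W g) \<partial>Q) = 0" by auto
qed

lemma noise_moments:
  assumes g: "g \<in> L2"
  shows "integrable Q (\<lambda>W. W g)" "integrable Q (\<lambda>W. (W g)\<^sup>2)"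
    "(\<integral>W. W g \<partial>Q) = 0" "(\<integral>W. (W g)\<^sup>2 \<partial>Q) = ip g g"
proof -
  note [measurable] = noise_measurable[OF g]
  have "integrable Q (\<lambda>W. W g) \<and> integrable Q (\<lambda>W. (W g)\<^sup>2) \<and> (\<integral>W. W g \<partial>Q) = 0 \<and> (\<integral>W. (W g)\<^sup>2 \<partial>Q) = ip g g"
    using L2norm_cases[of g]
  proof
    assume z: "L2norm g = 0"
    then have "ip g g = 0" using L2norm_square[of g] by simp
    then show ?thesis
      using noise_zero_integral[OF g z, of "\<lambda>x. x"] noise_zero_integral[OF g z, of "\<lambda>x. x\<^sup>2"] by simp
  next
    assume p: "0 < L2norm g"
    note d = noise_normal[OF g p]
    have e: "(\<integral>W. W g \<partial>Q) = 0" using normal_distributed_expectation[OF p d] .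
    have "integrable Q (\<lambda>W. W g)"
      using distributed_integrable[OF d, of "\<lambda>x. x"] integrable_normal_moment[OF p, of 0 1] by simp
    moreover have "integrable Q (\<lambda>W. (W g)\<^sup>2)"
      using distributed_integrable[OF d, of "\<lambda>x. x\<^sup>2"] integrable_normal_moment[OF p, of 0 2] by simp
    moreover have "(\<integral>W. (W g)\<^sup>2 \<partial>Q) = ip g g"
      using normal_distributed_variance[OF p d] e by (simp add: L2norm_square)
    ultimately show ?thesis using e by blast
  qed
  then show "integrable Q (\<lambda>W. W g)" "integrable Q (\<lambda>W. (W g)\<^sup>2)"
    "(\<integral>W. W g \<partial>Q) = 0" "(\<integral>W. (W g)\<^sup>2 \<partial>Q) = ip g g" by auto
qed

text \<open>By polarization from the second moments of \<open>W g\<close>, \<open>W h\<close> and \<open>W (g + h)\<close>.\<close>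
lemma noise_covariance:
  assumes g: "g \<in> L2" and h: "h \<in> L2"
  shows "(\<integral>W. W g * W h \<partial>Q) = ip g h"
proof -
  define s where "s = (\<lambda>x. 1 * g x + 1 * h x)"
  have s: "s \<in> L2" unfolding s_def by (rule L2_lin[OF g h])
  note [measurable] = noise_measurable[OF g] noise_measurable[OF h] noise_measurable[OF s]
  have "AE W in Q. W s = 1 * W g + 1 * W h" unfolding s_def by (rule noise_lin[OF g h])
  then have "AE W in Q. W g * W h = ((W s)\<^sup>2 - (W g)\<^sup>2 - (W h)\<^sup>2) / 2"
    by (rule AE_mp) (auto simp: power2_sum)
  then have "(\<integral>W. W g * W h \<partial>Q) = (\<integral>W. ((W s)\<^sup>2 - (W g)\<^sup>2 - (W h)\<^sup>2) / 2 \<partial>Q)"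
    by (intro integral_cong_AE) auto
  also have "\<dots> = (ip s s - ip g g - ip h h) / 2"
    using noise_moments[OF g] noise_moments[OF h] noise_moments[OF s] by simp
  also have "ip s s = ip g g + 2 * ip g h + ip h h"
    using ip_lin[OF g h s, of 1 1] ip_lin[OF g h g, of 1 1] ip_lin[OF g h h, of 1 1]
    unfolding s_def[symmetric] by (simp add: ip_commute[of g s] ip_commute[of h s] ip_commute[of h g])
  finally show ?thesis by simp
qed

lemma noise_tail:
  assumes g: "g \<in> L2" and "ip g g \<le> V" "0 \<le> t"
  shows "measure Q {W \<in> space Q. t < \<bar>W g\<bar>} \<le> sqrt 2 * exp (- (t\<^sup>2 / (4 * V)))"
  using L2norm_cases[of g]
proof
  assume p: "0 < L2norm g"
  show ?thesis
    by (rule normal_tail[OF prob_space_axioms p _ assms(3) noise_normal[OF g p]])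
      (simp add: L2norm_square assms)
next
  assume z: "L2norm g = 0"
  note [measurable] = noise_measurable[OF g]
  have "AE W in Q. \<not> t < \<bar>W g\<bar>" using noise_zero[OF g z] assms(3) by (auto elim: AE_mp)
  then have "measure Q {W \<in> space Q. t < \<bar>W g\<bar>} = 0"
    by (intro measure_eq_0_null_sets) (simp add: AE_iff_null_sets[symmetric] AE_iff_null null_sets_def)
  then show ?thesis by simp
qed

text \<open>A linear combination of the whitened coordinates is the noise in a single function, whose
  norm is the Euclidean norm of the coefficients.\<close>
lemma whitened_noise_law:
  assumes I: "finite I" and g: "\<And>j. j \<in> I \<Longrightarrow> g j \<in> L2"
    and T: "\<And>i k. i \<in> I \<Longrightarrow> k \<in> I \<Longrightarrow>
      (\<Sum>j\<in>I. \<Sum>m\<in>I. T i j * ip (g j) (g m) * T k m) = (if i = k then 1 else 0)"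
  shows "distr Q (Pi\<^sub>M I (\<lambda>_. lborel)) (\<lambda>W. \<lambda>i\<in>I. \<Sum>j\<in>I. T i j * W (g j))
    = density (Pi\<^sub>M I (\<lambda>_. lborel)) (\<lambda>z. ennreal (\<Prod>i\<in>I. std_normal_density (z i)))"
proof (rule distr_joint_std_normal[OF prob_space_axioms I])
  note [measurable] = noise_measurable[OF g]
  show "(\<lambda>W. \<Sum>j\<in>I. T i j * W (g j)) \<in> borel_measurable Q" for i by measurable
  fix t :: "_ \<Rightarrow> real"
  define e where "e i = (\<lambda>x. \<Sum>j\<in>I. T i j * g j x)" for i
  have e: "e i \<in> L2" for i unfolding e_def using I g by (rule L2_sum)
  have ee: "ip (e i) (e k) = (if i = k then 1 else 0)" if "i \<in> I" "k \<in> I" for i k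
    unfolding e_def using ip_sum_sum[OF I g] T[OF that] by simp
  define f where "f = (\<lambda>x. \<Sum>i\<in>I. t i * e i x)"
  have f: "f \<in> L2" unfolding f_def using I e by (rule L2_sum)
  have "AE W in Q. W (e i) = (\<Sum>j\<in>I. T i j * W (g j))" for i
    unfolding e_def using I g by (rule noise_sum)
  then have "AE W in Q. \<forall>i\<in>I. W (e i) = (\<Sum>j\<in>I. T i j * W (g j))" using I by (simp add: AE_finite_all)
  moreover have "AE W in Q. W f = (\<Sum>i\<in>I. t i * W (e i))" unfolding f_def using I e by (rule noise_sum)
  ultimately have ae: "AE W in Q. W f = (\<Sum>i\<in>I. t i * (\<Sum>j\<in>I. T i j * W (g j)))" by eventually_elim simp
  have "ip f f = (\<Sum>i\<in>I. \<Sum>k\<in>I. t i * ip (e i) (e k) * t k)"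
    unfolding f_def using I e by (rule ip_sum_sum)
  also have "\<dots> = (\<Sum>i\<in>I. \<Sum>k\<in>I. if i = k then (t i)\<^sup>2 else 0)"
    by (intro sum.cong refl) (simp add: ee power2_eq_square)
  finally have ff: "ip f f = (\<Sum>i\<in>I. (t i)\<^sup>2)" using I by simp
  note [measurable] = noise_measurable[OF f]
  have c: "(\<integral>W. c (\<Sum>i\<in>I. t i * (\<Sum>j\<in>I. T i j * W (g j))) \<partial>Q) = (\<integral>W. c (W f) \<partial>Q)"
    if [measurable]: "c \<in> borel_measurable borel" for c :: "real \<Rightarrow> real"
  proof (rule integral_cong_AE)
    show "AE W in Q. c (\<Sum>i\<in>I. t i * (\<Sum>j\<in>I. T i j * W (g j))) = c (W f)"
      using ae by eventually_elim simp
  qed measurable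
  show "(\<integral>W. cos (\<Sum>i\<in>I. t i * (\<Sum>j\<in>I. T i j * W (g j))) \<partial>Q) = exp (- (\<Sum>i\<in>I. (t i)\<^sup>2) / 2)"
    "(\<integral>W. sin (\<Sum>i\<in>I. t i * (\<Sum>j\<in>I. T i j * W (g j))) \<partial>Q) = 0"
    using noise_cos_sin[OF f] ff c[of cos] c[of sin] by auto
qed

end

section \<open>The observation\<close>

locale observation = white_noise_law Q for Q +
  fixes n :: nat and \<mu> :: "real \<Rightarrow> real"
  assumes n: "0 < n"
begin

text \<open>The observation as a function of the noise: probabilities under the law of \<open>Y\<close> become
  probabilities under the law of \<open>W\<close>.\<close>
definition obs :: "((real \<Rightarrow> real) \<Rightarrow> real) \<Rightarrow> (real \<Rightarrow> real) \<Rightarrow> real" where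
  "obs W = (\<lambda>g\<in>L2. ip g \<mu> + W g / sqrt (real n))"

abbreviation "P \<equiv> obs_law n \<mu> Q"

lemma obs_measurable [measurable]: "obs \<in> measurable Q (Pi\<^sub>M L2 (\<lambda>_. borel))"
  unfolding obs_def by (rule measurable_restrict) measurable

lemma P_eq: "P = distr Q (Pi\<^sub>M L2 (\<lambda>_. borel)) obs"
  by (simp add: obs_law_def obs_def[abs_def])

lemma sets_P [measurable_cong]: "sets P = sets (Pi\<^sub>M L2 (\<lambda>_. borel))"
  by (simp add: P_eq)

lemma prob_space_P: "prob_space P"
  unfolding P_eq by (rule prob_space_distr) measurable

lemma obs_apply: "g \<in> L2 \<Longrightarrow> obs W g = ip g \<mu> + W g / sqrt (real n)"
  by (simp add: obs_def)

lemma coordinate_measurable [measurable (raw)]: "g \<in> L2 \<Longrightarrow> (\<lambda>Y. Y g) \<in> borel_measurable P"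
  by (subst measurable_cong_sets[OF sets_P refl]) (rule measurable_component_singleton)

lemma measure_P:
  "A \<in> sets P \<Longrightarrow> measure P A = measure Q {W \<in> space Q. obs W \<in> A}"
  unfolding P_eq by (subst measure_distr) (auto simp: vimage_def Int_def conj_commute)

lemma integral_P:
  fixes f :: "((real \<Rightarrow> real) \<Rightarrow> real) \<Rightarrow> real"
  assumes "f \<in> borel_measurable (Pi\<^sub>M L2 (\<lambda>_. borel))"
  shows "(\<integral>Y. f Y \<partial>P) = (\<integral>W. f (obs W) \<partial>Q)"
  unfolding P_eq using assms by (intro integral_distr) auto

lemma obs_mean: assumes g: "g \<in> L2" shows "(\<integral>Y. Y g \<partial>P) = ip g \<mu>"
proof -
  have "(\<integral>Y. Y g \<partial>P) = (\<integral>W. ip g \<mu> + W g / sqrt (real n) \<partial>Q)"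
    using integral_P[OF measurable_component_singleton[OF g]] by (simp add: obs_apply[OF g])
  also have "\<dots> = ip g \<mu>" using noise_moments[OF g] by (simp add: prob_space)
  finally show ?thesis .
qed

lemma obs_covariance:
  assumes g: "g \<in> L2" and h: "h \<in> L2"
  shows "covariance P (\<lambda>Y. Y g) (\<lambda>Y. Y h) = ip g h / real n"
proof -
  note m = measurable_component_singleton[OF g, where M = "\<lambda>_. borel :: real measure"]
    measurable_component_singleton[OF h, where M = "\<lambda>_. borel :: real measure"]
  have "covariance P (\<lambda>Y. Y g) (\<lambda>Y. Y h) = (\<integral>Y. (Y g - ip g \<mu>) * (Y h - ip h \<mu>) \<partial>P)"
    by (simp add: covariance_def obs_mean g h)
  also have "\<dots> = (\<integral>W. (obs W g - ip g \<mu>) * (obs W h - ip h \<mu>) \<partial>Q)"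
    by (rule integral_P) (intro borel_measurable_times borel_measurable_diff m borel_measurable_const)
  also have "\<dots> = (\<integral>W. W g * W h / real n \<partial>Q)" using n by (simp add: obs_apply g h)
  finally show ?thesis by (simp add: noise_covariance[OF g h])
qed

end

section \<open>Gaussian measures with triangular precision factor\<close>

text \<open>By forward substitution.\<close>
lemma triangular_inverse:
  assumes "triangular M I"
  shows "\<exists>L\<in>measurable (Pi\<^sub>M I (\<lambda>_. lborel)) (Pi\<^sub>M I (\<lambda>_. lborel :: real measure)).
    \<forall>b\<in>space (Pi\<^sub>M I (\<lambda>_. lborel :: real measure)). L (lin M I b) = b"
  using assms
proof (induction rule: triangular.induct)
  case empty
  show ?case by (rule bexI[of _ "\<lambda>b. b"]) (auto simp: space_PiM lin_def)
next
  case (insert I i)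
  have fin[simp]: "finite I" using insert.hyps triangular_finite by auto
  from insert.IH obtain L where L[measurable]: "L \<in> measurable (Pi\<^sub>M I (\<lambda>_. lborel)) (Pi\<^sub>M I (\<lambda>_. lborel :: real measure))"
    and inv: "\<And>b. b \<in> space (Pi\<^sub>M I (\<lambda>_. lborel :: real measure)) \<Longrightarrow> L (lin M I b) = b" by blast
  define L' where "L' z = (L (restrict z I))(i := (z i - (\<Sum>j\<in>I. M i j * L (restrict z I) j)) / M i i)" for z
  have r[measurable]: "(\<lambda>z. restrict z I) \<in> measurable (Pi\<^sub>M (insert i I) (\<lambda>_. lborel)) (Pi\<^sub>M I (\<lambda>_. lborel :: real measure))"
    by (rule measurable_restrict_subset) auto
  have Lr: "(\<lambda>z. L (restrict z I)) \<in> measurable (Pi\<^sub>M (insert i I) (\<lambda>_. lborel)) (Pi\<^sub>M I (\<lambda>_. lborel :: real measure))"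
    by measurable
  have Lj[measurable]: "(\<lambda>z. L (restrict z I) j) \<in> borel_measurable (Pi\<^sub>M (insert i I) (\<lambda>_. lborel))" if "j \<in> I" for j
    using measurable_compose[OF Lr measurable_component_singleton[OF that]] by simp
  have "(\<lambda>z. (z i - (\<Sum>j\<in>I. M i j * L (restrict z I) j)) / M i i) \<in> borel_measurable (Pi\<^sub>M (insert i I) (\<lambda>_. lborel))"
    by measurable
  then have "L' \<in> measurable (Pi\<^sub>M (insert i I) (\<lambda>_. lborel)) (Pi\<^sub>M (insert i I) (\<lambda>_. lborel))"
    unfolding L'_def[abs_def] by (intro measurable_fun_upd[where J = I] Lr) auto
  moreover have "L' (lin M (insert i I) b) = b" if b: "b \<in> space (Pi\<^sub>M (insert i I) (\<lambda>_. lborel))" for b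
  proof -
    define x where "x = restrict b I"
    have x: "x \<in> space (Pi\<^sub>M I (\<lambda>_. lborel :: real measure))" by (auto simp: x_def space_PiM)
    have bx: "b = x(i := b i)" using b by (auto simp: x_def space_PiM PiE_def extensional_def fun_eq_iff)
    have r: "restrict (lin M (insert i I) b) I = lin M I x"
    proof
      fix k show "restrict (lin M (insert i I) b) I k = lin M I x k"
        using lin_insert(1)[of I i M k x "b i"] insert.hyps bx by (auto simp: lin_def)
    qed
    have "lin M (insert i I) b i = M i i * b i + (\<Sum>j\<in>I. M i j * x j)"
      using lin_insert(2)[of I i M x "b i"] insert.hyps bx by auto
    then show ?thesis using insert.hyps bx unfolding L'_def r inv[OF x] by auto
  qed
  ultimately show ?case by blast
qed

text \<open>A change of variables.  The inverse of \<open>M\<close> is needed as a measurable map, in order to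
  express events about \<open>h\<close> in the whitened vector.\<close>
lemma law_of_whitened:
  assumes M: "triangular M I" and h: "h \<in> measurable Q (Pi\<^sub>M I (\<lambda>_. lborel))"
    and law: "distr Q (Pi\<^sub>M I (\<lambda>_. lborel)) (\<lambda>\<omega>. lin M I (h \<omega>))
      = density (Pi\<^sub>M I (\<lambda>_. lborel)) (\<lambda>z. ennreal (\<Prod>i\<in>I. std_normal_density (z i)))"
  shows "distr Q (Pi\<^sub>M I (\<lambda>_. lborel)) h = density (Pi\<^sub>M I (\<lambda>_. lborel)) (\<lambda>b. ennreal (gauss M I b))"
proof (rule measure_eqI)
  let ?L = "Pi\<^sub>M I (\<lambda>_. lborel :: real measure)"
  show "sets (distr Q ?L h) = sets (density ?L (\<lambda>b. ennreal (gauss M I b)))" by simp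
  fix A assume "A \<in> sets (distr Q ?L h)"
  then have A[measurable]: "A \<in> sets ?L" by simp
  note [measurable] = h
  obtain L where L[measurable]: "L \<in> measurable ?L ?L"
    and inv: "\<And>b. b \<in> space ?L \<Longrightarrow> L (lin M I b) = b" using triangular_inverse[OF M] by blast
  have lm[measurable]: "lin M I \<in> measurable ?L ?L"
  proof -
    have "lin M I = (\<lambda>b. \<lambda>i\<in>I. lin M I b i + 0)" by (auto simp: lin_def fun_eq_iff)
    then show ?thesis using affine_measurable[of M I "\<lambda>_. 0"] by simp
  qed
  have r: "(\<lambda>i\<in>I. lin M I b i + 0) = lin M I b" for b by (auto simp: lin_def)
  define F :: "_ \<Rightarrow> ennreal" where "F z = indicator A (L z)" for z
  have F[measurable]: "F \<in> borel_measurable ?L" unfolding F_def by measurable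
  have "emeasure (distr Q ?L h) A = (\<integral>\<^sup>+b. indicator A b \<partial>distr Q ?L h)" by simp
  also have "\<dots> = (\<integral>\<^sup>+\<omega>. indicator A (h \<omega>) \<partial>Q)" by (rule nn_integral_distr) measurable
  also have "\<dots> = (\<integral>\<^sup>+\<omega>. F (lin M I (h \<omega>)) \<partial>Q)"
    using measurable_space[OF h] by (intro nn_integral_cong) (simp add: F_def inv)
  also have "\<dots> = (\<integral>\<^sup>+z. F z \<partial>distr Q ?L (\<lambda>\<omega>. lin M I (h \<omega>)))"
    by (rule nn_integral_distr[symmetric]) measurable
  also have "\<dots> = (\<integral>\<^sup>+z. ennreal (\<Prod>i\<in>I. std_normal_density (z i)) * F z \<partial>?L)"
    unfolding law by (rule nn_integral_density) measurable
  also have "\<dots> = ennreal (\<Prod>i\<in>I. M i i) *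
      (\<integral>\<^sup>+b. ennreal (\<Prod>i\<in>I. std_normal_density (lin M I b i)) * F (lin M I b) \<partial>?L)"
    by (subst nn_integral_triangular[OF M, where a = "\<lambda>_. 0"]) (simp_all only: r, measurable)
  also have "\<dots> = (\<integral>\<^sup>+b. ennreal (gauss M I b) * indicator A b \<partial>?L)"
  proof (subst nn_integral_cmult[symmetric])
    have "0 \<le> (\<Prod>i\<in>I. M i i)"
      using triangular_diag_pos[OF M] by (intro prod_nonneg) (auto simp: less_imp_le)
    then show "(\<integral>\<^sup>+b. ennreal (\<Prod>i\<in>I. M i i) * (ennreal (\<Prod>i\<in>I. std_normal_density (lin M I b i)) * F (lin M I b)) \<partial>?L)
      = (\<integral>\<^sup>+b. ennreal (gauss M I b) * indicator A b \<partial>?L)"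
      by (intro nn_integral_cong) (simp add: gauss_def prod.distrib ennreal_mult' F_def inv mult.assoc)
  qed measurable
  also have "\<dots> = emeasure (density ?L (\<lambda>b. ennreal (gauss M I b))) A"
    by (subst emeasure_density) auto
  finally show "emeasure (distr Q ?L h) A = emeasure (density ?L (\<lambda>b. ennreal (gauss M I b))) A" .
qed

section \<open>The Mahalanobis norm\<close>

text \<open>The Mahalanobis norm of the normal law with precision matrix \<open>M\<^sup>T M\<close>.\<close>
definition nrm :: "('i \<Rightarrow> 'i \<Rightarrow> real) \<Rightarrow> 'i set \<Rightarrow> ('i \<Rightarrow> real) \<Rightarrow> real" where
  "nrm M I b = L2_set (lin M I b) I"

lemma nrm_nonneg [simp]: "0 \<le> nrm M I b"
  by (simp add: nrm_def)

lemma nrm_square: "(nrm M I b)\<^sup>2 = (\<Sum>i\<in>I. (lin M I b i)\<^sup>2)"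
  by (simp add: nrm_def L2_set_def sum_nonneg)

lemma nrm_measurable [measurable]: "nrm M I \<in> borel_measurable (Pi\<^sub>M I (\<lambda>_. lborel))"
  unfolding nrm_def L2_set_def by measurable

lemma lin_diff: "i \<in> I \<Longrightarrow> lin M I (\<lambda>j. a j - b j) i = lin M I a i - lin M I b i"
  by (simp add: lin_def right_diff_distrib sum_subtractf)

lemma nrm_cong: "(\<And>i. i \<in> I \<Longrightarrow> a i = b i) \<Longrightarrow> nrm M I a = nrm M I b"
  by (auto simp: nrm_def lin_def intro!: L2_set_cong sum.cong)

lemma nrm_minus: "nrm M I (\<lambda>i. - b i) = nrm M I b"
  by (simp add: nrm_def lin_def sum_negf L2_set_def)

lemma nrm_sym: "nrm M I (\<lambda>i. a i - b i) = nrm M I (\<lambda>i. b i - a i)"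
  using nrm_minus[of M I "\<lambda>i. a i - b i"] by simp

lemma nrm_triangle: "nrm M I (\<lambda>i. a i - c i) \<le> nrm M I (\<lambda>i. a i - b i) + nrm M I (\<lambda>i. b i - c i)"
proof -
  have "nrm M I (\<lambda>i. a i - c i) = L2_set (\<lambda>i. lin M I (\<lambda>i. a i - b i) i + lin M I (\<lambda>i. b i - c i) i) I"
    unfolding nrm_def by (intro L2_set_cong refl) (simp add: lin_diff)
  also have "\<dots> \<le> nrm M I (\<lambda>i. a i - b i) + nrm M I (\<lambda>i. b i - c i)"
    unfolding nrm_def by (rule L2_set_triangle_ineq)
  finally show ?thesis .
qed

lemma nrm_diff_measurable [measurable]:
  "(\<lambda>b. nrm M I (\<lambda>i. a i - b i)) \<in> borel_measurable (Pi\<^sub>M I (\<lambda>_. lborel))"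
proof -
  have "nrm M I (\<lambda>i. a i - b i) = sqrt (\<Sum>i\<in>I. (\<Sum>j\<in>I. M i j * (a j - b j))\<^sup>2)" for b
    by (simp add: nrm_def L2_set_def lin_def)
  then show ?thesis by simp
qed

definition gauss_const :: "('i \<Rightarrow> 'i \<Rightarrow> real) \<Rightarrow> 'i set \<Rightarrow> real" where
  "gauss_const M I = (\<Prod>i\<in>I. M i i / sqrt (2 * pi))"

lemma gauss_nrm: "finite I \<Longrightarrow> gauss M I b = gauss_const M I * exp (- (nrm M I b)\<^sup>2 / 2)"
  by (simp add: gauss_def gauss_const_def normal_density_def nrm_square prod.distrib exp_sum[symmetric]
      sum_negf sum_divide_distrib prod_dividef)

lemma gauss_const_pos: "triangular M I \<Longrightarrow> 0 < gauss_const M I"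
  unfolding gauss_const_def by (intro prod_pos) (auto simp: triangular_diag_pos)

lemma gauss_nonneg: "triangular M I \<Longrightarrow> 0 \<le> gauss M I b"
  unfolding gauss_def by (intro prod_nonneg) (auto simp: less_imp_le triangular_diag_pos)

lemma nn_integral_gauss:
  fixes f :: "real \<Rightarrow> real"
  assumes M: "triangular M I" and [measurable]: "f \<in> borel_measurable borel" and f: "\<And>x. 0 \<le> f x"
  shows "(\<integral>\<^sup>+b. ennreal (gauss M I b * (\<Prod>i\<in>I. f (lin M I b i))) \<partial>Pi\<^sub>M I (\<lambda>_. lborel))
    = (\<Prod>i\<in>I. \<integral>\<^sup>+x. ennreal (std_normal_density x * f x) \<partial>lborel)"
proof -
  note fin = triangular_finite[OF M]
  let ?F = "\<lambda>z. \<Prod>i\<in>I. ennreal (std_normal_density (z i) * f (z i))"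
  have r: "(\<lambda>i\<in>I. lin M I b i + 0) = lin M I b" for b by (auto simp: lin_def)
  have pos: "0 \<le> (\<Prod>i\<in>I. M i i)"
    by (intro prod_nonneg) (auto simp: less_imp_le triangular_diag_pos[OF M])
  have "(\<Prod>i\<in>I. \<integral>\<^sup>+x. ennreal (std_normal_density x * f x) \<partial>lborel) = (\<integral>\<^sup>+z. ?F z \<partial>Pi\<^sub>M I (\<lambda>_. lborel))"
    by (rule lborel_prod.product_nn_integral_prod[OF fin, symmetric]) measurable
  also have "\<dots> = ennreal (\<Prod>i\<in>I. M i i) * (\<integral>\<^sup>+b. ?F (\<lambda>i\<in>I. lin M I b i + 0) \<partial>Pi\<^sub>M I (\<lambda>_. lborel))"
    by (rule nn_integral_triangular[OF M]) measurable
  also have "\<dots> = (\<integral>\<^sup>+b. ennreal (\<Prod>i\<in>I. M i i) * ?F (lin M I b) \<partial>Pi\<^sub>M I (\<lambda>_. lborel))"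
    unfolding r by (rule nn_integral_cmult[symmetric]) measurable
  also have "\<dots> = (\<integral>\<^sup>+b. ennreal (gauss M I b * (\<Prod>i\<in>I. f (lin M I b i))) \<partial>Pi\<^sub>M I (\<lambda>_. lborel))"
    using pos f by (intro nn_integral_cong) (simp add: gauss_def prod_ennreal ennreal_mult'[symmetric] prod.distrib mult_ac)
  finally show ?thesis by simp
qed

lemma gauss_total:
  assumes "triangular M I"
  shows "(\<integral>\<^sup>+b. ennreal (gauss M I b) \<partial>Pi\<^sub>M I (\<lambda>_. lborel)) = 1"
  using nn_integral_gauss[OF assms, of "\<lambda>_. 1"] by (simp add: nn_integral_std_normal)

lemma gauss_exp_square:
  assumes "triangular M I"
  shows "(\<integral>\<^sup>+b. ennreal (gauss M I b * exp ((nrm M I b)\<^sup>2 / 4)) \<partial>Pi\<^sub>M I (\<lambda>_. lborel)) = ennreal (sqrt 2 ^ card I)"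
proof -
  have "exp ((nrm M I b)\<^sup>2 / 4) = (\<Prod>i\<in>I. exp ((lin M I b i)\<^sup>2 / 4))" for b
    using triangular_finite[OF assms] by (simp add: exp_sum[symmetric] nrm_square sum_divide_distrib)
  then show ?thesis
    using nn_integral_gauss[OF assms, of "\<lambda>x. exp (x\<^sup>2 / 4)"] nn_integral_exp_square_normal[of 1]
    by (simp add: mult.commute[of "std_normal_density _"] prod_ennreal ennreal_power)
qed

text \<open>Translations are the case of the identity matrix.\<close>
lemma nn_integral_translate:
  assumes "finite I" and F: "F \<in> borel_measurable (Pi\<^sub>M I (\<lambda>_. lborel :: real measure))"
  shows "(\<integral>\<^sup>+b. F b \<partial>Pi\<^sub>M I (\<lambda>_. lborel)) = (\<integral>\<^sup>+b. F (\<lambda>i\<in>I. b i + a i) \<partial>Pi\<^sub>M I (\<lambda>_. lborel))"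
proof -
  let ?D = "\<lambda>i j. if i = j then 1 else (0::real)"
  have t: "triangular ?D I"
    using assms(1) by (induction I) (auto intro: triangular.intros)
  have "lin ?D I b i = b i" if "i \<in> I" for b i
    using assms(1) that by (simp add: lin_def if_distrib[of "\<lambda>x. x * _"] cong: if_cong)
  then have "(\<lambda>i\<in>I. lin ?D I b i + a i) = (\<lambda>i\<in>I. b i + a i)" for b by auto
  then show ?thesis using nn_integral_triangular[OF t F, of a] by simp
qed

abbreviation gauss_measure :: "('i \<Rightarrow> 'i \<Rightarrow> real) \<Rightarrow> 'i set \<Rightarrow> ('i \<Rightarrow> real) measure" where
  "gauss_measure M I \<equiv> density (Pi\<^sub>M I (\<lambda>_. lborel)) (\<lambda>b. ennreal (gauss M I b))"

lemma prob_space_gauss_measure: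
  assumes "triangular M I" shows "prob_space (gauss_measure M I)"
proof
  have "emeasure (gauss_measure M I) (space (gauss_measure M I))
      = (\<integral>\<^sup>+b. ennreal (gauss M I b) \<partial>Pi\<^sub>M I (\<lambda>_. lborel))"
    by (subst emeasure_density) (auto intro!: nn_integral_cong)
  then show "emeasure (gauss_measure M I) (space (gauss_measure M I)) = 1"
    by (simp add: gauss_total[OF assms])
qed

text \<open>The squared norm has a chi-square law; this is its Chernoff bound.\<close>
lemma gauss_tail_le:
  assumes M: "triangular M I" and "0 \<le> t"
  shows "measure (gauss_measure M I) {b \<in> space (Pi\<^sub>M I (\<lambda>_. lborel)). t \<le> nrm M I b}
    \<le> sqrt 2 ^ card I * exp (- (t\<^sup>2 / 4))"
proof -
  interpret prob_space "gauss_measure M I" by (rule prob_space_gauss_measure[OF M])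
  let ?A = "{b \<in> space (Pi\<^sub>M I (\<lambda>_. lborel)). t \<le> nrm M I b}"
  have "emeasure (gauss_measure M I) ?A = (\<integral>\<^sup>+b. ennreal (gauss M I b) * indicator ?A b \<partial>Pi\<^sub>M I (\<lambda>_. lborel))"
    by (rule emeasure_density) measurable
  also have "\<dots> \<le> (\<integral>\<^sup>+b. ennreal (exp (- (t\<^sup>2 / 4))) * ennreal (gauss M I b * exp ((nrm M I b)\<^sup>2 / 4)) \<partial>Pi\<^sub>M I (\<lambda>_. lborel))"
  proof (rule nn_integral_mono)
    fix b
    have "1 \<le> exp (- (t\<^sup>2 / 4)) * exp ((nrm M I b)\<^sup>2 / 4)" if "t \<le> nrm M I b"
      using that assms(2) power_mono[of t "nrm M I b" 2] by (simp add: exp_add[symmetric])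
    then have "gauss M I b * indicator ?A b \<le> exp (- (t\<^sup>2 / 4)) * (gauss M I b * exp ((nrm M I b)\<^sup>2 / 4))"
      using gauss_nonneg[OF M, of b] mult_left_mono[of 1 "exp (- (t\<^sup>2 / 4)) * exp ((nrm M I b)\<^sup>2 / 4)" "gauss M I b"]
      by (auto simp: indicator_def mult_ac)
    then show "ennreal (gauss M I b) * indicator ?A b
        \<le> ennreal (exp (- (t\<^sup>2 / 4))) * ennreal (gauss M I b * exp ((nrm M I b)\<^sup>2 / 4))"
      using gauss_nonneg[OF M, of b]
      by (simp add: ennreal_mult'[symmetric] ennreal_indicator[symmetric] ennreal_leI del: ennreal_indicator)
  qed
  also have "\<dots> = ennreal (exp (- (t\<^sup>2 / 4))) * ennreal (sqrt 2 ^ card I)"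
    by (subst nn_integral_cmult) (simp_all add: gauss_exp_square[OF M])
  finally show ?thesis
    by (simp add: emeasure_eq_measure ennreal_mult'[symmetric] mult.commute)
qed

text \<open>In the whitened coordinates the ball is Euclidean, and it contains the cube of half-width
  \<open>r / sqrt p\<close>, where \<open>p\<close> is the dimension.  The loss against the exact volume is only
  exponential in \<open>p\<close>.\<close>
lemma ball_volume:
  assumes M: "triangular M I" and I: "I \<noteq> {}" and r: "0 < r"
  shows "ennreal ((2 * r / sqrt (card I)) ^ card I / (\<Prod>i\<in>I. M i i))
    \<le> emeasure (Pi\<^sub>M I (\<lambda>_. lborel)) {b \<in> space (Pi\<^sub>M I (\<lambda>_. lborel)). nrm M I (\<lambda>i. b i - b0 i) \<le> r}"
    (is "_ \<le> emeasure ?L ?B")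
proof -
  note fin = triangular_finite[OF M]
  define x where "x = r / sqrt (card I)"
  have p: "0 < card I" using fin I by (simp add: card_gt_0_iff)
  have x: "0 < x" using r p by (simp add: x_def)
  define C where "C = Pi\<^sub>E I (\<lambda>_. {- x..x})"
  have C[measurable]: "C \<in> sets ?L" unfolding C_def using fin by (intro sets_PiM_I_finite) auto
  have B[measurable]: "?B \<in> sets ?L"
    unfolding nrm_sym[of M I _ b0] by measurable
  define a where "a i = - lin M I b0 i" for i
  have "ennreal ((2 * x) ^ card I) = (\<Prod>i\<in>I. emeasure lborel {- x..x})"
    using x by (simp add: ennreal_power)
  also have "\<dots> = emeasure ?L C"
    unfolding C_def by (rule lborel_prod.emeasure_PiM[OF fin, symmetric]) auto
  also have "\<dots> = (\<integral>\<^sup>+b. indicator C b \<partial>?L)" by simp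
  also have "\<dots> = ennreal (\<Prod>i\<in>I. M i i) * (\<integral>\<^sup>+b. indicator C (\<lambda>i\<in>I. lin M I b i + a i) \<partial>?L)"
    by (rule nn_integral_triangular[OF M]) measurable
  also have "(\<integral>\<^sup>+b. indicator C (\<lambda>i\<in>I. lin M I b i + a i) \<partial>?L) \<le> (\<integral>\<^sup>+b. indicator ?B b \<partial>?L)"
  proof (rule nn_integral_mono)
    fix b assume b: "b \<in> space ?L"
    have "nrm M I (\<lambda>i. b i - b0 i) \<le> r" if "(\<lambda>i\<in>I. lin M I b i + a i) \<in> C"
    proof -
      have "\<bar>lin M I (\<lambda>i. b i - b0 i) i\<bar> \<le> x" if "i \<in> I" for i
        using PiE_mem[OF \<open>_ \<in> C\<close>[unfolded C_def] that] that by (auto simp: lin_diff a_def)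
      then have "(nrm M I (\<lambda>i. b i - b0 i))\<^sup>2 \<le> (\<Sum>i\<in>I. x\<^sup>2)"
        unfolding nrm_square using x by (intro sum_mono) (metis abs_le_square_iff abs_of_pos)
      also have "\<dots> = r\<^sup>2" using p by (simp add: x_def power_divide)
      finally show ?thesis using r by (simp add: abs_le_square_iff[symmetric])
    qed
    then show "indicator C (\<lambda>i\<in>I. lin M I b i + a i) \<le> (indicator ?B b :: ennreal)"
      using b by (auto simp: indicator_def)
  qed
  finally have le: "ennreal ((2 * x) ^ card I) \<le> ennreal (\<Prod>i\<in>I. M i i) * emeasure ?L ?B"
    by (simp add: mult_left_mono)
  have pos: "0 < (\<Prod>i\<in>I. M i i)" by (intro prod_pos) (auto simp: triangular_diag_pos[OF M])
  have "ennreal ((2 * x) ^ card I / (\<Prod>i\<in>I. M i i)) = ennreal (1 / (\<Prod>i\<in>I. M i i)) * ennreal ((2 * x) ^ card I)"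
    using pos x by (simp add: ennreal_mult'[symmetric])
  also have "\<dots> \<le> ennreal (1 / (\<Prod>i\<in>I. M i i)) * (ennreal (\<Prod>i\<in>I. M i i) * emeasure ?L ?B)"
    by (intro mult_left_mono le) simp
  also have "\<dots> = emeasure ?L ?B"
    using pos by (simp add: mult.assoc[symmetric] ennreal_mult'[symmetric])
  finally show ?thesis by (simp add: x_def)
qed

section \<open>Normal approximation of the posterior\<close>

lemma measure_density_le:
  assumes [measurable]: "f \<in> borel_measurable L" "g \<in> borel_measurable L" "A \<in> sets L"
    and fin: "finite_measure (density L (\<lambda>x. ennreal (f x)))" "finite_measure (density L (\<lambda>x. ennreal (g x)))"
    and le: "\<And>x. x \<in> A \<Longrightarrow> c * f x \<le> d * g x" and cd: "0 \<le> c" "0 \<le> d"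
  shows "c * measure (density L (\<lambda>x. ennreal (f x))) A \<le> d * measure (density L (\<lambda>x. ennreal (g x))) A"
proof -
  have e: "ennreal (k * measure (density L (\<lambda>x. ennreal (h x))) A) = (\<integral>\<^sup>+x. ennreal (k * h x) * indicator A x \<partial>L)"
    if "0 \<le> k" "h \<in> borel_measurable L" "finite_measure (density L (\<lambda>x. ennreal (h x)))" for k and h :: "_ \<Rightarrow> real"
  proof -
    note [measurable] = that(2)
    have "ennreal (k * measure (density L (\<lambda>x. ennreal (h x))) A) = ennreal k * emeasure (density L (\<lambda>x. ennreal (h x))) A"
      using that finite_measure.emeasure_eq_measure[OF that(3)] by (simp add: ennreal_mult')
    also have "\<dots> = ennreal k * (\<integral>\<^sup>+x. ennreal (h x) * indicator A x \<partial>L)" by (simp add: emeasure_density)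
    also have "\<dots> = (\<integral>\<^sup>+x. ennreal k * (ennreal (h x) * indicator A x) \<partial>L)" by (rule nn_integral_cmult[symmetric]) measurable
    finally show ?thesis using that(1) by (simp add: ennreal_mult' mult.assoc)
  qed
  have "ennreal (c * measure (density L (\<lambda>x. ennreal (f x))) A) \<le> ennreal (d * measure (density L (\<lambda>x. ennreal (g x))) A)"
    using e[OF cd(1) _ fin(1)] e[OF cd(2) _ fin(2)]
    by (simp, intro nn_integral_mono) (auto simp: indicator_def le ennreal_leI)
  then show ?thesis using cd by simp
qed

text \<open>The arithmetic of the total variation bound below.  There \<open>y\<close> and \<open>x\<close> are the masses of a set
  under the normal law and the posterior, \<open>u\<close> and \<open>x'\<close> those of its part in a ball, and \<open>v'\<close>
  and \<open>v\<close> those of the ball.  The first hypothesis compares the two laws conditioned on the ball.\<close>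
lemma one_sided_tv:
  fixes x y u v \<phi> e1 e2 :: real
  assumes "x' * v' \<ge> (1 - \<phi>) * u * v" "x' \<le> x" "0 \<le> x'" "v' \<le> 1" "y - e2 \<le> u" "0 \<le> u" "u \<le> 1"
    "0 \<le> v" "v \<le> 1" "0 \<le> \<phi>" "\<phi> \<le> 1" "1 - e1 \<le> v"
  shows "y - (\<phi> + e1 + e2) \<le> x"
proof -
  have "u * v \<le> 1" using assms by (simp add: mult_le_one)
  then have "\<phi> * (u * v) \<le> \<phi>" using assms mult_left_mono[of "u * v" 1 \<phi>] by simp
  moreover have "u * (1 - v) \<le> 1 - v" using assms mult_right_mono[of u 1 "1 - v"] by simp
  ultimately have "u - \<phi> - (1 - v) \<le> (1 - \<phi>) * u * v" by (simp add: algebra_simps)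
  also have "\<dots> \<le> x' * v'" by fact
  also have "\<dots> \<le> x'" using assms mult_left_mono[of v' 1 x'] by simp
  finally show ?thesis using assms by linarith
qed

text \<open>On the ball of radius \<open>R\<close> around \<open>b0\<close> the prior density varies by a factor \<open>1 - \<phi>\<close> at
  most, so there the posterior and the normal law around \<open>bh\<close> agree up to \<open>\<phi>\<close>.  Off this ball the
  distance to \<open>bh\<close> is at least \<open>3 * R / 4\<close> and the likelihood at most \<open>exp (- 9 * R\<^sup>2 / 32)\<close>.
  On the ball of radius \<open>r\<close> the distance is at most \<open>R / 2\<close> and the likelihood at least
  \<open>exp (- R\<^sup>2 / 8)\<close>, and the prior density is at least \<open>\<pi> b0 / 2\<close>; this bounds the evidence from
  below.  The quotient of the two exponentials is \<open>exp (- 5 * R\<^sup>2 / 32)\<close>.\<close>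
lemma posterior_normal_approximation:
  fixes \<pi> :: "('i \<Rightarrow> real) \<Rightarrow> real" and b0 bh :: "'i \<Rightarrow> real" and r R \<phi> :: real
  assumes M: "triangular M I" and I: "I \<noteq> {}"
  defines "L \<equiv> Pi\<^sub>M I (\<lambda>_. lborel :: real measure)"
  defines "near_b0 s \<equiv> {b \<in> space L. nrm M I (\<lambda>i. b i - b0 i) \<le> s}"
  defines "lik b \<equiv> exp (- (nrm M I (\<lambda>i. bh i - b i))\<^sup>2 / 2)"
  defines "D \<equiv> (\<integral>b. \<pi> b * lik b \<partial>L)"
  defines "vol \<equiv> (2 * r / sqrt (card I)) ^ card I / (\<Prod>i\<in>I. M i i)"
  assumes \<pi>[measurable]: "\<pi> \<in> borel_measurable L" and \<pi>nn: "\<And>b. b \<in> space L \<Longrightarrow> 0 \<le> \<pi> b"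
    and \<pi>1: "(\<integral>\<^sup>+b. ennreal (\<pi> b) \<partial>L) = 1"
    and b0: "b0 \<in> space L" and r: "0 < r" "r \<le> R / 4"
    and near: "nrm M I (\<lambda>i. bh i - b0 i) \<le> R / 4"
    and \<phi>: "0 \<le> \<phi>" "\<phi> \<le> 1"
    and flat: "\<And>b b'. b \<in> near_b0 R \<Longrightarrow> b' \<in> near_b0 R \<Longrightarrow> (1 - \<phi>) * \<pi> b \<le> \<pi> b'"
    and small: "\<And>b. b \<in> near_b0 r \<Longrightarrow> \<pi> b0 / 2 \<le> \<pi> b" and pos: "0 < \<pi> b0"
    and A[measurable]: "A \<in> sets L"
  shows "\<bar>measure (density L (\<lambda>b. ennreal (\<pi> b * lik b / D))) A
      - measure (gauss_measure M I) {b \<in> space L. (\<lambda>i\<in>I. b i + bh i) \<in> A}\<bar>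
    \<le> \<phi> + 2 * exp (- 5 * R\<^sup>2 / 32) / (\<pi> b0 * vol) + sqrt 2 ^ card I * exp (- 9 * R\<^sup>2 / 64)"
proof -
  note fin = triangular_finite[OF M]
  have R: "0 < R" using r by simp
  have prodpos: "0 < (\<Prod>i\<in>I. M i i)" by (intro prod_pos) (auto simp: triangular_diag_pos[OF M])
  have vol: "0 < vol" using r fin I prodpos by (auto simp: vol_def card_gt_0_iff)
  have lm[measurable]: "lik \<in> borel_measurable L" unfolding lik_def L_def by measurable
  have near_b0m[measurable]: "near_b0 s \<in> sets L" for s
  proof -
    have "near_b0 s = {b \<in> space L. nrm M I (\<lambda>i. b0 i - b i) \<le> s}"
      unfolding near_b0_def using nrm_sym[of M I _ b0] by auto
    moreover have "{b \<in> space L. nrm M I (\<lambda>i. b0 i - b i) \<le> s} \<in> sets L"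
      unfolding L_def by measurable
    ultimately show ?thesis by (simp only:)
  qed
  have lik1: "0 \<le> lik b" "lik b \<le> 1" for b by (auto simp: lik_def)
  define K where "K = gauss_const M I"
  have K: "0 < K" unfolding K_def by (rule gauss_const_pos[OF M])
  define gs where "gs b = gauss M I (\<lambda>i. bh i - b i)" for b
  have gs: "gs b = K * lik b" for b by (simp add: gs_def gauss_nrm[OF fin] K_def lik_def)
  have gsm[measurable]: "gs \<in> borel_measurable L" unfolding gs[abs_def] by measurable
  define \<nu> where "\<nu> = density L (\<lambda>b. ennreal (\<pi> b * lik b))"
  define N where "N = density L (\<lambda>b. ennreal (gs b))"
  define \<Pi>0 where "\<Pi>0 = density L (\<lambda>b. ennreal (\<pi> b))"
  have spc[simp]: "space \<nu> = space L" "space N = space L" "space \<Pi>0 = space L"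
    "sets \<nu> = sets L" "sets N = sets L" "sets \<Pi>0 = sets L"
    by (simp_all add: \<nu>_def N_def \<Pi>0_def)
  have "emeasure \<Pi>0 (space \<Pi>0) = (\<integral>\<^sup>+b. ennreal (\<pi> b) \<partial>L)"
    unfolding \<Pi>0_def by (subst emeasure_density) (auto intro!: nn_integral_cong)
  then interpret P0: prob_space \<Pi>0 using \<pi>1 by (intro prob_spaceI) simp
  have nu_le: "emeasure \<nu> (space L) \<le> 1"
  proof -
    have "emeasure \<nu> (space L) = (\<integral>\<^sup>+b. ennreal (\<pi> b * lik b) \<partial>L)"
      unfolding \<nu>_def by (subst emeasure_density) (auto intro!: nn_integral_cong)
    also have "\<dots> \<le> (\<integral>\<^sup>+b. ennreal (\<pi> b) \<partial>L)"
      using \<pi>nn lik1 by (intro nn_integral_mono ennreal_leI mult_left_le) auto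
    finally show ?thesis using \<pi>1 by simp
  qed
  then interpret nu: finite_measure \<nu>
    by (intro finite_measureI) (auto simp: top_unique)
  \<comment> \<open>The normal law around \<open>bh\<close> is a translate of the centred one.\<close>
  have NT: "emeasure N B = emeasure (gauss_measure M I) {b \<in> space L. (\<lambda>i\<in>I. b i + bh i) \<in> B}"
    if B[measurable]: "B \<in> sets L" for B
  proof -
    have tm[measurable]: "(\<lambda>b. \<lambda>i\<in>I. b i + bh i) \<in> measurable L L"
      unfolding L_def by (rule measurable_restrict) measurable
    have "emeasure N B = (\<integral>\<^sup>+b. ennreal (gs b) * indicator B b \<partial>L)"
      unfolding N_def by (rule emeasure_density) measurable
    also have "\<dots> = (\<integral>\<^sup>+b. ennreal (gs (\<lambda>i\<in>I. b i + bh i)) * indicator B (\<lambda>i\<in>I. b i + bh i) \<partial>L)"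
      unfolding L_def by (rule nn_integral_translate[OF fin]) (simp add: L_def[symmetric])
    also have "\<dots> = (\<integral>\<^sup>+b. ennreal (gauss M I b) * indicator {b \<in> space L. (\<lambda>i\<in>I. b i + bh i) \<in> B} b \<partial>L)"
    proof (rule nn_integral_cong)
      fix b assume b: "b \<in> space L"
      have "nrm M I (\<lambda>i. bh i - (\<lambda>i\<in>I. b i + bh i) i) = nrm M I (\<lambda>i. - b i)"
        by (rule nrm_cong) simp
      then have "gs (\<lambda>i\<in>I. b i + bh i) = gauss M I b"
        unfolding gs_def gauss_nrm[OF fin] by (simp add: nrm_minus)
      then show "ennreal (gs (\<lambda>i\<in>I. b i + bh i)) * indicator B (\<lambda>i\<in>I. b i + bh i)
        = ennreal (gauss M I b) * indicator {b \<in> space L. (\<lambda>i\<in>I. b i + bh i) \<in> B} b"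
        using b by (auto simp: indicator_def)
    qed
    also have "\<dots> = emeasure (gauss_measure M I) {b \<in> space L. (\<lambda>i\<in>I. b i + bh i) \<in> B}"
      unfolding L_def[symmetric]
      by (rule emeasure_density[symmetric]) (simp_all add: L_def[symmetric], simp add: L_def)
    finally show ?thesis .
  qed
  interpret G: prob_space "gauss_measure M I" by (rule prob_space_gauss_measure[OF M])
  have "emeasure N (space N) = 1"
  proof -
    have "{b \<in> space L. (\<lambda>i\<in>I. b i + bh i) \<in> space L} = space (gauss_measure M I)"
      by (auto simp: L_def space_PiM)
    then show ?thesis using NT[of "space L"] G.emeasure_space_1 by simp
  qed
  then interpret N: prob_space N by (rule prob_spaceI)
  have NTm: "measure N B = measure (gauss_measure M I) {b \<in> space L. (\<lambda>i\<in>I. b i + bh i) \<in> B}"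
    if "B \<in> sets L" for B using NT[OF that] by (simp add: measure_def)
  have finN: "finite_measure (density L (\<lambda>b. ennreal (gs b)))"
    and finnu: "finite_measure (density L (\<lambda>b. ennreal (\<pi> b * lik b)))"
    and fin0: "finite_measure (density L (\<lambda>b. ennreal (\<pi> b)))"
    using N.finite_measure_axioms nu.finite_measure_axioms P0.finite_measure_axioms
    by (simp_all add: N_def \<nu>_def \<Pi>0_def)
  \<comment> \<open>Comparing both measures with the infimum \<open>m\<close> of the prior density on the ball makes the
      unknown normalising constants cancel in the quotients below.\<close>
  define m where "m = (INF b\<in>near_b0 R. \<pi> b)"
  have b0R: "b0 \<in> near_b0 R" using b0 R by (simp add: near_b0_def nrm_def lin_def L2_set_def)
  have bdd: "bdd_below (\<pi> ` near_b0 R)" using \<pi>nn by (intro bdd_belowI[of _ 0]) (auto simp: near_b0_def)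
  have m_le: "m \<le> \<pi> b" if "b \<in> near_b0 R" for b unfolding m_def by (rule cINF_lower[OF bdd that])
  have m_ge: "(1 - \<phi>) * \<pi> b \<le> m" if "b \<in> near_b0 R" for b
    unfolding m_def using b0R flat[OF that] by (intro cINF_greatest) auto
  have m0: "0 \<le> m" unfolding m_def using b0R \<pi>nn by (intro cINF_greatest) (auto simp: near_b0_def)
  have c1: "m * measure N B \<le> K * measure \<nu> B" if "B \<in> sets L" "B \<subseteq> near_b0 R" for B
    unfolding N_def \<nu>_def
  proof (rule measure_density_le[OF _ _ that(1) finN finnu])
    fix b assume "b \<in> B"
    then have "m * (K * lik b) \<le> \<pi> b * (K * lik b)" using m_le that(2) K lik1 by (intro mult_right_mono) auto
    then show "m * gs b \<le> K * (\<pi> b * lik b)" by (simp add: gs mult_ac)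
  qed (use m0 K in auto)
  have c2: "((1 - \<phi>) * K) * measure \<nu> (near_b0 R) \<le> m * measure N (near_b0 R)"
    unfolding N_def \<nu>_def
  proof (rule measure_density_le[OF _ _ near_b0m finnu finN])
    fix b assume "b \<in> near_b0 R"
    then have "(1 - \<phi>) * \<pi> b * (K * lik b) \<le> m * (K * lik b)" using m_ge K lik1 by (intro mult_right_mono) auto
    then show "(1 - \<phi>) * K * (\<pi> b * lik b) \<le> m * gs b" by (simp add: gs mult_ac)
  qed (use m0 K \<phi> in auto)
  have ratio: "(1 - \<phi>) * measure N B * measure \<nu> (near_b0 R) \<le> measure \<nu> B * measure N (near_b0 R)"
    if "B \<in> sets L" "B \<subseteq> near_b0 R" for B
  proof -
    have "K * ((1 - \<phi>) * measure N B * measure \<nu> (near_b0 R)) = ((1 - \<phi>) * K * measure \<nu> (near_b0 R)) * measure N B"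
      by (simp add: mult_ac)
    also have "\<dots> \<le> (m * measure N (near_b0 R)) * measure N B" by (intro mult_right_mono c2) simp
    also have "\<dots> = (m * measure N B) * measure N (near_b0 R)" by (simp add: mult_ac)
    also have "\<dots> \<le> (K * measure \<nu> B) * measure N (near_b0 R)" by (intro mult_right_mono c1 that) simp
    finally have "K * ((1 - \<phi>) * measure N B * measure \<nu> (near_b0 R)) \<le> K * (measure \<nu> B * measure N (near_b0 R))"
      by (simp add: mult_ac)
    then show ?thesis using K by simp
  qed
  have far: "3 * R / 4 \<le> nrm M I (\<lambda>i. bh i - b i)" if "b \<in> space L - near_b0 R" for b
    using that nrm_triangle[of M I b b0 bh] near by (auto simp: near_b0_def nrm_sym[of M I b bh])
  have nu_far: "measure \<nu> (space L - near_b0 R) \<le> exp (- 9 * R\<^sup>2 / 32)"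
  proof -
    have "1 * measure \<nu> (space L - near_b0 R) \<le> exp (- 9 * R\<^sup>2 / 32) * measure \<Pi>0 (space L - near_b0 R)"
      unfolding \<nu>_def \<Pi>0_def
    proof (rule measure_density_le[OF _ _ _ finnu fin0])
      fix b assume b: "b \<in> space L - near_b0 R"
      have "(3 * R / 4)\<^sup>2 \<le> (nrm M I (\<lambda>i. bh i - b i))\<^sup>2" using far[OF b] R by (intro power_mono) auto
      then have "lik b \<le> exp (- 9 * R\<^sup>2 / 32)" by (simp add: lik_def power_divide power_mult_distrib)
      then show "1 * (\<pi> b * lik b) \<le> exp (- 9 * R\<^sup>2 / 32) * \<pi> b"
        using b \<pi>nn mult_left_mono[of "lik b" "exp (- 9 * R\<^sup>2 / 32)" "\<pi> b"] by (simp add: mult.commute)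
    qed auto
    also have "\<dots> \<le> exp (- 9 * R\<^sup>2 / 32) * 1" by (intro mult_left_mono P0.prob_le_1) simp
    finally show ?thesis by simp
  qed
  have D: "D = measure \<nu> (space L)"
  proof -
    have "(\<integral>b. \<pi> b * lik b \<partial>L) = enn2real (\<integral>\<^sup>+b. ennreal (\<pi> b * lik b) \<partial>L)"
      using \<pi>nn lik1 by (intro integral_eq_nn_integral) auto
    also have "(\<integral>\<^sup>+b. ennreal (\<pi> b * lik b) \<partial>L) = emeasure \<nu> (space L)"
      unfolding \<nu>_def by (subst emeasure_density) (auto intro!: nn_integral_cong)
    finally show ?thesis by (simp add: D_def measure_def)
  qed
  have D_ge: "\<pi> b0 / 2 * exp (- R\<^sup>2 / 8) * vol \<le> D"
  proof -
    have "ennreal (\<pi> b0 / 2 * exp (- R\<^sup>2 / 8)) * ennreal vol \<le> ennreal (\<pi> b0 / 2 * exp (- R\<^sup>2 / 8)) * emeasure L (near_b0 r)"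
      unfolding vol_def near_b0_def L_def by (intro mult_left_mono ball_volume[OF M I r(1)]) simp
    also have "\<dots> = (\<integral>\<^sup>+b. ennreal (\<pi> b0 / 2 * exp (- R\<^sup>2 / 8)) * indicator (near_b0 r) b \<partial>L)"
      by (simp add: nn_integral_cmult)
    also have "\<dots> \<le> (\<integral>\<^sup>+b. ennreal (\<pi> b * lik b) * indicator (near_b0 r) b \<partial>L)"
    proof (intro nn_integral_mono)
      fix b
      have "\<pi> b0 / 2 * exp (- R\<^sup>2 / 8) \<le> \<pi> b * lik b" if b: "b \<in> near_b0 r"
      proof -
        have "nrm M I (\<lambda>i. bh i - b i) \<le> R / 2"
          using nrm_triangle[of M I bh b b0] b near r by (simp add: near_b0_def nrm_sym[of M I b0 b])
        then have "(nrm M I (\<lambda>i. bh i - b i))\<^sup>2 \<le> (R / 2)\<^sup>2" by (intro power_mono) auto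
        then have "exp (- R\<^sup>2 / 8) \<le> lik b" by (simp add: lik_def power_divide)
        then show ?thesis using small[OF b] pos by (intro mult_mono) auto
      qed
      then show "ennreal (\<pi> b0 / 2 * exp (- R\<^sup>2 / 8)) * indicator (near_b0 r) b
          \<le> ennreal (\<pi> b * lik b) * indicator (near_b0 r) b"
        by (auto simp: indicator_def ennreal_leI)
    qed
    also have "\<dots> = emeasure \<nu> (near_b0 r)" unfolding \<nu>_def by (rule emeasure_density[symmetric]) measurable
    also have "\<dots> \<le> emeasure \<nu> (space L)" by (intro emeasure_mono) (auto simp: near_b0_def)
    also have "\<dots> = ennreal D" by (simp add: D nu.emeasure_eq_measure)
    finally show ?thesis using pos by (simp add: ennreal_mult'[symmetric] D)
  qed
  have c0: "0 < \<pi> b0 / 2 * exp (- R\<^sup>2 / 8) * vol" using pos vol by simp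
  have D0: "0 < D" using c0 D_ge by linarith
  define Po where "Po = density L (\<lambda>b. ennreal (\<pi> b * lik b / D))"
  have Po: "measure Po B = measure \<nu> B / D" if B[measurable]: "B \<in> sets L" for B
  proof -
    have "emeasure Po B = (\<integral>\<^sup>+b. ennreal (1 / D) * (ennreal (\<pi> b * lik b) * indicator B b) \<partial>L)"
      unfolding Po_def using D0
      by (subst emeasure_density) (auto intro!: nn_integral_cong simp: ennreal_mult'[symmetric] mult.assoc[symmetric])
    also have "\<dots> = ennreal (1 / D) * emeasure \<nu> B"
      unfolding \<nu>_def by (simp add: nn_integral_cmult emeasure_density)
    finally show ?thesis using D0 by (simp add: measure_def enn2real_mult)
  qed
  define e1 where "e1 = 2 * exp (- 5 * R\<^sup>2 / 32) / (\<pi> b0 * vol)"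
  define e2 where "e2 = sqrt 2 ^ card I * exp (- 9 * R\<^sup>2 / 64)"
  have PB: "1 - e1 \<le> measure Po (near_b0 R)"
  proof -
    have "measure \<nu> (space L) = measure \<nu> (near_b0 R) + measure \<nu> (space L - near_b0 R)"
      using nu.finite_measure_compl[of "near_b0 R"] near_b0m[of R] by simp
    then have "1 - measure Po (near_b0 R) = measure \<nu> (space L - near_b0 R) / D"
      using D0 by (simp add: Po D field_simps)
    also have "\<dots> \<le> exp (- 9 * R\<^sup>2 / 32) / (\<pi> b0 / 2 * exp (- R\<^sup>2 / 8) * vol)"
      by (intro frac_le nu_far D_ge c0) auto
    also have "\<dots> = 2 * (exp (- 9 * R\<^sup>2 / 32) / exp (- R\<^sup>2 / 8)) / (\<pi> b0 * vol)"
      by (simp add: field_simps)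
    also have "exp (- 9 * R\<^sup>2 / 32) / exp (- R\<^sup>2 / 8) = exp (- 5 * R\<^sup>2 / 32)"
      unfolding exp_diff[symmetric] by (simp add: field_simps)
    finally show ?thesis by (simp add: e1_def)
  qed
  have NB: "1 - e2 \<le> measure N (near_b0 R)"
  proof -
    have "1 - measure N (near_b0 R) = measure N (space L - near_b0 R)"
      using N.prob_compl[of "near_b0 R"] by simp
    also have "\<dots> = measure (gauss_measure M I) {b \<in> space L. (\<lambda>i\<in>I. b i + bh i) \<in> space L - near_b0 R}"
      by (rule NTm) measurable
    also have "\<dots> \<le> measure (gauss_measure M I) {b \<in> space (Pi\<^sub>M I (\<lambda>_. lborel)). 3 * R / 4 \<le> nrm M I b}"
    proof (rule G.finite_measure_mono)
      show "{b \<in> space L. (\<lambda>i\<in>I. b i + bh i) \<in> space L - near_b0 R}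
          \<subseteq> {b \<in> space (Pi\<^sub>M I (\<lambda>_. lborel)). 3 * R / 4 \<le> nrm M I b}"
      proof safe
        fix b assume b: "b \<in> space L" "(\<lambda>i\<in>I. b i + bh i) \<in> space L" "(\<lambda>i\<in>I. b i + bh i) \<notin> near_b0 R"
        then show "b \<in> space (Pi\<^sub>M I (\<lambda>_. lborel))" by (simp add: L_def)
        have "nrm M I (\<lambda>i. bh i - (\<lambda>i\<in>I. b i + bh i) i) = nrm M I (\<lambda>i. - b i)"
          by (rule nrm_cong) simp
        then show "3 * R / 4 \<le> nrm M I b"
          using far[of "\<lambda>i\<in>I. b i + bh i"] b by (simp add: nrm_minus)
      qed
    qed measurable
    also have "\<dots> \<le> e2"
      unfolding e2_def using gauss_tail_le[OF M, of "3 * R / 4"] R by (simp add: power_divide power_mult_distrib)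
    finally show ?thesis by simp
  qed
  have lower: "measure N B - (\<phi> + e1 + e2) \<le> measure Po B" if B[measurable]: "B \<in> sets L" for B
  proof (rule one_sided_tv)
    show "(1 - \<phi>) * measure N (B \<inter> near_b0 R) * measure Po (near_b0 R) \<le> measure Po (B \<inter> near_b0 R) * measure N (near_b0 R)"
      using divide_right_mono[OF ratio[of "B \<inter> near_b0 R"], of D] D0 by (simp add: Po)
    show "measure Po (B \<inter> near_b0 R) \<le> measure Po B"
      using D0 nu.finite_measure_mono[of "B \<inter> near_b0 R" B] by (simp add: Po divide_right_mono)
    have "measure N B = measure N (B \<inter> near_b0 R) + measure N (B - near_b0 R)"
      by (subst N.finite_measure_Union[symmetric]) (auto intro!: arg_cong[of _ _ "measure N"])
    moreover have "measure N (B - near_b0 R) \<le> measure N (space N - near_b0 R)"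
      using sets.sets_into_space[OF B] by (intro N.finite_measure_mono) auto
    moreover have "measure N (space N - near_b0 R) = 1 - measure N (near_b0 R)" by (rule N.prob_compl) simp
    ultimately show "measure N B - e2 \<le> measure N (B \<inter> near_b0 R)" using NB by linarith
    show "measure Po (near_b0 R) \<le> 1"
      using D0 nu.finite_measure_mono[of "near_b0 R" "space L"] sets.sets_into_space[OF near_b0m[of R]]
      by (simp add: Po D)
  qed (use \<phi> PB in auto)
  \<comment> \<open>The upper bound for \<open>A\<close> is the lower bound for its complement.\<close>
  have "measure Po (space L - A) = 1 - measure Po A"
    using D0 nu.finite_measure_compl[of A] by (simp add: Po D diff_divide_distrib)
  moreover have "measure N (space L - A) = 1 - measure N A" using N.prob_compl[of A] by simp
  ultimately have "measure Po A \<le> measure N A + (\<phi> + e1 + e2)" using lower[of "space L - A"] by simp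
  then have "\<bar>measure Po A - measure N A\<bar> \<le> \<phi> + e1 + e2" using lower[OF A] by linarith
  then show ?thesis by (simp add: Po_def NTm e1_def e2_def)
qed

section \<open>Wavelet indices\<close>

lemma idx_inf_iff: "1 \<le> J0 \<Longrightarrow> (l, k) \<in> idx_inf J0 \<longleftrightarrow> J0 \<le> l \<and> k < 2 ^ l \<or> l = J0 - 1 \<and> k < 2 ^ J0"
  unfolding idx_inf_def idx_def by (auto intro: exI[of _ "Suc l"] exI[of _ J0])

lemma idx_subset_idx_inf: "J0 \<le> J \<Longrightarrow> idx J0 J \<subseteq> idx_inf J0"
  unfolding idx_inf_def by auto

lemma finite_idx: "finite (idx J0 J)"
proof -
  have "idx J0 J \<subseteq> {..<J} \<times> {..<2 ^ J} \<union> {J0 - 1} \<times> {..<2 ^ J0}"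
  proof
    fix i assume i: "i \<in> idx J0 J"
    have "k < 2 ^ J" if "k < 2 ^ l" "l < J" for k l :: nat
      using that(1) power_strict_increasing[OF that(2), of "2::nat"] by linarith
    then show "i \<in> {..<J} \<times> {..<2 ^ J} \<union> {J0 - 1} \<times> {..<2 ^ J0}"
      using i by (auto simp: idx_def)
  qed
  then show ?thesis by (rule finite_subset) auto
qed

lemma card_idx: "1 \<le> J0 \<Longrightarrow> J0 \<le> J \<Longrightarrow> card (idx J0 J) = 2 ^ J"
  using bij_betw_same_card[OF bij_betw_enum_idx] by simp

section \<open>Uniform bounds for wavelet series\<close>

lemma Ck_smooth_continuous: "Ck_smooth S f \<Longrightarrow> 1 \<le> S \<Longrightarrow> continuous_on UNIV f"
proof -
  assume "Ck_smooth S f" "1 \<le> S"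
  then have "(deriv ^^ 0) f field_differentiable at x" for x
    unfolding Ck_smooth_def by (auto dest!: spec[of _ "0::nat"])
  then show ?thesis
    by (auto intro!: continuous_at_imp_continuous_on field_differentiable_imp_continuous_at)
qed

lemma bounded_right_of:
  fixes f :: "real \<Rightarrow> real"
  assumes "continuous_on UNIV f" "\<exists>b. \<forall>y>b. f y = 0"
  shows "\<exists>B\<ge>0. \<forall>y\<ge>a. \<bar>f y\<bar> \<le> B"
proof -
  obtain b where b: "\<And>y. b < y \<Longrightarrow> f y = 0" using assms(2) by auto
  have "compact (f ` {a..b})"
    by (rule compact_continuous_image) (use assms(1) continuous_on_subset in \<open>auto\<close>)
  then obtain B where B: "\<And>y. y \<in> {a..b} \<Longrightarrow> \<bar>f y\<bar> \<le> B"
    using compact_imp_bounded bounded_iff by (metis (no_types, lifting) imageI real_norm_def)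
  have "\<forall>y\<ge>a. \<bar>f y\<bar> \<le> max 0 B"
  proof (intro allI impI)
    fix y assume "a \<le> y" then show "\<bar>f y\<bar> \<le> max 0 B"
      using B[of y] b[of y] by (cases "y \<le> b") auto
  qed
  then show ?thesis by (intro exI[of _ "max 0 B"]) auto
qed

lemma finite_common_bound:
  fixes F :: "(real \<Rightarrow> real) set"
  assumes "finite F" "\<And>f. f \<in> F \<Longrightarrow> \<exists>B\<ge>0. \<forall>y\<ge>a. \<bar>f y\<bar> \<le> B"
  shows "\<exists>B\<ge>0. \<forall>f\<in>F. \<forall>y\<ge>a. \<bar>f y\<bar> \<le> B"
  using assms
proof (induction F)
  case (insert f F)
  then obtain B1 B2 where "0 \<le> B1" "\<forall>f\<in>F. \<forall>y\<ge>a. \<bar>f y\<bar> \<le> B1" "0 \<le> B2" "\<forall>y\<ge>a. \<bar>f y\<bar> \<le> B2" by blast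
  then show ?case by (intro exI[of _ "max B1 B2"]) (auto simp: le_max_iff_disj)
qed (auto intro: exI[of _ 0])

lemma card_translates:
  fixes y :: real
  shows "card {k \<in> A. y - real N \<le> real k \<and> real k \<le> y + real N - 1} \<le> 2 * N"
proof -
  let ?S = "{k \<in> A. y - real N \<le> real k \<and> real k \<le> y + real N - 1}"
  have sub: "int ` ?S \<subseteq> {\<lceil>y - real N\<rceil>..\<lfloor>y + real N - 1\<rfloor>}"
  proof clarify
    fix k assume k: "y - real N \<le> real k" "real k \<le> y + real N - 1"
    have "\<lceil>y - real N\<rceil> \<le> int k" using k(1) by (intro ceiling_le) simp
    moreover have "int k \<le> \<lfloor>y + real N - 1\<rfloor>" using k(2) unfolding le_floor_iff by simp
    ultimately show "int k \<in> {\<lceil>y - real N\<rceil>..\<lfloor>y + real N - 1\<rfloor>}" by (simp only: atLeastAtMost_iff)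
  qed
  have "card ?S = card (int ` ?S)" by (simp add: card_image)
  also have "\<dots> \<le> card {\<lceil>y - real N\<rceil>..\<lfloor>y + real N - 1\<rfloor>}" by (rule card_mono[OF _ sub]) simp
  also have "\<dots> = nat (\<lfloor>y + real N - 1\<rfloor> - \<lceil>y - real N\<rceil> + 1)" by simp
  also have "\<dots> \<le> 2 * N"
  proof -
    have "real_of_int \<lfloor>y + real N - 1\<rfloor> - real_of_int \<lceil>y - real N\<rceil> \<le> 2 * real N - 1"
      using of_int_floor_le[of "y + real N - 1"] le_of_int_ceiling[of "y - real N"] by linarith
    then have "real_of_int (\<lfloor>y + real N - 1\<rfloor> - \<lceil>y - real N\<rceil>) \<le> real_of_int (2 * int N - 1)"
      by (simp only: of_int_diff of_int_mult of_int_numeral of_int_of_nat_eq of_int_1)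
    then have "\<lfloor>y + real N - 1\<rfloor> - \<lceil>y - real N\<rceil> \<le> 2 * int N - 1" by linarith
    then show ?thesis by linarith
  qed
  finally show ?thesis .
qed

text \<open>At a given point at most \<open>2 * N\<close> interior translates do not vanish, and there are \<open>2 * N\<close>
  edge functions.\<close>
lemma interval_system_bound:
  assumes g: "\<And>x. x \<notin> {1 - real N..real N} \<Longrightarrow> g x = 0" and gB: "\<And>y. 1 - real N \<le> y \<Longrightarrow> \<bar>g y\<bar> \<le> B"
    and edge: "\<And>k y. k < N \<Longrightarrow> 0 \<le> y \<Longrightarrow> \<bar>gL k y\<bar> \<le> B \<and> \<bar>gR k y\<bar> \<le> B"
    and x: "x \<in> {0..1}" and B: "0 \<le> B" and N: "2 * N \<le> 2 ^ j"
  shows "(\<Sum>k<2 ^ j. \<bar>interval_system N g gL gR j k x\<bar>) \<le> 4 * real N * B * 2 powr (real j / 2)"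
proof -
  define y where "y = 2 ^ j * x"
  define E1 where "E1 = {..<N}"
  define E2 where "E2 = {2 ^ j - N..<2 ^ j}"
  define E3 where "E3 = {k \<in> {..<2 ^ j}. y - real N \<le> real k \<and> real k \<le> y + real N - 1}"
  have fin: "finite E1" "finite E2" "finite E3" by (auto simp: E1_def E2_def E3_def)
  have bd: "\<bar>interval_system N g gL gR j k x\<bar>
      \<le> 2 powr (real j / 2) * (B * (indicator E1 k + indicator E2 k + indicator E3 k))"
    if k: "k < 2 ^ j" for k
  proof -
    have pw: "0 \<le> 2 powr (real j / 2)" by simp
    consider "k < N" | "N \<le> k" "k < 2 ^ j - N" | "N \<le> k" "2 ^ j - N \<le> k" by linarith
    then have "\<bar>if k < N then gL k (2 ^ j * x)
        else if k < 2 ^ j - N then g (2 ^ j * x - real k)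
        else gR (2 ^ j - 1 - k) (2 ^ j * (1 - x))\<bar> \<le> B * (indicator E1 k + indicator E2 k + indicator E3 k)"
    proof cases
      case 1
      then have "\<bar>gL k (2 ^ j * x)\<bar> \<le> B" using edge x by auto
      also have "B \<le> B * (indicator E1 k + indicator E2 k + indicator E3 k)"
        using 1 B by (auto simp: E1_def indicator_def)
      finally show ?thesis using 1 by simp
    next
      case 2
      show ?thesis
      proof (cases "2 ^ j * x - real k \<in> {1 - real N..real N}")
        case True
        then have "k \<in> E3" using k by (auto simp: E3_def y_def)
        then have "B \<le> B * (indicator E1 k + indicator E2 k + indicator E3 k)"
          using B by (auto simp: indicator_def)
        moreover have "\<bar>g (2 ^ j * x - real k)\<bar> \<le> B" using True gB by auto
        ultimately show ?thesis using 2 by simp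
      next
        case False
        then show ?thesis using 2 g B by simp
      qed
    next
      case 3
      have "2 ^ j - 1 - k < N" using 3 k N by linarith
      then have "\<bar>gR (2 ^ j - 1 - k) (2 ^ j * (1 - x))\<bar> \<le> B" using edge x by auto
      also have "B \<le> B * (indicator E1 k + indicator E2 k + indicator E3 k)"
        using 3 B k by (auto simp: E2_def indicator_def)
      finally show ?thesis using 3 by simp
    qed
    then show ?thesis unfolding interval_system_def abs_mult
      using mult_left_mono[OF _ pw] by simp
  qed
  have ind: "(\<Sum>k<2 ^ j. indicator E k :: real) \<le> real m" if "finite E" "card E \<le> m" for E :: "nat set" and m :: nat
  proof -
    have "(\<Sum>k<2 ^ j. indicator E k :: real) = real (card ({..<2 ^ j} \<inter> E))"
      by (simp add: indicator_def sum.If_cases Int_def)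
    also have "card ({..<2 ^ j} \<inter> E) \<le> m" using that card_mono[of E "{..<2 ^ j} \<inter> E"] by force
    finally show ?thesis by simp
  qed
  have lin3: "(\<Sum>k\<in>A. c * (B * (f k + g k + h k))) = c * (B * (sum f A + sum g A + sum h A))"
    for A and c :: real and f g h :: "nat \<Rightarrow> real"
    by (simp add: sum_distrib_left distrib_left sum.distrib)
  have "(\<Sum>k<2 ^ j. \<bar>interval_system N g gL gR j k x\<bar>)
      \<le> (\<Sum>k<2 ^ j. 2 powr (real j / 2) * (B * (indicator E1 k + indicator E2 k + indicator E3 k)))"
    by (intro sum_mono bd) simp
  also have "\<dots> = 2 powr (real j / 2) * (B * ((\<Sum>k<2 ^ j. indicator E1 k) + (\<Sum>k<2 ^ j. indicator E2 k) + (\<Sum>k<2 ^ j. indicator E3 k)))"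
    by (rule lin3)
  also have "\<dots> \<le> 2 powr (real j / 2) * (B * (real N + real N + real (2 * N)))"
    using B card_translates[of "{..<2 ^ j}" y N] fin
    by (intro mult_left_mono add_mono ind) (auto simp: E1_def E2_def E3_def)
  finally show ?thesis by (simp add: algebra_simps)
qed

text \<open>The exponent belongs to the level after \<open>l\<close> because level \<open>J0 - 1\<close> holds the scaling
  functions of resolution \<open>J0\<close>.\<close>
lemma cdv_level_bound:
  assumes cdv: "cdv_wavelet_basis S J0 \<psi>" and S: "1 \<le> S"
  shows "\<exists>C>0. \<forall>x\<in>{0..1}. \<forall>l. (\<Sum>k | (l, k) \<in> idx_inf J0. \<bar>\<psi> (l, k) x\<bar>) \<le> C * 2 powr (real (Suc l) / 2)"
proof -
  obtain N p q pL pR qL qR where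
    J0: "2 \<le> J0" "S \<le> N" "2 * N \<le> 2 ^ J0"
    and pair: "daubechies_pair N p q" and sm: "Ck_smooth S p" "Ck_smooth S q"
    and edge: "\<And>k g. k < N \<Longrightarrow> g \<in> {pL k, pR k, qL k, qR k} \<Longrightarrow> Ck_smooth S g \<and> (\<exists>A. \<forall>y>A. g y = 0)"
    and \<phi>: "\<And>k. k < 2 ^ J0 \<Longrightarrow> \<psi> (J0 - 1, k) = interval_system N p pL pR J0 k"
    and \<psi>: "\<And>l k. J0 \<le> l \<Longrightarrow> k < 2 ^ l \<Longrightarrow> \<psi> (l, k) = interval_system N q qL qR l k"
    using cdv unfolding cdv_wavelet_basis_def
    apply (elim exE conjE)
    subgoal for N p q pL pR qL qR by (rule that[of N p q pL pR qL qR]) auto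
    done
  have pq0: "\<And>x. x \<notin> {1 - real N..real N} \<Longrightarrow> p x = 0 \<and> q x = 0"
    using pair unfolding daubechies_pair_def by auto
  define F where "F = {p, q} \<union> (\<Union>k<N. {pL k, pR k, qL k, qR k})"
  have "\<exists>B\<ge>0. \<forall>y\<ge>1 - real N. \<bar>f y\<bar> \<le> B" if "f \<in> F" for f
  proof (rule bounded_right_of)
    have "Ck_smooth S f" using that sm edge unfolding F_def by blast
    then show "continuous_on UNIV f" using S by (rule Ck_smooth_continuous)
    have "\<forall>y>real N. p y = 0 \<and> q y = 0" using pq0 by auto
    then show "\<exists>b. \<forall>y>b. f y = 0" using that edge unfolding F_def by blast
  qed
  then obtain B where B: "0 \<le> B" "\<forall>f\<in>F. \<forall>y\<ge>1 - real N. \<bar>f y\<bar> \<le> B"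
    using finite_common_bound[of F "1 - real N"] by (auto simp: F_def)
  have N: "1 \<le> N" using J0 S by simp
  have eB: "\<bar>f y\<bar> \<le> B" if "f \<in> F" "0 \<le> y" for f y using B(2) that N by auto
  define C where "C = 4 * real N * B + 1"
  have C: "0 < C" using B N by (simp add: C_def add_nonneg_pos)
  have fin: "finite {k. (l, k) \<in> idx_inf J0}" for l
    using J0 by (auto simp: idx_inf_iff)
  have le: "(\<Sum>k<2 ^ j. \<bar>interval_system N g gL gR j k x\<bar>) \<le> C * 2 powr (real j / 2)"
    if x01: "x \<in> {0..1}" and j: "J0 \<le> j" and trip: "(g, gL, gR) \<in> {(p, pL, pR), (q, qL, qR)}" for x j g gL gR
  proof -
    have "2 * N \<le> 2 ^ j" using J0(3) power_increasing[OF j, of "2::nat"] by linarith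
    moreover have "g x = 0" if "x \<notin> {1 - real N..real N}" for x using trip pq0[OF that] by auto
    moreover have "\<bar>g y\<bar> \<le> B" if "1 - real N \<le> y" for y using trip B(2) that by (auto simp: F_def)
    moreover have "\<bar>gL k y\<bar> \<le> B \<and> \<bar>gR k y\<bar> \<le> B" if "k < N" "0 \<le> y" for k y
    proof -
      have "gL k \<in> F" "gR k \<in> F" using trip that(1) unfolding F_def by auto
      then show ?thesis using eB that(2) by simp
    qed
    ultimately have "(\<Sum>k<2 ^ j. \<bar>interval_system N g gL gR j k x\<bar>) \<le> 4 * real N * B * 2 powr (real j / 2)"
      using x01 B(1) by (intro interval_system_bound) auto
    also have "\<dots> \<le> C * 2 powr (real j / 2)" by (intro mult_right_mono) (auto simp: C_def)
    finally show ?thesis .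
  qed
  have "(\<Sum>k | (l, k) \<in> idx_inf J0. \<bar>\<psi> (l, k) x\<bar>) \<le> C * 2 powr (real (Suc l) / 2)" if x: "x \<in> {0..1}" for x l
  proof -
    consider "J0 \<le> l" | "l = J0 - 1" | "l < J0 - 1" by linarith
    then show ?thesis
    proof cases
      case 1
      then have "{k. (l, k) \<in> idx_inf J0} = {..<2 ^ l}" using J0 by (auto simp: idx_inf_iff)
      then have "(\<Sum>k | (l, k) \<in> idx_inf J0. \<bar>\<psi> (l, k) x\<bar>) = (\<Sum>k<2 ^ l. \<bar>interval_system N q qL qR l k x\<bar>)"
        using \<psi>[OF 1] by simp
      also have "\<dots> \<le> C * 2 powr (real l / 2)" by (rule le[OF x 1]) simp
      also have "\<dots> \<le> C * 2 powr (real (Suc l) / 2)" using C by (intro mult_left_mono powr_mono) auto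
      finally show ?thesis .
    next
      case 2
      then have "{k. (l, k) \<in> idx_inf J0} = {..<2 ^ J0}" "Suc l = J0" using J0 by (auto simp: idx_inf_iff)
      then have "(\<Sum>k | (l, k) \<in> idx_inf J0. \<bar>\<psi> (l, k) x\<bar>) = (\<Sum>k<2 ^ J0. \<bar>interval_system N p pL pR J0 k x\<bar>)"
        using \<phi> 2 by simp
      also have "\<dots> \<le> C * 2 powr (real (Suc l) / 2)" unfolding \<open>Suc l = J0\<close> by (rule le[OF x]) auto
      finally show ?thesis .
    next
      case 3
      then have "{k. (l, k) \<in> idx_inf J0} = {}" using J0 by (auto simp: idx_inf_iff)
      then show ?thesis using C by simp
    qed
  qed
  then show ?thesis using C by blast
qed

text \<open>The series converges uniformly, to a bounded function with the same coefficients as \<open>d\<close>;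
  by completeness this function equals \<open>d\<close> almost everywhere.\<close>
lemma orthonormal_series_bound:
  assumes onb: "orthonormal_basis_on (idx_inf J0) \<psi>" and J0: "1 \<le> J0"
    and lev: "\<And>x l. x \<in> {0..1} \<Longrightarrow> (\<Sum>k | (l, k) \<in> idx_inf J0. \<bar>\<psi> (l, k) x\<bar>) \<le> c l"
    and d: "d \<in> L2" and coef: "\<And>l k. (l, k) \<in> idx_inf J0 \<Longrightarrow> \<bar>ip d (\<psi> (l, k))\<bar> \<le> \<beta> l"
    and sum: "summable (\<lambda>l. \<beta> l * c l)" and \<beta>: "\<And>l. 0 \<le> \<beta> l"
  shows "AE x in unit_leb. \<bar>d x\<bar> \<le> (\<Sum>l. \<beta> l * c l)"
proof -
  define K where "K l = {k. (l, k) \<in> idx_inf J0}" for l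
  have fin: "finite (K l)" for l using J0 by (auto simp: K_def idx_inf_iff)
  define t where "t l x = (\<Sum>k\<in>K l. ip d (\<psi> (l, k)) * \<psi> (l, k) x)" for l x
  define T where "T = (\<Sum>l. \<beta> l * c l)"
  have \<psi>L: "\<psi> i \<in> L2" if "i \<in> idx_inf J0" for i using onb that by (simp add: orthonormal_basis_on_def)
  have \<psi>o: "ip (\<psi> i) (\<psi> j) = (if i = j then 1 else 0)" if "i \<in> idx_inf J0" "j \<in> idx_inf J0" for i j
    using onb that by (simp add: orthonormal_basis_on_def)
  have tb: "\<bar>t l x\<bar> \<le> \<beta> l * c l" if x: "x \<in> {0..1}" for l x
  proof -
    have "\<bar>t l x\<bar> \<le> (\<Sum>k\<in>K l. \<bar>ip d (\<psi> (l, k)) * \<psi> (l, k) x\<bar>)" unfolding t_def by (rule sum_abs)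
    also have "\<dots> \<le> (\<Sum>k\<in>K l. \<beta> l * \<bar>\<psi> (l, k) x\<bar>)"
      unfolding abs_mult by (intro sum_mono mult_right_mono coef) (auto simp: K_def)
    also have "\<dots> \<le> \<beta> l * c l"
      using lev[OF x, of l] \<beta>[of l] unfolding sum_distrib_left[symmetric] K_def by (intro mult_left_mono)
    finally show ?thesis .
  qed
  have tsum: "summable (\<lambda>l. t l x)" if "x \<in> {0..1}" for x
    by (rule summable_comparison_test'[OF sum, of 0]) (use tb[OF that] in simp)
  define G where "G m x = (\<Sum>l<m. t l x)" for m x
  define g where "g x = (if x \<in> {0..1} then \<Sum>l. t l x else 0)" for x
  have Gg: "(\<lambda>m. G m x) \<longlonglongrightarrow> g x" if "x \<in> {0..1}" for x
    unfolding G_def g_def using summable_LIMSEQ[OF tsum[OF that]] that by simp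
  have T0: "0 \<le> T" unfolding T_def
  proof (rule suminf_nonneg[OF sum])
    fix l show "0 \<le> \<beta> l * c l" using tb[of 0 l] by (smt (verit) atLeastAtMost_iff)
  qed
  have GT: "\<bar>G m x\<bar> \<le> T" if x: "x \<in> {0..1}" for m x
  proof -
    have "\<bar>G m x\<bar> \<le> (\<Sum>l<m. \<beta> l * c l)"
      unfolding G_def using tb[OF x] by (intro order_trans[OF sum_abs] sum_mono)
    also have "\<dots> \<le> T" unfolding T_def
      by (rule sum_le_suminf[OF sum]) (use tb[OF x] in \<open>auto intro: order_trans[OF abs_ge_zero]\<close>)
    finally show ?thesis .
  qed
  have gT: "\<bar>g x\<bar> \<le> T" if x: "x \<in> {0..1}" for x
    using LIMSEQ_le_const2[OF tendsto_rabs[OF Gg[OF x]]] GT[OF x] by blast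
  have tL: "t l \<in> L2" for l
    unfolding t_def[abs_def] using fin \<psi>L by (intro L2_sum) (auto simp: K_def)
  have GL: "G m \<in> L2" for m
    unfolding G_def[abs_def] using L2_sum[of "{..<m}" t "\<lambda>_. 1"] tL by simp
  have gm: "g \<in> borel_measurable unit_leb"
  proof (rule borel_measurable_LIMSEQ_real)
    show "G m \<in> borel_measurable unit_leb" for m using GL by (simp add: L2_def)
    show "(\<lambda>m. G m x) \<longlonglongrightarrow> g x" if "x \<in> space unit_leb" for x using Gg that by simp
  qed
  have finm: "finite_measure unit_leb" by (intro finite_measureI) (simp add: emeasure_restrict_space)
  have bint: "integrable unit_leb h" if "h \<in> borel_measurable unit_leb" "\<And>x. x \<in> {0..1} \<Longrightarrow> \<bar>h x\<bar> \<le> b" for h :: "real \<Rightarrow> real" and b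
    using that by (intro finite_measure.integrable_const_bound[OF finm, of _ b]) (auto intro!: AE_I2)
  have gL: "g \<in> L2" unfolding L2_def
  proof (intro CollectI conjI gm bint)
    show "(\<lambda>x. (g x)\<^sup>2) \<in> borel_measurable unit_leb" using gm by measurable
    show "\<bar>(g x)\<^sup>2\<bar> \<le> T\<^sup>2" if "x \<in> {0..1}" for x using gT[OF that] T0 by (simp add: abs_le_square_iff[symmetric])
  qed
  have one: "(\<lambda>_. 1) \<in> L2" unfolding L2_def by (auto intro!: bint)
  have ipg: "ip g (\<psi> i) = ip d (\<psi> i)" if i: "i \<in> idx_inf J0" for i
  proof -
    obtain l0 k0 where i0: "i = (l0, k0)" by force
    have ipt: "ip (t l) (\<psi> i) = (if l = l0 then ip d (\<psi> i) else 0)" for l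
    proof -
      have "ip (t l) (\<psi> i) = (\<Sum>k\<in>K l. ip d (\<psi> (l, k)) * ip (\<psi> (l, k)) (\<psi> i))"
        unfolding t_def[abs_def] using fin \<psi>L i by (intro ip_sum) (auto simp: K_def)
      also have "\<dots> = (\<Sum>k\<in>K l. if k = k0 then (if l = l0 then ip d (\<psi> i) else 0) else 0)"
        using i by (intro sum.cong refl) (auto simp: \<psi>o K_def i0)
      also have "\<dots> = (if l = l0 then ip d (\<psi> i) else 0)"
        using fin[of l] i by (auto simp: K_def i0)
      finally show ?thesis .
    qed
    have "ip (G m) (\<psi> i) = (\<Sum>l<m. ip (t l) (\<psi> i))" for m
      unfolding G_def[abs_def] using ip_sum[of "{..<m}" t "\<psi> i" "\<lambda>_. 1"] tL \<psi>L[OF i] by simp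
    then have ipG: "ip (G m) (\<psi> i) = ip d (\<psi> i)" if "l0 < m" for m using that by (simp add: ipt)
    have "(\<lambda>m. ip (G m) (\<psi> i)) \<longlonglongrightarrow> ip g (\<psi> i)"
      unfolding ip_def
    proof (rule integral_dominated_convergence[where w = "\<lambda>x. T * \<bar>\<psi> i x\<bar>"])
      show "integrable unit_leb (\<lambda>x. T * \<bar>\<psi> i x\<bar>)"
        using L2_prod_integrable[OF one \<psi>L[OF i]] by (intro integrable_mult_right integrable_abs) simp
      show "AE x in unit_leb. (\<lambda>m. G m x * \<psi> i x) \<longlonglongrightarrow> g x * \<psi> i x"
        using Gg by (intro AE_I2 tendsto_mult_right) simp
      show "AE x in unit_leb. norm (G m x * \<psi> i x) \<le> T * \<bar>\<psi> i x\<bar>" for m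
        using GT by (intro AE_I2) (simp add: abs_mult mult_right_mono)
    qed (use gm GL \<psi>L[OF i] in \<open>auto simp: L2_def intro!: borel_measurable_times\<close>)
    moreover have "(\<lambda>m. ip (G m) (\<psi> i)) \<longlonglongrightarrow> ip d (\<psi> i)"
      by (rule tendsto_eventually, rule eventually_mono[OF eventually_gt_at_top[of l0]]) (rule ipG)
    ultimately show ?thesis by (rule LIMSEQ_unique)
  qed
  have dg: "(\<lambda>x. d x - g x) \<in> L2" by (rule L2_diff[OF d gL])
  have "\<forall>i\<in>idx_inf J0. ip (\<lambda>x. d x - g x) (\<psi> i) = 0"
    using ipg \<psi>L by (simp add: ip_diff[OF d gL])
  then have "L2norm (\<lambda>x. d x - g x) = 0" using onb dg unfolding orthonormal_basis_on_def by blast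
  then have "(\<integral>x. (d x - g x) * (d x - g x) \<partial>unit_leb) = 0" by (simp add: L2norm_def ip_def)
  then have "AE x in unit_leb. (d x - g x) * (d x - g x) = 0"
    by (subst (asm) integral_nonneg_eq_0_iff_AE) (use L2_prod_integrable[OF dg dg] in auto)
  then show ?thesis
  proof (rule AE_mp, intro AE_I2 impI)
    fix x assume "x \<in> space unit_leb" "(d x - g x) * (d x - g x) = 0"
    then show "\<bar>d x\<bar> \<le> (\<Sum>l. \<beta> l * c l)" using gT[of x] by (simp add: T_def)
  qed
qed

lemma Linf_norm_le:
  assumes "d \<in> L2" "AE x in unit_leb. \<bar>d x\<bar> \<le> T" shows "Linf_norm d \<le> ereal T"
  unfolding Linf_norm_def
  by (rule esssup_I) (use assms in \<open>auto simp: L2_def\<close>)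

section \<open>Coverage of a random quantile\<close>

context real_distribution
begin

text \<open>The set is a half-line bounded by a quantile, open or closed according to the value of
  the distribution function there.\<close>
lemma prob_cdf_le:
  assumes "0 \<le> c" shows "measure M {t. cdf M t \<le> c} \<le> c"
proof (cases "{r. cdf M r \<le> c} = {}")
  case True then show ?thesis using assms by (simp only: measure_empty)
next
  case False
  define S where "S = {r. cdf M r \<le> c}"
  show ?thesis
  proof (cases "bdd_above S")
    case unb: False
    have "cdf M x \<le> c" for x
    proof -
      obtain r where "r \<in> S" "x < r" using unb by (meson bdd_above.I not_le_imp_less)
      then show ?thesis using cdf_nondecreasing[of x r] by (simp add: S_def)
    qed
    then have "1 \<le> c"
      by (intro tendsto_upperbound[OF cdf_lim_at_top_prob]) auto
    then show ?thesis using prob_le_1 order_trans by blast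
  next
    case bdd: True
    define s where "s = Sup S"
    have le: "r \<le> s" if "r \<in> S" for r unfolding s_def using that bdd by (rule cSup_upper)
    show ?thesis
    proof (cases "cdf M s \<le> c")
      case True
      have "measure M S \<le> measure M {..s}" by (rule finite_measure_mono) (use le in auto)
      then show ?thesis using True by (simp add: S_def cdf_def2)
    next
      case notS: False
      have "measure M S \<le> measure M {..<s}"
        by (rule finite_measure_mono) (use le notS in \<open>force simp: S_def less_le\<close>, simp)
      also have "\<dots> \<le> c"
      proof (rule tendsto_upperbound[OF cdf_at_left])
        have "cdf M x \<le> c" if xs: "x < s" for x
        proof -
          obtain r where "r \<in> S" "x < r" using xs False bdd unfolding s_def
            by (subst (asm) less_cSup_iff) (auto simp: S_def)
          then show ?thesis using cdf_nondecreasing[of x r] by (simp add: S_def)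
        qed
        then show "eventually (\<lambda>x. cdf M x \<le> c) (at_left s)"
          by (auto simp: eventually_at_filter)
      qed simp
      finally show ?thesis by (simp add: S_def)
    qed
  qed
qed

text \<open>By right continuity, the lower quantile of order \<open>c\<close> is attained, and the open half-line
  above it has mass at most \<open>1 - c\<close>.\<close>
lemma prob_above_quantile:
  assumes "c \<le> 1"
  shows "\<exists>B\<in>sets borel. {t. \<exists>r<t. c \<le> cdf M r} \<subseteq> B \<and> measure M B \<le> 1 - c"
proof -
  define S where "S = {r. c \<le> cdf M r}"
  consider "c \<le> 0" | "0 < c" "S = {}" | "0 < c" "S \<noteq> {}" by linarith
  then show ?thesis
  proof cases
    case 1
    then show ?thesis by (intro bexI[of _ UNIV] conjI order_trans[OF prob_le_1]) auto
  next
    case 2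
    then show ?thesis using assms by (intro bexI[of _ "{}"]) (auto simp: S_def)
  next
    case 3
    have bdd: "bdd_below S"
    proof (rule ccontr)
      assume unb: "\<not> bdd_below S"
      have "c \<le> cdf M x" for x
      proof -
        obtain r where "r \<in> S" "r < x" using unb by (meson bdd_below.I not_le_imp_less)
        then show ?thesis using cdf_nondecreasing[of r x] by (simp add: S_def)
      qed
      then have "c \<le> 0" by (intro tendsto_lowerbound[OF cdf_lim_at_bot]) auto
      then show False using 3 by simp
    qed
    define s where "s = Inf S"
    have "c \<le> cdf M s"
    proof (rule tendsto_lowerbound)
      show "(cdf M \<longlongrightarrow> cdf M s) (at_right s)"
        using cdf_is_right_cont[of s] by (simp add: continuous_within)
      have "c \<le> cdf M x" if sx: "s < x" for x
      proof -
        obtain r where "r \<in> S" "r < x" using sx 3(2) bdd unfolding s_def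
          by (subst (asm) cInf_less_iff) auto
        then show ?thesis using cdf_nondecreasing[of r x] by (simp add: S_def)
      qed
      then show "eventually (\<lambda>x. c \<le> cdf M x) (at_right s)" by (auto simp: eventually_at_filter)
    qed simp
    moreover have "measure M {s<..} = 1 - cdf M s"
      using prob_compl[of "{..s}"] by (simp add: cdf_def2 Compl_eq_Diff_UNIV[symmetric])
    moreover have "{t. \<exists>r<t. c \<le> cdf M r} \<subseteq> {s<..}"
      using cInf_lower[OF _ bdd] by (force simp: s_def S_def)
    ultimately show ?thesis by (intro bexI[of _ "{s<..}"]) auto
  qed
qed

end

text \<open>For a constant \<open>R\<close> there is nothing to show.  In general \<open>R\<close> depends on the same data as \<open>T\<close>,
  but on \<open>H\<close> the inequality \<open>T Y \<le> R Y\<close> implies that the distribution function of \<open>T\<close> is at most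
  \<open>q + \<epsilon>\<close> at \<open>T Y\<close>.  This event concerns \<open>T\<close> alone, and its probability is at most \<open>q + \<epsilon>\<close>.
  The other direction is similar.\<close>
lemma random_quantile_coverage:
  fixes T R :: "'a \<Rightarrow> real"
  assumes "prob_space P" and [measurable]: "T \<in> borel_measurable P" "R \<in> borel_measurable P" "H \<in> sets P"
    and q: "0 \<le> q" "q \<le> 1" "0 \<le> \<epsilon>"
    and close: "\<And>Y. Y \<in> H \<Longrightarrow> \<bar>measure P {Y' \<in> space P. T Y' \<le> R Y} - q\<bar> \<le> \<epsilon>"
    and H: "measure P (space P - H) \<le> \<eta>"
  shows "\<bar>measure P {Y \<in> space P. T Y \<le> R Y} - q\<bar> \<le> \<epsilon> + \<eta>"
proof -
  interpret prob_space P by fact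
  define D where "D = distr P borel T"
  interpret D: real_distribution D
    by (simp add: D_def real_distribution_def real_distribution_axioms_def prob_space_distr)
  have cdf: "cdf D r = measure P {Y' \<in> space P. T Y' \<le> r}" for r
    by (simp add: D_def cdf_def2 measure_distr vimage_def Int_def conj_commute)
  have mD: "measure D B = measure P {Y \<in> space P. T Y \<in> B}" if "B \<in> sets borel" for B
    using that by (simp add: D_def measure_distr vimage_def Int_def conj_commute)
  have cm: "cdf D \<in> borel_measurable borel"
    by (rule borel_measurable_mono) (auto intro: monoI D.cdf_nondecreasing)
  have split: "measure P A \<le> measure P B + \<eta>" if "A \<in> sets P" "B \<in> sets P" "A \<inter> H \<subseteq> B" for A B
  proof -
    have "measure P A \<le> measure P (B \<union> (space P - H))"
      using that sets.sets_into_space[OF that(1)] by (intro finite_measure_mono) auto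
    also have "\<dots> \<le> measure P B + measure P (space P - H)"
      using that by (intro measure_Un_le) auto
    finally show ?thesis using H by simp
  qed
  have low: "{Y \<in> space P. T Y \<le> R Y} \<in> sets P" by measurable
  have up: "measure P {Y \<in> space P. T Y \<le> R Y} \<le> q + \<epsilon> + \<eta>"
  proof -
    have B: "{t. cdf D t \<le> q + \<epsilon>} \<in> sets borel" using cm by measurable
    have "measure P {Y \<in> space P. T Y \<le> R Y} \<le> measure P {Y \<in> space P. T Y \<in> {t. cdf D t \<le> q + \<epsilon>}} + \<eta>"
    proof (rule split[OF low])
      show "{Y \<in> space P. T Y \<in> {t. cdf D t \<le> q + \<epsilon>}} \<in> sets P" using B by measurable
      show "{Y \<in> space P. T Y \<le> R Y} \<inter> H \<subseteq> {Y \<in> space P. T Y \<in> {t. cdf D t \<le> q + \<epsilon>}}"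
      proof clarsimp
        fix Y assume Y: "Y \<in> space P" "T Y \<le> R Y" "Y \<in> H"
        have "cdf D (T Y) \<le> cdf D (R Y)" by (rule D.cdf_nondecreasing) fact
        then show "cdf D (T Y) \<le> q + \<epsilon>" using close[OF Y(3)] by (simp add: cdf)
      qed
    qed
    also have "\<dots> = measure D {t. cdf D t \<le> q + \<epsilon>} + \<eta>" by (simp only: mD[OF B])
    also have "measure D {t. cdf D t \<le> q + \<epsilon>} \<le> q + \<epsilon>" by (rule D.prob_cdf_le) (use q in simp)
    finally show ?thesis by simp
  qed
  obtain B where B[measurable]: "B \<in> sets borel" and Bs: "{t. \<exists>r<t. q - \<epsilon> \<le> cdf D r} \<subseteq> B" "measure D B \<le> 1 - (q - \<epsilon>)"
    using D.prob_above_quantile[of "q - \<epsilon>"] q by auto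
  have "1 - measure P {Y \<in> space P. T Y \<le> R Y} = measure P (space P - {Y \<in> space P. T Y \<le> R Y})"
    using prob_compl[OF low] by simp
  also have "\<dots> \<le> measure P {Y \<in> space P. T Y \<in> B} + \<eta>"
  proof (rule split)
    show "(space P - {Y \<in> space P. T Y \<le> R Y}) \<inter> H \<subseteq> {Y \<in> space P. T Y \<in> B}"
    proof clarsimp
      fix Y assume Y: "Y \<in> space P" "\<not> T Y \<le> R Y" "Y \<in> H"
      then have "R Y < T Y" "q - \<epsilon> \<le> cdf D (R Y)" using close[OF Y(3)] by (auto simp: cdf)
      then show "T Y \<in> B" using Bs(1) by blast
    qed
  qed measurable
  also have "measure P {Y \<in> space P. T Y \<in> B} = measure D B" by (rule mD[symmetric]) measurable
  finally show ?thesis using Bs(2) up by linarith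
qed

section \<open>Maxima of weighted noise coefficients\<close>

context white_noise_law
begin

text \<open>There are at most \<open>2 ^ (l + 1)\<close> variables of level \<open>l\<close>, and each exceeds its threshold with
  probability at most \<open>sqrt 2 * exp (- a * l)\<close>.  Half of the exponent makes the sum over the
  variables converge, since \<open>2 * exp (- a / 2) \<le> 1 / 2\<close>; the other half remains as the bound.\<close>
lemma noise_union_tail:
  fixes g :: "nat \<times> nat \<Rightarrow> real \<Rightarrow> real"
  assumes g: "\<And>l k. (l, k) \<in> S \<Longrightarrow> g (l, k) \<in> L2 \<and> ip (g (l, k)) (g (l, k)) \<le> V"
    and S: "\<And>l k. (l, k) \<in> S \<Longrightarrow> m \<le> l \<and> k < 2 ^ Suc l"
    and V: "0 < V" and x: "0 \<le> x" and a: "a = x\<^sup>2 / (4 * V)" "4 \<le> a"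
  defines "E \<equiv> {W \<in> space Q. \<exists>l k. (l, k) \<in> S \<and> x * sqrt (real l) < \<bar>W (g (l, k))\<bar>}"
  shows "E \<in> sets Q" "measure Q E \<le> 6 * exp (- a * real m / 2)"
proof -
  define F where "F l k = {W \<in> space Q. x * sqrt (real l) < \<bar>W (g (l, k))\<bar>}" for l k
  define K where "K l = {k. (l, k) \<in> S}" for l
  have finK: "finite (K l)" and cK: "card (K l) \<le> 2 ^ Suc l" for l
  proof -
    have sub: "K l \<subseteq> {..<2 ^ Suc l}" using S by (auto simp: K_def)
    show "finite (K l)" by (rule finite_subset[OF sub]) simp
    show "card (K l) \<le> 2 ^ Suc l" using card_mono[OF _ sub] by simp
  qed
  have Fm: "F l k \<in> sets Q" if "k \<in> K l" for l k
  proof -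
    have "g (l, k) \<in> L2" using g that by (simp add: K_def)
    note [measurable] = noise_measurable[OF this]
    show ?thesis unfolding F_def by measurable
  qed
  define U where "U j = (\<Union>k\<in>K (m + j). F (m + j) k)" for j
  have Um: "U j \<in> sets Q" for j unfolding U_def using Fm finK by (intro sets.finite_UN) auto
  have EU: "E = (\<Union>j. U j)"
  proof
    show "E \<subseteq> (\<Union>j. U j)"
    proof
      fix W assume "W \<in> E"
      then obtain l k where lk: "(l, k) \<in> S" "W \<in> space Q" "x * sqrt (real l) < \<bar>W (g (l, k))\<bar>"
        by (auto simp: E_def)
      then have "W \<in> U (l - m)" using S[OF lk(1)] by (auto simp: U_def K_def F_def)
      then show "W \<in> (\<Union>j. U j)" by blast
    qed
    show "(\<Union>j. U j) \<subseteq> E"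
    proof
      fix W assume "W \<in> (\<Union>j. U j)"
      then obtain j k where "(m + j, k) \<in> S" "W \<in> F (m + j) k" by (auto simp: U_def K_def)
      then show "W \<in> E" unfolding F_def E_def by blast
    qed
  qed
  show "E \<in> sets Q" unfolding EU using Um by auto
  have e2: "2 * exp (- (a / 2)) \<le> 1 / 2"
  proof -
    have "(4::real) \<le> exp 2" using exp_ge_one_plus_x_over_n_power_n[of 2 2] by simp
    also have "exp 2 \<le> exp (a / 2)" using a(2) by simp
    finally have "exp (- (a / 2)) \<le> 1 / 4" by (simp add: exp_minus field_simps)
    then show ?thesis by simp
  qed
  define c where "c = 2 * sqrt 2 * exp (- a * real m / 2)"
  have Ub: "measure Q (U j) \<le> c * (1 / 2) ^ j" for j
  proof -
    define l where "l = m + j"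
    have "measure Q (U j) \<le> (\<Sum>k\<in>K l. measure Q (F l k))"
      unfolding U_def l_def using Fm finK by (intro finite_measure_subadditive_finite) auto
    also have "\<dots> \<le> (\<Sum>k\<in>K l. sqrt 2 * exp (- a * real l))"
    proof (rule sum_mono)
      fix k assume "k \<in> K l"
      then have gk: "g (l, k) \<in> L2" "ip (g (l, k)) (g (l, k)) \<le> V" using g by (auto simp: K_def)
      have "measure Q (F l k) \<le> sqrt 2 * exp (- ((x * sqrt (real l))\<^sup>2 / (4 * V)))"
        unfolding F_def using x by (intro noise_tail gk) auto
      then show "measure Q (F l k) \<le> sqrt 2 * exp (- a * real l)"
        by (simp add: a(1) power_mult_distrib)
    qed
    also have "\<dots> = real (card (K l)) * (sqrt 2 * exp (- a * real l))" by simp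
    also have "\<dots> \<le> 2 ^ Suc l * (sqrt 2 * exp (- a * real l))"
      using cK[of l] by (intro mult_right_mono) (simp_all flip: of_nat_le_iff[where ?'a = real])
    also have "\<dots> = 2 * sqrt 2 * (exp (- (a / 2) * real l) * (2 * exp (- (a / 2))) ^ l)"
      by (simp add: power_mult_distrib exp_of_nat_mult[symmetric] exp_add[symmetric] mult.commute mult.left_commute)
    also have "\<dots> \<le> 2 * sqrt 2 * (exp (- a * real m / 2) * (1 / 2) ^ j)"
    proof (intro mult_left_mono mult_mono)
      have "a * real m \<le> a * real l" using a(2) by (intro mult_left_mono) (auto simp: l_def)
      then show "exp (- (a / 2) * real l) \<le> exp (- a * real m / 2)" by simp
      have "(2 * exp (- (a / 2))) ^ l \<le> (1 / 2) ^ l" by (rule power_mono[OF e2]) simp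
      also have "\<dots> \<le> (1 / 2) ^ j" by (rule power_decreasing) (auto simp: l_def)
      finally show "(2 * exp (- (a / 2))) ^ l \<le> (1 / 2) ^ j" .
    qed auto
    finally show ?thesis by (simp add: c_def mult.assoc)
  qed
  have sg: "summable (\<lambda>j. c * (1 / 2 :: real) ^ j)" by (intro summable_mult summable_geometric) auto
  have su: "summable (\<lambda>j. measure Q (U j))"
    by (rule summable_comparison_test'[OF sg, of 0]) (use Ub in simp)
  have "measure Q E \<le> (\<Sum>j. measure Q (U j))"
    unfolding EU using Um su by (intro finite_measure_subadditive_countably) auto
  also have "\<dots> \<le> (\<Sum>j. c * (1 / 2) ^ j)" by (rule suminf_le[OF Ub su sg])
  also have "\<dots> = c * 2"
    by (subst suminf_mult) (auto simp: suminf_geometric)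
  also have "\<dots> \<le> 6 * exp (- a * real m / 2)"
  proof -
    have "sqrt 2 \<le> 3 / 2" by (rule real_le_lsqrt) (auto simp: power2_eq_square)
    then have "4 * sqrt 2 * exp (- a * real m / 2) \<le> 6 * exp (- a * real m / 2)"
      by (intro mult_right_mono) auto
    then show ?thesis by (simp add: c_def)
  qed
  finally show "measure Q E \<le> 6 * exp (- a * real m / 2)" .
qed

end

section \<open>Diameter of Besov sections of a band\<close>

lemma sum_half_powers: "(\<Sum>l<m. 2 powr (real (Suc l) / 2)) \<le> 4 * 2 powr (real m / 2)"
proof (induction m)
  case (Suc m)
  have r: "2 powr (real (Suc m) / 2) = sqrt 2 * 2 powr (real m / 2)"
    by (simp add: powr_half_sqrt[symmetric] powr_add[symmetric] add_divide_distrib)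
  have "4 / 3 \<le> sqrt 2" by (rule real_le_rsqrt) (simp add: power2_eq_square)
  then have "4 * 2 powr (real m / 2) \<le> 3 * (sqrt 2 * 2 powr (real m / 2))"
    using mult_right_mono[of 4 "3 * sqrt 2" "2 powr (real m / 2)"] by simp
  then show ?case using Suc.IH unfolding sum.lessThan_Suc r by linarith
qed simp

text \<open>Both parts of the coefficient sum are geometric: increasing below level \<open>J - 1\<close>, where the
  coefficients are only bounded by \<open>\<omega>\<close>, and decreasing from there on.\<close>
lemma besov_section_bound:
  assumes onb: "orthonormal_basis_on (idx_inf J0) \<psi>" and J0: "1 \<le> J0"
    and lev: "\<And>x l. x \<in> {0..1} \<Longrightarrow> (\<Sum>k | (l, k) \<in> idx_inf J0. \<bar>\<psi> (l, k) x\<bar>) \<le> c * 2 powr (real (Suc l) / 2)"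
    and c: "0 \<le> c" and d: "d \<in> L2" and s: "0 < s" and J: "1 \<le> J" and \<omega>: "0 \<le> \<omega>" and B: "0 \<le> B"
    and low: "\<And>l k. (l, k) \<in> idx_inf J0 \<Longrightarrow> l < J - 1 \<Longrightarrow> \<bar>ip d (\<psi> (l, k))\<bar> \<le> 2 * \<omega>"
    and high: "\<And>l k. (l, k) \<in> idx_inf J0 \<Longrightarrow> J - 1 \<le> l \<Longrightarrow> \<bar>ip d (\<psi> (l, k))\<bar> \<le> 2 * B * 2 powr (- real l * (s + 1 / 2))"
  shows "Linf_norm d \<le> ereal (8 * c * (\<omega> * 2 powr (real J / 2))
    + 4 * c * 2 powr s / (1 - 2 powr (- s)) * (2 powr (- real J * s) * B))"
proof -
  define m where "m = J - 1"
  have Jm: "real J = real m + 1" using J by (simp add: m_def)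
  define \<beta> where "\<beta> l = (if l < m then 2 * \<omega> else 2 * B * 2 powr (- real l * (s + 1 / 2)))" for l
  define C where "C l = c * 2 powr (real (Suc l) / 2)" for l
  define \<rho> where "\<rho> = 2 powr (- s)"
  have \<rho>: "0 < \<rho>" "\<rho> < 1" using s by (auto simp: \<rho>_def powr_less_one)
  have tail: "\<beta> (l + m) * C (l + m) = 2 * sqrt 2 * B * c * 2 powr (- real m * s) * \<rho> ^ l" for l
  proof -
    have "2 powr (- real (l + m) * (s + 1 / 2)) * 2 powr (real (Suc (l + m)) / 2)
        = 2 powr (1 / 2 + (- real m * s) + real l * (- s))"
      unfolding powr_add[symmetric] by (rule arg_cong[of _ _ "\<lambda>z. 2 powr z"]) (simp add: field_simps)
    also have "\<dots> = sqrt 2 * 2 powr (- real m * s) * \<rho> ^ l"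
    proof -
      have "\<rho> ^ l = 2 powr (real l * (- s))"
        using \<rho>(1) by (simp add: powr_realpow[symmetric]) (simp add: \<rho>_def powr_powr mult.commute)
      then show ?thesis unfolding powr_add by (simp add: powr_half_sqrt)
    qed
    finally show ?thesis by (simp add: \<beta>_def C_def mult_ac)
  qed
  have sums_tail: "(\<lambda>l. \<beta> (l + m) * C (l + m)) sums (2 * sqrt 2 * B * c * 2 powr (- real m * s) * (1 / (1 - \<rho>)))"
    unfolding tail using \<rho> by (intro sums_mult geometric_sums) auto
  then have sum: "summable (\<lambda>l. \<beta> l * C l)"
    using summable_iff_shift[of "\<lambda>l. \<beta> l * C l" m] by (simp add: sums_iff)
  have "AE x in unit_leb. \<bar>d x\<bar> \<le> (\<Sum>l. \<beta> l * C l)"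
  proof (rule orthonormal_series_bound[OF onb J0 _ d _ sum])
    show "(\<Sum>k | (l, k) \<in> idx_inf J0. \<bar>\<psi> (l, k) x\<bar>) \<le> C l" if "x \<in> {0..1}" for x l
      unfolding C_def by (rule lev[OF that])
    show "\<bar>ip d (\<psi> (l, k))\<bar> \<le> \<beta> l" if "(l, k) \<in> idx_inf J0" for l k
      using low[OF that] high[OF that] by (auto simp: \<beta>_def m_def)
    show "0 \<le> \<beta> l" for l using \<omega> B by (simp add: \<beta>_def)
  qed
  then have "Linf_norm d \<le> ereal (\<Sum>l. \<beta> l * C l)" by (rule Linf_norm_le[OF d])
  also have "(\<Sum>l. \<beta> l * C l) \<le> 8 * c * (\<omega> * 2 powr (real J / 2))
    + 4 * c * 2 powr s / (1 - 2 powr (- s)) * (2 powr (- real J * s) * B)"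
  proof -
    have "(\<Sum>l. \<beta> l * C l) = (\<Sum>l. \<beta> (l + m) * C (l + m)) + (\<Sum>l<m. \<beta> l * C l)"
      by (rule suminf_split_initial_segment[OF sum])
    also have "(\<Sum>l. \<beta> (l + m) * C (l + m)) = 2 * sqrt 2 * B * c * 2 powr (- real m * s) * (1 / (1 - \<rho>))"
      using sums_tail by (rule sums_unique[symmetric])
    also have "\<dots> \<le> 4 * B * c * 2 powr (- real m * s) * (1 / (1 - \<rho>))"
    proof -
      have "sqrt 2 \<le> 2" by (rule real_le_lsqrt) auto
      then show ?thesis using B c \<rho> by (intro mult_right_mono) auto
    qed
    also have "2 powr (- real m * s) = 2 powr s * 2 powr (- real J * s)"
      unfolding powr_add[symmetric] by (rule arg_cong[of _ _ "\<lambda>z. 2 powr z"]) (simp add: Jm algebra_simps)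
    also have "(\<Sum>l<m. \<beta> l * C l) = 2 * \<omega> * c * (\<Sum>l<m. 2 powr (real (Suc l) / 2))"
      unfolding sum_distrib_left by (intro sum.cong) (auto simp: \<beta>_def C_def)
    also have "\<dots> \<le> 2 * \<omega> * c * (4 * 2 powr (real J / 2))"
    proof (intro mult_left_mono)
      have "2 powr (real m / 2) \<le> (2::real) powr (real J / 2)" by (intro powr_mono) (auto simp: Jm)
      then show "(\<Sum>l<m. 2 powr (real (Suc l) / 2)) \<le> 4 * 2 powr (real J / 2)"
        using sum_half_powers[of m] by linarith
    qed (use \<omega> c in auto)
    finally show ?thesis by (simp add: \<rho>_def mult_ac)
  qed
  finally show ?thesis by simp
qed

lemma besov_norm_coefficients:
  assumes "besov_norm s J0 \<psi> f \<le> ereal B" "J0 \<le> l" "k < 2 ^ l"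
  shows "\<bar>ip f (\<psi> (l, k))\<bar> \<le> B * 2 powr (- real l * (s + 1 / 2))"
proof -
  define m where "m = Max ((\<lambda>k. \<bar>ip (\<psi> (J0 - 1, k)) f\<bar>) ` {..<2 ^ J0})"
  define S where "S = (SUP (l, k)\<in>{(l, k). J0 \<le> l \<and> k < 2 ^ l}. ereal (2 powr (real l * (s + 1 / 2)) * \<bar>ip (\<psi> (l, k)) f\<bar>))"
  have "0 \<le> \<bar>ip (\<psi> (J0 - 1, 0)) f\<bar>" by simp
  also have "\<dots> \<le> m" unfolding m_def by (rule Max_ge) auto
  finally have "0 \<le> ereal m" by simp
  then have "0 + S \<le> ereal m + S" by (rule add_right_mono)
  also have "ereal m + S \<le> ereal B" using assms(1) by (simp add: besov_norm_def m_def S_def)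
  finally have "S \<le> ereal B" by simp
  moreover have "ereal (2 powr (real l * (s + 1 / 2)) * \<bar>ip (\<psi> (l, k)) f\<bar>) \<le> S"
    unfolding S_def by (rule SUP_upper2[of "(l, k)"]) (use assms in auto)
  ultimately have "ereal (2 powr (real l * (s + 1 / 2)) * \<bar>ip (\<psi> (l, k)) f\<bar>) \<le> ereal B" by (rule order_trans[rotated])
  then have le: "2 powr (real l * (s + 1 / 2)) * \<bar>ip (\<psi> (l, k)) f\<bar> \<le> B" by simp
  have one: "2 powr (- real l * (s + 1 / 2)) * 2 powr (real l * (s + 1 / 2)) = 1"
    by (simp add: powr_add[symmetric])
  have "\<bar>ip f (\<psi> (l, k))\<bar> = 2 powr (- real l * (s + 1 / 2)) * (2 powr (real l * (s + 1 / 2)) * \<bar>ip (\<psi> (l, k)) f\<bar>)"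
    using ip_commute[of f "\<psi> (l, k)"] by (simp only: mult.assoc[symmetric] one mult_1)
  also have "\<dots> \<le> 2 powr (- real l * (s + 1 / 2)) * B" by (intro mult_left_mono le) simp
  finally show ?thesis by (simp only: mult.commute)
qed

section \<open>The truncated experiment\<close>

text \<open>The drift \<open>\<mu>\<close> stands for the image of \<open>f0\<close> under the operator, which enters only through
  its scalar products with the functions \<open>v1\<close>.  The constants \<open>c\<close> and \<open>C\<close> are those of
  near-orthogonality.\<close>
locale wvd_experiment = observation Q n \<mu>
  for Q :: "((real \<Rightarrow> real) \<Rightarrow> real) measure" and n :: nat and \<mu> :: "real \<Rightarrow> real" +
  fixes J0 J :: nat and \<psi> v1 :: "nat \<times> nat \<Rightarrow> real \<Rightarrow> real" and \<kappa> :: "nat \<times> nat \<Rightarrow> real"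
    and f0 :: "real \<Rightarrow> real" and c C :: real
  assumes J0: "2 \<le> J0" and J: "J0 \<le> J" and nJ: "2 ^ J \<le> n"
    and onb: "orthonormal_basis_on (idx_inf J0) \<psi>"
    and v1: "\<And>i. i \<in> idx_inf J0 \<Longrightarrow> v1 i \<in> L2"
    and \<kappa>: "\<And>i. i \<in> idx_inf J0 \<Longrightarrow> 0 < \<kappa> i"
    and c: "0 < c" and C: "0 < C"
    and near: "\<And>F a. finite F \<Longrightarrow> F \<subseteq> idx_inf J0 \<Longrightarrow>
        c * (\<Sum>i\<in>F. (a i)\<^sup>2) \<le> (L2norm (\<lambda>x. \<Sum>i\<in>F. a i * v1 i x))\<^sup>2 \<and>
        (L2norm (\<lambda>x. \<Sum>i\<in>F. a i * v1 i x))\<^sup>2 \<le> C * (\<Sum>i\<in>F. (a i)\<^sup>2)"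
    and vag: "\<And>i. i \<in> idx_inf J0 \<Longrightarrow> ip (v1 i) \<mu> = \<kappa> i * ip f0 (\<psi> i)"
    and f0: "f0 \<in> L2"
begin

abbreviation "I \<equiv> idx J0 J"
abbreviation "L \<equiv> Pi\<^sub>M I (\<lambda>_. lborel :: real measure)"
abbreviation "S \<equiv> obs_cov J0 J v1 P"
abbreviation "X \<equiv> design J0 J \<kappa> v1 P"

lemma finI: "finite I" by (rule finite_idx)

lemma cardI: "card I = 2 ^ J" using card_idx J0 J by simp

lemma I_ne: "I \<noteq> {}" using cardI by (metis card.empty power_not_zero zero_neq_numeral)

lemma I_inf: "i \<in> I \<Longrightarrow> i \<in> idx_inf J0" using idx_subset_idx_inf[OF J] by blast

lemma n4: "4 \<le> n"
proof -
  have "(2::nat) ^ 2 \<le> 2 ^ J" using J0 J by (intro power_increasing) auto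
  then show ?thesis using nJ by simp
qed

lemma v1_norm: "i \<in> idx_inf J0 \<Longrightarrow> ip (v1 i) (v1 i) \<le> C"
  using near[of "{i}" "\<lambda>_. 1"] by (simp add: L2norm_square)

text \<open>The matrix is \<open>sqrt n T diag \<kappa>\<close> with the orthonormalising matrix \<open>T\<close> of the functions \<open>v1\<close>.
  The bound for its diagonal is where the lower near-orthogonality constant enters: it keeps the
  conditional standard deviations of the errors above \<open>sqrt (c / n) / \<kappa>\<close>.\<close>
lemma whitening_exists:
  "\<exists>M. triangular M I \<and> (\<forall>i\<in>I. M i i \<le> sqrt (real n / c) * \<kappa> i) \<and>
     (\<forall>b. vec_norm2 (X *\<^sub>v to_vec J0 J b) = nrm M I b) \<and>
     (\<forall>y b. vec_norm2 (inv_sqrt_mat S *\<^sub>v to_vec J0 J y - X *\<^sub>v to_vec J0 J b) = nrm M I (\<lambda>i. y i / \<kappa> i - b i)) \<and>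
     sqrt (Determinant.det (transpose_mat X * X)) = (\<Prod>i\<in>I. M i i) \<and>
     distr Q L (\<lambda>W. \<lambda>i\<in>I. W (v1 i) / (sqrt (real n) * \<kappa> i)) = gauss_measure M I"
proof -
  define p :: nat where "p = 2 ^ J"
  define e where "e = enum_idx J0"
  have bij: "bij_betw e {..<p} I" unfolding e_def p_def using J0 J by (intro bij_betw_enum_idx) auto
  define r where "r = the_inv_into {..<p} e"
  have inj: "inj_on e {..<p}" and img: "e ` {..<p} = I" using bij by (auto simp: bij_betw_def)
  have re: "r (e a) = a" if "a < p" for a
    unfolding r_def using inj that by (intro the_inv_into_f_f) auto
  have eI: "e a \<in> I" if "a < p" for a using img that by auto
  have sumI: "(\<Sum>i\<in>I. f i) = (\<Sum>a<p. f (e a))" for f :: "_ \<Rightarrow> real"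
    by (rule sum.reindex_bij_betw[OF bij, symmetric])
  have prodI: "(\<Prod>i\<in>I. f i) = (\<Prod>a<p. f (e a))" for f :: "_ \<Rightarrow> real"
    by (rule prod.reindex_bij_betw[OF bij, symmetric])
  define G where "G a b = ip (v1 (e a)) (v1 (e b))" for a b
  have sym: "G a b = G b a" for a b by (simp add: G_def ip_commute)
  have quad: "c * (\<Sum>a<p. (x a)\<^sup>2) \<le> (\<Sum>a<p. \<Sum>b<p. x a * G a b * x b) \<and>
      (\<Sum>a<p. \<Sum>b<p. x a * G a b * x b) \<le> C * (\<Sum>a<p. (x a)\<^sup>2)" for x
  proof -
    have "(L2norm (\<lambda>t. \<Sum>i\<in>I. x (r i) * v1 i t))\<^sup>2 = (\<Sum>i\<in>I. \<Sum>j\<in>I. x (r i) * ip (v1 i) (v1 j) * x (r j))"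
      unfolding L2norm_square by (rule ip_sum_sum[OF finI v1[OF I_inf]])
    also have "\<dots> = (\<Sum>a<p. \<Sum>b<p. x a * G a b * x b)" by (simp add: sumI re G_def)
    finally show ?thesis
      using near[OF finI idx_subset_idx_inf[OF J], of "\<lambda>i. x (r i)"] by (simp add: sumI re)
  qed
  have "0 < (\<Sum>a<p. \<Sum>b<p. x a * G a b * x b)" if nz: "\<exists>a<p. x a \<noteq> 0" for x
  proof -
    obtain a where "a < p" "x a \<noteq> 0" using nz by auto
    then have "0 < (\<Sum>a<p. (x a)\<^sup>2)" by (intro sum_pos2[of _ a]) auto
    then show ?thesis using quad[of x] c by (auto intro: less_le_trans[OF mult_pos_pos])
  qed
  from gram_schmidt[of G p, OF sym this] obtain T where T: "\<forall>a<p. 0 < T a a" "\<forall>a b. a < b \<longrightarrow> T a b = 0"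
    "\<forall>a<p. \<forall>b<p. (\<Sum>c<p. \<Sum>d<p. T a c * G c d * T b d) = (if a = b then 1 else 0)" by blast
  define k where "k a = (if a < p then \<kappa> (e a) else 1)" for a
  have k: "0 < k a" for a using \<kappa>[OF I_inf[OF eI]] by (simp add: k_def)
  have n0: "0 < real n" using n by simp
  have Seq: "S = Matrix.mat p p (\<lambda>(a, b). G a b / real n)"
    unfolding obs_cov_def p_def[symmetric] e_def[symmetric]
    by (rule eq_matI) (auto simp: G_def obs_covariance v1 I_inf eI)
  have Deq: "mat_diag (2 ^ J) (\<lambda>i. \<kappa> (enum_idx J0 i)) = mat_diag p k"
    unfolding p_def[symmetric] e_def[symmetric] mat_diag_def by (rule eq_matI) (auto simp: k_def)
  have Xeq: "X = inv_sqrt_mat (Matrix.mat p p (\<lambda>(a, b). G a b / real n)) * mat_diag p k"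
    unfolding design_def Deq Seq ..
  have vec: "to_vec J0 J b = Matrix.vec p (\<lambda>a. b (e a))" for b by (simp add: to_vec_def p_def e_def)
  note W = whitened_design[of G c p C "real n" k T, OF sym _ _ c n0 k T]
  define M where "M i j = sqrt (real n) * T (r i) (r j) * \<kappa> j" for i j
  have linM: "lin M I b (e a) = (\<Sum>b'<p. sqrt (real n) * T a b' * k b' * b (e b'))" if "a < p" for a b
    using that by (simp add: lin_def eI sumI M_def re k_def)
  have nrmM: "(nrm M I b)\<^sup>2 = (\<Sum>a<p. (\<Sum>b'<p. sqrt (real n) * T a b' * k b' * b (e b'))\<^sup>2)" for b
    unfolding nrm_square by (simp add: sumI linM)
  have vn: "0 \<le> vec_norm2 v" for v by (simp add: vec_norm2_def scalar_prod_self_nonneg)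
  have W1: "vec_norm2 (X *\<^sub>v to_vec J0 J b) = nrm M I b" for b
    by (rule power2_eq_imp_eq[OF _ vn nrm_nonneg])
      (use W(1)[of "\<lambda>a. b (e a)"] quad in \<open>simp add: Xeq vec nrmM\<close>)
  have W2: "vec_norm2 (inv_sqrt_mat S *\<^sub>v to_vec J0 J y - X *\<^sub>v to_vec J0 J b) = nrm M I (\<lambda>i. y i / \<kappa> i - b i)" for y b
  proof (rule power2_eq_imp_eq[OF _ vn nrm_nonneg])
    have "(\<Sum>b'<p. sqrt (real n) * T a b' * k b' * (y (e b') / \<kappa> (e b') - b (e b')))
      = (\<Sum>b'<p. sqrt (real n) * T a b' * k b' * (y (e b') / k b' - b (e b')))" for a
      by (intro sum.cong) (auto simp: k_def)
    then show "(vec_norm2 (inv_sqrt_mat S *\<^sub>v to_vec J0 J y - X *\<^sub>v to_vec J0 J b))\<^sup>2 = (nrm M I (\<lambda>i. y i / \<kappa> i - b i))\<^sup>2"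
      using W(2)[of "\<lambda>a. y (e a)" "\<lambda>a. b (e a)"] quad by (simp add: Xeq Seq vec nrmM)
  qed
  have W3: "sqrt (Determinant.det (transpose_mat X * X)) = (\<Prod>i\<in>I. M i i)"
    using W(3) quad by (simp add: Xeq prodI M_def re k_def)
  have Tp: "0 < M (e a) (e a)" if "a < p" for a
    using that T(1) n0 \<kappa>[OF I_inf[OF eI[OF that]]] by (simp add: M_def re)
  have "triangular M (e ` {..<m})" if "m \<le> p" for m
    using that
  proof (induction m)
    case 0 then show ?case by (simp add: triangular.empty)
  next
    case (Suc m)
    have "triangular M (insert (e m) (e ` {..<m}))"
    proof (rule triangular.insert)
      show "triangular M (e ` {..<m})" using Suc by simp
      show "e m \<notin> e ` {..<m}"
        using inj_on_image_mem_iff[OF inj, of m "{..<m}"] Suc.prems by auto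
      show "M j (e m) = 0" if "j \<in> e ` {..<m}" for j
        using that Suc.prems T(2) by (auto simp: M_def re)
      show "0 < M (e m) (e m)" using Suc.prems by (intro Tp) simp
    qed
    then show ?case by (simp add: lessThan_Suc)
  qed
  from this[of p] have tri: "triangular M I" by (simp add: img)
  have diag: "M i i \<le> sqrt (real n / c) * \<kappa> i" if i: "i \<in> I" for i
  proof -
    obtain a where a: "a < p" "i = e a" using i img by auto
    \<comment> \<open>Each row of \<open>T\<close> has length one for the form \<open>G\<close>, which dominates \<open>c\<close> times the Euclidean one.\<close>
    have "c * (T a a)\<^sup>2 \<le> c * (\<Sum>b<p. (T a b)\<^sup>2)"
      using a c by (intro mult_left_mono member_le_sum) auto
    also have "\<dots> \<le> 1" using quad[of "T a"] T(3) a by simp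
    finally have "T a a \<le> sqrt (1 / c)" using c by (intro real_le_rsqrt) (simp add: field_simps)
    then have "sqrt (real n) * T a a * \<kappa> i \<le> sqrt (real n) * sqrt (1 / c) * \<kappa> i"
      using \<kappa>[OF I_inf[OF i]] by (intro mult_right_mono mult_left_mono) auto
    then show ?thesis using a by (simp add: M_def re real_sqrt_divide real_sqrt_mult)
  qed
  have law: "distr Q L (\<lambda>W. \<lambda>i\<in>I. W (v1 i) / (sqrt (real n) * \<kappa> i)) = gauss_measure M I"
  proof (rule law_of_whitened[OF tri])
    note [measurable] = noise_measurable[OF v1[OF I_inf]]
    show "(\<lambda>W. \<lambda>i\<in>I. W (v1 i) / (sqrt (real n) * \<kappa> i)) \<in> measurable Q L"
      by (rule measurable_restrict) simp
    have lin: "lin M I (\<lambda>i\<in>I. W (v1 i) / (sqrt (real n) * \<kappa> i)) = (\<lambda>i\<in>I. \<Sum>j\<in>I. T (r i) (r j) * W (v1 j))" for W :: "(real \<Rightarrow> real) \<Rightarrow> real"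
      unfolding lin_def
    proof (intro restrict_ext sum.cong refl)
      fix i j assume j: "j \<in> I"
      show "M i j * (\<lambda>i\<in>I. W (v1 i) / (sqrt (real n) * \<kappa> i)) j = T (r i) (r j) * W (v1 j)"
        using j n0 \<kappa>[OF I_inf[OF j]] by (simp add: M_def)
    qed
    show "distr Q L (\<lambda>W. lin M I (\<lambda>i\<in>I. W (v1 i) / (sqrt (real n) * \<kappa> i)))
      = density L (\<lambda>z. ennreal (\<Prod>i\<in>I. std_normal_density (z i)))"
      unfolding lin
    proof (rule whitened_noise_law[OF finI v1[OF I_inf]])
      fix i i' assume i: "i \<in> I" "i' \<in> I"
      have "\<exists>a<p. j = e a" if "j \<in> I" for j using that img by blast
      from this[OF i(1)] this[OF i(2)] obtain a b where ab: "a < p" "i = e a" "b < p" "i' = e b" by blast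
      have "(\<Sum>j\<in>I. \<Sum>m\<in>I. T (r i) (r j) * ip (v1 j) (v1 m) * T (r i') (r m)) = (if a = b then 1 else 0)"
        using T(3) ab by (simp add: sumI re G_def)
      also have "\<dots> = (if i = i' then 1 else 0)" using ab inj by (auto simp: inj_on_def)
      finally show "(\<Sum>j\<in>I. \<Sum>m\<in>I. T (r i) (r j) * ip (v1 j) (v1 m) * T (r i') (r m)) = (if i = i' then 1 else 0)" .
    qed
  qed
  show ?thesis using tri diag W1 W2 W3 law by blast
qed

definition M :: "nat \<times> nat \<Rightarrow> nat \<times> nat \<Rightarrow> real" where
  "M = (SOME M. triangular M I \<and> (\<forall>i\<in>I. M i i \<le> sqrt (real n / c) * \<kappa> i) \<and>
     (\<forall>b. vec_norm2 (X *\<^sub>v to_vec J0 J b) = nrm M I b) \<and>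
     (\<forall>y b. vec_norm2 (inv_sqrt_mat S *\<^sub>v to_vec J0 J y - X *\<^sub>v to_vec J0 J b) = nrm M I (\<lambda>i. y i / \<kappa> i - b i)) \<and>
     sqrt (Determinant.det (transpose_mat X * X)) = (\<Prod>i\<in>I. M i i) \<and>
     distr Q L (\<lambda>W. \<lambda>i\<in>I. W (v1 i) / (sqrt (real n) * \<kappa> i)) = gauss_measure M I)"

lemma M_triangular: "triangular M I"
  and M_diag: "i \<in> I \<Longrightarrow> M i i \<le> sqrt (real n / c) * \<kappa> i"
  and design_nrm: "vec_norm2 (X *\<^sub>v to_vec J0 J b) = nrm M I b"
  and residual_nrm: "vec_norm2 (inv_sqrt_mat S *\<^sub>v to_vec J0 J y - X *\<^sub>v to_vec J0 J b) = nrm M I (\<lambda>i. y i / \<kappa> i - b i)"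
  and design_det: "sqrt (Determinant.det (transpose_mat X * X)) = (\<Prod>i\<in>I. M i i)"
  and noise_law: "distr Q L (\<lambda>W. \<lambda>i\<in>I. W (v1 i) / (sqrt (real n) * \<kappa> i)) = gauss_measure M I"
  using someI_ex[OF whitening_exists] unfolding M_def[symmetric] by auto

lemma M_prod_pos: "0 < (\<Prod>i\<in>I. M i i)"
  by (intro prod_pos) (simp add: triangular_diag_pos[OF M_triangular])

sublocale Gam: prob_space "gauss_measure M I"
  by (rule prob_space_gauss_measure[OF M_triangular])

section \<open>The estimation error\<close>

text \<open>The error of the centre; by the sequence model its law does not depend on \<open>f0\<close>.\<close>
definition err :: "((real \<Rightarrow> real) \<Rightarrow> real) \<Rightarrow> nat \<times> nat \<Rightarrow> real" where
  "err Y i = fhat_coef \<kappa> v1 Y i - ip f0 (\<psi> i)"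

lemma err_obs: "i \<in> idx_inf J0 \<Longrightarrow> err (obs W) i = W (v1 i) / (sqrt (real n) * \<kappa> i)"
  using \<kappa>[of i] n by (simp add: err_def fhat_coef_def obs_apply v1 vag field_simps)

lemma err_measurable [measurable (raw)]: "i \<in> idx_inf J0 \<Longrightarrow> (\<lambda>Y. err Y i) \<in> borel_measurable P"
  unfolding err_def fhat_coef_def using coordinate_measurable[OF v1] by auto

lemma err_vec_measurable [measurable]: "(\<lambda>Y. \<lambda>i\<in>I. err Y i) \<in> measurable P L"
  by (rule measurable_restrict) (simp add: I_inf)

lemma err_law: "distr P L (\<lambda>Y. \<lambda>i\<in>I. err Y i) = gauss_measure M I"
proof -
  have em: "(\<lambda>Y. \<lambda>i\<in>I. err Y i) \<in> measurable (Pi\<^sub>M L2 (\<lambda>_. borel)) L"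
    using err_vec_measurable by (simp only: measurable_cong_sets[OF sets_P refl])
  have "distr P L (\<lambda>Y. \<lambda>i\<in>I. err Y i) = distr Q L ((\<lambda>Y. \<lambda>i\<in>I. err Y i) \<circ> obs)"
    unfolding P_eq by (rule distr_distr[OF em obs_measurable])
  also have "(\<lambda>Y. \<lambda>i\<in>I. err Y i) \<circ> obs = (\<lambda>W. \<lambda>i\<in>I. W (v1 i) / (sqrt (real n) * \<kappa> i))"
    by (auto simp: fun_eq_iff err_obs I_inf)
  finally show ?thesis by (simp only: noise_law)
qed

lemma prob_err:
  assumes [measurable]: "B \<in> sets L"
  shows "measure P {Y \<in> space P. (\<lambda>i\<in>I. err Y i) \<in> B} = measure (gauss_measure M I) B"
  unfolding err_law[symmetric] by (subst measure_distr) (auto simp: vimage_def Int_def conj_commute)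

text \<open>The data for which the normal approximation is used.  A quarter of the radius leaves room
  for the triangle inequalities in \<open>posterior_normal_approximation\<close>.\<close>
definition good :: "real \<Rightarrow> ((real \<Rightarrow> real) \<Rightarrow> real) set" where
  "good R = {Y \<in> space P. nrm M I (err Y) \<le> R / 4}"

lemma nrm_restrict: "nrm M I (\<lambda>i\<in>I. b i) = nrm M I b"
  by (rule nrm_cong) simp

lemma good_sets [measurable]: "good R \<in> sets P"
proof -
  have "(\<lambda>Y. nrm M I (\<lambda>i\<in>I. err Y i)) \<in> borel_measurable P"
    by (rule measurable_compose[OF err_vec_measurable nrm_measurable])
  then have [measurable]: "(\<lambda>Y. nrm M I (err Y)) \<in> borel_measurable P" by (simp add: nrm_restrict)
  show ?thesis unfolding good_def by measurable
qed

lemma prob_not_good: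
  assumes "0 \<le> R"
  shows "measure P (space P - good R) \<le> sqrt 2 ^ 2 ^ J * exp (- (R\<^sup>2 / 64))"
proof -
  interpret PP: prob_space P by (rule prob_space_P)
  let ?B = "{b \<in> space L. R / 4 \<le> nrm M I b}"
  have "measure P (space P - good R) \<le> measure P {Y \<in> space P. (\<lambda>i\<in>I. err Y i) \<in> ?B}"
  proof (rule PP.finite_measure_mono)
    show "space P - good R \<subseteq> {Y \<in> space P. (\<lambda>i\<in>I. err Y i) \<in> ?B}"
      by (auto simp: good_def nrm_restrict measurable_space[OF err_vec_measurable])
    have "?B \<in> sets L" by measurable
    then show "{Y \<in> space P. (\<lambda>i\<in>I. err Y i) \<in> ?B} \<in> sets P"
      using measurable_sets[OF err_vec_measurable, of ?B] by (simp add: vimage_def Int_def conj_commute)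
  qed
  also have "\<dots> = measure (gauss_measure M I) ?B" by (rule prob_err) measurable
  also have "\<dots> \<le> sqrt 2 ^ 2 ^ J * exp (- (R\<^sup>2 / 64))"
    using gauss_tail_le[OF M_triangular, of "R / 4"] assms by (simp add: cardI power_divide)
  finally show ?thesis .
qed

section \<open>Bands\<close>

lemma level_pos: "(l, k) \<in> idx_inf J0 \<Longrightarrow> 1 \<le> l"
  using J0 by (auto simp: idx_inf_iff)

lemma series_L2: "series J0 J \<psi> b \<in> L2"
  unfolding series_def[abs_def] using onb finI I_inf
  by (intro L2_sum) (auto simp: orthonormal_basis_on_def)

lemma series_coef:
  assumes j: "j \<in> idx_inf J0"
  shows "ip (series J0 J \<psi> b) (\<psi> j) = (if j \<in> I then b j else 0)"
proof -
  have "ip (series J0 J \<psi> b) (\<psi> j) = (\<Sum>i\<in>I. b i * ip (\<psi> i) (\<psi> j))"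
    unfolding series_def[abs_def] using onb finI I_inf j
    by (intro ip_sum) (auto simp: orthonormal_basis_on_def)
  also have "\<dots> = (\<Sum>i\<in>I. if i = j then b j else 0)"
    using onb I_inf j by (intro sum.cong) (auto simp: orthonormal_basis_on_def)
  finally show ?thesis using finI by simp
qed

lemma band_iff:
  assumes w: "\<And>l. 1 \<le> l \<Longrightarrow> 0 < w l"
  shows "f \<in> band J0 \<psi> w a R \<longleftrightarrow> f \<in> L2 \<and> (\<forall>l k. (l, k) \<in> idx_inf J0 \<longrightarrow> \<bar>ip f (\<psi> (l, k)) - a (l, k)\<bar> \<le> w l * R)"
proof -
  have "\<bar>ip f (\<psi> (l, k)) - a (l, k)\<bar> / w l \<le> R \<longleftrightarrow> \<bar>ip f (\<psi> (l, k)) - a (l, k)\<bar> \<le> w l * R"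
    if "(l, k) \<in> idx_inf J0" for l k
    using w[OF level_pos[OF that]] by (simp add: divide_le_eq mult.commute)
  then show ?thesis unfolding band_def by (auto simp: SUP_le_iff)
qed

text \<open>At the levels from \<open>J\<close> on both series have zero coefficients, and the condition reduces to
  \<open>0 \<le> R\<close>.  The right-hand side implies this, because the index set is not empty.\<close>
lemma series_in_band_iff:
  assumes w: "\<And>l. 1 \<le> l \<Longrightarrow> 0 < w l"
  shows "series J0 J \<psi> b \<in> band J0 \<psi> w (\<lambda>i. ip (series J0 J \<psi> a) (\<psi> i)) R
    \<longleftrightarrow> (\<forall>i\<in>I. \<bar>b i - a i\<bar> \<le> w (fst i) * R)"
proof
  assume "series J0 J \<psi> b \<in> band J0 \<psi> w (\<lambda>i. ip (series J0 J \<psi> a) (\<psi> i)) R"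
  then show "\<forall>i\<in>I. \<bar>b i - a i\<bar> \<le> w (fst i) * R"
    using I_inf series_coef by (force simp: band_iff[OF w])
next
  assume le: "\<forall>i\<in>I. \<bar>b i - a i\<bar> \<le> w (fst i) * R"
  obtain i0 where i0: "i0 \<in> I" using I_ne by auto
  obtain l0 k0 where lk: "i0 = (l0, k0)" by force
  have "0 < w l0" using w level_pos I_inf i0 lk by blast
  moreover have "0 \<le> w l0 * R" using le i0 lk by (force intro: order_trans[OF abs_ge_zero])
  ultimately have R: "0 \<le> R" by (simp add: zero_le_mult_iff)
  have "\<bar>ip (series J0 J \<psi> b) (\<psi> (l, k)) - ip (series J0 J \<psi> a) (\<psi> (l, k))\<bar> \<le> w l * R"
    if "(l, k) \<in> idx_inf J0" for l k
    using le R w[OF level_pos[OF that]] that by (force simp: series_coef)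
  then show "series J0 J \<psi> b \<in> band J0 \<psi> w (\<lambda>i. ip (series J0 J \<psi> a) (\<psi> i)) R"
    using series_L2 by (simp add: band_iff[OF w])
qed

lemma idx_inf_split: "(l, k) \<in> idx_inf J0 \<longleftrightarrow> (l, k) \<in> I \<or> J \<le> l \<and> k < 2 ^ l"
  using J0 J by (auto simp: idx_inf_iff idx_def)

lemma high_freq_event_iff:
  assumes w: "\<And>l. 1 \<le> l \<Longrightarrow> 0 < w l"
  shows "Y \<in> high_freq_event J \<psi> \<kappa> v1 w P f0 Rhat \<longleftrightarrow>
    Y \<in> space P \<and> (\<forall>l k. J \<le> l \<and> k < 2 ^ l \<longrightarrow> \<bar>err Y (l, k)\<bar> \<le> w l * Rhat Y)"
proof -
  have "\<bar>ip f0 (\<psi> (l, k)) - fhat_coef \<kappa> v1 Y (l, k)\<bar> / w l \<le> R \<longleftrightarrow> \<bar>err Y (l, k)\<bar> \<le> w l * R"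
    if "J \<le> l" for l k R
  proof -
    have "1 \<le> l" using that J J0 by simp
    from w[OF this] show ?thesis
      by (simp add: divide_le_eq mult.commute err_def abs_minus_commute)
  qed
  then show ?thesis unfolding high_freq_event_def by (auto simp: SUP_le_iff)
qed

lemma high_freq_event_sets:
  assumes w: "\<And>l. 1 \<le> l \<Longrightarrow> 0 < w l" and R[measurable]: "Rhat \<in> borel_measurable P"
  shows "high_freq_event J \<psi> \<kappa> v1 w P f0 Rhat \<in> sets P"
proof -
  define E where "E l k = (if J \<le> l \<and> k < 2 ^ l then {Y \<in> space P. \<bar>err Y (l, k)\<bar> \<le> w l * Rhat Y} else space P)" for l k
  have "E l k \<in> sets P" for l k
  proof (cases "J \<le> l \<and> k < 2 ^ l")
    case True
    then have "(l, k) \<in> idx_inf J0" by (simp add: idx_inf_split)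
    note [measurable] = err_measurable[OF this]
    show ?thesis using True unfolding E_def by simp
  qed (auto simp: E_def)
  then have "(\<Inter>l. \<Inter>k. E l k) \<in> sets P" by (intro sets.countable_INT) auto
  also have "(\<Inter>l. \<Inter>k. E l k) = high_freq_event J \<psi> \<kappa> v1 w P f0 Rhat"
  proof -
    have "Y \<in> E l k \<longleftrightarrow> Y \<in> space P \<and> (J \<le> l \<and> k < 2 ^ l \<longrightarrow> \<bar>err Y (l, k)\<bar> \<le> w l * Rhat Y)" for Y l k
      by (auto simp: E_def)
    moreover have "Y \<in> high_freq_event J \<psi> \<kappa> v1 w P f0 Rhat \<longleftrightarrow>
        Y \<in> space P \<and> (\<forall>l k. J \<le> l \<and> k < 2 ^ l \<longrightarrow> \<bar>err Y (l, k)\<bar> \<le> w l * Rhat Y)" for Y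
      using w by (rule high_freq_event_iff)
    ultimately show ?thesis by (simp add: set_eq_iff)
  qed
  finally show ?thesis .
qed

text \<open>The quasi-posterior only sees the levels below \<open>J\<close>, so that coverage has to be split at
  this level.\<close>
lemma f0_in_band_iff:
  assumes w: "\<And>l. 1 \<le> l \<Longrightarrow> 0 < w l" and Y: "Y \<in> space P"
  shows "f0 \<in> band J0 \<psi> w (fhat_coef \<kappa> v1 Y) (Rhat Y) \<longleftrightarrow>
    (\<forall>i\<in>I. \<bar>err Y i\<bar> \<le> w (fst i) * Rhat Y) \<and> Y \<in> high_freq_event J \<psi> \<kappa> v1 w P f0 Rhat"
proof -
  have "f0 \<in> band J0 \<psi> w (fhat_coef \<kappa> v1 Y) (Rhat Y) \<longleftrightarrow>
      (\<forall>l k. (l, k) \<in> idx_inf J0 \<longrightarrow> \<bar>err Y (l, k)\<bar> \<le> w l * Rhat Y)"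
    using w f0 by (subst band_iff) (auto simp: err_def abs_minus_commute)
  moreover have "Y \<in> high_freq_event J \<psi> \<kappa> v1 w P f0 Rhat \<longleftrightarrow>
      (\<forall>l k. J \<le> l \<and> k < 2 ^ l \<longrightarrow> \<bar>err Y (l, k)\<bar> \<le> w l * Rhat Y)"
    using w Y by (subst high_freq_event_iff) auto
  ultimately show ?thesis by (auto simp: idx_inf_split)
qed

section \<open>Normal approximation of the quasi-posterior\<close>

lemma local_ball_eq: "local_ball J0 J X b0 R = {b \<in> space L. nrm M I (\<lambda>i. b i - b0 i) \<le> R}"
  by (simp add: local_ball_def coef_lebesgue_def design_nrm)

abbreviation "\<beta>0 \<equiv> true_coefs J0 J \<psi> f0"

lemma \<beta>0_space: "\<beta>0 \<in> space L"
  by (auto simp: true_coefs_def space_PiM)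

lemma \<beta>0_apply: "i \<in> I \<Longrightarrow> \<beta>0 i = ip f0 (\<psi> i)"
  by (simp add: true_coefs_def)

lemma prior_flatness_bounds:
  assumes prior: "prior_density J0 J \<pi>" and pos: "0 < \<pi> \<beta>0" and R: "0 \<le> R"
  defines "\<phi> \<equiv> prior_flatness J0 J X \<beta>0 \<pi> R"
  shows "0 \<le> \<phi>" "\<phi> \<le> 1"
    and "\<And>b b'. b \<in> local_ball J0 J X \<beta>0 R \<Longrightarrow> b' \<in> local_ball J0 J X \<beta>0 R \<Longrightarrow> (1 - \<phi>) * \<pi> b \<le> \<pi> b'"
proof -
  let ?B = "local_ball J0 J X \<beta>0 R"
  have nn: "0 \<le> \<pi> b" if "b \<in> ?B" for b
    using prior that by (auto simp: prior_density_def local_ball_def)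
  have b0: "\<beta>0 \<in> ?B" using \<beta>0_space R by (simp add: local_ball_eq nrm_def lin_def L2_set_def)
  define m where "m = (INF (b, b')\<in>?B \<times> ?B. \<pi> b' / \<pi> b)"
  have bdd: "bdd_below ((\<lambda>(b, b'). \<pi> b' / \<pi> b) ` (?B \<times> ?B))"
    using nn by (intro bdd_belowI[of _ 0]) auto
  have le: "m \<le> \<pi> b' / \<pi> b" if "b \<in> ?B" "b' \<in> ?B" for b b'
    unfolding m_def using cINF_lower[OF bdd, of "(b, b')"] that by auto
  have "0 \<le> m" unfolding m_def using b0 nn by (intro cINF_greatest) auto
  moreover have "m \<le> 1" using le[OF b0 b0] pos by simp
  moreover have m: "m = 1 - \<phi>" by (simp add: \<phi>_def prior_flatness_def m_def)
  ultimately show "0 \<le> \<phi>" "\<phi> \<le> 1" by auto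
  fix b b' assume b: "b \<in> ?B" "b' \<in> ?B"
  show "(1 - \<phi>) * \<pi> b \<le> \<pi> b'"
  proof (cases "\<pi> b = 0")
    case False
    then have "0 < \<pi> b" using nn[OF b(1)] by simp
    then show ?thesis using le[OF b] m by (simp add: le_divide_eq)
  qed (use nn b in simp)
qed

text \<open>The design matrix is square and invertible: the residual sum of squares is the squared
  Mahalanobis distance to the coefficients of the centre.\<close>
lemma quasi_posterior_eq:
  fixes Y \<pi>
  defines "lik b \<equiv> exp (- (nrm M I (\<lambda>i. fhat_coef \<kappa> v1 Y i - b i))\<^sup>2 / 2)"
  shows "quasi_posterior J0 J \<kappa> v1 P \<pi> Y = density L (\<lambda>b. ennreal (\<pi> b * lik b / (\<integral>b. \<pi> b * lik b \<partial>L)))"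
  by (simp add: quasi_posterior_def Let_def coef_lebesgue_def residual_nrm lik_def fhat_coef_def[abs_def])

text \<open>The square of the radius is \<open>64 * (C1 + 4) * 2^J * ln n\<close>.  The factor 64 compensates the
  denominator in \<open>prob_not_good\<close>, and \<open>C1\<close> outweighs the exponent in the condition on the prior
  density at the true coefficients.\<close>
definition radius :: "real \<Rightarrow> real" where
  "radius C1 = 8 * sqrt (C1 + 4) * sqrt (2 ^ J * ln (real n))"

abbreviation "tiny \<equiv> real n powr (- 1 * 2 ^ J)"

lemma ln_n: "1 \<le> ln (real n)"
proof -
  have "4 \<le> real n" using n4 by simp
  then have "exp 1 \<le> real n" using exp_le by linarith
  then show ?thesis using n by (simp add: ln_ge_iff)
qed

lemma tiny_eq: "tiny = exp (- (2 ^ J * ln (real n)))"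
  using n by (simp add: powr_def)

lemma radius_square: "0 < C1 \<Longrightarrow> (radius C1)\<^sup>2 = 64 * (C1 + 4) * (2 ^ J * ln (real n))"
  using ln_n by (simp add: radius_def power_mult_distrib)

lemma sqrt2_power_le: "sqrt 2 ^ 2 ^ J \<le> exp (2 ^ J * ln (real n))"
proof -
  have "sqrt 2 \<le> real n" using n4 real_le_lsqrt[of 2 2] by simp
  then have "sqrt 2 ^ 2 ^ J \<le> real n ^ 2 ^ J" by (intro power_mono) auto
  also have "\<dots> = exp (2 ^ J * ln (real n))"
    using n exp_of_nat_mult[of "2 ^ J" "ln (real n)"] by simp
  finally show ?thesis .
qed

lemma gauss_tails_tiny:
  assumes C1: "0 < C1" and a: "2 \<le> 64 * (C1 + 4) * a"
  shows "sqrt 2 ^ 2 ^ J * exp (- (a * (radius C1)\<^sup>2)) \<le> tiny"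
proof -
  define z where "z = 2 ^ J * ln (real n)"
  have z: "0 \<le> z" using ln_n by (simp add: z_def)
  have "sqrt 2 ^ 2 ^ J * exp (- (a * (radius C1)\<^sup>2)) \<le> exp z * exp (- (a * (radius C1)\<^sup>2))"
    unfolding z_def by (intro mult_right_mono sqrt2_power_le) simp
  also have "\<dots> = exp (z - (64 * (C1 + 4) * a) * z)"
    by (simp add: radius_square[OF C1] z_def exp_add[symmetric] mult_ac)
  also have "\<dots> \<le> exp (- z)" using mult_right_mono[OF a z] by simp
  finally show ?thesis by (simp only: tiny_eq z_def)
qed

lemma prob_not_good_tiny: "0 < C1 \<Longrightarrow> measure P (space P - good (radius C1)) \<le> tiny"
  using prob_not_good[of "radius C1"] gauss_tails_tiny[of C1 "1 / 64"] ln_n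
  by (auto simp: radius_def)

text \<open>The evidence is bounded below through the ball of radius \<open>1 / sqrt n\<close>.  Its volume contains the
  reciprocal of the determinant, which cancels against the condition on the prior density; what
  remains is \<open>n powr (- (C1 + 1) * 2^J)\<close>, since \<open>2^J \<le> n\<close>.\<close>
lemma posterior_close:
  assumes C1: "0 < C1" and prior: "prior_density J0 J \<pi>"
    and mass: "sqrt (Determinant.det (transpose_mat X * X)) * real n powr (- C1 * 2 ^ J) \<le> \<pi> \<beta>0"
    and flat: "prior_flatness J0 J X \<beta>0 \<pi> (1 / sqrt (real n)) \<le> 1 / 2"
    and Y: "Y \<in> good (radius C1)" and A: "A \<in> sets L"
  shows "\<bar>measure (quasi_posterior J0 J \<kappa> v1 P \<pi> Y) A
      - measure (gauss_measure M I) {b \<in> space L. (\<lambda>i\<in>I. b i + fhat_coef \<kappa> v1 Y i) \<in> A}\<bar>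
    \<le> prior_flatness J0 J X \<beta>0 \<pi> (radius C1) + 3 * tiny"
proof -
  define R where "R = radius C1"
  define \<phi> where "\<phi> = prior_flatness J0 J X \<beta>0 \<pi> R"
  define z where "z = 2 ^ J * ln (real n)"
  define p :: real where "p = 2 ^ J"
  have p: "1 \<le> p" "p \<le> real n" using nJ by (auto simp: p_def)
  have n0: "0 < real n" "1 \<le> real n" using n by auto
  have z: "1 \<le> z" using ln_n p mult_mono[of 1 "2 ^ J" 1 "ln (real n)"] by (simp add: z_def p_def)
  have R0: "0 \<le> R" using ln_n C1 by (auto simp: R_def radius_def intro!: mult_nonneg_nonneg)
  have RR: "R\<^sup>2 = 64 * (C1 + 4) * z" using radius_square[OF C1] by (simp add: R_def z_def)
  have pos: "0 < \<pi> \<beta>0"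
    using mass M_prod_pos n0 unfolding design_det by (intro less_le_trans[OF _ mass[unfolded design_det]]) auto
  note small = prior_flatness_bounds[OF prior pos, of "1 / sqrt (real n)"]
  note large = prior_flatness_bounds[OF prior pos R0, folded \<phi>_def]
  have b0s: "\<beta>0 \<in> local_ball J0 J X \<beta>0 (1 / sqrt (real n))"
    using \<beta>0_space by (simp add: local_ball_eq nrm_def lin_def L2_set_def)
  have half: "\<pi> \<beta>0 / 2 \<le> \<pi> b" if "b \<in> {b \<in> space L. nrm M I (\<lambda>i. b i - \<beta>0 i) \<le> 1 / sqrt (real n)}" for b
  proof -
    have "(1 - prior_flatness J0 J X \<beta>0 \<pi> (1 / sqrt (real n))) * \<pi> \<beta>0 \<le> \<pi> b"
      using that b0s by (intro small(3)) (auto simp: local_ball_eq)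
    moreover have "(1 / 2) * \<pi> \<beta>0 \<le> (1 - prior_flatness J0 J X \<beta>0 \<pi> (1 / sqrt (real n))) * \<pi> \<beta>0"
      using flat pos by (intro mult_right_mono) auto
    ultimately show ?thesis by simp
  qed
  have nearR: "nrm M I (\<lambda>i. fhat_coef \<kappa> v1 Y i - \<beta>0 i) \<le> R / 4"
    using Y nrm_cong[of I "\<lambda>i. fhat_coef \<kappa> v1 Y i - \<beta>0 i" "err Y" M]
    by (simp add: good_def R_def err_def \<beta>0_apply)
  have rR: "1 / sqrt (real n) \<le> R / 4"
  proof -
    have "1 \<le> 4 * (C1 + 4) * z" using C1 z mult_mono[of 1 "4 * (C1 + 4)" 1 z] by simp
    moreover have "(R / 4)\<^sup>2 = 4 * (C1 + 4) * z" by (simp add: power_divide RR)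
    ultimately have "1 \<le> (R / 4)\<^sup>2" by simp
    then have "1 \<le> R / 4" using R0 by (intro power2_le_imp_le[of 1]) auto
    moreover have "1 / sqrt (real n) \<le> 1" using n0 by simp
    ultimately show ?thesis by linarith
  qed
  have prm: "\<pi> \<in> borel_measurable L" "\<And>b. b \<in> space L \<Longrightarrow> 0 \<le> \<pi> b" "(\<integral>\<^sup>+b. ennreal (\<pi> b) \<partial>L) = 1"
    using prior by (auto simp: prior_density_def coef_lebesgue_def)
  define vol where "vol = (2 * (1 / sqrt (real n)) / sqrt (real (card I))) ^ card I / (\<Prod>i\<in>I. M i i)"
  have main: "\<bar>measure (quasi_posterior J0 J \<kappa> v1 P \<pi> Y) A
      - measure (gauss_measure M I) {b \<in> space L. (\<lambda>i\<in>I. b i + fhat_coef \<kappa> v1 Y i) \<in> A}\<bar>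
    \<le> \<phi> + 2 * exp (- 5 * R\<^sup>2 / 32) / (\<pi> \<beta>0 * vol) + sqrt 2 ^ card I * exp (- 9 * R\<^sup>2 / 64)"
    unfolding quasi_posterior_eq vol_def
  proof (rule posterior_normal_approximation[OF M_triangular I_ne prm \<beta>0_space _ rR nearR large(1,2) _ _ pos A])
    show "0 < 1 / sqrt (real n)" using n0 by simp
    show "(1 - \<phi>) * \<pi> b \<le> \<pi> b'" if "b \<in> {b \<in> space L. nrm M I (\<lambda>i. b i - \<beta>0 i) \<le> R}"
      "b' \<in> {b \<in> space L. nrm M I (\<lambda>i. b i - \<beta>0 i) \<le> R}" for b b'
      using that by (intro large(3)) (auto simp: local_ball_eq)
  qed (erule half | assumption)+
  have e2: "sqrt 2 ^ card I * exp (- 9 * R\<^sup>2 / 64) \<le> tiny"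
    using gauss_tails_tiny[OF C1, of "9 / 64"] C1 by (simp add: cardI R_def)
  have pv: "exp (- ((C1 + 1) * z)) \<le> \<pi> \<beta>0 * vol"
  proof -
    have cI: "real (card I) = p" by (simp add: cardI p_def)
    have pn: "real n powr (- C1 * 2 ^ J) = exp (- (C1 * z))" using n0 by (simp add: powr_def z_def)
    have "1 / real n \<le> 2 * (1 / sqrt (real n)) / sqrt p"
    proof -
      have "sqrt (real n) * sqrt p \<le> sqrt (real n) * sqrt (real n)" using p by (intro mult_left_mono) auto
      also have "\<dots> = real n" by simp
      finally show ?thesis using n0 p by (simp add: field_simps)
    qed
    then have "(1 / real n) ^ card I \<le> (2 * (1 / sqrt (real n)) / sqrt p) ^ card I"
      using n0 by (intro power_mono) auto
    also have "(1 / real n) ^ card I = exp (- z)"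
      using n0 exp_of_nat_mult[of "2 ^ J" "ln (real n)"] by (simp add: cardI z_def exp_minus field_simps)
    finally have v: "exp (- z) / (\<Prod>i\<in>I. M i i) \<le> vol"
      unfolding vol_def cI using M_prod_pos by (intro divide_right_mono) auto
    have "exp (- ((C1 + 1) * z)) = (\<Prod>i\<in>I. M i i) * exp (- (C1 * z)) * (exp (- z) / (\<Prod>i\<in>I. M i i))"
      using M_prod_pos by (simp add: exp_add[symmetric] algebra_simps)
    also have "\<dots> \<le> \<pi> \<beta>0 * vol"
      using mass M_prod_pos pos v unfolding design_det pn by (intro mult_mono) auto
    finally show ?thesis .
  qed
  have "0 < \<pi> \<beta>0 * vol" by (rule less_le_trans[OF exp_gt_zero pv])
  then have "2 * exp (- 5 * R\<^sup>2 / 32) / (\<pi> \<beta>0 * vol) \<le> 2 * exp (- 5 * R\<^sup>2 / 32) / exp (- ((C1 + 1) * z))"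
    using pv by (intro divide_left_mono mult_pos_pos[of "\<pi> \<beta>0 * vol"]) auto
  also have "\<dots> = 2 * exp ((C1 + 1) * z - 10 * (C1 + 4) * z)"
  proof -
    have "exp (- 5 * R\<^sup>2 / 32) / exp (- ((C1 + 1) * z)) = exp ((C1 + 1) * z - 10 * (C1 + 4) * z)"
      unfolding exp_diff[symmetric] by (rule arg_cong[of _ _ exp]) (simp add: RR field_simps)
    then show ?thesis by simp
  qed
  also have "\<dots> \<le> 2 * exp (- z)"
  proof -
    have "0 \<le> C1 * z" using C1 z by simp
    then show ?thesis using z by (simp add: algebra_simps)
  qed
  also have "exp (- z) = tiny" by (simp only: tiny_eq z_def)
  finally show ?thesis using main e2 by (simp add: \<phi>_def R_def)
qed

end

section \<open>Coverage\<close>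

context wvd_experiment
begin

definition box :: "(nat \<Rightarrow> real) \<Rightarrow> real \<Rightarrow> (nat \<times> nat \<Rightarrow> real) set" where
  "box w R = {b \<in> space L. \<forall>i\<in>I. \<bar>b i\<bar> \<le> w (fst i) * R}"

lemma box_sets [measurable]: "box w R \<in> sets L"
proof -
  have "{b \<in> space L. \<forall>i\<in>I. \<bar>b i\<bar> \<le> w (fst i) * R} \<in> sets L"
    using finI by (intro sets.sets_Collect_finite_All) measurable
  then show ?thesis by (simp add: box_def)
qed

lemma box_mono:
  assumes "\<And>l. 1 \<le> l \<Longrightarrow> 0 < w l" "R \<le> R'" shows "box w R \<subseteq> box w R'"
proof -
  have "w (fst i) * R \<le> w (fst i) * R'" if "i \<in> I" for i
    using level_pos[of "fst i" "snd i"] I_inf[OF that] assms by (intro mult_left_mono) (auto simp: less_imp_le)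
  then show ?thesis by (force simp: box_def)
qed

lemma prob_box: "measure P {Y \<in> space P. \<forall>i\<in>I. \<bar>err Y i\<bar> \<le> w (fst i) * R} = measure (gauss_measure M I) (box w R)"
proof -
  have "{Y \<in> space P. \<forall>i\<in>I. \<bar>err Y i\<bar> \<le> w (fst i) * R} = {Y \<in> space P. (\<lambda>i\<in>I. err Y i) \<in> box w R}"
    using measurable_space[OF err_vec_measurable] by (auto simp: box_def)
  then show ?thesis by (simp add: prob_err)
qed

text \<open>The set of the credible radius, shifted by the centre, is a box around the origin.  Its
  normal mass is both the approximate posterior mass and, by \<open>prob_box\<close>, a sampling probability.\<close>
lemma credible_close:
  assumes C1: "0 < C1" and prior: "prior_density J0 J \<pi>"
    and mass: "sqrt (Determinant.det (transpose_mat X * X)) * real n powr (- C1 * 2 ^ J) \<le> \<pi> \<beta>0"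
    and flat: "prior_flatness J0 J X \<beta>0 \<pi> (1 / sqrt (real n)) \<le> 1 / 2"
    and w: "\<And>l. 1 \<le> l \<Longrightarrow> 0 < w l"
    and cred: "credible_radius J0 J \<psi> \<kappa> v1 w P \<pi> \<alpha> Rhat"
    and Y: "Y \<in> good (radius C1)"
  shows "\<bar>measure (gauss_measure M I) (box w (Rhat Y)) - (1 - \<alpha>)\<bar>
    \<le> prior_flatness J0 J X \<beta>0 \<pi> (radius C1) + 3 * tiny"
proof -
  define A where "A = {b \<in> space L. \<forall>i\<in>I. \<bar>b i - fhat_coef \<kappa> v1 Y i\<bar> \<le> w (fst i) * Rhat Y}"
  have A: "A \<in> sets L"
    unfolding A_def using finI by (intro sets.sets_Collect_finite_All) measurable
  have eq: "{b \<in> space (coef_lebesgue J0 J). series J0 J \<psi> b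
      \<in> band J0 \<psi> w (\<lambda>i. ip (series J0 J \<psi> (fhat_coef \<kappa> v1 Y)) (\<psi> i)) (Rhat Y)} = A"
    using series_in_band_iff[of w] w by (simp add: A_def coef_lebesgue_def)
  have "Y \<in> space P" using Y by (simp add: good_def)
  then have "measure (quasi_posterior J0 J \<kappa> v1 P \<pi> Y) A = 1 - \<alpha>"
    using cred unfolding credible_radius_def eq[symmetric] by blast
  moreover have "{b \<in> space L. (\<lambda>i\<in>I. b i + fhat_coef \<kappa> v1 Y i) \<in> A} = box w (Rhat Y)"
    by (auto simp: A_def box_def space_PiM)
  ultimately show ?thesis
    using posterior_close[OF C1 prior mass flat Y A] by (simp add: abs_minus_commute)
qed

text \<open>The statistic \<open>T\<close> is the smallest radius at which the band covers the low levels of \<open>f0\<close>, and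
  the credible radius is an approximate quantile of it.\<close>
lemma coverage:
  assumes C1: "0 < C1" and \<alpha>: "0 < \<alpha>" "\<alpha> < 1" and prior: "prior_density J0 J \<pi>"
    and mass: "sqrt (Determinant.det (transpose_mat X * X)) * real n powr (- C1 * 2 ^ J) \<le> \<pi> \<beta>0"
    and flat: "prior_flatness J0 J X \<beta>0 \<pi> (1 / sqrt (real n)) \<le> 1 / 2"
    and w: "\<And>l. 1 \<le> l \<Longrightarrow> 0 < w l"
    and cred: "credible_radius J0 J \<psi> \<kappa> v1 w P \<pi> \<alpha> Rhat"
  shows "\<bar>measure P {Y \<in> space P. f0 \<in> band J0 \<psi> w (fhat_coef \<kappa> v1 Y) (Rhat Y)} - (1 - \<alpha>)\<bar>
    \<le> prior_flatness J0 J X \<beta>0 \<pi> (radius C1) + 4 * tiny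
      + measure P (space P - high_freq_event J \<psi> \<kappa> v1 w P f0 Rhat)"
proof -
  interpret PP: prob_space P by (rule prob_space_P)
  have Rm[measurable]: "Rhat \<in> borel_measurable P" using cred by (simp add: credible_radius_def)
  define \<phi> where "\<phi> = prior_flatness J0 J X \<beta>0 \<pi> (radius C1)"
  define H3 where "H3 = high_freq_event J \<psi> \<kappa> v1 w P f0 Rhat"
  have H3[measurable]: "H3 \<in> sets P" unfolding H3_def by (rule high_freq_event_sets[OF w Rm])
  have wI: "0 < w (fst i)" if "i \<in> I" for i
    using level_pos[of "fst i" "snd i"] I_inf[OF that] w by simp
  have pos: "0 < \<pi> \<beta>0"
    using M_prod_pos n by (intro less_le_trans[OF _ mass[unfolded design_det]]) auto
  have R0: "0 \<le> radius C1" using C1 ln_n by (auto simp: radius_def intro!: mult_nonneg_nonneg)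
  note \<phi>0 = prior_flatness_bounds(1)[OF prior pos R0, folded \<phi>_def]
  define T where "T Y = Max ((\<lambda>i. \<bar>err Y i\<bar> / w (fst i)) ` I)" for Y
  have T: "T Y \<le> r \<longleftrightarrow> (\<forall>i\<in>I. \<bar>err Y i\<bar> \<le> w (fst i) * r)" for Y r
    unfolding T_def using finI I_ne wI by (subst Max_le_iff) (auto simp: divide_le_eq mult.commute)
  have Tm[measurable]: "T \<in> borel_measurable P"
    unfolding T_def[abs_def] using finI by (intro borel_measurable_Max) (auto simp: I_inf)
  have low: "\<bar>measure P {Y \<in> space P. T Y \<le> Rhat Y} - (1 - \<alpha>)\<bar> \<le> (\<phi> + 3 * tiny) + tiny"
  proof (rule random_quantile_coverage[OF prob_space_P Tm Rm good_sets])
    show "\<bar>measure P {Y' \<in> space P. T Y' \<le> Rhat Y} - (1 - \<alpha>)\<bar> \<le> \<phi> + 3 * tiny" if "Y \<in> good (radius C1)" for Y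
      using credible_close[OF C1 prior mass flat w cred that] by (simp add: T prob_box \<phi>_def)
    show "measure P (space P - good (radius C1)) \<le> tiny" by (rule prob_not_good_tiny[OF C1])
    show "0 \<le> \<phi> + 3 * tiny" using \<phi>0 by simp
  qed (use \<alpha> in auto)
  define Lo where "Lo = {Y \<in> space P. T Y \<le> Rhat Y}"
  have Lo[measurable]: "Lo \<in> sets P" unfolding Lo_def by measurable
  have eq: "{Y \<in> space P. f0 \<in> band J0 \<psi> w (fhat_coef \<kappa> v1 Y) (Rhat Y)} = Lo \<inter> H3"
    using f0_in_band_iff[of w] w sets.sets_into_space[OF H3] by (auto simp: Lo_def T H3_def)
  have "measure P Lo \<le> measure P (Lo \<inter> H3) + measure P (space P - H3)"
  proof -
    have "measure P Lo \<le> measure P (Lo \<inter> H3 \<union> (space P - H3))"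
      using sets.sets_into_space[OF Lo] by (intro PP.finite_measure_mono) auto
    also have "\<dots> \<le> measure P (Lo \<inter> H3) + measure P (space P - H3)" by (intro measure_Un_le) auto
    finally show ?thesis .
  qed
  moreover have "measure P (Lo \<inter> H3) \<le> measure P Lo" by (rule PP.finite_measure_mono) auto
  ultimately show ?thesis
    using low unfolding eq Lo_def[symmetric] \<phi>_def[symmetric] H3_def[symmetric] by linarith
qed

section \<open>Size of the credible radius\<close>

text \<open>Each of the \<open>2^J\<close> conditional probabilities is at most \<open>1 - upper_tail t\<close>.\<close>
lemma gauss_box_small:
  assumes R: "0 \<le> R" and w: "\<And>l. 1 \<le> l \<Longrightarrow> 0 < w l"
    and t: "\<And>i. i \<in> I \<Longrightarrow> sqrt (real n / c) * \<kappa> i * w (fst i) * R \<le> t"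
  shows "measure (gauss_measure M I) (box w R) \<le> exp (- (2 ^ J * upper_tail t))"
proof -
  have "emeasure (gauss_measure M I) (box w R) = (\<integral>\<^sup>+b. ennreal (gauss M I b) * indicator (box w R) b \<partial>L)"
    by (rule emeasure_density) measurable
  also have "\<dots> \<le> (\<integral>\<^sup>+b. ennreal (gauss M I b) * indicator {b. \<forall>i\<in>I. \<bar>b i\<bar> \<le> w (fst i) * R} b \<partial>L)"
    by (intro nn_integral_mono mult_left_mono) (auto simp: box_def indicator_def)
  also have "\<dots> \<le> ennreal (\<Prod>i\<in>I. 1 - upper_tail (M i i * (w (fst i) * R)))"
    by (rule gauss_cube_bound[OF M_triangular])
  also have "\<dots> \<le> ennreal ((1 - upper_tail t) ^ card I)"
  proof (rule ennreal_leI)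
    have "(\<Prod>i\<in>I. 1 - upper_tail (M i i * (w (fst i) * R))) \<le> (\<Prod>i\<in>I. 1 - upper_tail t)"
    proof (rule prod_mono)
      fix i assume i: "i \<in> I"
      have wi: "0 < w (fst i)" using level_pos[of "fst i" "snd i"] I_inf[OF i] w by simp
      have "M i i * (w (fst i) * R) \<le> sqrt (real n / c) * \<kappa> i * (w (fst i) * R)"
        using M_diag[OF i] wi R by (intro mult_right_mono) auto
      then have le: "M i i * (w (fst i) * R) \<le> t" using t[OF i] by (simp add: mult_ac)
      have nn: "0 \<le> M i i * (w (fst i) * R)"
        using triangular_diag_pos[OF M_triangular i] wi R by simp
      have "(M i i * (w (fst i) * R) + 1)\<^sup>2 \<le> (t + 1)\<^sup>2" using le nn by (intro power_mono) auto
      then have "upper_tail t \<le> upper_tail (M i i * (w (fst i) * R))"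
        using le nn by (simp add: upper_tail_def normal_density_def divide_right_mono)
      then show "0 \<le> 1 - upper_tail (M i i * (w (fst i) * R)) \<and> 1 - upper_tail (M i i * (w (fst i) * R)) \<le> 1 - upper_tail t"
        using upper_tail_bounds(2)[of "M i i * (w (fst i) * R)"] by simp
    qed
    then show "(\<Prod>i\<in>I. 1 - upper_tail (M i i * (w (fst i) * R))) \<le> (1 - upper_tail t) ^ card I" by simp
  qed
  also have "\<dots> \<le> ennreal (exp (- (2 ^ J * upper_tail t)))"
  proof (rule ennreal_leI)
    have "(1 - upper_tail t) ^ 2 ^ J \<le> exp (- upper_tail t) ^ 2 ^ J"
      using exp_ge_add_one_self[of "- upper_tail t"] upper_tail_bounds(2)[of t] by (intro power_mono) auto
    also have "\<dots> = exp (- (2 ^ J * upper_tail t))"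
      by (simp add: exp_of_nat_mult[symmetric])
    finally show "(1 - upper_tail t) ^ card I \<le> exp (- (2 ^ J * upper_tail t))" by (simp add: cardI)
  qed
  finally show ?thesis by (simp add: Gam.emeasure_eq_measure)
qed

lemma prob_large_err:
  assumes S: "\<And>l k. (l, k) \<in> K \<Longrightarrow> (l, k) \<in> idx_inf J0 \<and> m \<le> l"
    and x: "0 \<le> x" "\<And>l k. (l, k) \<in> K \<Longrightarrow> x * sqrt (real l) \<le> sqrt (real n) * \<kappa> (l, k) * b l"
    and a: "a = x\<^sup>2 / (4 * C)" "4 \<le> a"
  shows "\<exists>E\<in>sets P. {Y \<in> space P. \<exists>l k. (l, k) \<in> K \<and> b l < \<bar>err Y (l, k)\<bar>} \<subseteq> E \<and>
    measure P E \<le> 6 * exp (- a * real m / 2)"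
proof -
  interpret PP: prob_space P by (rule prob_space_P)
  define E where "E = {Y \<in> space P. \<exists>l k. (l, k) \<in> K \<and> b l < \<bar>err Y (l, k)\<bar>}"
  define F where "F l k = (if (l, k) \<in> K then {Y \<in> space P. b l < \<bar>err Y (l, k)\<bar>} else {})" for l k
  have "F l k \<in> sets P" for l k
  proof (cases "(l, k) \<in> K")
    case True
    then have "(l, k) \<in> idx_inf J0" using S by simp
    note [measurable] = err_measurable[OF this]
    show ?thesis using True unfolding F_def by simp
  qed (simp add: F_def)
  then have "(\<Union>l. \<Union>k. F l k) \<in> sets P" by (intro sets.countable_UN) auto
  also have "(\<Union>l. \<Union>k. F l k) = E" by (auto simp: F_def E_def split: if_splits)
  finally have Em: "E \<in> sets P" .
  define N where "N = {W \<in> space Q. \<exists>l k. (l, k) \<in> K \<and> x * sqrt (real l) < \<bar>W (v1 (l, k))\<bar>}"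
  have lev: "k < 2 ^ Suc l" if lk: "(l, k) \<in> idx_inf J0" for l k
  proof -
    consider "k < 2 ^ l" | "Suc l = J0" "k < 2 ^ J0" using lk J0 by (auto simp: idx_inf_iff)
    then show ?thesis by cases simp_all
  qed
  have N: "N \<in> sets Q" "measure Q N \<le> 6 * exp (- a * real m / 2)"
    unfolding N_def using S lev
    by (intro noise_union_tail[OF _ _ C x(1) a]; auto simp: v1 v1_norm)+
  have "measure P E = measure Q {W \<in> space Q. obs W \<in> E}" by (rule measure_P[OF Em])
  also have "\<dots> \<le> measure Q N"
  proof (rule finite_measure_mono[OF _ N(1)], safe)
    fix W assume W: "W \<in> space Q" "obs W \<in> E"
    then obtain l k where lk: "(l, k) \<in> K" "b l < \<bar>err (obs W) (l, k)\<bar>" by (auto simp: E_def)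
    have i: "(l, k) \<in> idx_inf J0" using S lk by simp
    have pos: "0 < sqrt (real n) * \<kappa> (l, k)" using n \<kappa>[OF i] by simp
    have "b l < \<bar>W (v1 (l, k))\<bar> / (sqrt (real n) * \<kappa> (l, k))"
      using lk(2) \<kappa>[OF i] by (simp add: err_obs[OF i] abs_mult)
    then have "sqrt (real n) * \<kappa> (l, k) * b l < \<bar>W (v1 (l, k))\<bar>"
      using pos by (simp add: less_divide_eq mult.commute)
    then have "x * sqrt (real l) < \<bar>W (v1 (l, k))\<bar>" using x(2)[OF lk(1)] by linarith
    then show "W \<in> N" unfolding N_def using W(1) lk(1) by blast
  qed
  finally have "measure P E \<le> 6 * exp (- a * real m / 2)" using N(2) by linarith
  then show ?thesis using Em by (intro bexI[of _ E]) (simp_all add: E_def)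
qed

text \<open>Otherwise the box contains the one for \<open>\<tau> / sqrt n\<close>, whose mass exceeds \<open>1 - \<alpha> / 2\<close> by the
  union bound.\<close>
lemma radius_upper_bound:
  assumes w: "\<And>l. 1 \<le> l \<Longrightarrow> 0 < w l"
    and G: "measure (gauss_measure M I) (box w R) < 1 - \<alpha> / 2"
    and \<tau>: "0 \<le> \<tau>" and m0: "0 < m0" "\<And>l k. (l, k) \<in> idx_inf J0 \<Longrightarrow> m0 * sqrt (real l) \<le> \<kappa> (l, k) * w l"
    and a: "4 \<le> (m0 * \<tau>)\<^sup>2 / (4 * C)" "6 * exp (- ((m0 * \<tau>)\<^sup>2 / (4 * C)) / 2) < \<alpha> / 2"
  shows "R < \<tau> / sqrt (real n)"
proof (rule ccontr)
  assume "\<not> R < \<tau> / sqrt (real n)"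
  then have "box w (\<tau> / sqrt (real n)) \<subseteq> box w R" using w by (intro box_mono) auto
  then have "measure (gauss_measure M I) (box w (\<tau> / sqrt (real n))) \<le> measure (gauss_measure M I) (box w R)"
    by (intro Gam.finite_measure_mono) auto
  moreover have "1 - \<alpha> / 2 < measure (gauss_measure M I) (box w (\<tau> / sqrt (real n)))"
  proof -
    interpret PP: prob_space P by (rule prob_space_P)
    define A where "A = {Y \<in> space P. \<forall>i\<in>I. \<bar>err Y i\<bar> \<le> w (fst i) * (\<tau> / sqrt (real n))}"
    have A: "A \<in> sets P"
      unfolding A_def using finI I_inf by (intro sets.sets_Collect_finite_All) auto
    have "\<exists>E\<in>sets P. {Y \<in> space P. \<exists>l k. (l, k) \<in> I \<and> w l * (\<tau> / sqrt (real n)) < \<bar>err Y (l, k)\<bar>} \<subseteq> E \<and>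
      measure P E \<le> 6 * exp (- ((m0 * \<tau>)\<^sup>2 / (4 * C)) * real 1 / 2)"
    proof (rule prob_large_err[OF _ _ _ refl a(1)])
      show "(l, k) \<in> idx_inf J0 \<and> 1 \<le> l" if "(l, k) \<in> I" for l k using I_inf[OF that] level_pos by blast
      show "0 \<le> m0 * \<tau>" using m0 \<tau> by simp
      show "m0 * \<tau> * sqrt (real l) \<le> sqrt (real n) * \<kappa> (l, k) * (w l * (\<tau> / sqrt (real n)))" if "(l, k) \<in> I" for l k
        using mult_right_mono[OF m0(2)[OF I_inf[OF that]] \<tau>] n by (simp add: mult_ac)
    qed
    then obtain E where E: "E \<in> sets P" "{Y \<in> space P. \<exists>l k. (l, k) \<in> I \<and> w l * (\<tau> / sqrt (real n)) < \<bar>err Y (l, k)\<bar>} \<subseteq> E"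
      "measure P E \<le> 6 * exp (- ((m0 * \<tau>)\<^sup>2 / (4 * C)) * real 1 / 2)" by blast
    have "space P - A \<subseteq> E" using E(2) by (force simp: A_def not_le)
    then have "measure P (space P - A) \<le> measure P E" using E(1) by (rule PP.finite_measure_mono)
    then have "1 - measure P A < \<alpha> / 2" using PP.prob_compl[OF A] E(3) a(2) by simp
    then show ?thesis using prob_box[of w "\<tau> / sqrt (real n)"] by (simp add: A_def)
  qed
  ultimately show False using G by simp
qed

end

section \<open>Consequences of admissibility of the weights\<close>

locale weights =
  fixes J0 :: nat and \<kappa> :: "nat \<times> nat \<Rightarrow> real" and w :: "nat \<Rightarrow> real"
  assumes J0: "2 \<le> J0" and \<kappa>: "\<And>i. i \<in> idx_inf J0 \<Longrightarrow> 0 < \<kappa> i"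
    and adm: "admissible_weights J0 \<kappa> w"
begin

lemma w_pos: "1 \<le> l \<Longrightarrow> 0 < w l" using adm by (simp add: admissible_weights_def)

lemma high_idx: "J0 \<le> l \<Longrightarrow> k < 2 ^ l \<Longrightarrow> (l, k) \<in> idx_inf J0"
  using J0 by (simp add: idx_inf_iff)

lemma weight_u_le:
  assumes "J0 \<le> J" "J \<le> l" "k < 2 ^ l"
  shows "weight_u \<kappa> w J * sqrt (real l) \<le> \<kappa> (l, k) * w l"
proof -
  have l: "1 \<le> l" using assms J0 by simp
  have "bdd_below ((\<lambda>(l, k). \<kappa> (l, k) * w l / sqrt (real l)) ` {(l, k). J \<le> l \<and> k < 2 ^ l})"
  proof (rule bdd_belowI[of _ 0], clarify)
    fix l k assume lk: "J \<le> l" "k < (2::nat) ^ l"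
    then have "0 < \<kappa> (l, k)" "0 < w l" using \<kappa>[OF high_idx] w_pos assms J0 by auto
    then show "0 \<le> \<kappa> (l, k) * w l / sqrt (real l)" by simp
  qed
  then have "weight_u \<kappa> w J \<le> \<kappa> (l, k) * w l / sqrt (real l)"
    unfolding weight_u_def using assms by (intro cINF_lower2[where x = "(l, k)"]) auto
  then show ?thesis using l by (simp add: le_divide_eq)
qed

lemma kappa_max_ge: "i \<in> idx J0 J \<Longrightarrow> \<kappa> i \<le> kappa_max J0 \<kappa> J"
  unfolding kappa_max_def using finite_idx by (intro Max_ge) auto

lemma kappa_min_le: "i \<in> idx J0 J \<Longrightarrow> kappa_min J0 \<kappa> J \<le> \<kappa> i"
  unfolding kappa_min_def using finite_idx by (intro Min_le) auto

lemma coarse_idx: "(J0 - 1, 0) \<in> idx J0 J" by (simp add: idx_def)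

lemma kappa_min_pos: "J0 \<le> J \<Longrightarrow> 0 < kappa_min J0 \<kappa> J"
  unfolding kappa_min_def using finite_idx coarse_idx \<kappa> idx_subset_idx_inf
  by (subst Min_gr_iff) blast+

lemma kappa_max_pos: "J0 \<le> J \<Longrightarrow> 0 < kappa_max J0 \<kappa> J"
  using kappa_max_ge[OF coarse_idx] \<kappa> coarse_idx idx_subset_idx_inf by (meson less_le_trans subsetD)

lemma weight_max_ge: "J0 - 1 \<le> l \<Longrightarrow> l \<le> J - 1 \<Longrightarrow> w l \<le> weight_max J0 w J"
  unfolding weight_max_def by (intro Max_ge) auto

lemma weight_max_pos: assumes "J0 \<le> J" shows "0 < weight_max J0 w J"
proof -
  have "0 < w (J0 - 1)" by (rule w_pos) (use J0 in linarith)
  also have "\<dots> \<le> weight_max J0 w J" by (rule weight_max_ge) (use assms in auto)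
  finally show ?thesis .
qed

lemma ratio_ge_1: "J0 \<le> J \<Longrightarrow> 1 \<le> weight_ratio J0 \<kappa> w J"
  using adm by (simp add: admissible_weights_def)

lemma ratio_at_top: "filterlim (weight_ratio J0 \<kappa> w) at_top sequentially"
  using adm by (simp add: admissible_weights_def)

lemma weight_u_eq:
  assumes "J0 \<le> J"
  shows "weight_u \<kappa> w J * sqrt (real J) = weight_ratio J0 \<kappa> w J * (kappa_max J0 \<kappa> J * weight_max J0 w J)"
  using kappa_max_pos[OF assms] weight_max_pos[OF assms] by (simp add: weight_ratio_def)

lemma weight_u_pos: assumes "J0 \<le> J" shows "0 < weight_u \<kappa> w J"
proof -
  have "0 < weight_u \<kappa> w J * sqrt (real J)"
    unfolding weight_u_eq[OF assms]
    using ratio_ge_1[OF assms] kappa_max_pos[OF assms] weight_max_pos[OF assms] by simp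
  then show ?thesis by (simp add: zero_less_mult_iff)
qed

text \<open>The infimum \<open>weight_u\<close> covers the levels from \<open>J0\<close> on; the scaling functions at level
  \<open>J0 - 1\<close> are finitely many.\<close>
lemma uniform_lower_weight: "\<exists>m0>0. \<forall>l k. (l, k) \<in> idx_inf J0 \<longrightarrow> m0 * sqrt (real l) \<le> \<kappa> (l, k) * w l"
proof -
  define q where "q k = \<kappa> (J0 - 1, k) * w (J0 - 1) / sqrt (real (J0 - 1))" for k
  define m1 where "m1 = Min (q ` {..<2 ^ J0})"
  have c: "(J0 - 1, k) \<in> idx_inf J0" if "k < 2 ^ J0" for k using that J0 by (simp add: idx_inf_iff)
  have qp: "0 < q k" if "k < 2 ^ J0" for k
    using \<kappa>[OF c[OF that]] w_pos[of "J0 - 1"] J0 by (simp add: q_def)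
  have ne: "q ` {..<2 ^ J0} \<noteq> {}" by (auto simp: lessThan_empty_iff)
  have m1: "0 < m1" unfolding m1_def using qp ne by (subst Min_gr_iff) auto
  have m1le: "m1 * sqrt (real (J0 - 1)) \<le> \<kappa> (J0 - 1, k) * w (J0 - 1)" if "k < 2 ^ J0" for k
  proof -
    have "m1 \<le> q k" unfolding m1_def using that by (intro Min_le) auto
    then show ?thesis using J0 by (simp add: q_def le_divide_eq)
  qed
  define m0 where "m0 = min m1 (weight_u \<kappa> w J0)"
  have "m0 * sqrt (real l) \<le> \<kappa> (l, k) * w l" if lk: "(l, k) \<in> idx_inf J0" for l k
  proof -
    consider "J0 \<le> l" "k < 2 ^ l" | "l = J0 - 1" "k < 2 ^ J0" using lk J0 by (auto simp: idx_inf_iff)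
    then show ?thesis
    proof cases
      case 1
      have "m0 * sqrt (real l) \<le> weight_u \<kappa> w J0 * sqrt (real l)" by (intro mult_right_mono) (auto simp: m0_def)
      also have "\<dots> \<le> \<kappa> (l, k) * w l" using 1 by (intro weight_u_le) auto
      finally show ?thesis .
    next
      case 2
      have "m0 * sqrt (real l) \<le> m1 * sqrt (real l)" by (intro mult_right_mono) (auto simp: m0_def)
      also have "\<dots> \<le> \<kappa> (l, k) * w l" using 2 m1le by simp
      finally show ?thesis .
    qed
  qed
  moreover have "0 < m0" using m1 weight_u_pos[of J0] by (simp add: m0_def)
  ultimately show ?thesis by blast
qed

text \<open>The ratio at \<open>J - 1\<close> compares the largest weight below that level with \<open>weight_u\<close> at
  \<open>J - 1\<close>, which is at most \<open>weight_v\<close> at \<open>J\<close> because both involve level \<open>J - 1\<close>.\<close>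
lemma coarse_weights_bound:
  assumes J: "J0 + 1 \<le> J" and \<tau>: "0 \<le> \<tau>" "\<tau> \<le> weight_ratio J0 \<kappa> w (J - 1)"
  shows "weight_max J0 w (J - 1) * \<tau> \<le> weight_v J0 \<kappa> w J * sqrt (real J) / kappa_min J0 \<kappa> J"
proof -
  define J' where "J' = J - 1"
  have J': "J0 \<le> J'" "J = Suc J'" using J by (auto simp: J'_def)
  note pos = kappa_max_pos[OF J'(1)] weight_max_pos[OF J'(1)]
  have kk: "kappa_min J0 \<kappa> J \<le> kappa_max J0 \<kappa> J'"
    using kappa_min_le[OF coarse_idx] kappa_max_ge[OF coarse_idx] by (rule order_trans)
  have kp: "0 < kappa_min J0 \<kappa> J" using kappa_min_pos J by simp
  have wm: "0 \<le> weight_max J0 w J' * \<tau>" using pos \<tau> by simp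
  have fin: "finite {(l, k). J0 \<le> l \<and> l \<le> J - 1 \<and> k < (2::nat) ^ l}"
    by (rule finite_subset[OF _ finite_idx[of J0 J]]) (use J in \<open>auto simp: idx_def\<close>)
  have "weight_u \<kappa> w J' * sqrt (real J') \<le> \<kappa> (J', 0) * w J'" by (rule weight_u_le) (use J' in auto)
  then have "weight_u \<kappa> w J' \<le> \<kappa> (J', 0) * w J' / sqrt (real J')" using J' J0 by (simp add: le_divide_eq)
  also have "\<dots> \<le> weight_v J0 \<kappa> w J"
  proof -
    have bdd: "bdd_above ((\<lambda>(l, k). \<kappa> (l, k) * w l / sqrt (real l)) ` {(l, k). J0 \<le> l \<and> l \<le> J - 1 \<and> k < (2::nat) ^ l})"
      using fin by (intro bdd_above_finite finite_imageI)
    have "(J', 0) \<in> {(l, k). J0 \<le> l \<and> l \<le> J - 1 \<and> k < (2::nat) ^ l}" using J' by simp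
    from cSUP_upper[OF this bdd] show ?thesis by (simp add: weight_v_def)
  qed
  finally have uv: "weight_u \<kappa> w J' \<le> weight_v J0 \<kappa> w J" .
  have "weight_max J0 w J' * \<tau> * kappa_min J0 \<kappa> J \<le> weight_max J0 w J' * \<tau> * kappa_max J0 \<kappa> J'"
    using kk wm by (rule mult_left_mono)
  also have "\<dots> = \<tau> * (kappa_max J0 \<kappa> J' * weight_max J0 w J')" by simp
  also have "\<dots> \<le> weight_ratio J0 \<kappa> w J' * (kappa_max J0 \<kappa> J' * weight_max J0 w J')"
    using \<tau> pos by (intro mult_right_mono) (auto simp: J'_def)
  also have "\<dots> = weight_u \<kappa> w J' * sqrt (real J')" by (rule weight_u_eq[OF J'(1), symmetric])
  also have "\<dots> \<le> weight_v J0 \<kappa> w J * sqrt (real J)"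
    using uv weight_u_pos[OF J'(1)] J' by (intro mult_mono) auto
  finally show ?thesis using kp by (simp add: le_divide_eq J'_def)
qed

end

context wvd_experiment
begin

lemma weights_locale: "admissible_weights J0 \<kappa> w \<Longrightarrow> weights J0 \<kappa> w"
  using J0 \<kappa> by unfold_locales auto

text \<open>The order of magnitude of the maximum of the weighted errors.  The factor \<open>sqrt c / 2\<close> makes
  the whitened half-widths of the box at most \<open>sqrt J / 2\<close>, for which \<open>2^J * upper_tail\<close> still
  tends to infinity.\<close>
definition radius_floor :: "(nat \<Rightarrow> real) \<Rightarrow> real" where
  "radius_floor w = sqrt c / 2 * sqrt (real J) / (sqrt (real n) * (kappa_max J0 \<kappa> J * weight_max J0 w J))"

lemma radius_lower_bound:
  assumes adm: "admissible_weights J0 \<kappa> w"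
    and G: "(1 - \<alpha>) / 2 \<le> measure (gauss_measure M I) (box w R)"
    and small: "exp (- (2 ^ J * upper_tail (sqrt (real J) / 2))) < (1 - \<alpha>) / 2"
  shows "radius_floor w \<le> R"
proof (rule ccontr)
  interpret weights J0 \<kappa> w by (rule weights_locale[OF adm])
  note pos = kappa_max_pos[OF J] weight_max_pos[OF J]
  assume "\<not> radius_floor w \<le> R"
  then have "measure (gauss_measure M I) (box w R) \<le> measure (gauss_measure M I) (box w (radius_floor w))"
    using w_pos by (intro Gam.finite_measure_mono box_mono) auto
  also have "\<dots> \<le> exp (- (2 ^ J * upper_tail (sqrt (real J) / 2)))"
  proof (rule gauss_box_small[OF _ w_pos])
    show "0 \<le> radius_floor w" using pos c by (simp add: radius_floor_def)
    fix i assume i: "i \<in> I"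
    define z where "z = kappa_max J0 \<kappa> J * weight_max J0 w J"
    have z: "0 < z" using pos by (simp add: z_def)
    have ii: "(fst i, snd i) \<in> I" using i by simp
    have lev: "J0 - 1 \<le> fst i" "fst i \<le> J - 1" using ii J by (auto simp: idx_def)
    have "\<kappa> i * w (fst i) \<le> z"
      unfolding z_def using kappa_max_ge[OF i] weight_max_ge[OF lev] pos w_pos[OF level_pos[OF I_inf[OF ii]]]
      by (intro mult_mono) auto
    then have q: "\<kappa> i * w (fst i) / z \<le> 1" using z by simp
    have "sqrt (real n / c) * \<kappa> i * w (fst i) * radius_floor w = sqrt (real J) / 2 * (\<kappa> i * w (fst i) / z)"
      using c n by (simp add: radius_floor_def z_def[symmetric] real_sqrt_divide)
    also have "\<dots> \<le> sqrt (real J) / 2 * 1" by (intro mult_left_mono q) simp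
    finally show "sqrt (real n / c) * \<kappa> i * w (fst i) * radius_floor w \<le> sqrt (real J) / 2" by simp
  qed
  finally show False using G small by simp
qed

text \<open>For good data the bounds \<open>w l * Rhat Y\<close> are at least \<open>w l * radius_floor w\<close>.  By the
  definition of \<open>weight_u\<close>, this is at level \<open>l\<close> at least \<open>sqrt c / 2 * weight_ratio * sqrt l\<close> in
  units of \<open>1 / (sqrt n * \<kappa>)\<close>, as the union bound requires.\<close>
lemma high_frequency_tail:
  assumes adm: "admissible_weights J0 \<kappa> w" and Rm: "Rhat \<in> borel_measurable P"
    and C1: "0 < C1" and R: "\<And>Y. Y \<in> good (radius C1) \<Longrightarrow> radius_floor w \<le> Rhat Y"
    and a: "4 \<le> c * (weight_ratio J0 \<kappa> w J)\<^sup>2 / (16 * C)"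
  shows "measure P (space P - high_freq_event J \<psi> \<kappa> v1 w P f0 Rhat)
    \<le> 6 * exp (- (c * (weight_ratio J0 \<kappa> w J)\<^sup>2 / (16 * C)) * real J / 2) + tiny"
proof -
  interpret weights J0 \<kappa> w by (rule weights_locale[OF adm])
  interpret PP: prob_space P by (rule prob_space_P)
  define H3 where "H3 = high_freq_event J \<psi> \<kappa> v1 w P f0 Rhat"
  have H3[measurable]: "H3 \<in> sets P" unfolding H3_def by (rule high_freq_event_sets[OF w_pos Rm])
  note pos = kappa_max_pos[OF J] weight_max_pos[OF J]
  define \<rho> where "\<rho> = weight_ratio J0 \<kappa> w J"
  have \<rho>: "1 \<le> \<rho>" unfolding \<rho>_def by (rule ratio_ge_1[OF J])
  define x where "x = sqrt c / 2 * \<rho>"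
  define K where "K = {(l, k). J \<le> l \<and> k < (2::nat) ^ l}"
  have ax: "c * \<rho>\<^sup>2 / (16 * C) = x\<^sup>2 / (4 * C)" using c by (simp add: x_def power_mult_distrib power_divide)
  have KI: "(l, k) \<in> idx_inf J0 \<and> J \<le> l" if "(l, k) \<in> K" for l k
    using that by (simp add: K_def idx_inf_split)
  have "\<exists>E\<in>sets P. {Y \<in> space P. \<exists>l k. (l, k) \<in> K \<and> w l * radius_floor w < \<bar>err Y (l, k)\<bar>} \<subseteq> E \<and>
    measure P E \<le> 6 * exp (- (c * \<rho>\<^sup>2 / (16 * C)) * real J / 2)"
  proof (rule prob_large_err[OF KI _ _ ax])
    show "0 \<le> x" using c \<rho> by (simp add: x_def)
    show "4 \<le> c * \<rho>\<^sup>2 / (16 * C)" using a by (simp add: \<rho>_def)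
    fix l k assume lk: "(l, k) \<in> K"
    have "x * sqrt (real l) = sqrt c / 2 * (weight_u \<kappa> w J * sqrt (real J)) / (kappa_max J0 \<kappa> J * weight_max J0 w J) * sqrt (real l)"
      using pos unfolding weight_u_eq[OF J] by (simp add: x_def \<rho>_def)
    also have "\<dots> = sqrt c / 2 * sqrt (real J) / (kappa_max J0 \<kappa> J * weight_max J0 w J) * (weight_u \<kappa> w J * sqrt (real l))"
      by simp
    also have "\<dots> \<le> sqrt c / 2 * sqrt (real J) / (kappa_max J0 \<kappa> J * weight_max J0 w J) * (\<kappa> (l, k) * w l)"
      using lk pos c by (intro mult_left_mono weight_u_le[OF J]) (auto simp: K_def)
    also have "\<dots> = sqrt (real n) * \<kappa> (l, k) * (w l * radius_floor w)"
      using n by (simp add: radius_floor_def)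
    finally show "x * sqrt (real l) \<le> sqrt (real n) * \<kappa> (l, k) * (w l * radius_floor w)" .
  qed
  then obtain E where E[measurable]: "E \<in> sets P"
    and Es: "{Y \<in> space P. \<exists>l k. (l, k) \<in> K \<and> w l * radius_floor w < \<bar>err Y (l, k)\<bar>} \<subseteq> E"
    and Ep: "measure P E \<le> 6 * exp (- (c * \<rho>\<^sup>2 / (16 * C)) * real J / 2)" by blast
  have "space P - H3 \<subseteq> E \<union> (space P - good (radius C1))"
  proof
    fix Y assume Y: "Y \<in> space P - H3"
    have h: "Y \<in> H3 \<longleftrightarrow> Y \<in> space P \<and> (\<forall>l k. J \<le> l \<and> k < 2 ^ l \<longrightarrow> \<bar>err Y (l, k)\<bar> \<le> w l * Rhat Y)"
      unfolding H3_def using w_pos by (rule high_freq_event_iff)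
    show "Y \<in> E \<union> (space P - good (radius C1))"
    proof (cases "Y \<in> good (radius C1)")
      case True
      obtain l k where lk: "J \<le> l" "k < 2 ^ l" "w l * Rhat Y < \<bar>err Y (l, k)\<bar>" using Y h by force
      have "0 < w l" using lk J J0 by (intro w_pos) simp
      then have "w l * radius_floor w \<le> w l * Rhat Y" using R[OF True] by simp
      then have "w l * radius_floor w < \<bar>err Y (l, k)\<bar>" using lk(3) by linarith
      moreover have "(l, k) \<in> K" using lk by (simp add: K_def)
      ultimately have "Y \<in> {Y \<in> space P. \<exists>l k. (l, k) \<in> K \<and> w l * radius_floor w < \<bar>err Y (l, k)\<bar>}"
        using Y by blast
      then show ?thesis using Es by blast
    qed (use Y in auto)
  qed
  then have "measure P (space P - H3) \<le> measure P (E \<union> (space P - good (radius C1)))"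
    by (rule PP.finite_measure_mono) measurable
  also have "\<dots> \<le> measure P E + measure P (space P - good (radius C1))" by (intro measure_Un_le) auto
  also have "\<dots> \<le> 6 * exp (- (c * \<rho>\<^sup>2 / (16 * C)) * real J / 2) + tiny"
    by (intro add_mono Ep prob_not_good_tiny[OF C1])
  finally show ?thesis by (simp only: H3_def \<rho>_def)
qed

section \<open>Diameter of the band\<close>

text \<open>The split is at level \<open>J - 1\<close> instead of \<open>J\<close>, since \<open>coarse_weights_bound\<close> concerns the
  levels below it.  Leaving one more level to the Besov ball costs a factor \<open>2 powr s\<close>.\<close>
lemma band_diameter:
  assumes adm: "admissible_weights J0 \<kappa> w" and JJ: "J0 + 1 \<le> J" and s: "0 < s" and B: "0 < B"
    and lev: "\<And>x l. x \<in> {0..1} \<Longrightarrow> (\<Sum>k | (l, k) \<in> idx_inf J0. \<bar>\<psi> (l, k) x\<bar>) \<le> D * 2 powr (real (Suc l) / 2)"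
    and D: "0 < D" and R: "R \<le> \<tau> / sqrt (real n)"
    and \<tau>: "0 \<le> \<tau>" "\<tau> \<le> weight_ratio J0 \<kappa> w (J - 1)"
    and f: "f \<in> band J0 \<psi> w a R" "besov_norm s J0 \<psi> f \<le> ereal B"
    and g: "g \<in> band J0 \<psi> w a R" "besov_norm s J0 \<psi> g \<le> ereal B"
  shows "Linf_norm (\<lambda>x. f x - g x) \<le> ereal (8 * D * (weight_v J0 \<kappa> w J
      * sqrt (2 ^ J * real J / ((kappa_min J0 \<kappa> J)\<^sup>2 * real n)))
    + 4 * D * 2 powr s / (1 - 2 powr (- s)) * (2 powr (- real J * s) * B))"
proof -
  interpret weights J0 \<kappa> w by (rule weights_locale[OF adm])
  have fL: "f \<in> L2" and gL: "g \<in> L2" using f g by (auto simp: band_def)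
  have band: "\<bar>ip h (\<psi> (l, k)) - a (l, k)\<bar> \<le> w l * R" if "h \<in> band J0 \<psi> w a R" "(l, k) \<in> idx_inf J0" for h l k
    using that w_pos by (subst (asm) band_iff) auto
  have \<psi>L: "\<psi> (l, k) \<in> L2" if "(l, k) \<in> idx_inf J0" for l k
    using onb that by (auto simp: orthonormal_basis_on_def)
  define W where "W = weight_max J0 w (J - 1)"
  have W: "0 < W" unfolding W_def using JJ by (intro weight_max_pos) simp
  define \<omega> where "\<omega> = W * \<tau> / sqrt (real n)"
  have "Linf_norm (\<lambda>x. f x - g x) \<le> ereal (8 * D * (\<omega> * 2 powr (real J / 2))
    + 4 * D * 2 powr s / (1 - 2 powr (- s)) * (2 powr (- real J * s) * B))"
  proof (rule besov_section_bound[OF onb _ lev _ L2_diff[OF fL gL] s])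
    show "1 \<le> J0" "1 \<le> J" "0 \<le> D" "0 \<le> \<omega>" "0 \<le> B" using J0 J D B W \<tau> by (auto simp: \<omega>_def)
    fix l k assume lk: "(l, k) \<in> idx_inf J0"
    have d: "\<bar>ip (\<lambda>x. f x - g x) (\<psi> (l, k))\<bar> \<le> \<bar>ip f (\<psi> (l, k))\<bar> + \<bar>ip g (\<psi> (l, k))\<bar>"
      "\<bar>ip (\<lambda>x. f x - g x) (\<psi> (l, k))\<bar> \<le> \<bar>ip f (\<psi> (l, k)) - a (l, k)\<bar> + \<bar>ip g (\<psi> (l, k)) - a (l, k)\<bar>"
      unfolding ip_diff[OF fL gL \<psi>L[OF lk]] by linarith+
    {
      assume l: "l < J - 1"
      have "J0 - 1 \<le> l" using lk J0 by (auto simp: idx_inf_iff)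
      then have "w l \<le> W" unfolding W_def using l by (intro weight_max_ge) auto
      moreover have wl: "0 < w l" by (rule w_pos[OF level_pos[OF lk]])
      moreover have "w l * R \<le> w l * (\<tau> / sqrt (real n))" using wl by (intro mult_left_mono R) simp
      moreover have "w l * (\<tau> / sqrt (real n)) \<le> W * (\<tau> / sqrt (real n))"
        using \<open>w l \<le> W\<close> \<tau> by (intro mult_right_mono) auto
      ultimately have "w l * R \<le> \<omega>" by (simp add: \<omega>_def)
      then show "\<bar>ip (\<lambda>x. f x - g x) (\<psi> (l, k))\<bar> \<le> 2 * \<omega>"
        using d(2) band[OF f(1) lk] band[OF g(1) lk] by linarith
    }
    {
      assume l: "J - 1 \<le> l"
      then have "J0 \<le> l" "k < 2 ^ l" using JJ lk J0 by (auto simp: idx_inf_iff)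
      then show "\<bar>ip (\<lambda>x. f x - g x) (\<psi> (l, k))\<bar> \<le> 2 * B * 2 powr (- real l * (s + 1 / 2))"
        using d(1) besov_norm_coefficients[OF f(2)] besov_norm_coefficients[OF g(2)] by fastforce
    }
  qed
  also have "ereal (8 * D * (\<omega> * 2 powr (real J / 2)) + 4 * D * 2 powr s / (1 - 2 powr (- s)) * (2 powr (- real J * s) * B))
    \<le> ereal (8 * D * (weight_v J0 \<kappa> w J * sqrt (2 ^ J * real J / ((kappa_min J0 \<kappa> J)\<^sup>2 * real n)))
    + 4 * D * 2 powr s / (1 - 2 powr (- s)) * (2 powr (- real J * s) * B))"
  proof -
    have kp: "0 < kappa_min J0 \<kappa> J" by (rule kappa_min_pos[OF J])
    have "\<omega> * 2 powr (real J / 2) \<le> weight_v J0 \<kappa> w J * sqrt (real J) / kappa_min J0 \<kappa> J / sqrt (real n) * 2 powr (real J / 2)"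
      unfolding \<omega>_def W_def using coarse_weights_bound[OF JJ \<tau>] by (intro mult_right_mono divide_right_mono) auto
    also have "\<dots> = weight_v J0 \<kappa> w J * sqrt (2 ^ J * real J / ((kappa_min J0 \<kappa> J)\<^sup>2 * real n))"
    proof -
      have "2 powr (real J / 2) = sqrt (2 ^ J)"
        by (simp add: powr_realpow[symmetric] powr_half_sqrt[symmetric] powr_powr)
      then show ?thesis using kp by (simp add: real_sqrt_mult real_sqrt_divide)
    qed
    finally show ?thesis using D by simp
  qed
  finally show ?thesis .
qed

end

section \<open>Level thresholds\<close>

text \<open>The tail at \<open>sqrt J / 2\<close> is of order at least \<open>exp (- J / 4)\<close>, because
  \<open>(t + 1)\<^sup>2 / 2 \<le> t\<^sup>2 + 1\<close>, and \<open>2 ^ J \<ge> exp (J / 2)\<close>.\<close>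
lemma exponential_tail_vanishes:
  assumes "0 < (\<delta>::real)"
  shows "eventually (\<lambda>J. exp (- (2 ^ J * upper_tail (sqrt (real J) / 2))) < \<delta>) sequentially"
proof -
  define k where "k = exp (- 1) / sqrt (2 * pi)"
  have k: "0 < k" by (simp add: k_def)
  have lb: "k * (real J / 4) \<le> 2 ^ J * upper_tail (sqrt (real J) / 2)" for J
  proof -
    define t where "t = sqrt (real J) / 2"
    have t: "0 \<le> t" "t\<^sup>2 = real J / 4" by (auto simp: t_def power_divide)
    have "(t + 1)\<^sup>2 / 2 \<le> t\<^sup>2 + 1"
    proof -
      have "0 \<le> (t - 1)\<^sup>2" by simp
      then show ?thesis by (simp add: power2_eq_square algebra_simps)
    qed
    then have "exp (- (real J / 4) - 1) \<le> exp (- ((t + 1)\<^sup>2 / 2))" using t by simp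
    then have q: "exp (- (real J / 4) - 1) / sqrt (2 * pi) \<le> upper_tail t"
      using t by (simp add: upper_tail_def normal_density_def divide_right_mono)
    have "exp (1 / 2 :: real) ^ J \<le> 2 ^ J"
    proof (intro power_mono)
      have "exp (1 / 2 :: real) ^ 2 = exp 1" by (simp add: exp_of_nat_mult[symmetric])
      also have "\<dots> \<le> 2\<^sup>2" using exp_le by simp
      finally show "exp (1 / 2 :: real) \<le> 2" by (rule power2_le_imp_le) simp
    qed simp
    then have e: "exp (real J / 2) \<le> 2 ^ J" by (simp add: exp_of_nat_mult[symmetric])
    have "real J / 4 \<le> exp (real J / 4)" using exp_ge_add_one_self[of "real J / 4"] by linarith
    then have "k * (real J / 4) \<le> k * exp (real J / 4)" using k by (intro mult_left_mono) auto
    also have "\<dots> = exp (real J / 2) * (exp (- (real J / 4) - 1) / sqrt (2 * pi))"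
      by (simp add: k_def exp_add[symmetric])
    also have "\<dots> \<le> 2 ^ J * upper_tail t" using e q by (intro mult_mono) auto
    finally show ?thesis by (simp add: t_def)
  qed
  have "((\<lambda>J. exp (- (k * (real J / 4)))) \<longlongrightarrow> 0) sequentially"
  proof -
    have "exp (- (k * (real J / 4))) = exp (- (k / 4)) ^ J" for J
      by (simp add: exp_of_nat_mult[symmetric] mult.commute)
    moreover have "(\<lambda>J. exp (- (k / 4)) ^ J) \<longlonglongrightarrow> 0" using k by (intro LIMSEQ_power_zero) simp
    ultimately show ?thesis by simp
  qed
  then have "eventually (\<lambda>J. exp (- (k * (real J / 4))) < \<delta>) sequentially"
    using assms by (rule order_tendstoD(2))
  then show ?thesis
  proof eventually_elim
    case (elim J)
    then show ?case using lb[of J] by (smt (verit) exp_le_cancel_iff)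
  qed
qed

text \<open>What "sufficiently large" has to ensure for the level.  The numbers \<open>\<tau>\<close> and \<open>m0\<close> come first,
  from the union bound at probability \<open>\<alpha> / 2\<close>; the threshold \<open>N\<close> then depends on the divergence
  of the ratio.\<close>
lemma (in weights) level_thresholds:
  assumes \<alpha>: "0 < \<alpha>" "\<alpha> < 1" and cC: "0 < (c::real)" "0 < C"
  shows "\<exists>N \<tau> m0. 0 \<le> \<tau> \<and> 0 < m0 \<and> (\<forall>l k. (l, k) \<in> idx_inf J0 \<longrightarrow> m0 * sqrt (real l) \<le> \<kappa> (l, k) * w l) \<and>
    4 \<le> (m0 * \<tau>)\<^sup>2 / (4 * C) \<and> 6 * exp (- ((m0 * \<tau>)\<^sup>2 / (4 * C)) / 2) < \<alpha> / 2 \<and>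
    (\<forall>J\<ge>N. J0 + 1 \<le> J \<and> \<tau> \<le> weight_ratio J0 \<kappa> w (J - 1) \<and>
      4 \<le> c * (weight_ratio J0 \<kappa> w J)\<^sup>2 / (16 * C) \<and>
      exp (- (2 ^ J * upper_tail (sqrt (real J) / 2))) < (1 - \<alpha>) / 2)"
proof -
  obtain m0 where m0: "0 < m0" "\<forall>l k. (l, k) \<in> idx_inf J0 \<longrightarrow> m0 * sqrt (real l) \<le> \<kappa> (l, k) * w l"
    using uniform_lower_weight by blast
  define y where "y = max 4 (1 + 2 * ln (12 / \<alpha>))"
  define \<tau> where "\<tau> = sqrt (4 * C * y) / m0"
  have y: "4 \<le> y" "2 * ln (12 / \<alpha>) < y" by (auto simp: y_def)
  have my: "(m0 * \<tau>)\<^sup>2 / (4 * C) = y" using m0 cC y by (simp add: \<tau>_def)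
  have "exp (- y / 2) < exp (- ln (12 / \<alpha>))" using y by simp
  also have "\<dots> = \<alpha> / 12" using \<alpha> by (simp add: exp_minus)
  finally have ey: "6 * exp (- y / 2) < \<alpha> / 2" by simp
  have "eventually (\<lambda>J. J0 + 1 \<le> J) sequentially" by (rule eventually_ge_at_top)
  moreover have "eventually (\<lambda>J. \<tau> \<le> weight_ratio J0 \<kappa> w (J - 1)) sequentially"
  proof -
    have "filterlim (\<lambda>J. weight_ratio J0 \<kappa> w (J - 1)) at_top sequentially"
      by (rule filterlim_compose[OF ratio_at_top]) (rule filterlim_minus_const_nat_at_top)
    then show ?thesis by (simp add: filterlim_at_top)
  qed
  moreover have "eventually (\<lambda>J. 4 \<le> c * (weight_ratio J0 \<kappa> w J)\<^sup>2 / (16 * C)) sequentially"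
  proof -
    have "eventually (\<lambda>J. sqrt (64 * C / c) \<le> weight_ratio J0 \<kappa> w J) sequentially"
      using ratio_at_top by (simp add: filterlim_at_top)
    then show ?thesis
    proof eventually_elim
      case (elim J)
      have "64 * C / c = (sqrt (64 * C / c))\<^sup>2" using cC by simp
      also have "\<dots> \<le> (weight_ratio J0 \<kappa> w J)\<^sup>2" using elim cC by (intro power_mono) auto
      finally show ?case using cC by (simp add: field_simps)
    qed
  qed
  moreover have "eventually (\<lambda>J. exp (- (2 ^ J * upper_tail (sqrt (real J) / 2))) < (1 - \<alpha>) / 2) sequentially"
    using \<alpha> by (intro exponential_tail_vanishes) simp
  ultimately have "eventually (\<lambda>J. J0 + 1 \<le> J \<and> \<tau> \<le> weight_ratio J0 \<kappa> w (J - 1) \<and>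
      4 \<le> c * (weight_ratio J0 \<kappa> w J)\<^sup>2 / (16 * C) \<and>
      exp (- (2 ^ J * upper_tail (sqrt (real J) / 2))) < (1 - \<alpha>) / 2) sequentially"
    by eventually_elim blast
  then obtain N where "\<forall>J\<ge>N. J0 + 1 \<le> J \<and> \<tau> \<le> weight_ratio J0 \<kappa> w (J - 1) \<and>
      4 \<le> c * (weight_ratio J0 \<kappa> w J)\<^sup>2 / (16 * C) \<and>
      exp (- (2 ^ J * upper_tail (sqrt (real J) / 2))) < (1 - \<alpha>) / 2"
    unfolding eventually_sequentially by blast
  moreover have "0 \<le> \<tau>" using m0 cC y by (simp add: \<tau>_def)
  ultimately show ?thesis using m0 my y ey by (intro exI[of _ N] exI[of _ \<tau>] exI[of _ m0]) simp
qed

theorem proposition3p3: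
  fixes s :: real and S J0 :: nat
    and \<psi> v1 v2 :: "nat \<times> nat \<Rightarrow> real \<Rightarrow> real"
    and \<kappa> :: "nat \<times> nat \<Rightarrow> real"
    and K :: "(real \<Rightarrow> real) \<Rightarrow> real \<Rightarrow> real"
  assumes "0 < s" "s < real S"
    and "cdv_wavelet_basis S J0 \<psi>"
    and "wvd J0 \<psi> K v1 v2 \<kappa>"
  shows "\<exists>(c1 :: real \<Rightarrow> real) (c2 :: real \<Rightarrow> real) (c3 :: real \<Rightarrow> real) (c4 :: real \<Rightarrow> real)
            (Jmin :: real \<Rightarrow> (nat \<Rightarrow> real) \<Rightarrow> nat).
    (\<forall>C1>0. 0 < c1 C1 \<and> 0 < c2 C1) \<and>
    (\<forall>\<alpha>. 0 < \<alpha> \<and> \<alpha> < 1 \<longrightarrow> 0 < c3 \<alpha> \<and> 0 < c4 \<alpha>) \<and>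
    (\<forall>C1 \<alpha> w (n :: nat) J f0 Q P X \<beta>0 \<pi> Rhat H3.
       0 < C1 \<longrightarrow> 0 < \<alpha> \<longrightarrow> \<alpha> < 1 \<longrightarrow> J0 \<le> J \<longrightarrow> 2 ^ J \<le> n \<longrightarrow>
       f0 \<in> besov s J0 \<psi> \<longrightarrow> admissible_weights J0 \<kappa> w \<longrightarrow>
       white_noise Q \<longrightarrow> P = obs_law n (K f0) Q \<longrightarrow>
       X = design J0 J \<kappa> v1 P \<longrightarrow> \<beta>0 = true_coefs J0 J \<psi> f0 \<longrightarrow>
       prior_density J0 J \<pi> \<longrightarrow>
       credible_radius J0 J \<psi> \<kappa> v1 w P \<pi> \<alpha> Rhat \<longrightarrow>
       H3 = high_freq_event J \<psi> \<kappa> v1 w P f0 Rhat \<longrightarrow>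
       \<pi> \<beta>0 \<ge> sqrt (Determinant.det (transpose_mat X * X)) * real n powr (- C1 * 2 ^ J) \<longrightarrow>
       prior_flatness J0 J X \<beta>0 \<pi> (1 / sqrt (real n)) \<le> 1 / 2 \<longrightarrow>
       (2 \<le> n \<longrightarrow>
          \<bar>measure P {Y \<in> space P. f0 \<in> band J0 \<psi> w (fhat_coef \<kappa> v1 Y) (Rhat Y)} - (1 - \<alpha>)\<bar>
            \<le> prior_flatness J0 J X \<beta>0 \<pi> (c1 C1 * sqrt (2 ^ J * ln (real n)))
              + c1 C1 * real n powr (- c2 C1 * 2 ^ J) + measure P (space P - H3)) \<and>
       (prior_flatness J0 J X \<beta>0 \<pi> (c1 C1 * sqrt (2 ^ J * ln (real n)))
          + c1 C1 * real n powr (- c2 C1 * 2 ^ J) < min (\<alpha> / 2) ((1 - \<alpha>) / 2) \<longrightarrow>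
        Jmin \<alpha> w \<le> J \<longrightarrow>
          measure P (space P - H3)
            \<le> c3 \<alpha> * (exp (- c4 \<alpha> * real J * (real J / (kappa_max J0 \<kappa> J * weight_max J0 w J)\<^sup>2)
                              * (weight_u \<kappa> w J)\<^sup>2)
                       + real n powr (- c2 C1 * 2 ^ J)) \<and>
          (\<forall>B>0. \<exists>E\<in>sets P. measure P E \<ge> 1 - c1 C1 * real n powr (- c2 C1 * 2 ^ J) \<and>
             (\<forall>Y\<in>E. \<forall>C. C = band J0 \<psi> w (fhat_coef \<kappa> v1 Y) (Rhat Y) \<inter>
                              {f. besov_norm s J0 \<psi> f \<le> ereal B} \<longrightarrow>
                (SUP f\<in>C. SUP g\<in>C. Linf_norm (\<lambda>x. f x - g x))
                  \<le> ereal (c3 \<alpha> * (weight_v J0 \<kappa> w J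
                                     * sqrt (2 ^ J * real J / ((kappa_min J0 \<kappa> J)\<^sup>2 * real n))
                                   + 2 powr (- real J * s) * B))))))"
proof -
  have J0: "2 \<le> J0" using assms(3) unfolding cdv_wavelet_basis_def by blast
  have onb: "orthonormal_basis_on (idx_inf J0) \<psi>" using assms(3) unfolding cdv_wavelet_basis_def by blast
  have "1 \<le> S" using assms(1,2) by (cases S) auto
  from cdv_level_bound[OF assms(3) this] obtain D where D: "0 < D"
    and lev: "\<And>x l. x \<in> {0..1} \<Longrightarrow> (\<Sum>k | (l, k) \<in> idx_inf J0. \<bar>\<psi> (l, k) x\<bar>) \<le> D * 2 powr (real (Suc l) / 2)"
    by blast
  have v1: "\<And>i. i \<in> idx_inf J0 \<Longrightarrow> v1 i \<in> L2" and \<kappa>: "\<And>i. i \<in> idx_inf J0 \<Longrightarrow> 0 < \<kappa> i"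
    and vag: "\<And>i f. i \<in> idx_inf J0 \<Longrightarrow> f \<in> L2 \<Longrightarrow> ip (v1 i) (K f) = \<kappa> i * ip f (\<psi> i)"
    and no: "near_orthogonal (idx_inf J0) v1"
    using assms(4) unfolding wvd_def by blast+
  obtain c C where cC: "0 < c" "0 < C" and near: "\<forall>F a. finite F \<and> F \<subseteq> idx_inf J0 \<longrightarrow>
        c * (\<Sum>i\<in>F. (a i)\<^sup>2) \<le> (L2norm (\<lambda>x. \<Sum>i\<in>F. a i * v1 i x))\<^sup>2 \<and>
        (L2norm (\<lambda>x. \<Sum>i\<in>F. a i * v1 i x))\<^sup>2 \<le> C * (\<Sum>i\<in>F. (a i)\<^sup>2)"
    using no unfolding near_orthogonal_def by (elim exE conjE) (rule that)
  define D2 where "D2 = 4 * D * 2 powr s / (1 - 2 powr (- s))"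
  have s1: "2 powr (- s) < 1" using assms(1) by (simp add: powr_less_one)
  have D2: "0 \<le> D2" using D s1 by (simp add: D2_def)
  \<comment> \<open>The constant \<open>c1\<close> is both the factor in the radius and, being at least 4, a factor of
      \<open>n powr (- 2^J)\<close> that absorbs all terms of this order.\<close>
  define c1 where "c1 C1 = 8 * sqrt (C1 + 4)" for C1 :: real
  define c2 where "c2 C1 = (1 :: real)" for C1 :: real
  define c3 where "c3 \<alpha> = 6 + 8 * D + D2" for \<alpha> :: real
  define c4 where "c4 \<alpha> = c / (32 * C)" for \<alpha> :: real
  define good_level where "good_level \<alpha> w N \<longleftrightarrow> (\<exists>\<tau> m0. 0 \<le> \<tau> \<and> 0 < m0 \<and>
    (\<forall>l k. (l, k) \<in> idx_inf J0 \<longrightarrow> m0 * sqrt (real l) \<le> \<kappa> (l, k) * w l) \<and>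
    4 \<le> (m0 * \<tau>)\<^sup>2 / (4 * C) \<and> 6 * exp (- ((m0 * \<tau>)\<^sup>2 / (4 * C)) / 2) < \<alpha> / 2 \<and>
    (\<forall>J\<ge>N. J0 + 1 \<le> J \<and> \<tau> \<le> weight_ratio J0 \<kappa> w (J - 1) \<and>
      4 \<le> c * (weight_ratio J0 \<kappa> w J)\<^sup>2 / (16 * C) \<and>
      exp (- (2 ^ J * upper_tail (sqrt (real J) / 2))) < (1 - \<alpha>) / 2))" for \<alpha> w N
  \<comment> \<open>The threshold is chosen for each weight sequence before \<open>n\<close>, the prior and the data; the
      existence of \<open>N\<close> is known only for admissible weights.\<close>
  define Jmin where "Jmin \<alpha> w = (SOME N. good_level \<alpha> w N)" for \<alpha> w
  have c1: "0 < c1 C1" "4 \<le> c1 C1" if "0 < C1" for C1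
  proof -
    have "2 \<le> sqrt (C1 + 4)" using that by (intro real_le_rsqrt) simp
    then show "0 < c1 C1" "4 \<le> c1 C1" using that by (auto simp: c1_def)
  qed
  show ?thesis
  proof (rule exI[of _ c1], rule exI[of _ c2], rule exI[of _ c3], rule exI[of _ c4], rule exI[of _ Jmin],
      intro conjI allI impI)
    show "0 < c1 C1" "0 < c2 C1" if "0 < C1" for C1 using c1[OF that] by (auto simp: c2_def)
    show "0 < c3 \<alpha>" "0 < c4 \<alpha>" if "0 < \<alpha> \<and> \<alpha> < 1" for \<alpha>
      using D D2 cC by (auto simp: c3_def c4_def)
  next
    fix C1 \<alpha> w and n J :: nat and f0 Q P X \<beta>0 \<pi> Rhat H3
    assume C1: "0 < C1" and \<alpha>: "0 < \<alpha>" "\<alpha> < 1" and J: "J0 \<le> J" "2 ^ J \<le> n"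
      and f0: "f0 \<in> besov s J0 \<psi>" and adm: "admissible_weights J0 \<kappa> w"
      and Q: "white_noise Q" and P: "P = obs_law n (K f0) Q"
      and X: "X = design J0 J \<kappa> v1 P" and \<beta>0: "\<beta>0 = true_coefs J0 J \<psi> f0"
      and prior: "prior_density J0 J \<pi>" and cred: "credible_radius J0 J \<psi> \<kappa> v1 w P \<pi> \<alpha> Rhat"
      and H3: "H3 = high_freq_event J \<psi> \<kappa> v1 w P f0 Rhat"
      and mass: "sqrt (Determinant.det (transpose_mat X * X)) * real n powr (- C1 * 2 ^ J) \<le> \<pi> \<beta>0"
      and flat: "prior_flatness J0 J X \<beta>0 \<pi> (1 / sqrt (real n)) \<le> 1 / 2"
    have fL: "f0 \<in> L2" using f0 by (simp add: besov_def)
    have npos: "0 < n" using J(2) by (metis less_le_trans zero_less_numeral zero_less_power)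
    interpret wn: white_noise_law Q by unfold_locales (rule Q)
    interpret E: wvd_experiment Q n "K f0" J0 J \<psi> v1 \<kappa> f0 c C
      by unfold_locales (fact npos J0 J onb v1 \<kappa> cC vag[OF _ fL] fL near[rule_format, OF conjI])+
    interpret W: weights J0 \<kappa> w by (rule E.weights_locale[OF adm])
    note cred' = cred[unfolded P] and mass' = mass[unfolded X P \<beta>0]
      and flat' = flat[unfolded X P \<beta>0]
    have rad: "c1 C1 * sqrt (2 ^ J * ln (real n)) = E.radius C1" by (simp add: c1_def E.radius_def)
    have tiny: "real n powr (- c2 C1 * 2 ^ J) = E.tiny" by (simp add: c2_def)
    have tiny4: "4 * E.tiny \<le> c1 C1 * E.tiny" using c1(2)[OF C1] by (intro mult_right_mono) auto
    have tiny0: "0 \<le> E.tiny" by simp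
    define \<phi> where "\<phi> = prior_flatness J0 J X \<beta>0 \<pi> (c1 C1 * sqrt (2 ^ J * ln (real n)))"
    have \<phi>: "\<phi> = prior_flatness J0 J E.X E.\<beta>0 \<pi> (E.radius C1)" by (simp add: \<phi>_def rad X P \<beta>0)
    show "\<bar>measure P {Y \<in> space P. f0 \<in> band J0 \<psi> w (fhat_coef \<kappa> v1 Y) (Rhat Y)} - (1 - \<alpha>)\<bar>
            \<le> prior_flatness J0 J X \<beta>0 \<pi> (c1 C1 * sqrt (2 ^ J * ln (real n)))
              + c1 C1 * real n powr (- c2 C1 * 2 ^ J) + measure P (space P - H3)"
    proof -
      have "\<bar>measure P {Y \<in> space P. f0 \<in> band J0 \<psi> w (fhat_coef \<kappa> v1 Y) (Rhat Y)} - (1 - \<alpha>)\<bar>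
          \<le> \<phi> + 4 * E.tiny + measure P (space P - H3)"
        unfolding \<phi> H3 P by (rule E.coverage[OF C1 \<alpha> prior mass' flat' W.w_pos cred'])
      then show ?thesis using tiny4 unfolding \<phi>_def[symmetric] tiny by linarith
    qed
    assume small: "prior_flatness J0 J X \<beta>0 \<pi> (c1 C1 * sqrt (2 ^ J * ln (real n)))
          + c1 C1 * real n powr (- c2 C1 * 2 ^ J) < min (\<alpha> / 2) ((1 - \<alpha>) / 2)"
      and Jm: "Jmin \<alpha> w \<le> J"
    have "\<exists>N. good_level \<alpha> w N"
      unfolding good_level_def using W.level_thresholds[OF \<alpha> cC] by blast
    then have "good_level \<alpha> w (Jmin \<alpha> w)" unfolding Jmin_def by (rule someI_ex)
    then obtain \<tau> m0 where \<tau>: "0 \<le> \<tau>" and m0: "0 < m0"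
      "\<And>l k. (l, k) \<in> idx_inf J0 \<Longrightarrow> m0 * sqrt (real l) \<le> \<kappa> (l, k) * w l"
      and a: "4 \<le> (m0 * \<tau>)\<^sup>2 / (4 * C)" "6 * exp (- ((m0 * \<tau>)\<^sup>2 / (4 * C)) / 2) < \<alpha> / 2"
      and JJ: "J0 + 1 \<le> J" "\<tau> \<le> weight_ratio J0 \<kappa> w (J - 1)"
        "4 \<le> c * (weight_ratio J0 \<kappa> w J)\<^sup>2 / (16 * C)"
        "exp (- (2 ^ J * upper_tail (sqrt (real J) / 2))) < (1 - \<alpha>) / 2"
      unfolding good_level_def using Jm by blast
    have sm: "\<phi> + 3 * E.tiny < \<alpha> / 2" "\<phi> + 3 * E.tiny < (1 - \<alpha>) / 2"
      using small tiny4 tiny0 unfolding \<phi>_def[symmetric] tiny by linarith+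
    have close: "\<bar>measure (gauss_measure E.M E.I) (E.box w (Rhat Y)) - (1 - \<alpha>)\<bar> \<le> \<phi> + 3 * E.tiny"
      if "Y \<in> E.good (E.radius C1)" for Y
      unfolding \<phi> by (rule E.credible_close[OF C1 prior mass' flat' W.w_pos cred' that])
    have Rlow: "E.radius_floor w \<le> Rhat Y" if "Y \<in> E.good (E.radius C1)" for Y
    proof (rule E.radius_lower_bound[OF adm _ JJ(4)])
      show "(1 - \<alpha>) / 2 \<le> measure (gauss_measure E.M E.I) (E.box w (Rhat Y))"
        using close[OF that] sm by (simp add: abs_le_iff) 
    qed
    have Rup: "Rhat Y < \<tau> / sqrt (real n)" if "Y \<in> E.good (E.radius C1)" for Y
    proof (rule E.radius_upper_bound[OF W.w_pos _ \<tau> m0 a])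
      show "measure (gauss_measure E.M E.I) (E.box w (Rhat Y)) < 1 - \<alpha> / 2"
        using close[OF that] sm by linarith
    qed
    have c3: "6 \<le> c3 \<alpha>" "8 * D \<le> c3 \<alpha>" "D2 \<le> c3 \<alpha>" using D D2 by (auto simp: c3_def)
    have exponent: "- (c * (weight_ratio J0 \<kappa> w J)\<^sup>2 / (16 * C)) * real J / 2
      = - c4 \<alpha> * real J * (real J / (kappa_max J0 \<kappa> J * weight_max J0 w J)\<^sup>2) * (weight_u \<kappa> w J)\<^sup>2"
      by (simp add: c4_def weight_ratio_def power_mult_distrib power_divide mult_ac)
    show "measure P (space P - H3)
            \<le> c3 \<alpha> * (exp (- c4 \<alpha> * real J * (real J / (kappa_max J0 \<kappa> J * weight_max J0 w J)\<^sup>2)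
                              * (weight_u \<kappa> w J)\<^sup>2)
                       + real n powr (- c2 C1 * 2 ^ J))"
    proof -
      have "measure P (space P - H3) \<le> 6 * exp (- (c * (weight_ratio J0 \<kappa> w J)\<^sup>2 / (16 * C)) * real J / 2) + E.tiny"
        unfolding H3 P using cred' by (intro E.high_frequency_tail[OF adm _ C1 Rlow JJ(3)]) (simp_all add: credible_radius_def)
      also have "\<dots> \<le> c3 \<alpha> * exp (- (c * (weight_ratio J0 \<kappa> w J)\<^sup>2 / (16 * C)) * real J / 2) + c3 \<alpha> * E.tiny"
        using c3(1) mult_right_mono[of 1 "c3 \<alpha>" E.tiny] by (intro add_mono mult_right_mono) auto
      finally show ?thesis unfolding exponent tiny by (simp only: distrib_left)
    qed
    fix B :: real assume B: "0 < B"
    show "\<exists>E\<in>sets P. measure P E \<ge> 1 - c1 C1 * real n powr (- c2 C1 * 2 ^ J) \<and>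
             (\<forall>Y\<in>E. \<forall>C. C = band J0 \<psi> w (fhat_coef \<kappa> v1 Y) (Rhat Y) \<inter>
                              {f. besov_norm s J0 \<psi> f \<le> ereal B} \<longrightarrow>
                (SUP f\<in>C. SUP g\<in>C. Linf_norm (\<lambda>x. f x - g x))
                  \<le> ereal (c3 \<alpha> * (weight_v J0 \<kappa> w J
                                     * sqrt (2 ^ J * real J / ((kappa_min J0 \<kappa> J)\<^sup>2 * real n))
                                   + 2 powr (- real J * s) * B)))"
    proof (intro bexI conjI ballI allI impI)
      \<comment> \<open>The same event serves for all \<open>B\<close>.\<close>
      show gs: "E.good (E.radius C1) \<in> sets P" unfolding P by (rule E.good_sets)
      interpret PP: prob_space P unfolding P by (rule E.prob_space_P)
      have "1 - measure P (E.good (E.radius C1)) \<le> E.tiny"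
        using E.prob_not_good_tiny[OF C1] PP.prob_compl[OF gs] by (simp add: P)
      then show "1 - c1 C1 * real n powr (- c2 C1 * 2 ^ J) \<le> measure P (E.good (E.radius C1))"
        using tiny4 tiny0 unfolding tiny by linarith
      fix Y Cs assume Y: "Y \<in> E.good (E.radius C1)"
        and Cs: "Cs = band J0 \<psi> w (fhat_coef \<kappa> v1 Y) (Rhat Y) \<inter> {f. besov_norm s J0 \<psi> f \<le> ereal B}"
      define q where "q = weight_v J0 \<kappa> w J * sqrt (2 ^ J * real J / ((kappa_min J0 \<kappa> J)\<^sup>2 * real n))"
      have q: "0 \<le> q"
      proof -
        have "0 \<le> weight_v J0 \<kappa> w J * sqrt (real J) / kappa_min J0 \<kappa> J"
          using W.coarse_weights_bound[OF JJ(1) _ order_trans[OF _ W.ratio_ge_1], of 0] JJ(1) by simp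
        then have "0 \<le> weight_v J0 \<kappa> w J"
          using W.kappa_min_pos[OF J(1)] JJ(1) by (simp add: zero_le_divide_iff zero_le_mult_iff)
        then show ?thesis by (simp add: q_def)
      qed
      have "Linf_norm (\<lambda>x. f x - g x) \<le> ereal (c3 \<alpha> * (q + 2 powr (- real J * s) * B))"
        if "f \<in> Cs" "g \<in> Cs" for f g
      proof -
        have fg: "f \<in> band J0 \<psi> w (fhat_coef \<kappa> v1 Y) (Rhat Y)" "besov_norm s J0 \<psi> f \<le> ereal B"
          "g \<in> band J0 \<psi> w (fhat_coef \<kappa> v1 Y) (Rhat Y)" "besov_norm s J0 \<psi> g \<le> ereal B"
          using that Cs by auto
        have "Linf_norm (\<lambda>x. f x - g x) \<le> ereal (8 * D * q + D2 * (2 powr (- real J * s) * B))"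
          unfolding q_def D2_def
          by (rule E.band_diameter[OF adm JJ(1) assms(1) B lev D less_imp_le[OF Rup[OF Y]] \<tau> JJ(2) fg])
        also have "8 * D * q + D2 * (2 powr (- real J * s) * B) \<le> c3 \<alpha> * q + c3 \<alpha> * (2 powr (- real J * s) * B)"
          using c3 q B by (intro add_mono mult_right_mono) auto
        finally show ?thesis by (simp add: distrib_left)
      qed
      then show "(SUP f\<in>Cs. SUP g\<in>Cs. Linf_norm (\<lambda>x. f x - g x))
          \<le> ereal (c3 \<alpha> * (weight_v J0 \<kappa> w J * sqrt (2 ^ J * real J / ((kappa_min J0 \<kappa> J)\<^sup>2 * real n))
              + 2 powr (- real J * s) * B))"
        unfolding q_def by (intro SUP_least)
    qed
  qed
qed

end
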